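(* Fix $l\ge 1$, $n\ge 0$ and $\underline\mu\in\Lambda(P^l_n)$. For $\delta\in\mathbb C$ consider the tonal partition algebra $P^l_n$ over $\mathbb C$ with parameter $\delta$ and its standard module $\mathcal S^n_{\underline\mu}$. Then $\mathcal S^n_{\underline\mu}$ is a simple $P^l_n$-module for all but finitely many values of $\delta\in\mathbb C$.
   Context: Partitions and products: for $n,m\ge 0$ let $\mathsf P_{n,m}$ be the set of set partitions of the disjoint union $\{1,\dots,n\}\cup\{1',\dots,m'\}$. For $p\in\mathsf P_{n,m}$, $p'\in\mathsf P_{m,r}$: rename each $i'$ of $p$ and each $i\in\{1,\dots,m\}$ of $p'$ as $i''$; take the finest partition of $\{1,\dots,n\}\cup\{1'',\dots,m''\}\cup\{1',\dots,r'\}$ such that every part of $p$ and of $p'$ is contained in a part; let $c$ be the number of its parts contained in $\{1'',\dots,m''\}$; delete all $i''$ (and empty parts) to get $q$; then $pp'=\delta^cq$. $p\otimes p'$ is side-by-side juxtaposition ($p'$ to the right). A part $s$ is $l$-tone if $|s\cap\{1,\dots,n\}|\equiv|s\cap\{1',\dots,m'\}|$ mod $l$; a partition is $l$-tone if all its parts are. The tonal partition algebra $P^l_n$ has basis the set $\mathsf P^l_n$ of $l$-tone partitions in $\mathsf P_{n,n}$. Propagating vector: a part is propagating if it meets both rows $\{1,\dots,n\}$, $\{1',\dots,n'\}$. For $p\in\mathsf P^l_n$ let $\#^i(p)$ ($1\le i\le l$) be the number of propagating parts $s$ with $|s\cap\{1,\dots,n\}|\equiv i$ mod $l$, and $\#^-(p)=(\#^1(p),\dots,\#^l(p))$.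 Index poset: for $\mathbf m=(m_1,\dots,m_l)$ let $r_{\mathbf m}=\sum_i i\,m_i$; $\gamma^{l,n}=\{\mathbf m\in\mathbb N_0^l:(n-r_{\mathbf m})/l\in\mathbb N_0\}$. With $\epsilon_i$ the standard basis of $\mathbb Z^l$, indices read mod $l$ in $\{1,\dots,l\}$, let $v_{ij}=\epsilon_{i+j}-\epsilon_i-\epsilon_j$ ($1\le i\le j\le l$); $\mathbf m\ge\mathbf m'$ iff $\mathbf m'-\mathbf m$ is a nonnegative integral combination of the $v_{ij}$. Elements and quotients: $b^i\in\mathsf P_{i,i}$ has the single part $\{1,\dots,i,1',\dots,i'\}$; $w\in\mathsf P_{l,0}$, $w^\star\in\mathsf P_{0,l}$ are the one-part partitions; $a^{\mathbf m}=(b^l)^{\otimes m_l}\otimes\cdots\otimes(b^1)^{\otimes m_1}\otimes(ww^\star)^{\otimes(n-r_{\mathbf m})/l}$. $I^{<\mathbf m}=\sum_{\mathbf m'<\mathbf m}P^l_na^{\mathbf m'}P^l_n$ and $P^{\mathbf m}_n=P^l_n/I^{<\mathbf m}$. Standard modules: let $S_{\mathbf m}=S_{m_1}\times\cdots\times S_{m_l}$. The left ideal $P^{\mathbf m}_na^{\mathbf m}$ has basis the classes of those $p\in\mathsf P^l_n$ with $\#^-(p)=\mathbf m$ and with the same restriction to the bottom row, and the same non-propagating bottom parts, as $a^{\mathbf m}$. It is a right $S_{\mathbf m}$-module by permuting, for each $i$, the $m_i$ bottom blocks of size $i$ attached to propagating parts: if $B_{i,1},\dots,B_{i,m_i}$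 are these blocks from left to right, then in $p\cdot\sigma$ the propagating part of $p$ with bottom block $B_{i,\sigma_i(j)}$ is given the bottom block $B_{i,j}$. Let $\Lambda_{\mathbf m}$ be the set of $l$-tuples $\underline\mu=(\mu^1,\dots,\mu^l)$ of integer partitions with $\mu^i\vdash m_i$, and $\Lambda(P^l_n)=\bigsqcup_{\mathbf m\in\gamma^{l,n}}\Lambda_{\mathbf m}$. Let $\mathrm{Sp}_{\underline\mu}$ be the Specht module of $S_{\mathbf m}$ (outer tensor product of Specht modules of the factors). The standard module is $\mathcal S^n_{\underline\mu}\cong\Delta_{\underline\mu}=P^{\mathbf m}_na^{\mathbf m}\otimes_{\mathbb CS_{\mathbf m}}\mathrm{Sp}_{\underline\mu}$ for $\underline\mu\in\Lambda_{\mathbf m}$, a left $P^l_n$-module. *)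

theory Defs
  imports Complex_Main
    "HOL-Library.Disjoint_Sets"
    "HOL-Number_Theory.Cong"
    "HOL-Combinatorics.Permutations"
    "HOL-Algebra.Module"
    "HOL-Algebra.QuotRing"
    "HOL-Algebra.Product_Groups"
    "HOL-Algebra.Sym_Groups"
    "HOL-Algebra.Free_Abelian_Groups"
begin

section \<open>Modules over a not necessarily commutative ring\<close>

text \<open>The library locale \<^locale>\<open>module\<close> asks for a commutative ring. The record type
  \<^type>\<open>module\<close> and the locale \<^locale>\<open>submodule\<close> do not, and are reused. The fields
  \<^const>\<open>monoid.mult\<close> and \<^const>\<open>monoid.one\<close> of a module record carry no meaning.\<close>

locale left_module = R?: ring R + M?: abelian_group M
  for R :: "('a, 'c) ring_scheme" (structure) and M :: "('a, 'b, 'd) module_scheme" (structure) +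
  assumes smult_closed:
      "\<lbrakk>a \<in> carrier R; x \<in> carrier M\<rbrakk> \<Longrightarrow> a \<odot>\<^bsub>M\<^esub> x \<in> carrier M"
    and smult_l_distr:
      "\<lbrakk>a \<in> carrier R; b \<in> carrier R; x \<in> carrier M\<rbrakk> \<Longrightarrow>
        (a \<oplus>\<^bsub>R\<^esub> b) \<odot>\<^bsub>M\<^esub> x = a \<odot>\<^bsub>M\<^esub> x \<oplus>\<^bsub>M\<^esub> b \<odot>\<^bsub>M\<^esub> x"
    and smult_r_distr:
      "\<lbrakk>a \<in> carrier R; x \<in> carrier M; y \<in> carrier M\<rbrakk> \<Longrightarrow>
        a \<odot>\<^bsub>M\<^esub> (x \<oplus>\<^bsub>M\<^esub> y) = a \<odot>\<^bsub>M\<^esub> x \<oplus>\<^bsub>M\<^esub> a \<odot>\<^bsub>M\<^esub> y"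
    and smult_assoc1:
      "\<lbrakk>a \<in> carrier R; b \<in> carrier R; x \<in> carrier M\<rbrakk> \<Longrightarrow>
        (a \<otimes>\<^bsub>R\<^esub> b) \<odot>\<^bsub>M\<^esub> x = a \<odot>\<^bsub>M\<^esub> (b \<odot>\<^bsub>M\<^esub> x)"
    and smult_one:
      "x \<in> carrier M \<Longrightarrow> \<one>\<^bsub>R\<^esub> \<odot>\<^bsub>M\<^esub> x = x"

definition simple_module :: "('a, 'c) ring_scheme \<Rightarrow> ('a, 'b, 'd) module_scheme \<Rightarrow> bool" where
  "simple_module R M \<longleftrightarrow>
     left_module R M \<and> carrier M \<noteq> {\<zero>\<^bsub>M\<^esub>} \<and>
     (\<forall>H. submodule H R M \<longrightarrow> H = {\<zero>\<^bsub>M\<^esub>} \<or> H = carrier M)"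

text \<open>The tensor product over \<open>R\<close> of a right module \<open>M\<close> and a left module \<open>N\<close>, as the quotient of
  the free abelian group on pairs. The right action is stored in the field \<^const>\<open>smult\<close>
  of \<open>M\<close>: there \<open>r \<odot>\<^bsub>M\<^esub> x\<close> stands for the element \<open>x r\<close>.\<close>

definition tensor_relations ::
  "('r, 'c) ring_scheme \<Rightarrow> ('r, 'a, 'd) module_scheme \<Rightarrow> ('r, 'b, 'e) module_scheme
     \<Rightarrow> (('a \<times> 'b) \<Rightarrow>\<^sub>0 int) set" where
  "tensor_relations R M N =
     generate (free_Abelian_group (carrier M \<times> carrier N))
       ({frag_of (x \<oplus>\<^bsub>M\<^esub> x', y) - frag_of (x, y) - frag_of (x', y) | x x' y.
           x \<in> carrier M \<and> x' \<in> carrier M \<and> y \<in> carrier N} \<union>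
        {frag_of (x, y \<oplus>\<^bsub>N\<^esub> y') - frag_of (x, y) - frag_of (x, y') | x y y'.
           x \<in> carrier M \<and> y \<in> carrier N \<and> y' \<in> carrier N} \<union>
        {frag_of (r \<odot>\<^bsub>M\<^esub> x, y) - frag_of (x, r \<odot>\<^bsub>N\<^esub> y) | r x y.
           r \<in> carrier R \<and> x \<in> carrier M \<and> y \<in> carrier N})"

definition tensor_group ::
  "('r, 'c) ring_scheme \<Rightarrow> ('r, 'a, 'd) module_scheme \<Rightarrow> ('r, 'b, 'e) module_scheme
     \<Rightarrow> (('a \<times> 'b) \<Rightarrow>\<^sub>0 int) set monoid" where
  "tensor_group R M N =
     free_Abelian_group (carrier M \<times> carrier N) Mod tensor_relations R M N"

text \<open>If \<open>act\<close> is a left action on \<open>M\<close> commuting with the right \<open>R\<close>-action, it makes the tensor product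
  a left module by \<open>s (x \<otimes> y) = (s x) \<otimes> y\<close>.\<close>

definition tensor_module ::
  "('s \<Rightarrow> 'a \<Rightarrow> 'a) \<Rightarrow> ('r, 'c) ring_scheme \<Rightarrow> ('r, 'a, 'd) module_scheme \<Rightarrow>
     ('r, 'b, 'e) module_scheme \<Rightarrow> ('s, (('a \<times> 'b) \<Rightarrow>\<^sub>0 int) set) module" where
  "tensor_module act R M N =
     \<lparr>carrier = carrier (tensor_group R M N),
      monoid.mult = undefined,
      monoid.one = undefined,
      ring.zero = \<one>\<^bsub>tensor_group R M N\<^esub>,
      add = (\<lambda>C D. C \<otimes>\<^bsub>tensor_group R M N\<^esub> D),
      smult = (\<lambda>s C. \<Union>c\<in>C. tensor_relations R M N
                 #>\<^bsub>free_Abelian_group (carrier M \<times> carrier N)\<^esub>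
                   frag_extend (\<lambda>(x, y). frag_of (act s x, y)) c)\<rparr>"

section \<open>Linear combinations and group algebras\<close>

text \<open>A vector in the complex space with basis \<open>B\<close> is a function vanishing outside \<open>B\<close>.\<close>

definition basis_vec :: "'a \<Rightarrow> 'a \<Rightarrow> complex" where
  "basis_vec p = (\<lambda>q. if q = p then 1 else 0)"

definition supported_on :: "'a set \<Rightarrow> ('a \<Rightarrow> complex) set" where
  "supported_on B = {x. \<forall>p. p \<notin> B \<longrightarrow> x p = 0}"

definition cspan :: "('a \<Rightarrow> complex) set \<Rightarrow> ('a \<Rightarrow> complex) set" where
  "cspan S = {\<lambda>x. \<Sum>f\<in>F. c f * f x | F c. finite F \<and> F \<subseteq> S}"

text \<open>Intended for a finite group \<open>G\<close>.\<close>

definition group_algebra :: "('g, 'c) monoid_scheme \<Rightarrow> ('g \<Rightarrow> complex) ring" where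
  "group_algebra G =
     \<lparr>carrier = supported_on (carrier G),
      monoid.mult = (\<lambda>\<alpha> \<beta> g. \<Sum>h\<in>carrier G. \<Sum>k\<in>carrier G.
                 if h \<otimes>\<^bsub>G\<^esub> k = g then \<alpha> h * \<beta> k else 0),
      monoid.one = basis_vec \<one>\<^bsub>G\<^esub>,
      ring.zero = (\<lambda>_. 0),
      add = (\<lambda>\<alpha> \<beta> g. \<alpha> g + \<beta> g)\<rparr>"

section \<open>Partition diagrams\<close>

text \<open>\<open>Top i\<close>, \<open>Bot i\<close> and \<open>Mid i\<close> are the points written \<open>i\<close>, \<open>i'\<close> and \<open>i''\<close>.\<close>

datatype vertex = Top nat | Mid nat | Bot nat

type_synonym diagram = "vertex set set"

definition diagrams :: "nat \<Rightarrow> nat \<Rightarrow> diagram set" where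
  "diagrams n m = {p. partition_on (Top ` {1..n} \<union> Bot ` {1..m}) p}"

fun bot_to_mid :: "vertex \<Rightarrow> vertex" where
  "bot_to_mid (Top i) = Top i"
| "bot_to_mid (Mid i) = Mid i"
| "bot_to_mid (Bot i) = Mid i"

fun top_to_mid :: "vertex \<Rightarrow> vertex" where
  "top_to_mid (Top i) = Mid i"
| "top_to_mid (Mid i) = Mid i"
| "top_to_mid (Bot i) = Bot i"

definition finest_containing :: "'a set \<Rightarrow> 'a set set \<Rightarrow> 'a set set" where
  "finest_containing V S =
     (THE Q. partition_on V Q \<and> (\<forall>s\<in>S. \<exists>t\<in>Q. s \<subseteq> t) \<and>
        (\<forall>Q'. partition_on V Q' \<and> (\<forall>s\<in>S. \<exists>t\<in>Q'. s \<subseteq> t) \<longrightarrow> refines V Q Q'))"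

definition stack :: "nat \<Rightarrow> nat \<Rightarrow> nat \<Rightarrow> diagram \<Rightarrow> diagram \<Rightarrow> diagram" where
  "stack n m r p p' =
     finest_containing (Top ` {1..n} \<union> Mid ` {1..m} \<union> Bot ` {1..r})
       ((`) bot_to_mid ` p \<union> (`) top_to_mid ` p')"

definition loops :: "nat \<Rightarrow> nat \<Rightarrow> nat \<Rightarrow> diagram \<Rightarrow> diagram \<Rightarrow> nat" where
  "loops n m r p p' = card {s \<in> stack n m r p p'. s \<subseteq> Mid ` {1..m}}"

definition compose :: "nat \<Rightarrow> nat \<Rightarrow> nat \<Rightarrow> diagram \<Rightarrow> diagram \<Rightarrow> diagram" where
  "compose n m r p p' = (\<lambda>s. s - Mid ` {1..m}) ` stack n m r p p' - {{}}"

fun shift :: "nat \<Rightarrow> nat \<Rightarrow> vertex \<Rightarrow> vertex" where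
  "shift n m (Top i) = Top (n + i)"
| "shift n m (Mid i) = Mid i"
| "shift n m (Bot i) = Bot (m + i)"

text \<open>Juxtaposition, where \<open>p\<close> lies in \<open>diagrams n m\<close>.\<close>

definition juxtapose :: "nat \<Rightarrow> nat \<Rightarrow> diagram \<Rightarrow> diagram \<Rightarrow> diagram" where
  "juxtapose n m p p' = p \<union> (`) (shift n m) ` p'"

text \<open>Each entry \<open>(k, p)\<close> of the list consists of a number and a member \<open>p\<close> of \<open>diagrams k k\<close>.\<close>

fun juxtapose_list :: "(nat \<times> diagram) list \<Rightarrow> diagram" where
  "juxtapose_list [] = {}"
| "juxtapose_list ((k, p) # ps) = juxtapose k k p (juxtapose_list ps)"

section \<open>The tonal partition algebra\<close>

definition is_tone :: "nat \<Rightarrow> vertex set \<Rightarrow> bool" where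
  "is_tone l s \<longleftrightarrow> [card (s \<inter> range Top) = card (s \<inter> range Bot)] (mod l)"

definition tonal :: "nat \<Rightarrow> nat \<Rightarrow> diagram set" where
  "tonal l n = {p \<in> diagrams n n. \<forall>s\<in>p. is_tone l s}"

definition identity_diagram :: "nat \<Rightarrow> diagram" where
  "identity_diagram n = (\<lambda>i. {Top i, Bot i}) ` {1..n}"

definition tonal_algebra :: "nat \<Rightarrow> nat \<Rightarrow> complex \<Rightarrow> (diagram \<Rightarrow> complex) ring" where
  "tonal_algebra l n \<delta> =
     \<lparr>carrier = supported_on (tonal l n),
      monoid.mult = (\<lambda>x y q. \<Sum>p\<in>tonal l n. \<Sum>p'\<in>tonal l n.
                 if compose n n n p p' = q then \<delta> ^ loops n n n p p' * x p * y p' else 0),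
      monoid.one = basis_vec (identity_diagram n),
      ring.zero = (\<lambda>_. 0),
      add = (\<lambda>x y p. x p + y p)\<rparr>"

definition propagating :: "vertex set \<Rightarrow> bool" where
  "propagating s \<longleftrightarrow> s \<inter> range Top \<noteq> {} \<and> s \<inter> range Bot \<noteq> {}"

text \<open>A vector in \<open>\<nat>\<^sub>0\<^sup>l\<close> is a function \<^typ>\<open>nat \<Rightarrow> nat\<close> vanishing outside \<open>{1..l}\<close>.\<close>

definition prop_vec :: "nat \<Rightarrow> diagram \<Rightarrow> nat \<Rightarrow> nat" where
  "prop_vec l p = (\<lambda>i. if i \<in> {1..l}
     then card {s \<in> p. propagating s \<and> [card (s \<inter> range Top) = i] (mod l)} else 0)"

section \<open>The index poset\<close>

definition rsum :: "nat \<Rightarrow> (nat \<Rightarrow> nat) \<Rightarrow> nat" where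
  "rsum l m = (\<Sum>i=1..l. i * m i)"

definition gamma :: "nat \<Rightarrow> nat \<Rightarrow> (nat \<Rightarrow> nat) set" where
  "gamma l n = {m. (\<forall>i. i \<notin> {1..l} \<longrightarrow> m i = 0) \<and> rsum l m \<le> n \<and> l dvd (n - rsum l m)}"

text \<open>The representative in \<open>{1..l}\<close> of \<open>k \<ge> 1\<close> modulo \<open>l\<close>.\<close>

definition residue_index :: "nat \<Rightarrow> nat \<Rightarrow> nat" where
  "residue_index l k = (k - 1) mod l + 1"

definition unit_vec :: "nat \<Rightarrow> nat \<Rightarrow> int" where
  "unit_vec i = (\<lambda>k. if k = i then 1 else 0)"

definition v_vec :: "nat \<Rightarrow> nat \<Rightarrow> nat \<Rightarrow> nat \<Rightarrow> int" where
  "v_vec l i j = (\<lambda>k. unit_vec (residue_index l (i + j)) k - unit_vec i k - unit_vec j k)"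

definition index_le :: "nat \<Rightarrow> (nat \<Rightarrow> nat) \<Rightarrow> (nat \<Rightarrow> nat) \<Rightarrow> bool" where
  "index_le l m' m \<longleftrightarrow>
     (\<exists>c :: nat \<Rightarrow> nat \<Rightarrow> nat. \<forall>k.
        int (m' k) - int (m k) = (\<Sum>j=1..l. \<Sum>i=1..j. int (c i j) * v_vec l i j k))"

definition index_less :: "nat \<Rightarrow> (nat \<Rightarrow> nat) \<Rightarrow> (nat \<Rightarrow> nat) \<Rightarrow> bool" where
  "index_less l m' m \<longleftrightarrow> index_le l m' m \<and> m' \<noteq> m"

section \<open>The diagrams \<open>a\<^sup>m\<close> and the quotient algebras\<close>

definition b_diag :: "nat \<Rightarrow> diagram" where
  "b_diag i = {Top ` {1..i} \<union> Bot ` {1..i}}"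

definition w_diag :: "nat \<Rightarrow> diagram" where
  "w_diag l = {Top ` {1..l}}"

definition w_star :: "nat \<Rightarrow> diagram" where
  "w_star l = {Bot ` {1..l}}"

definition a_diag :: "nat \<Rightarrow> nat \<Rightarrow> (nat \<Rightarrow> nat) \<Rightarrow> diagram" where
  "a_diag l n m = juxtapose_list
     (concat (map (\<lambda>i. replicate (m i) (i, b_diag i)) (rev [1..<Suc l])) @
      replicate ((n - rsum l m) div l) (l, compose l 0 l (w_diag l) (w_star l)))"

text \<open>The sum over \<open>m' < m\<close> of the ideals \<open>P a P\<close> with \<open>a = a\<^bsup>m'\<^esup>\<close>, each of which is additively
  spanned by the products \<open>x a y\<close>.\<close>

definition ideal_below ::
  "nat \<Rightarrow> nat \<Rightarrow> complex \<Rightarrow> (nat \<Rightarrow> nat) \<Rightarrow> (diagram \<Rightarrow> complex) set" where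
  "ideal_below l n \<delta> m =
     generate (add_monoid (tonal_algebra l n \<delta>))
       {x \<otimes>\<^bsub>tonal_algebra l n \<delta>\<^esub> basis_vec (a_diag l n m') \<otimes>\<^bsub>tonal_algebra l n \<delta>\<^esub> y | x y m'.
          x \<in> carrier (tonal_algebra l n \<delta>) \<and> y \<in> carrier (tonal_algebra l n \<delta>) \<and>
          m' \<in> gamma l n \<and> index_less l m' m}"

definition quotient_algebra ::
  "nat \<Rightarrow> nat \<Rightarrow> complex \<Rightarrow> (nat \<Rightarrow> nat) \<Rightarrow> (diagram \<Rightarrow> complex) set ring" where
  "quotient_algebra l n \<delta> m = tonal_algebra l n \<delta> Quot ideal_below l n \<delta> m"

definition quotient_class ::
  "nat \<Rightarrow> nat \<Rightarrow> complex \<Rightarrow> (nat \<Rightarrow> nat) \<Rightarrow> (diagram \<Rightarrow> complex) \<Rightarrow> (diagram \<Rightarrow> complex) set" where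
  "quotient_class l n \<delta> m x = ideal_below l n \<delta> m +>\<^bsub>tonal_algebra l n \<delta>\<^esub> x"

section \<open>The left ideal generated by \<open>a\<^sup>m\<close> as a right module over the group algebra\<close>

definition sym_product :: "nat \<Rightarrow> (nat \<Rightarrow> nat) \<Rightarrow> (nat \<Rightarrow> nat \<Rightarrow> nat) monoid" where
  "sym_product l m = product_group {1..l} (\<lambda>i. sym_group (m i))"

definition bottom_restriction :: "diagram \<Rightarrow> diagram" where
  "bottom_restriction p = (\<lambda>s. s \<inter> range Bot) ` p - {{}}"

definition nonprop_bottom :: "diagram \<Rightarrow> diagram" where
  "nonprop_bottom p = {s \<in> p. \<not> propagating s \<and> s \<inter> range Bot \<noteq> {}}"

definition half_basis :: "nat \<Rightarrow> nat \<Rightarrow> (nat \<Rightarrow> nat) \<Rightarrow> diagram set" where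
  "half_basis l n m = {p \<in> tonal l n. prop_vec l p = m \<and>
     bottom_restriction p = bottom_restriction (a_diag l n m) \<and>
     nonprop_bottom p = nonprop_bottom (a_diag l n m)}"

text \<open>\<open>bottom_block l m i j\<close> is the bottom row of the \<open>j\<close>-th (from the left) tensor factor \<open>b\<^sup>i\<close>
  of \<open>a\<^sup>m\<close>; the factors \<open>b\<^sup>k\<close> with \<open>k > i\<close> stand to the left of it.\<close>

definition bottom_block :: "nat \<Rightarrow> (nat \<Rightarrow> nat) \<Rightarrow> nat \<Rightarrow> nat \<Rightarrow> vertex set" where
  "bottom_block l m i j =
     (let s = (\<Sum>k=Suc i..l. k * m k) + (j - 1) * i in Bot ` {s + 1..s + i})"

definition permute_blocks ::
  "nat \<Rightarrow> (nat \<Rightarrow> nat) \<Rightarrow> diagram \<Rightarrow> (nat \<Rightarrow> nat \<Rightarrow> nat) \<Rightarrow> diagram" where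
  "permute_blocks l m p \<sigma> =
     {s \<in> p. \<not> propagating s} \<union>
     {(s \<inter> range Top) \<union> bottom_block l m i j | s i j.
        s \<in> p \<and> propagating s \<and> i \<in> {1..l} \<and> j \<in> {1..m i} \<and>
        s \<inter> range Bot = bottom_block l m i (\<sigma> i j)}"

text \<open>The bilinear extension of \<^const>\<open>permute_blocks\<close>.\<close>

definition permute_blocks_lin ::
  "nat \<Rightarrow> nat \<Rightarrow> (nat \<Rightarrow> nat) \<Rightarrow> (diagram \<Rightarrow> complex) \<Rightarrow>
     ((nat \<Rightarrow> nat \<Rightarrow> nat) \<Rightarrow> complex) \<Rightarrow> diagram \<Rightarrow> complex" where
  "permute_blocks_lin l n m x \<alpha> = (\<lambda>q.
     \<Sum>\<sigma>\<in>carrier (sym_product l m). \<Sum>p\<in>half_basis l n m.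
       if permute_blocks l m p \<sigma> = q then x p * \<alpha> \<sigma> else 0)"

text \<open>A right module in the encoding explained at \<^const>\<open>tensor_relations\<close>. A class in the left ideal
  has exactly one representative that is a combination of \<^const>\<open>half_basis\<close> diagrams,
  and the action is computed on it.\<close>

definition left_ideal ::
  "nat \<Rightarrow> nat \<Rightarrow> complex \<Rightarrow> (nat \<Rightarrow> nat) \<Rightarrow>
     ((nat \<Rightarrow> nat \<Rightarrow> nat) \<Rightarrow> complex, (diagram \<Rightarrow> complex) set) module" where
  "left_ideal l n \<delta> m =
     \<lparr>carrier = {C \<otimes>\<^bsub>quotient_algebra l n \<delta> m\<^esub>
                   quotient_class l n \<delta> m (basis_vec (a_diag l n m)) | C.
                 C \<in> carrier (quotient_algebra l n \<delta> m)},
      monoid.mult = undefined,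
      monoid.one = undefined,
      ring.zero = \<zero>\<^bsub>quotient_algebra l n \<delta> m\<^esub>,
      add = (\<lambda>C D. C \<oplus>\<^bsub>quotient_algebra l n \<delta> m\<^esub> D),
      smult = (\<lambda>\<alpha> C. \<Union>x \<in> C \<inter> supported_on (half_basis l n m).
                 quotient_class l n \<delta> m (permute_blocks_lin l n m x \<alpha>))\<rparr>"

section \<open>Specht modules\<close>

definition integer_partition :: "nat list \<Rightarrow> nat \<Rightarrow> bool" where
  "integer_partition \<mu> k \<longleftrightarrow> sorted_wrt (\<ge>) \<mu> \<and> 0 \<notin> set \<mu> \<and> sum_list \<mu> = k"

text \<open>Pairs (row, column), both counted from 0.\<close>

definition cells :: "nat list \<Rightarrow> (nat \<times> nat) set" where
  "cells \<mu> = {(r, c). r < length \<mu> \<and> c < \<mu> ! r}"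

definition tableaux :: "nat list \<Rightarrow> (nat \<times> nat \<Rightarrow> nat) set" where
  "tableaux \<mu> = {t \<in> extensional (cells \<mu>). bij_betw t (cells \<mu>) {1..sum_list \<mu>}}"

text \<open>A tabloid is given by the set of entries in each row.\<close>

type_synonym tabloid = "nat \<Rightarrow> nat set"

definition tabloid_of :: "nat list \<Rightarrow> (nat \<times> nat \<Rightarrow> nat) \<Rightarrow> tabloid" where
  "tabloid_of \<mu> t = (\<lambda>r. t ` {x \<in> cells \<mu>. fst x = r})"

definition column_stabilizer :: "nat list \<Rightarrow> (nat \<times> nat \<Rightarrow> nat) \<Rightarrow> (nat \<Rightarrow> nat) set" where
  "column_stabilizer \<mu> t = {\<pi>. \<pi> permutes {1..sum_list \<mu>} \<and>
     (\<forall>c. \<pi> ` t ` {x \<in> cells \<mu>. snd x = c} = t ` {x \<in> cells \<mu>. snd x = c})}"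

definition polytabloid :: "nat list \<Rightarrow> (nat \<times> nat \<Rightarrow> nat) \<Rightarrow> tabloid \<Rightarrow> complex" where
  "polytabloid \<mu> t = (\<lambda>T. \<Sum>\<pi>\<in>column_stabilizer \<mu> t.
     of_int (sign \<pi>) * basis_vec (tabloid_of \<mu> (\<pi> \<circ> t)) T)"

definition specht :: "nat list \<Rightarrow> (tabloid \<Rightarrow> complex) set" where
  "specht \<mu> = cspan (polytabloid \<mu> ` tableaux \<mu>)"

text \<open>The outer tensor product of the Specht modules of the factors, realised inside the functions
  of an \<open>l\<close>-tuple of tabloids: the pure tensor of \<open>f\<^sub>1, \<dots>, f\<^sub>l\<close> is the product function
  \<open>T \<mapsto> f\<^sub>1 (T\<^sub>1) \<cdots> f\<^sub>l (T\<^sub>l)\<close>. An element \<open>\<sigma>\<close> of the group sends \<open>f\<close> to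
  \<open>T \<mapsto> f (\<sigma>\<^bsup>-1\<^esup> T)\<close>, which extends the action on tabloids; the inverse enters
  as a preimage.\<close>

definition outer_specht ::
  "nat \<Rightarrow> (nat \<Rightarrow> nat) \<Rightarrow> (nat \<Rightarrow> nat list) \<Rightarrow>
     ((nat \<Rightarrow> nat \<Rightarrow> nat) \<Rightarrow> complex, (nat \<Rightarrow> tabloid) \<Rightarrow> complex) module" where
  "outer_specht l m \<mu> =
     \<lparr>carrier = cspan {\<lambda>T. \<Prod>i=1..l. f i (T i) | f. \<forall>i\<in>{1..l}. f i \<in> specht (\<mu> i)},
      monoid.mult = undefined,
      monoid.one = undefined,
      ring.zero = (\<lambda>_. 0),
      add = (\<lambda>f g T. f T + g T),
      smult = (\<lambda>\<alpha> f T. \<Sum>\<sigma>\<in>carrier (sym_product l m). \<alpha> \<sigma> * f (\<lambda>i r. \<sigma> i -` T i r))\<rparr>"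

section \<open>Standard modules\<close>

text \<open>A tuple \<open>(\<mu>\<^sup>1, \<dots>, \<mu>\<^sup>l)\<close> is a function that takes the value \<^term>\<open>[]\<close> outside \<open>{1..l}\<close>.\<close>

definition Lambda_index :: "nat \<Rightarrow> (nat \<Rightarrow> nat) \<Rightarrow> (nat \<Rightarrow> nat list) set" where
  "Lambda_index l m = {\<mu>. (\<forall>i\<in>{1..l}. integer_partition (\<mu> i) (m i)) \<and>
     (\<forall>i. i \<notin> {1..l} \<longrightarrow> \<mu> i = [])}"

definition Lambda_tonal :: "nat \<Rightarrow> nat \<Rightarrow> (nat \<Rightarrow> nat list) set" where
  "Lambda_tonal l n = (\<Union>m\<in>gamma l n. Lambda_index l m)"

text \<open>The index \<open>m\<close> is determined by \<open>\<mu>\<close>, since \<open>m\<^sub>i\<close> is the size of \<open>\<mu>\<^sup>i\<close>.\<close>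

definition standard_module ::
  "nat \<Rightarrow> nat \<Rightarrow> complex \<Rightarrow> (nat \<Rightarrow> nat list) \<Rightarrow>
     (diagram \<Rightarrow> complex,
      (((diagram \<Rightarrow> complex) set \<times> ((nat \<Rightarrow> tabloid) \<Rightarrow> complex)) \<Rightarrow>\<^sub>0 int) set) module" where
  "standard_module l n \<delta> \<mu> =
     (let m = (\<lambda>i. sum_list (\<mu> i)) in
       tensor_module
         (\<lambda>x C. quotient_class l n \<delta> m x \<otimes>\<^bsub>quotient_algebra l n \<delta> m\<^esub> C)
         (group_algebra (sym_product l m)) (left_ideal l n \<delta> m) (outer_specht l m \<mu>))"

end

theory Submission imports "Jordan_Normal_Form.Determinant" "HOL-Computational_Algebra.Polynomial" Defs
begin

text \<open>Let \<open>H\<close> be the diagram basis of the left ideal generated by \<open>a\<^bsup>m\<^esup>\<close>, and let \<open>q\<^sup>*\<close> be the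
  reflection of \<open>q \<in> H\<close>. Modulo \<open>I\<^bsup><m\<^esup>\<close> the product \<open>q\<^sup>* p\<close> of \<open>q, p \<in> H\<close> is either zero or
  \<open>\<delta>\<^bsup>L\<^esup> a\<^bsup>m\<^esup> \<sigma>\<close> with \<open>\<sigma> \<in> S\<^sub>m\<close>; let the matrix entry \<open>g(q, p)\<close> be \<open>\<delta>\<^bsup>L\<^esup>\<close> if it is nonzero with
  \<open>\<sigma> = 1\<close>, and zero otherwise. The exponent on the diagonal is the number of non-propagating top parts
  of \<open>p\<close>, and off the diagonal the exponent is strictly smaller than the mean of the corresponding
  diagonal exponents. So \<open>det g\<close> is a monic polynomial in \<open>\<delta>\<close> and \<open>g\<close> is invertible for almost all
  \<open>\<delta>\<close>. For such \<open>\<delta> \<noteq> 0\<close>, multiplying a nonzero tensor by a suitable \<open>q\<^sup>*\<close> gives some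
  \<open>a\<^bsup>m\<^esup> \<otimes> w\<close> with \<open>w \<noteq> 0\<close>; irreducibility of the outer Specht module then gives all
  \<open>a\<^bsup>m\<^esup> \<otimes> v\<close>, and these generate the standard module.\<close>

subsection \<open>Connected components of a hypergraph\<close>

text \<open>The exponent bound comes from loops: a loop of \<open>flip q\<close> against
  \<open>p\<close> swallows at least one non-propagating top part of \<open>p\<close> and one of
  \<open>q\<close>, so the loop number is at most the smaller of the two diagonal exponents. If it
  equals both, every loop is a single part of either diagram; when the product is a^m without a
  permutation, the propagating tops then agree as well, so p = q. Keeping only \<sigma> = 1 makes
  the matrix scalar although the form takes values in the group algebra: the form commutes with the
  right action, so applying it to p \<otimes> v_p amounts to applying the scalar matrix to the sums
  of \<sigma> v_{p \<sigma>} over the group. The value 0 is set aside because a^m a^m is a power of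
  \<delta> times a^m; inverting this power puts the products that leave H into the ideal and
  identifies the left ideal with the span of H. The tensor product is a quotient of a free abelian
  group, where nothing is visibly nonzero; a balanced functional has to certify that.\<close>

definition conn :: "'a set set \<Rightarrow> 'a \<Rightarrow> 'a \<Rightarrow> bool" where
  "conn S = (\<lambda>x y. \<exists>s\<in>S. x \<in> s \<and> y \<in> s)\<^sup>*\<^sup>*"

definition comps :: "'a set set \<Rightarrow> 'a set set" where
  "comps S = (\<lambda>x. {y. conn S x y}) ` \<Union>S"

definition erase :: "'a set \<Rightarrow> 'a set set \<Rightarrow> 'a set set" where
  "erase M P = (\<lambda>s. s - M) ` P - {{}}"

lemma conn_refl [simp]: "conn S x x"
  by (simp add: conn_def)

lemma conn_trans [trans]: "conn S x y \<Longrightarrow> conn S y z \<Longrightarrow> conn S x z"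
  by (auto simp: conn_def)

lemma conn_edge: "s \<in> S \<Longrightarrow> x \<in> s \<Longrightarrow> y \<in> s \<Longrightarrow> conn S x y"
  by (auto simp: conn_def intro!: r_into_rtranclp)

lemma conn_sym: "conn S x y \<Longrightarrow> conn S y x"
  unfolding conn_def
  by (rule sympD[OF symp_rtranclp]) (auto simp: symp_def)

lemma conn_induct [consumes 1, case_names refl step]:
  assumes "conn S x y" "P x"
    and "\<And>y z s. conn S x y \<Longrightarrow> P y \<Longrightarrow> s \<in> S \<Longrightarrow> y \<in> s \<Longrightarrow> z \<in> s \<Longrightarrow> P z"
  shows "P y"
  using assms(1) unfolding conn_def
  by (induction rule: rtranclp_induct) (use assms(2,3) in \<open>auto simp: conn_def\<close>)

text \<open>The standard way below to bound a component: exhibit a set that contains every edge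
  meeting it.\<close>

lemma conn_closed:
  assumes "conn S x y" "x \<in> t" "\<And>s. s \<in> S \<Longrightarrow> s \<inter> t \<noteq> {} \<Longrightarrow> s \<subseteq> t"
  shows "y \<in> t"
  using assms(1) by (induction rule: conn_induct) (use assms(2,3) in blast)+

lemma conn_mono: "conn S x y \<Longrightarrow> (\<And>s. s \<in> S \<Longrightarrow> \<exists>t\<in>T. s \<subseteq> t) \<Longrightarrow> conn T x y"
  by (induction rule: conn_induct) (auto, meson conn_edge conn_trans subsetD)

lemma comps_connD: "t \<in> comps S \<Longrightarrow> x \<in> t \<Longrightarrow> y \<in> t \<Longrightarrow> conn S x y"
  by (auto simp: comps_def intro: conn_trans conn_sym)

lemma comps_closed: "t \<in> comps S \<Longrightarrow> x \<in> t \<Longrightarrow> conn S x y \<Longrightarrow> y \<in> t"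
  by (auto simp: comps_def intro: conn_trans)

lemma comps_edge: "t \<in> comps S \<Longrightarrow> s \<in> S \<Longrightarrow> s \<inter> t \<noteq> {} \<Longrightarrow> s \<subseteq> t"
  by (meson comps_closed conn_edge disjoint_iff subsetI)

lemma comps_nonempty: "t \<in> comps S \<Longrightarrow> t \<noteq> {}"
proof -
  assume "t \<in> comps S"
  then obtain x where "t = {y. conn S x y}" by (auto simp: comps_def)
  then have "x \<in> t" by simp
  then show ?thesis by blast
qed

lemma Union_comps: "\<Union>(comps S) = \<Union>S"
proof
  show "\<Union>(comps S) \<subseteq> \<Union>S"
  proof
    fix y assume "y \<in> \<Union>(comps S)"
    then obtain x where "x \<in> \<Union>S" "conn S x y" by (auto simp: comps_def)
    then show "y \<in> \<Union>S" using conn_closed[of S x y "\<Union>S"] by blast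
  qed
  show "\<Union>S \<subseteq> \<Union>(comps S)"
  proof
    fix x assume "x \<in> \<Union>S"
    then have "{y. conn S x y} \<in> comps S" unfolding comps_def by (rule imageI)
    then show "x \<in> \<Union>(comps S)" by (intro UnionI[of "{y. conn S x y}"]) auto
  qed
qed

lemma comps_partition: "partition_on (\<Union>S) (comps S)"
proof (rule partition_onI)
  show "disjnt p q" if "p \<in> comps S" "q \<in> comps S" "p \<noteq> q" for p q
    using that unfolding disjnt_def by (metis comps_closed comps_connD disjoint_iff subsetI subset_antisym)
qed (use comps_nonempty[of "{}" S] in \<open>auto simp: Union_comps\<close>)

lemma comps_disjoint: "t \<in> comps S \<Longrightarrow> u \<in> comps S \<Longrightarrow> x \<in> t \<Longrightarrow> x \<in> u \<Longrightarrow> t = u"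
  by (intro subset_antisym subsetI) (meson comps_closed comps_connD)+

lemma comps_edge_ex: "s \<in> S \<Longrightarrow> s \<noteq> {} \<Longrightarrow> \<exists>t\<in>comps S. s \<subseteq> t"
proof -
  assume s: "s \<in> S" "s \<noteq> {}"
  then obtain x where x: "x \<in> s" by blast
  then have "x \<in> \<Union>(comps S)" using s by (auto simp: Union_comps)
  then obtain t where "t \<in> comps S" "x \<in> t" by blast
  then show ?thesis using comps_edge[of t S s] s x by blast
qed

lemma comps_subset: "t \<in> comps S \<Longrightarrow> t \<subseteq> \<Union>S"
  using Union_comps[of S] by blast

lemma partition_on_same: "partition_on V P \<Longrightarrow> s \<in> P \<Longrightarrow> t \<in> P \<Longrightarrow> x \<in> s \<Longrightarrow> x \<in> t \<Longrightarrow> s = t"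
  by (auto simp: partition_on_def disjoint_def)

lemma partition_on_eqI:
  assumes "partition_on V P" "partition_on V Q" "\<And>p. p \<in> P \<Longrightarrow> \<exists>q\<in>Q. p \<subseteq> q" "\<And>q. q \<in> Q \<Longrightarrow> \<exists>p\<in>P. q \<subseteq> p"
  shows "P = Q"
proof -
  have *: "A \<subseteq> B" if A: "partition_on V A" and 1: "\<And>p. p \<in> A \<Longrightarrow> \<exists>q\<in>B. p \<subseteq> q" and 2: "\<And>q. q \<in> B \<Longrightarrow> \<exists>p\<in>A. q \<subseteq> p"
    for A B :: "'a set set"
  proof
    fix p assume p: "p \<in> A"
    from 1[OF p] obtain q where q: "q \<in> B" "p \<subseteq> q" by blast
    from 2[OF q(1)] obtain p' where p': "p' \<in> A" "q \<subseteq> p'" by blast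
    have "p \<noteq> {}" using A p by (auto simp: partition_on_def)
    then have "p = p'" using partition_on_same[OF A p p'(1)] p' q by blast
    then show "p \<in> B" using p' q by auto
  qed
  show ?thesis using *[of P Q] *[of Q P] assms by blast
qed

text \<open>Edges inside the parts make \<open>Q\<close> no finer than the components, connectedness
  of the parts makes it no coarser.\<close>

lemma comps_eqI:
  assumes "partition_on (\<Union>S) Q" "\<And>s. s \<in> S \<Longrightarrow> s \<noteq> {} \<Longrightarrow> \<exists>t\<in>Q. s \<subseteq> t"
    and "\<And>t x y. t \<in> Q \<Longrightarrow> x \<in> t \<Longrightarrow> y \<in> t \<Longrightarrow> conn S x y"
  shows "comps S = Q"
proof (rule partition_on_eqI[OF comps_partition assms(1)])
  fix t assume t: "t \<in> comps S"
  then obtain x where x: "x \<in> t" using comps_nonempty by blast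
  then have "x \<in> \<Union>S" using t comps_subset[of t S] by blast
  then obtain q where q: "q \<in> Q" "x \<in> q" using assms(1) by (auto simp: partition_on_def)
  have "y \<in> q" if "y \<in> t" for y
  proof (rule conn_closed[OF comps_connD[OF t x that] q(2)])
    fix s assume s: "s \<in> S" "s \<inter> q \<noteq> {}"
    then obtain u where u: "u \<in> Q" "s \<subseteq> u" using assms(2)[of s] by blast
    then have "u = q" using s q partition_on_same[OF assms(1)] by blast
    then show "s \<subseteq> q" using u by simp
  qed
  then show "\<exists>q\<in>Q. t \<subseteq> q" using q by blast
next
  fix q assume q: "q \<in> Q"
  then have "q \<noteq> {}" using assms(1) by (auto simp: partition_on_def)
  then obtain x where x: "x \<in> q" by blast
  then have "x \<in> \<Union>S" using assms(1) q by (auto simp: partition_on_def)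
  then have "{y. conn S x y} \<in> comps S" by (auto simp: comps_def)
  then show "\<exists>t\<in>comps S. q \<subseteq> t" using assms(3)[OF q x] by blast
qed

lemma comps_image:
  assumes "inj_on f (\<Union>S)"
  shows "comps ((`) f ` S) = (`) f ` comps S"
proof (rule comps_eqI)
  have "partition_on (f ` \<Union>S) ((`) f ` comps S)"
  proof -
    have "{} \<notin> (`) f ` comps S" using comps_nonempty by blast
    then show ?thesis using partition_on_inj_image[OF comps_partition assms] by simp
  qed
  then show "partition_on (\<Union> ((`) f ` S)) ((`) f ` comps S)"
    by (simp add: image_Union)
next
  show "s \<in> (`) f ` S \<Longrightarrow> s \<noteq> {} \<Longrightarrow> \<exists>t\<in>(`) f ` comps S. s \<subseteq> t" for s
  proof -
    assume "s \<in> (`) f ` S" "s \<noteq> {}"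
    then obtain u where u: "u \<in> S" "u \<noteq> {}" "s = f ` u" by auto
    then obtain t where "t \<in> comps S" "u \<subseteq> t" using comps_edge_ex[of u S] by blast
    then show ?thesis using u by blast
  qed
next
  fix t x y assume t: "t \<in> (`) f ` comps S" "x \<in> t" "y \<in> t"
  then obtain u a b where u: "u \<in> comps S" "a \<in> u" "b \<in> u" "x = f a" "y = f b" by auto
  have "conn S a b" using comps_connD u by metis
  then have "conn ((`) f ` S) (f a) (f b)"
  proof (induction rule: conn_induct)
    case (step y z s)
    then show ?case by (meson conn_edge conn_trans image_eqI)
  qed simp
  then show "conn ((`) f ` S) x y" using u by simp
qed

text \<open>Parts of a competing partition are closed under the edges and so contain whole
  components. As \<open>refines\<close> is antisymmetric, the description by \<open>THE\<close> has
  exactly one value.\<close>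

lemma finest_containing_eq:
  assumes V: "\<Union>S = V" and ne: "{} \<notin> S"
  shows "finest_containing V S = comps S"
proof -
  have P: "partition_on V (comps S)" using comps_partition[of S] V by simp
  have min: "refines V (comps S) Q'" if Q': "partition_on V Q'" "\<forall>s\<in>S. \<exists>t\<in>Q'. s \<subseteq> t" for Q'
    unfolding refines_def
  proof (intro conjI P Q' ballI)
    fix t assume t: "t \<in> comps S"
    then obtain x where x: "x \<in> t" using comps_nonempty by blast
    then have "x \<in> V" using t comps_subset[of t S] V by blast
    then obtain q where q: "q \<in> Q'" "x \<in> q" using Q'(1) by (auto simp: partition_on_def)
    have "y \<in> q" if "y \<in> t" for y
    proof (rule conn_closed[OF comps_connD[OF t x that] q(2)])
      fix s assume s: "s \<in> S" "s \<inter> q \<noteq> {}"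
      then obtain u where u: "u \<in> Q'" "s \<subseteq> u" using Q'(2) by blast
      then have "u = q" using s q partition_on_same[OF Q'(1)] by blast
      then show "s \<subseteq> q" using u by simp
    qed
    then show "\<exists>Y\<in>Q'. t \<subseteq> Y" using q by blast
  qed
  have edge: "\<forall>s\<in>S. \<exists>t\<in>comps S. s \<subseteq> t" using comps_edge_ex ne by metis
  show ?thesis unfolding finest_containing_def
  proof (rule the_equality)
    fix Q assume Q: "partition_on V Q \<and> (\<forall>s\<in>S. \<exists>t\<in>Q. s \<subseteq> t) \<and>
      (\<forall>Q'. partition_on V Q' \<and> (\<forall>s\<in>S. \<exists>t\<in>Q'. s \<subseteq> t) \<longrightarrow> refines V Q Q')"
    then have "refines V Q (comps S)" "refines V (comps S) Q" using P edge min by auto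
    then show "Q = comps S" by (metis refines_asym)
  qed (use P edge min in auto)
qed

section \<open>Erasing points from components\<close>

lemma Union_erase: "\<Union>(erase M P) = \<Union>P - M"
  by (auto simp: erase_def)

lemma erase_iff: "t \<in> erase M P \<longleftrightarrow> t \<noteq> {} \<and> (\<exists>s\<in>P. t = s - M)"
  by (auto simp: erase_def)

lemma erase_mem: "s \<in> P \<Longrightarrow> \<not> s \<subseteq> M \<Longrightarrow> s - M \<in> erase M P"
  by (auto simp: erase_def)

lemma erase_erase: "erase M (erase N P) = erase (M \<union> N) P"
proof -
  have "(\<exists>u\<in>erase N P. t = u - M) \<longleftrightarrow> (\<exists>s\<in>P. t = s - (M \<union> N))" if "t \<noteq> {}" for t
  proof
    assume "\<exists>u\<in>erase N P. t = u - M"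
    then obtain s where "s \<in> P" "t = s - N - M" by (auto simp: erase_def)
    then show "\<exists>s\<in>P. t = s - (M \<union> N)" by (intro bexI[of _ s]) auto
  next
    assume "\<exists>s\<in>P. t = s - (M \<union> N)"
    then obtain s where s: "s \<in> P" "t = s - (M \<union> N)" by blast
    then have "s - N \<in> erase N P" using that by (intro erase_mem) auto
    moreover have "t = s - N - M" using s by auto
    ultimately show "\<exists>u\<in>erase N P. t = u - M" by blast
  qed
  then have "t \<in> erase M (erase N P) \<longleftrightarrow> t \<in> erase (M \<union> N) P" for t unfolding erase_iff[of t] by metis
  then show ?thesis by blast
qed

lemma eraseE: "t \<in> erase M P \<Longrightarrow> (\<And>s. s \<in> P \<Longrightarrow> t = s - M \<Longrightarrow> \<not> s \<subseteq> M \<Longrightarrow> Q) \<Longrightarrow> Q"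
  by (auto simp: erase_def)

lemma partition_on_erase: "partition_on V P \<Longrightarrow> partition_on (V - M) (erase M P)"
  by (auto simp: erase_def partition_on_def disjoint_def)

lemma erase_image: "inj f \<Longrightarrow> erase (f ` M) ((`) f ` P) = (`) f ` erase M P"
proof -
  assume f: "inj f"
  have "f ` s - f ` M = f ` (s - M)" for s using f by (simp add: image_set_diff)
  then have "(\<lambda>s. s - f ` M) ` (`) f ` P = (`) f ` (\<lambda>s. s - M) ` P" by (simp add: image_image)
  moreover have "(`) f ` Q - {{}} = (`) f ` (Q - {{}})" for Q by auto
  ultimately show ?thesis unfolding erase_def by simp
qed

text \<open>A path between points outside \<open>M\<close> enters and leaves \<open>M\<close> along
  edges of \<open>S\<close>, because \<open>S'\<close> avoids \<open>M\<close>. Each excursion stays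
  in one component of \<open>S\<close> and is replaced by a single edge of
  \<open>erase M (comps S)\<close>.\<close>

lemma conn_erase:
  assumes M: "\<Union>S' \<inter> M = {}" and xy: "conn (S \<union> S') x y" "x \<notin> M" "y \<notin> M"
  shows "conn (erase M (comps S) \<union> S') x y"
proof -
  let ?T = "erase M (comps S) \<union> S'"
  have cs: "conn ?T z w" if zw: "conn S z w" "z \<notin> M" "w \<notin> M" for z w
  proof (cases "z = w")
    case False
    then have "z \<in> \<Union>S" using conn_closed[OF zw(1), of "{z}"] by blast
    then have "{v. conn S z v} - M \<in> erase M (comps S)" using zw by (intro erase_mem) (auto simp: comps_def)
    then show ?thesis using zw by (intro conn_edge[of "{v. conn S z v} - M"]) auto
  qed simp
  \<comment> \<open>\<open>w\<close> is the last point of the path outside \<open>M\<close>; from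
    there on only edges of \<open>S\<close> have been used.\<close>
  have "\<exists>w. w \<notin> M \<and> conn ?T x w \<and> conn S w y \<and> (y \<notin> M \<longrightarrow> w = y)"
    using xy(1)
  proof (induction rule: conn_induct)
    case refl
    then show ?case using xy by (intro exI[of _ x]) auto
  next
    case (step y z s)
    then obtain w where w: "w \<notin> M" "conn ?T x w" "conn S w y" "y \<notin> M \<longrightarrow> w = y" by blast
    show ?case
    proof (cases "s \<in> S")
      case True
      then have wz: "conn S w z" using w conn_edge conn_trans step by metis
      show ?thesis
      proof (cases "z \<in> M")
        case True then show ?thesis using w wz by blast
      next
        case False then show ?thesis using cs[OF wz w(1) False] w conn_trans by (metis conn_refl)
      qed
    next
      case False
      then have s: "s \<in> S'" using step by auto
      then have "y \<notin> M" "z \<notin> M" using M step by auto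
      then show ?thesis using w s step conn_edge[of s ?T y z] conn_trans by (metis UnI2 conn_refl)
    qed
  qed
  then show ?thesis using xy(3) by blast
qed

text \<open>A middle row that the later diagrams do not touch can be erased before they are
  attached. Associativity of the composition rests on this two-stage computation.\<close>

lemma comps_erase:
  assumes M: "\<Union>S' \<inter> M = {}"
  shows "comps (erase M (comps S) \<union> S') = erase M (comps (S \<union> S'))"
proof (rule comps_eqI)
  have "\<Union>(erase M (comps S) \<union> S') = \<Union>(S \<union> S') - M"
    using M by (auto simp: Union_erase Union_comps)
  then show "partition_on (\<Union> (erase M (comps S) \<union> S')) (erase M (comps (S \<union> S')))"
    by (simp add: comps_partition partition_on_erase del: Union_Un_distrib)
next
  fix s assume s: "s \<in> erase M (comps S) \<union> S'" "s \<noteq> {}"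
  then obtain x where x: "x \<in> s" by blast
  have xM: "x \<notin> M" using s x M by (auto simp: erase_def)
  have xU: "x \<in> \<Union>(S \<union> S')" using s x Union_comps[of S] by (auto simp: erase_def)
  have "conn (S \<union> S') x y \<and> y \<notin> M" if "y \<in> s" for y
  proof (cases "s \<in> S'")
    case True
    then show ?thesis using that x M conn_edge[of s "S \<union> S'" x y] by auto
  next
    case False
    then obtain u where "u \<in> comps S" "s = u - M" using s by (auto simp: erase_def)
    then show ?thesis using comps_connD[of u S x y] that x conn_mono[of S x y "S \<union> S'"] by blast
  qed
  then have "s \<subseteq> {y. conn (S \<union> S') x y} - M" by auto
  moreover have "{y. conn (S \<union> S') x y} - M \<in> erase M (comps (S \<union> S'))"
  proof (intro erase_mem)
    show "{y. conn (S \<union> S') x y} \<in> comps (S \<union> S')" unfolding comps_def using xU by (rule imageI)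
    show "\<not> {y. conn (S \<union> S') x y} \<subseteq> M" using xM conn_refl[of "S \<union> S'" x] by blast
  qed
  ultimately show "\<exists>t\<in>erase M (comps (S \<union> S')). s \<subseteq> t" by blast
next
  fix t x y assume t: "t \<in> erase M (comps (S \<union> S'))" "x \<in> t" "y \<in> t"
  then obtain s where s: "s \<in> comps (S \<union> S')" "t = s - M" by (auto elim!: eraseE)
  then have "conn (S \<union> S') x y" "x \<notin> M" "y \<notin> M" using t comps_connD[of s "S \<union> S'" x y] by auto
  then show "conn (erase M (comps S) \<union> S') x y" by (rule conn_erase[OF M])
qed

text \<open>No edge of \<open>S'\<close> has a point in \<open>M\<close>, so a component inside
  \<open>M\<close> grows by edges of \<open>S\<close> alone. Loops closed in the first stage are
  thus not affected by the second.\<close>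

lemma comps_inside:
  assumes M: "\<Union>S' \<inter> M = {}" "{} \<notin> S'"
  shows "{s \<in> comps (S \<union> S'). s \<subseteq> M} = {s \<in> comps S. s \<subseteq> M}"
proof -
  have eq: "{y. conn (S \<union> S') x y} = {y. conn S x y}"
    if "{y. conn (S \<union> S') x y} \<subseteq> M \<or> {y. conn S x y} \<subseteq> M" for x
  proof -
    have "conn S x y" if "conn (S \<union> S') x y" "{y. conn (S \<union> S') x y} \<subseteq> M \<or> {y. conn S x y} \<subseteq> M" for y
      using that(1)
    proof (induction rule: conn_induct)
      case (step y z s)
      have "y \<in> M" using step that by blast
      then have "s \<in> S" using step M by auto
      then show ?case using step conn_edge conn_trans by metis
    qed simp
    moreover have "conn S x y \<Longrightarrow> conn (S \<union> S') x y" for y using conn_mono[of S x y "S \<union> S'"] by blast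
    ultimately show ?thesis using that by blast
  qed
  show ?thesis
  proof safe
    fix t assume t: "t \<in> comps (S \<union> S')" "t \<subseteq> M"
    then obtain x where x: "x \<in> \<Union>(S \<union> S')" "t = {y. conn (S \<union> S') x y}" by (auto simp: comps_def)
    have "x \<in> t" using x by simp
    then have "x \<in> \<Union>S" using x(1) t M by blast
    moreover have "t = {y. conn S x y}" using eq[of x] t x by blast
    ultimately show "t \<in> comps S" by (auto simp: comps_def)
  next
    fix t assume t: "t \<in> comps S" "t \<subseteq> M"
    then obtain x where x: "x \<in> \<Union>S" "t = {y. conn S x y}" by (auto simp: comps_def)
    then have "t = {y. conn (S \<union> S') x y}" using eq[of x] t by blast
    then show "t \<in> comps (S \<union> S')" using x(1) by (auto simp: comps_def)
  qed
qed

text \<open>A loop over \<open>M\<close> and \<open>N\<close> together either lies in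
  \<open>M\<close> and is counted in the first stage, or it survives the erasure of \<open>M\<close>
  and then lies in \<open>N\<close>. Distinct survivors stay distinct, since components are
  disjoint.\<close>

lemma card_comps_inside:
  assumes M: "\<Union>S' \<inter> M = {}" "{} \<notin> S'" "finite (comps (S \<union> S'))" "M \<inter> N = {}"
  shows "card {s \<in> comps (S \<union> S'). s \<subseteq> M \<union> N} =
    card {s \<in> comps S. s \<subseteq> M} + card {s \<in> comps (erase M (comps S) \<union> S'). s \<subseteq> N}"
proof -
  let ?C = "comps (S \<union> S')"
  let ?B = "{s \<in> ?C. s \<subseteq> M \<union> N \<and> \<not> s \<subseteq> M}"
  have "{s \<in> ?C. s \<subseteq> M \<union> N} = {s \<in> ?C. s \<subseteq> M} \<union> ?B" by auto
  then have "card {s \<in> ?C. s \<subseteq> M \<union> N} = card {s \<in> ?C. s \<subseteq> M} + card ?B"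
    using M(3) by (simp add: card_Un_disjoint disjoint_iff)
  moreover have "card ?B = card {s \<in> erase M ?C. s \<subseteq> N}"
  proof (rule bij_betw_same_card[of "\<lambda>s. s - M"])
    show "bij_betw (\<lambda>s. s - M) ?B {s \<in> erase M ?C. s \<subseteq> N}"
    proof (rule bij_betw_imageI)
      show "inj_on (\<lambda>s. s - M) ?B"
      proof (rule inj_onI)
        fix s t assume st: "s \<in> ?B" "t \<in> ?B" "s - M = t - M"
        then obtain x where "x \<in> s" "x \<notin> M" by blast
        then show "s = t" using st comps_disjoint[of s "S \<union> S'" t x] by blast
      qed
      show "(\<lambda>s. s - M) ` ?B = {s \<in> erase M ?C. s \<subseteq> N}"
        by (auto simp: erase_def)
    qed
  qed
  ultimately show ?thesis using comps_inside[OF M(1,2)] comps_erase[OF M(1)] by simp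
qed

subsection \<open>Composition of diagrams through components\<close>

text \<open>The type \<open>vertex\<close> offers three rows only. Sending rows to numbered copies
  inside \<open>nat \<times> nat\<close> lets three diagrams be stacked on four rows.\<close>

definition row3 :: "nat \<Rightarrow> nat \<Rightarrow> nat \<Rightarrow> vertex \<Rightarrow> nat \<times> nat" where
  "row3 a b c v = (case v of Top i \<Rightarrow> (a, i) | Mid i \<Rightarrow> (b, i) | Bot i \<Rightarrow> (c, i))"

text \<open>A diagram has no \<open>Mid\<close> points, so the middle row is a dummy;
  \<open>a + c + 1\<close> differs from \<open>a\<close> and from \<open>c\<close>, which keeps
  \<open>row3\<close> injective when \<open>a \<noteq> c\<close>.\<close>

definition place :: "nat \<Rightarrow> nat \<Rightarrow> diagram \<Rightarrow> (nat \<times> nat) set set" where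
  "place a c p = (`) (row3 a (a + c + 1) c) ` p"

lemma row3_simps [simp]:
  "row3 a b c (Top i) = (a, i)" "row3 a b c (Mid i) = (b, i)" "row3 a b c (Bot i) = (c, i)"
  by (simp_all add: row3_def)

lemma inj_row3: "a \<noteq> b \<Longrightarrow> b \<noteq> c \<Longrightarrow> a \<noteq> c \<Longrightarrow> inj (row3 a b c)"
  by (auto simp: inj_def row3_def split: vertex.splits)

lemma diagrams_part: "p \<in> diagrams n m \<Longrightarrow> s \<in> p \<Longrightarrow> s \<subseteq> Top ` {1..n} \<union> Bot ` {1..m}"
  by (auto simp: diagrams_def partition_on_def)

lemma diagrams_Union: "p \<in> diagrams n m \<Longrightarrow> \<Union>p = Top ` {1..n} \<union> Bot ` {1..m}"
  by (auto simp: diagrams_def partition_on_def)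

lemma diagrams_nonempty: "p \<in> diagrams n m \<Longrightarrow> s \<in> p \<Longrightarrow> s \<noteq> {}"
  by (auto simp: diagrams_def partition_on_def)

lemma diagrams_same: "p \<in> diagrams n m \<Longrightarrow> s \<in> p \<Longrightarrow> t \<in> p \<Longrightarrow> x \<in> s \<Longrightarrow> x \<in> t \<Longrightarrow> s = t"
  unfolding diagrams_def by (auto dest: partition_on_same)

lemma diagrams_cover: "p \<in> diagrams n m \<Longrightarrow> x \<in> Top ` {1..n} \<union> Bot ` {1..m} \<Longrightarrow> \<exists>s\<in>p. x \<in> s"
  using diagrams_Union[of p n m] by blast

lemma finite_diagram: "p \<in> diagrams n m \<Longrightarrow> finite p"
  using finite_elements[of "Top ` {1..n} \<union> Bot ` {1..m}" p] by (simp add: diagrams_def)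

lemma finite_diagram_part: "p \<in> diagrams n m \<Longrightarrow> s \<in> p \<Longrightarrow> finite s"
  using diagrams_part[of p n m s] by (auto intro: finite_subset)

lemma finite_diagrams: "finite (diagrams n m)"
  by (simp add: diagrams_def finitely_many_partition_on)

definition edges :: "diagram \<Rightarrow> diagram \<Rightarrow> diagram" where
  "edges p p' = (`) bot_to_mid ` p \<union> (`) top_to_mid ` p'"

lemma bot_to_mid_image:
  assumes "s \<subseteq> Top ` {1..n} \<union> Bot ` {1..m}"
  shows "bot_to_mid ` s = (s \<inter> range Top) \<union> {Mid i | i. Bot i \<in> s}"
proof -
  have "s = (s \<inter> range Top) \<union> (s \<inter> range Bot)" using assms by auto
  then have "bot_to_mid ` s = bot_to_mid ` (s \<inter> range Top) \<union> bot_to_mid ` (s \<inter> range Bot)"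
    by (metis image_Un)
  also have "bot_to_mid ` (s \<inter> range Top) = id ` (s \<inter> range Top)" by (intro image_cong) auto
  also have "bot_to_mid ` (s \<inter> range Bot) = {Mid i | i. Bot i \<in> s}" by (force simp: image_iff)
  finally show ?thesis by simp
qed

lemma top_to_mid_image:
  assumes "s \<subseteq> Top ` {1..n} \<union> Bot ` {1..m}"
  shows "top_to_mid ` s = {Mid i | i. Top i \<in> s} \<union> (s \<inter> range Bot)"
proof -
  have "s = (s \<inter> range Top) \<union> (s \<inter> range Bot)" using assms by auto
  then have "top_to_mid ` s = top_to_mid ` (s \<inter> range Top) \<union> top_to_mid ` (s \<inter> range Bot)"
    by (metis image_Un)
  also have "top_to_mid ` (s \<inter> range Bot) = id ` (s \<inter> range Bot)" by (intro image_cong) auto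
  also have "top_to_mid ` (s \<inter> range Top) = {Mid i | i. Top i \<in> s}" by (force simp: image_iff)
  finally show ?thesis by simp
qed

lemma Union_edges:
  assumes "p \<in> diagrams n m" "p' \<in> diagrams m r"
  shows "\<Union>(edges p p') = Top ` {1..n} \<union> Mid ` {1..m} \<union> Bot ` {1..r}"
proof -
  have "\<Union>(edges p p') = bot_to_mid ` \<Union>p \<union> top_to_mid ` \<Union>p'"
    by (auto simp: edges_def)
  also have "\<dots> = Top ` {1..n} \<union> Mid ` {1..m} \<union> Bot ` {1..r}"
    unfolding diagrams_Union[OF assms(1)] diagrams_Union[OF assms(2)]
    by (auto simp: image_Un image_image)
  finally show ?thesis .
qed

lemma stack_eq:
  assumes "p \<in> diagrams n m" "p' \<in> diagrams m r"
  shows "stack n m r p p' = comps (edges p p')"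
  unfolding stack_def edges_def[symmetric]
proof (rule finest_containing_eq)
  show "{} \<notin> edges p p'" using assms diagrams_nonempty by (auto simp: edges_def)
qed (rule Union_edges[OF assms])

lemma stack_partition:
  assumes "p \<in> diagrams n m" "p' \<in> diagrams m r"
  shows "partition_on (Top ` {1..n} \<union> Mid ` {1..m} \<union> Bot ` {1..r}) (stack n m r p p')"
  using comps_partition[of "edges p p'"] stack_eq[OF assms] Union_edges[OF assms] by simp

lemma finite_stack:
  assumes "p \<in> diagrams n m" "p' \<in> diagrams m r"
  shows "finite (stack n m r p p')"
  by (rule finite_elements[OF _ stack_partition[OF assms]]) auto

lemma compose_erase:
  assumes "p \<in> diagrams n m" "p' \<in> diagrams m r"
  shows "compose n m r p p' = erase (range Mid) (stack n m r p p')"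
proof -
  have "s - Mid ` {1..m} = s - range Mid" if "s \<in> stack n m r p p'" for s
    using partition_onD1[OF stack_partition[OF assms]] that by auto
  then show ?thesis unfolding compose_def erase_def by (simp cong: image_cong)
qed

lemma loops_eq:
  assumes "p \<in> diagrams n m" "p' \<in> diagrams m r"
  shows "loops n m r p p' = card {s \<in> stack n m r p p'. s \<subseteq> range Mid}"
proof -
  have "s \<subseteq> Mid ` {1..m} \<longleftrightarrow> s \<subseteq> range Mid" if "s \<in> stack n m r p p'" for s
    using partition_onD1[OF stack_partition[OF assms]] that by auto
  then show ?thesis unfolding loops_def by (metis (no_types, lifting) Collect_cong)
qed

lemma compose_diagrams:
  assumes "p \<in> diagrams n m" "p' \<in> diagrams m r"
  shows "compose n m r p p' \<in> diagrams n r"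
proof -
  have "Top ` {1..n} \<union> Mid ` {1..m} \<union> Bot ` {1..r} - range Mid = Top ` {1..n} \<union> Bot ` {1..r}" by auto
  then show ?thesis
    using partition_on_erase[OF stack_partition[OF assms], of "range Mid"]
    by (simp add: compose_erase[OF assms] diagrams_def)
qed

lemma place_row3:
  assumes "p \<in> diagrams n m"
  shows "place a c p = (`) (row3 a b c) ` p"
proof -
  have "row3 a (a + c + 1) c ` s = row3 a b c ` s" if "s \<in> p" for s
    using diagrams_part[OF assms that] by (intro image_cong) auto
  then show ?thesis unfolding place_def by (rule image_cong[OF refl])
qed

lemma place_edges:
  assumes "p \<in> diagrams n m" "p' \<in> diagrams m r"
  shows "(`) (row3 a b c) ` edges p p' = place a b p \<union> place b c p'"
proof -
  have 1: "row3 a b c ` bot_to_mid ` s = row3 a (a + b + 1) b ` s" if "s \<in> p" for s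
    unfolding image_image using diagrams_part[OF assms(1) that] by (intro image_cong) auto
  have 2: "row3 a b c ` top_to_mid ` s = row3 b (b + c + 1) c ` s" if "s \<in> p'" for s
    unfolding image_image using diagrams_part[OF assms(2) that] by (intro image_cong) auto
  have "(`) (row3 a b c) ` (`) bot_to_mid ` p = place a b p"
    unfolding place_def image_image[of "(`) (row3 a b c)"] by (rule image_cong[OF refl 1])
  moreover have "(`) (row3 a b c) ` (`) top_to_mid ` p' = place b c p'"
    unfolding place_def image_image[of "(`) (row3 a b c)"] by (rule image_cong[OF refl 2])
  ultimately show ?thesis by (simp add: edges_def image_Un)
qed

lemma place_stack:
  assumes "p \<in> diagrams n m" "p' \<in> diagrams m r" "a \<noteq> b" "b \<noteq> c" "a \<noteq> c"
  shows "(`) (row3 a b c) ` stack n m r p p' = comps (place a b p \<union> place b c p')"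
  using comps_image[of "row3 a b c" "edges p p'"] inj_row3[OF assms(3-5)]
  by (simp add: stack_eq[OF assms(1,2)] place_edges[OF assms(1,2)] inj_on_subset[of _ UNIV])

lemma row3_range_Mid: "row3 a b c ` range Mid = {b} \<times> UNIV"
  by (auto simp: image_image image_iff)

lemma place_compose:
  assumes "p \<in> diagrams n m" "p' \<in> diagrams m r" "a \<noteq> b" "b \<noteq> c" "a \<noteq> c"
  shows "place a c (compose n m r p p') = erase ({b} \<times> UNIV) (comps (place a b p \<union> place b c p'))"
proof -
  have "place a c (compose n m r p p') = (`) (row3 a b c) ` erase (range Mid) (stack n m r p p')"
    unfolding compose_erase[OF assms(1,2), symmetric] by (rule place_row3[OF compose_diagrams[OF assms(1,2)]])
  also have "\<dots> = erase (row3 a b c ` range Mid) ((`) (row3 a b c) ` stack n m r p p')"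
    by (rule erase_image[OF inj_row3[OF assms(3-5)], symmetric])
  finally show ?thesis by (simp only: row3_range_Mid place_stack[OF assms])
qed

lemma loops_place:
  assumes "p \<in> diagrams n m" "p' \<in> diagrams m r" "a \<noteq> b" "b \<noteq> c" "a \<noteq> c"
  shows "loops n m r p p' = card {s \<in> comps (place a b p \<union> place b c p'). s \<subseteq> {b} \<times> UNIV}"
proof -
  let ?f = "row3 a b c"
  have inj: "inj ?f" by (rule inj_row3[OF assms(3-5)])
  have "?f ` s \<subseteq> {b} \<times> UNIV \<longleftrightarrow> s \<subseteq> range Mid" for s
    unfolding row3_range_Mid[of a b c, symmetric] using inj by (rule inj_image_subset_iff)
  then have "{s \<in> comps (place a b p \<union> place b c p'). s \<subseteq> {b} \<times> UNIV} = (`) ?f ` {s \<in> stack n m r p p'. s \<subseteq> range Mid}"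
    unfolding place_stack[OF assms, symmetric] by auto
  moreover have "inj_on ((`) ?f) A" for A using inj by (auto simp: inj_on_def inj_image_eq_iff)
  ultimately show ?thesis by (simp add: loops_eq[OF assms(1,2)] card_image)
qed

lemma place_inject:
  assumes "p \<in> diagrams n m" "q \<in> diagrams n m" "a \<noteq> c" "place a c p = place a c q"
  shows "p = q"
proof -
  have "inj (row3 a (a + c + 1) c)" using assms(3) by (intro inj_row3) auto
  then have "inj ((`) ((`) (row3 a (a + c + 1) c)))" by (auto simp: inj_def inj_image_eq_iff)
  then show ?thesis using assms(4) by (simp add: place_def inj_eq)
qed

lemma place_rows: "p \<in> diagrams n m \<Longrightarrow> \<Union>(place a c p) \<subseteq> {a, c} \<times> UNIV"
proof -
  assume "p \<in> diagrams n m"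
  then have "\<Union>(place a c p) = row3 a (a + c + 1) c ` (Top ` {1..n} \<union> Bot ` {1..m})"
    unfolding place_def by (simp add: image_Union[symmetric] diagrams_Union)
  then show ?thesis by (auto simp: image_Un image_image)
qed

lemma finite_place: "p \<in> diagrams n m \<Longrightarrow> finite (\<Union>(place a c p))"
  unfolding place_def by (auto intro: finite_diagram finite_diagram_part)

lemma empty_notin_place: "p \<in> diagrams n m \<Longrightarrow> {} \<notin> place a c p"
  unfolding place_def using diagrams_nonempty by auto

lemma finite_comps: "finite (\<Union>S) \<Longrightarrow> finite (comps S)"
  by (simp add: comps_def)

text \<open>The three diagrams occupy the rows 0 to 3. Either bracketing erases the rows 1 and 2
  from the components of one and the same hypergraph, only in a different order; the loops are the
  components inside these two rows.\<close>

lemma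
  assumes p: "p \<in> diagrams n m" and q: "q \<in> diagrams m r" and s: "s \<in> diagrams r t"
  shows compose_assoc: "compose n r t (compose n m r p q) s = compose n m t p (compose m r t q s)"
    and loops_assoc: "loops n m r p q + loops n r t (compose n m r p q) s =
      loops m r t q s + loops n m t p (compose m r t q s)"
proof -
  let ?P = "place 0 1 p" and ?Q = "place 1 2 q" and ?S = "place 2 3 s"
  let ?R1 = "{1} \<times> UNIV :: (nat \<times> nat) set" and ?R2 = "{2} \<times> UNIV :: (nat \<times> nat) set"
  have pq: "compose n m r p q \<in> diagrams n r" and qs: "compose m r t q s \<in> diagrams m t"
    using compose_diagrams p q s by blast+
  have dS: "\<Union>?S \<inter> ?R1 = {}" using place_rows[OF s, of 2 3] by auto
  have dP: "\<Union>?P \<inter> ?R2 = {}" using place_rows[OF p, of 0 1] by auto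
  have fin: "finite (comps (?P \<union> ?Q \<union> ?S))"
    using finite_place[OF p, of 0 1] finite_place[OF q, of 1 2] finite_place[OF s, of 2 3]
    by (intro finite_comps) auto
  have c1: "comps (place 0 2 (compose n m r p q) \<union> ?S) = erase ?R1 (comps (?P \<union> ?Q \<union> ?S))"
    using place_compose[OF p q, of 0 1 2] comps_erase[OF dS, of "?P \<union> ?Q"] by simp
  have c2: "comps (?P \<union> place 1 3 (compose m r t q s)) = erase ?R2 (comps (?P \<union> ?Q \<union> ?S))"
    using place_compose[OF q s, of 1 2 3] comps_erase[OF dP, of "?Q \<union> ?S"] by (simp add: Un_ac)
  have "place 0 3 (compose n r t (compose n m r p q) s) = place 0 3 (compose n m t p (compose m r t q s))"
    using place_compose[OF pq s, of 0 2 3] place_compose[OF p qs, of 0 1 3] c1 c2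
    by (simp add: erase_erase Un_commute)
  then show "compose n r t (compose n m r p q) s = compose n m t p (compose m r t q s)"
    using place_inject[of _ n t _ 0 3] compose_diagrams p q s pq qs by (metis zero_neq_numeral)
  have "loops n m r p q + loops n r t (compose n m r p q) s = card {u \<in> comps (?P \<union> ?Q \<union> ?S). u \<subseteq> ?R1 \<union> ?R2}"
    using card_comps_inside[OF dS empty_notin_place[OF s] fin, of ?R2] loops_place[OF p q, of 0 1 2]
      loops_place[OF pq s, of 0 2 3] place_compose[OF p q, of 0 1 2]
    by (simp add: disjoint_iff)
  moreover have "loops m r t q s + loops n m t p (compose m r t q s) = card {u \<in> comps (?P \<union> ?Q \<union> ?S). u \<subseteq> ?R1 \<union> ?R2}"
    using card_comps_inside[of ?P ?R2 "?Q \<union> ?S" ?R1] dP empty_notin_place[OF p, of 0 1] fin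
      loops_place[OF q s, of 1 2 3] loops_place[OF p qs, of 0 1 3] place_compose[OF q s, of 1 2 3]
    by (simp add: disjoint_iff Un_ac)
  ultimately show "loops n m r p q + loops n r t (compose n m r p q) s =
      loops m r t q s + loops n m t p (compose m r t q s)" by simp
qed

section \<open>Reflection in the horizontal axis\<close>

fun flip_vertex :: "vertex \<Rightarrow> vertex" where
  "flip_vertex (Top i) = Bot i"
| "flip_vertex (Mid i) = Mid i"
| "flip_vertex (Bot i) = Top i"

definition flip :: "diagram \<Rightarrow> diagram" where
  "flip p = (`) flip_vertex ` p"

lemma flip_vertex_invol [simp]: "flip_vertex (flip_vertex v) = v"
  by (cases v) auto

lemma inj_flip_vertex: "inj flip_vertex"
  by (metis flip_vertex_invol injI)

lemma flip_flip [simp]: "flip (flip p) = p"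
  by (simp add: flip_def image_image)

lemma flip_diagrams: "p \<in> diagrams n m \<Longrightarrow> flip p \<in> diagrams m n"
proof -
  assume "p \<in> diagrams n m"
  then have P: "partition_on (Top ` {1..n} \<union> Bot ` {1..m}) p" by (simp add: diagrams_def)
  have "{} \<notin> flip p" using P by (auto simp: flip_def partition_on_def)
  moreover have "flip_vertex ` (Top ` {1..n} \<union> Bot ` {1..m}) = Top ` {1..m} \<union> Bot ` {1..n}"
    by (auto simp: image_Un image_image)
  ultimately show ?thesis
    using partition_on_inj_image[OF P, of flip_vertex] inj_on_subset[OF inj_flip_vertex]
    by (simp add: diagrams_def flip_def)
qed

lemma place_flip:
  assumes "p \<in> diagrams n m"
  shows "place a c (flip p) = place c a p"
proof -
  have "row3 a (a + c + 1) c ` flip_vertex ` s = row3 c (c + a + 1) a ` s" if "s \<in> p" for s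
    unfolding image_image using diagrams_part[OF assms that] by (intro image_cong) auto
  then show ?thesis unfolding place_def flip_def image_image[of "(`) _" "(`) _"] by (rule image_cong[OF refl])
qed

text \<open>Reflecting exchanges the two row numbers of \<open>place\<close>. Both sides therefore
  come from the same hypergraph, read with the rows 0, 1, 2 in opposite orders.\<close>

lemma
  assumes p: "p \<in> diagrams n m" and q: "q \<in> diagrams m r"
  shows compose_flip: "compose r m n (flip q) (flip p) = flip (compose n m r p q)"
    and loops_flip: "loops r m n (flip q) (flip p) = loops n m r p q"
proof -
  have c: "compose n m r p q \<in> diagrams n r" by (rule compose_diagrams[OF p q])
  have f: "flip q \<in> diagrams r m" "flip p \<in> diagrams m n" using p q flip_diagrams by auto
  have "place 0 2 (compose r m n (flip q) (flip p)) = place 0 2 (flip (compose n m r p q))"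
    using place_compose[OF f, of 0 1 2] place_compose[OF p q, of 2 1 0]
    by (simp add: place_flip[OF p] place_flip[OF q] place_flip[OF c] Un_commute)
  then show "compose r m n (flip q) (flip p) = flip (compose n m r p q)"
    using place_inject[of _ r n _ 0 2] compose_diagrams[OF f] flip_diagrams[OF c] by simp
  show "loops r m n (flip q) (flip p) = loops n m r p q"
    using loops_place[OF f, of 0 1 2] loops_place[OF p q, of 2 1 0]
    by (simp add: place_flip[OF p] place_flip[OF q] Un_commute)
qed

section \<open>The identity diagram as a unit\<close>

fun mid_to_top :: "vertex \<Rightarrow> vertex" where
  "mid_to_top (Top i) = Top i"
| "mid_to_top (Mid i) = Top i"
| "mid_to_top (Bot i) = Bot i"

lemma identity_diagrams: "identity_diagram n \<in> diagrams n n"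
  unfolding diagrams_def identity_diagram_def
  by (auto intro!: partition_onI simp: disjnt_def)

text \<open>In the stack each \<open>Mid i\<close> hangs on \<open>Top i\<close>, so the components
  are the preimages of the parts of \<open>p\<close> under the folding map
  \<open>mid_to_top\<close>. Each preimage contains its part and hence a vertex outside the middle
  row: no loops.\<close>

lemma
  assumes p: "p \<in> diagrams n m"
  shows compose_identity_left: "compose n n m (identity_diagram n) p = p"
    and loops_identity_left: "loops n n m (identity_diagram n) p = 0"
proof -
  let ?E = "edges (identity_diagram n) p" and ?Q = "(-`) mid_to_top ` p"
  have P: "partition_on (Top ` {1..n} \<union> Bot ` {1..m}) p" using p by (simp add: diagrams_def)
  have dE: "?E = (\<lambda>i. {Top i, Mid i}) ` {1..n} \<union> (`) top_to_mid ` p"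
    by (auto simp: edges_def identity_diagram_def image_image)
  have sub: "s \<subseteq> mid_to_top -` s" if "s \<in> p" for s
    using diagrams_part[OF p that] by auto
  have minus: "mid_to_top -` s - range Mid = s" if "s \<in> p" for s
  proof
    show "mid_to_top -` s - range Mid \<subseteq> s"
    proof
      fix x assume "x \<in> mid_to_top -` s - range Mid"
      then show "x \<in> s" by (cases x) auto
    qed
    show "s \<subseteq> mid_to_top -` s - range Mid" using sub[OF that] diagrams_part[OF p that] by auto
  qed
  have ne: "{} \<notin> ?Q" using sub diagrams_nonempty[OF p] by fastforce
  have "mid_to_top -` (Top ` {1..n} \<union> Bot ` {1..m}) = Top ` {1..n} \<union> Mid ` {1..n} \<union> Bot ` {1..m}"
  proof (rule Set.set_eqI)
    fix x show "x \<in> mid_to_top -` (Top ` {1..n} \<union> Bot ` {1..m}) \<longleftrightarrow> x \<in> Top ` {1..n} \<union> Mid ` {1..n} \<union> Bot ` {1..m}"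
      by (cases x) auto
  qed
  then have "partition_on (\<Union>?E) ?Q"
    using partition_on_vimage[OF P, of mid_to_top] ne Union_edges[OF identity_diagrams p] by simp
  then have "comps ?E = ?Q"
  proof (rule comps_eqI)
    fix e assume "e \<in> ?E" "e \<noteq> {}"
    then consider i where "i \<in> {1..n}" "e = {Top i, Mid i}" | s where "s \<in> p" "e = top_to_mid ` s"
      unfolding dE by blast
    then show "\<exists>t\<in>?Q. e \<subseteq> t"
    proof cases
      case 1
      then obtain s where "s \<in> p" "Top i \<in> s" using diagrams_cover[OF p, of "Top i"] by auto
      then show ?thesis using 1 by (intro bexI[of _ "mid_to_top -` s"]) auto
    next
      case 2
      have "mid_to_top (top_to_mid x) = x" if "x \<in> s" for x
        using diagrams_part[OF p 2(1)] that by auto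
      then have "e \<subseteq> mid_to_top -` s" using 2(2) by auto
      then show ?thesis using 2(1) by (intro bexI[of _ "mid_to_top -` s"]) auto
    qed
  next
    fix t x y assume t: "t \<in> ?Q" "x \<in> t" "y \<in> t"
    then obtain s where s: "s \<in> p" "mid_to_top x \<in> s" "mid_to_top y \<in> s" by auto
    have c: "conn ?E z (top_to_mid (mid_to_top z))" if "mid_to_top z \<in> s" for z
    proof (cases z)
      case (Top i)
      then have "i \<in> {1..n}" using that diagrams_part[OF p s(1)] by auto
      then have "{Top i, Mid i} \<in> ?E" by (auto simp: dE)
      then show ?thesis using conn_edge[of "{Top i, Mid i}" ?E "Top i" "Mid i"] Top by simp
    qed auto
    have "top_to_mid ` s \<in> ?E" using s by (auto simp: dE)
    then have "conn ?E (top_to_mid (mid_to_top x)) (top_to_mid (mid_to_top y))"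
      using s by (intro conn_edge[of "top_to_mid ` s"]) auto
    then show "conn ?E x y" using c[OF s(2)] c[OF s(3)] by (meson conn_sym conn_trans)
  qed
  then have st: "stack n n m (identity_diagram n) p = ?Q"
    by (simp add: stack_eq[OF identity_diagrams p])
  have "(\<lambda>s. s - range Mid) ` ?Q = p" unfolding image_image using minus by simp
  then show "compose n n m (identity_diagram n) p = p"
    using diagrams_nonempty[OF p] by (auto simp: compose_erase[OF identity_diagrams p] st erase_def)
  have "\<not> mid_to_top -` s \<subseteq> range Mid" if "s \<in> p" for s
    using minus[OF that] diagrams_nonempty[OF p that] by blast
  then have "{s \<in> ?Q. s \<subseteq> range Mid} = {}" by auto
  then show "loops n n m (identity_diagram n) p = 0" by (simp only: loops_eq[OF identity_diagrams p] st card.empty)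
qed

lemma flip_identity: "flip (identity_diagram n) = identity_diagram n"
  unfolding flip_def identity_diagram_def image_image by (intro image_cong) auto

lemma
  assumes p: "p \<in> diagrams n m"
  shows compose_identity_right: "compose n m m p (identity_diagram m) = p"
    and loops_identity_right: "loops n m m p (identity_diagram m) = 0"
  using compose_flip[OF identity_diagrams flip_diagrams[OF p]] loops_flip[OF identity_diagrams flip_diagrams[OF p]]
    compose_identity_left[OF flip_diagrams[OF p]] loops_identity_left[OF flip_diagrams[OF p]]
  by (simp_all add: flip_identity)

subsection \<open>The tonal algebra is a ring\<close>

lemma card_eq_sum_parts:
  assumes "finite V" "partition_on V P" "\<And>s. s \<in> P \<Longrightarrow> s \<subseteq> t \<or> s \<inter> t = {}"
  shows "card (t \<inter> V \<inter> X) = (\<Sum>s\<in>{s \<in> P. s \<subseteq> t}. card (s \<inter> X))"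
proof -
  have "t \<inter> V \<inter> X = (\<Union>s\<in>{s \<in> P. s \<subseteq> t}. s \<inter> X)"
    using assms(2,3) by (fastforce simp: partition_on_def)
  also have "card \<dots> = (\<Sum>s\<in>{s \<in> P. s \<subseteq> t}. card (s \<inter> X))"
  proof (rule card_UN_disjoint)
    show "finite {s \<in> P. s \<subseteq> t}" using finite_elements[OF assms(1,2)] by simp
    show "\<forall>i\<in>{s \<in> P. s \<subseteq> t}. finite (i \<inter> X)"
      using assms(1,2) by (auto simp: partition_on_def intro: finite_subset)
    show "\<forall>i\<in>{s \<in> P. s \<subseteq> t}. \<forall>j\<in>{s \<in> P. s \<subseteq> t}. i \<noteq> j \<longrightarrow> i \<inter> X \<inter> (j \<inter> X) = {}"
      using partition_on_same[OF assms(2)] by blast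
  qed
  finally show ?thesis .
qed

lemma inj_on_bot_to_mid: "s \<subseteq> range Top \<union> range Bot \<Longrightarrow> inj_on bot_to_mid s"
  by (rule inj_on_subset[of _ "range Top \<union> range Bot"]) (auto simp: inj_on_def)

lemma inj_on_top_to_mid: "s \<subseteq> range Top \<union> range Bot \<Longrightarrow> inj_on top_to_mid s"
  by (rule inj_on_subset[of _ "range Top \<union> range Bot"]) (auto simp: inj_on_def)

lemma diagrams_part': "p \<in> diagrams n m \<Longrightarrow> s \<in> p \<Longrightarrow> s \<subseteq> range Top \<union> range Bot"
  using diagrams_part[of p n m s] by auto

lemma card_Mid: "card {Mid i | i. P i} = card {i. P i}"
  by (rule bij_betw_same_card[symmetric, of Mid]) (auto simp: bij_betw_def inj_on_def)

lemma card_range_Bot: "card (s \<inter> range Bot) = card {i. Bot i \<in> s}"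
  by (rule bij_betw_same_card[symmetric, of Bot]) (auto simp: bij_betw_def inj_on_def)

lemma card_range_Top: "card (s \<inter> range Top) = card {i. Top i \<in> s}"
  by (rule bij_betw_same_card[symmetric, of Top]) (auto simp: bij_betw_def inj_on_def)

lemma
  assumes "s \<subseteq> Top ` {1..n} \<union> Bot ` {1..m}"
  shows bot_to_mid_Top: "bot_to_mid ` s \<inter> range Top = s \<inter> range Top"
    and bot_to_mid_Bot: "bot_to_mid ` s \<inter> range Bot = {}"
    and card_bot_to_mid: "card (bot_to_mid ` s \<inter> range Mid) = card (s \<inter> range Bot)"
    and top_to_mid_Bot: "top_to_mid ` s \<inter> range Bot = s \<inter> range Bot"
    and top_to_mid_Top: "top_to_mid ` s \<inter> range Top = {}"
    and card_top_to_mid: "card (top_to_mid ` s \<inter> range Mid) = card (s \<inter> range Top)"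
proof -
  note b = bot_to_mid_image[OF assms] and t = top_to_mid_image[OF assms]
  have "bot_to_mid ` s \<inter> range Mid = {Mid i | i. Bot i \<in> s}" unfolding b by auto
  then show "card (bot_to_mid ` s \<inter> range Mid) = card (s \<inter> range Bot)" by (simp add: card_Mid card_range_Bot)
  have "top_to_mid ` s \<inter> range Mid = {Mid i | i. Top i \<in> s}" unfolding t by auto
  then show "card (top_to_mid ` s \<inter> range Mid) = card (s \<inter> range Top)" by (simp add: card_Mid card_range_Top)
qed (auto simp: bot_to_mid_image[OF assms] top_to_mid_image[OF assms])

lemma partition_bot_to_mid:
  assumes "p \<in> diagrams n m"
  shows "partition_on (Top ` {1..n} \<union> Mid ` {1..m}) ((`) bot_to_mid ` p)"
proof -
  have P: "partition_on (Top ` {1..n} \<union> Bot ` {1..m}) p" using assms by (simp add: diagrams_def)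
  have "inj_on bot_to_mid (Top ` {1..n} \<union> Bot ` {1..m})" by (rule inj_on_bot_to_mid) auto
  moreover have "{} \<notin> (`) bot_to_mid ` p" using diagrams_nonempty[OF assms] by auto
  ultimately show ?thesis using partition_on_inj_image[OF P, of bot_to_mid] by (simp add: image_Un image_image)
qed

lemma partition_top_to_mid:
  assumes "p \<in> diagrams n m"
  shows "partition_on (Mid ` {1..n} \<union> Bot ` {1..m}) ((`) top_to_mid ` p)"
proof -
  have P: "partition_on (Top ` {1..n} \<union> Bot ` {1..m}) p" using assms by (simp add: diagrams_def)
  have "inj_on top_to_mid (Top ` {1..n} \<union> Bot ` {1..m})" by (rule inj_on_top_to_mid) auto
  moreover have "{} \<notin> (`) top_to_mid ` p" using diagrams_nonempty[OF assms] by auto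
  ultimately show ?thesis using partition_on_inj_image[OF P, of top_to_mid] by (simp add: image_Un image_image)
qed

lemma stack_part: 
  assumes "p \<in> diagrams n m" "p' \<in> diagrams m r" "t \<in> stack n m r p p'"
  shows "t \<subseteq> Top ` {1..n} \<union> Mid ` {1..m} \<union> Bot ` {1..r}"
  using partition_onD1[OF stack_partition[OF assms(1,2)]] assms(3) by auto

lemma stack_same:
  assumes "p \<in> diagrams n m" "p' \<in> diagrams m r" "t \<in> stack n m r p p'" "u \<in> stack n m r p p'" "x \<in> t" "x \<in> u"
  shows "t = u"
  by (rule partition_on_same[OF stack_partition[OF assms(1,2)] assms(3-)])

lemma stack_edge_top:
  assumes "p \<in> diagrams n m" "p' \<in> diagrams m r" "t \<in> stack n m r p p'" "s \<in> p"
  shows "bot_to_mid ` s \<subseteq> t \<or> bot_to_mid ` s \<inter> t = {}"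
  using comps_edge[of t "edges p p'" "bot_to_mid ` s"] assms by (auto simp: stack_eq edges_def)

lemma stack_edge_bot:
  assumes "p \<in> diagrams n m" "p' \<in> diagrams m r" "t \<in> stack n m r p p'" "s \<in> p'"
  shows "top_to_mid ` s \<subseteq> t \<or> top_to_mid ` s \<inter> t = {}"
  using comps_edge[of t "edges p p'" "top_to_mid ` s"] assms by (auto simp: stack_eq edges_def)

text \<open>A component is a union of parts of \<open>p\<close> on the upper two rows and a union of
  parts of \<open>p'\<close> on the lower two. Counting its middle row in both ways is what
  transports congruences modulo \<open>l\<close> from top to bottom.\<close>

lemma
  assumes p: "p \<in> diagrams n m" and p': "p' \<in> diagrams m r" and t: "t \<in> stack n m r p p'"
  shows card_stack_top: "card (t \<inter> range Top) = (\<Sum>s\<in>{s \<in> p. bot_to_mid ` s \<subseteq> t}. card (s \<inter> range Top))"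
    and card_stack_mid: "card (t \<inter> range Mid) = (\<Sum>s\<in>{s \<in> p. bot_to_mid ` s \<subseteq> t}. card (s \<inter> range Bot))"
    and card_stack_mid': "card (t \<inter> range Mid) = (\<Sum>s\<in>{s \<in> p'. top_to_mid ` s \<subseteq> t}. card (s \<inter> range Top))"
    and card_stack_bot: "card (t \<inter> range Bot) = (\<Sum>s\<in>{s \<in> p'. top_to_mid ` s \<subseteq> t}. card (s \<inter> range Bot))"
proof -
  let ?V = "Top ` {1..n} \<union> Mid ` {1..m}" and ?V' = "Mid ` {1..m} \<union> Bot ` {1..r}"
  have i: "t \<inter> ?V \<inter> range Top = t \<inter> range Top" "t \<inter> ?V \<inter> range Mid = t \<inter> range Mid"
    "t \<inter> ?V' \<inter> range Mid = t \<inter> range Mid" "t \<inter> ?V' \<inter> range Bot = t \<inter> range Bot"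
    using stack_part[OF p p' t] by auto
  have U: "{e \<in> (`) bot_to_mid ` p. e \<subseteq> t} = (`) bot_to_mid ` {s \<in> p. bot_to_mid ` s \<subseteq> t}"
    "{e \<in> (`) top_to_mid ` p'. e \<subseteq> t} = (`) top_to_mid ` {s \<in> p'. top_to_mid ` s \<subseteq> t}" by auto
  have inj: "inj_on ((`) bot_to_mid) {s \<in> p. bot_to_mid ` s \<subseteq> t}"
    by (rule inj_onI) (use inj_on_image_eq_iff[OF inj_on_bot_to_mid[of "range Top \<union> range Bot"]] diagrams_part'[OF p] in auto)
  have inj': "inj_on ((`) top_to_mid) {s \<in> p'. top_to_mid ` s \<subseteq> t}"
    by (rule inj_onI) (use inj_on_image_eq_iff[OF inj_on_top_to_mid[of "range Top \<union> range Bot"]] diagrams_part'[OF p'] in auto)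
  have 1: "card (t \<inter> ?V \<inter> X) = (\<Sum>s\<in>{s \<in> p. bot_to_mid ` s \<subseteq> t}. card (bot_to_mid ` s \<inter> X))" for X
    using card_eq_sum_parts[OF _ partition_bot_to_mid[OF p], of t X] stack_edge_top[OF p p' t]
    unfolding U sum.reindex[OF inj] by auto
  have 2: "card (t \<inter> ?V' \<inter> X) = (\<Sum>s\<in>{s \<in> p'. top_to_mid ` s \<subseteq> t}. card (top_to_mid ` s \<inter> X))" for X
    using card_eq_sum_parts[OF _ partition_top_to_mid[OF p'], of t X] stack_edge_bot[OF p p' t]
    unfolding U sum.reindex[OF inj'] by auto
  show "card (t \<inter> range Top) = (\<Sum>s\<in>{s \<in> p. bot_to_mid ` s \<subseteq> t}. card (s \<inter> range Top))"
    using 1[of "range Top"] i bot_to_mid_Top[OF diagrams_part[OF p]] by simp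
  show "card (t \<inter> range Mid) = (\<Sum>s\<in>{s \<in> p. bot_to_mid ` s \<subseteq> t}. card (s \<inter> range Bot))"
    using 1[of "range Mid"] i card_bot_to_mid[OF diagrams_part[OF p]] by simp
  show "card (t \<inter> range Mid) = (\<Sum>s\<in>{s \<in> p'. top_to_mid ` s \<subseteq> t}. card (s \<inter> range Top))"
    using 2[of "range Mid"] i card_top_to_mid[OF diagrams_part[OF p']] by simp
  show "card (t \<inter> range Bot) = (\<Sum>s\<in>{s \<in> p'. top_to_mid ` s \<subseteq> t}. card (s \<inter> range Bot))"
    using 2[of "range Bot"] i top_to_mid_Bot[OF diagrams_part[OF p']] by simp
qed

lemma tonal_diagrams: "p \<in> tonal l n \<Longrightarrow> p \<in> diagrams n n"
  by (simp add: tonal_def)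

lemma finite_tonal: "finite (tonal l n)"
  using finite_diagrams[of n n] by (auto simp: tonal_def)

lemma compose_tonal:
  assumes p: "p \<in> tonal l n" and p': "p' \<in> tonal l n"
  shows "compose n n n p p' \<in> tonal l n"
proof -
  note d = tonal_diagrams[OF p] tonal_diagrams[OF p']
  have "is_tone l s" if "s \<in> compose n n n p p'" for s
  proof -
    obtain t where t: "t \<in> stack n n n p p'" "s = t - range Mid"
      using \<open>s \<in> compose n n n p p'\<close> by (auto simp: compose_erase[OF d] elim!: eraseE)
    have 1: "[card (t \<inter> range Top) = card (t \<inter> range Mid)] (mod l)"
      unfolding card_stack_top[OF d t(1)] card_stack_mid[OF d t(1)]
      using p by (intro cong_sum) (auto simp: tonal_def is_tone_def)
    have 2: "[card (t \<inter> range Mid) = card (t \<inter> range Bot)] (mod l)"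
      unfolding card_stack_mid'[OF d t(1)] card_stack_bot[OF d t(1)]
      using p' by (intro cong_sum) (auto simp: tonal_def is_tone_def)
    have "s \<inter> range Top = t \<inter> range Top" "s \<inter> range Bot = t \<inter> range Bot" using t(2) by auto
    then show ?thesis using cong_trans[OF 1 2] by (simp add: is_tone_def)
  qed
  then show ?thesis using compose_diagrams[OF d] by (simp add: tonal_def)
qed

lemma identity_tonal: "identity_diagram n \<in> tonal l n"
proof -
  have e: "{Top i, Bot i} \<inter> range Top = {Top i}" "{Top i, Bot i} \<inter> range Bot = {Bot i}" for i by auto
  have "is_tone l {Top i, Bot i}" for i unfolding is_tone_def e by simp
  then show ?thesis using identity_diagrams[of n] by (auto simp: tonal_def identity_diagram_def)
qed

lemma flip_tonal:
  assumes "p \<in> tonal l n" shows "flip p \<in> tonal l n"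
proof -
  have "is_tone l (flip_vertex ` s)" if "is_tone l s" for s
  proof -
    have "flip_vertex ` s \<inter> range Top = flip_vertex ` (s \<inter> range Bot)" for s
    proof -
      have "Top ` UNIV = flip_vertex ` range Bot" by (simp add: image_image)
      then show ?thesis by (simp add: image_Int[OF inj_flip_vertex])
    qed
    moreover have "flip_vertex ` s \<inter> range Bot = flip_vertex ` (s \<inter> range Top)" for s
    proof -
      have "Bot ` UNIV = flip_vertex ` range Top" by (simp add: image_image)
      then show ?thesis by (simp add: image_Int[OF inj_flip_vertex])
    qed
    moreover have "card (flip_vertex ` A) = card A" for A
      by (rule card_image) (rule inj_on_subset[OF inj_flip_vertex], simp)
    ultimately show ?thesis using that by (simp add: is_tone_def cong_sym)
  qed
  then show ?thesis using assms flip_diagrams[of p n n] by (auto simp: tonal_def flip_def)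
qed

context
  fixes l n :: nat and \<delta> :: complex
begin

abbreviation "PA \<equiv> tonal_algebra l n \<delta>"

lemma PA_simps:
  "carrier PA = supported_on (tonal l n)" "\<zero>\<^bsub>PA\<^esub> = (\<lambda>_. 0)" "\<one>\<^bsub>PA\<^esub> = basis_vec (identity_diagram n)"
  "x \<oplus>\<^bsub>PA\<^esub> y = (\<lambda>p. x p + y p)"
  "x \<otimes>\<^bsub>PA\<^esub> y = (\<lambda>q. \<Sum>p\<in>tonal l n. \<Sum>p'\<in>tonal l n.
                 if compose n n n p p' = q then \<delta> ^ loops n n n p p' * x p * y p' else 0)"
  by (simp_all add: tonal_algebra_def)

lemma PA_mult_closed: "x \<otimes>\<^bsub>PA\<^esub> y \<in> carrier PA"
  unfolding PA_simps supported_on_def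
  by (auto intro!: sum.neutral dest: compose_tonal)

lemma PA_basis_mult:
  assumes "p \<in> tonal l n" "p' \<in> tonal l n"
  shows "basis_vec p \<otimes>\<^bsub>PA\<^esub> basis_vec p' = (\<lambda>q. \<delta> ^ loops n n n p p' * basis_vec (compose n n n p p') q)"
proof (rule ext)
  fix q
  have "(basis_vec p \<otimes>\<^bsub>PA\<^esub> basis_vec p') q = (\<Sum>u\<in>tonal l n. \<Sum>u'\<in>tonal l n. if u' = p' then
     (if u = p then (if compose n n n u u' = q then \<delta> ^ loops n n n u u' else 0) else 0) else 0)"
    unfolding PA_simps by (intro sum.cong refl) (simp add: basis_vec_def)
  also have "\<dots> = \<delta> ^ loops n n n p p' * basis_vec (compose n n n p p') q"
    using assms finite_tonal by (auto simp: basis_vec_def)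
  finally show "(basis_vec p \<otimes>\<^bsub>PA\<^esub> basis_vec p') q = \<dots>" .
qed

lemma PA_assoc: "(x \<otimes>\<^bsub>PA\<^esub> y) \<otimes>\<^bsub>PA\<^esub> z = x \<otimes>\<^bsub>PA\<^esub> (y \<otimes>\<^bsub>PA\<^esub> z)"
proof (rule ext)
  fix q
  let ?T = "tonal l n" and ?c = "compose n n n" and ?L = "loops n n n"
  have "((x \<otimes>\<^bsub>PA\<^esub> y) \<otimes>\<^bsub>PA\<^esub> z) q = (\<Sum>s\<in>?T. \<Sum>c\<in>?T. \<Sum>a\<in>?T. \<Sum>b\<in>?T.
      if ?c s c = q then \<delta> ^ ?L s c * (if ?c a b = s then \<delta> ^ ?L a b * x a * y b else 0) * z c else 0)"
    unfolding PA_simps by (intro sum.cong refl) (simp add: sum_distrib_left sum_distrib_right)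
  also have "\<dots> = (\<Sum>c\<in>?T. \<Sum>a\<in>?T. \<Sum>b\<in>?T. \<Sum>s\<in>?T.
      if ?c s c = q then \<delta> ^ ?L s c * (if ?c a b = s then \<delta> ^ ?L a b * x a * y b else 0) * z c else 0)"
  proof -
    let ?f = "\<lambda>s c a b. if ?c s c = q then \<delta> ^ ?L s c * (if ?c a b = s then \<delta> ^ ?L a b * x a * y b else 0) * z c else 0"
    have "(\<Sum>s\<in>?T. \<Sum>c\<in>?T. \<Sum>a\<in>?T. \<Sum>b\<in>?T. ?f s c a b) = (\<Sum>c\<in>?T. \<Sum>s\<in>?T. \<Sum>a\<in>?T. \<Sum>b\<in>?T. ?f s c a b)"
      by (rule sum.swap)
    also have "\<dots> = (\<Sum>c\<in>?T. \<Sum>a\<in>?T. \<Sum>s\<in>?T. \<Sum>b\<in>?T. ?f s c a b)"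
      by (rule sum.cong[OF refl]) (rule sum.swap)
    also have "\<dots> = (\<Sum>c\<in>?T. \<Sum>a\<in>?T. \<Sum>b\<in>?T. \<Sum>s\<in>?T. ?f s c a b)"
      by (rule sum.cong[OF refl], rule sum.cong[OF refl]) (rule sum.swap)
    finally show ?thesis .
  qed
  also have "\<dots> = (\<Sum>c\<in>?T. \<Sum>a\<in>?T. \<Sum>b\<in>?T. \<Sum>s\<in>?T. if ?c a b = s then
      (if ?c s c = q then \<delta> ^ (?L a b + ?L s c) * x a * y b * z c else 0) else 0)"
    by (intro sum.cong refl) (auto simp: power_add)
  \<comment> \<open>The intermediate diagram \<open>s\<close> runs over all tonal diagrams; as these
    are closed under composition, exactly one value of \<open>s\<close> survives.\<close>
  also have "\<dots> = (\<Sum>c\<in>?T. \<Sum>a\<in>?T. \<Sum>b\<in>?T.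
      if ?c (?c a b) c = q then \<delta> ^ (?L a b + ?L (?c a b) c) * x a * y b * z c else 0)"
    by (intro sum.cong refl) (simp add: finite_tonal compose_tonal)
  also have "\<dots> = (\<Sum>c\<in>?T. \<Sum>a\<in>?T. \<Sum>b\<in>?T.
      if ?c a (?c b c) = q then \<delta> ^ (?L b c + ?L a (?c b c)) * x a * y b * z c else 0)"
    by (intro sum.cong refl)
      (simp add: compose_assoc[OF tonal_diagrams tonal_diagrams tonal_diagrams] loops_assoc[OF tonal_diagrams tonal_diagrams tonal_diagrams])
  also have "\<dots> = (\<Sum>c\<in>?T. \<Sum>a\<in>?T. \<Sum>b\<in>?T. \<Sum>s\<in>?T. if ?c b c = s then
      (if ?c a s = q then \<delta> ^ (?L b c + ?L a s) * x a * y b * z c else 0) else 0)"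
    by (intro sum.cong refl) (simp add: finite_tonal compose_tonal)
  also have "\<dots> = (\<Sum>c\<in>?T. \<Sum>a\<in>?T. \<Sum>b\<in>?T. \<Sum>s\<in>?T.
      if ?c a s = q then \<delta> ^ ?L a s * x a * (if ?c b c = s then \<delta> ^ ?L b c * y b * z c else 0) else 0)"
    by (intro sum.cong refl) (auto simp: power_add)
  also have "\<dots> = (\<Sum>a\<in>?T. \<Sum>c\<in>?T. \<Sum>b\<in>?T. \<Sum>s\<in>?T.
      if ?c a s = q then \<delta> ^ ?L a s * x a * (if ?c b c = s then \<delta> ^ ?L b c * y b * z c else 0) else 0)"
    by (rule sum.swap)
  also have "\<dots> = (\<Sum>a\<in>?T. \<Sum>s\<in>?T. \<Sum>b\<in>?T. \<Sum>c\<in>?T.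
      if ?c a s = q then \<delta> ^ ?L a s * x a * (if ?c b c = s then \<delta> ^ ?L b c * y b * z c else 0) else 0)"
  proof (rule sum.cong[OF refl])
    fix a
    let ?f = "\<lambda>c b s. if ?c a s = q then \<delta> ^ ?L a s * x a * (if ?c b c = s then \<delta> ^ ?L b c * y b * z c else 0) else 0"
    have "(\<Sum>c\<in>?T. \<Sum>b\<in>?T. \<Sum>s\<in>?T. ?f c b s) = (\<Sum>c\<in>?T. \<Sum>s\<in>?T. \<Sum>b\<in>?T. ?f c b s)"
      by (rule sum.cong[OF refl]) (rule sum.swap)
    also have "\<dots> = (\<Sum>s\<in>?T. \<Sum>c\<in>?T. \<Sum>b\<in>?T. ?f c b s)" by (rule sum.swap)
    also have "\<dots> = (\<Sum>s\<in>?T. \<Sum>b\<in>?T. \<Sum>c\<in>?T. ?f c b s)" by (rule sum.cong[OF refl]) (rule sum.swap)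
    finally show "(\<Sum>c\<in>?T. \<Sum>b\<in>?T. \<Sum>s\<in>?T. ?f c b s) = (\<Sum>s\<in>?T. \<Sum>b\<in>?T. \<Sum>c\<in>?T. ?f c b s)" .
  qed
  also have "\<dots> = (x \<otimes>\<^bsub>PA\<^esub> (y \<otimes>\<^bsub>PA\<^esub> z)) q"
    unfolding PA_simps by (intro sum.cong refl) (simp add: sum_distrib_left sum_distrib_right)
  finally show "((x \<otimes>\<^bsub>PA\<^esub> y) \<otimes>\<^bsub>PA\<^esub> z) q = (x \<otimes>\<^bsub>PA\<^esub> (y \<otimes>\<^bsub>PA\<^esub> z)) q" .
qed

lemma PA_one_left:
  assumes "x \<in> carrier PA" shows "\<one>\<^bsub>PA\<^esub> \<otimes>\<^bsub>PA\<^esub> x = x"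
proof (rule ext)
  fix q
  have "(\<one>\<^bsub>PA\<^esub> \<otimes>\<^bsub>PA\<^esub> x) q = (\<Sum>p\<in>tonal l n. \<Sum>p'\<in>tonal l n. if p' = q then
     (if p = identity_diagram n then x p' else 0) else 0)"
    unfolding PA_simps
    by (intro sum.cong refl) (auto simp: basis_vec_def loops_identity_left[OF tonal_diagrams] compose_identity_left[OF tonal_diagrams])
  also have "\<dots> = x q" using assms
    by (cases "q \<in> tonal l n") (simp_all add: finite_tonal identity_tonal PA_simps supported_on_def)
  finally show "(\<one>\<^bsub>PA\<^esub> \<otimes>\<^bsub>PA\<^esub> x) q = x q" .
qed

lemma PA_one_right:
  assumes "x \<in> carrier PA" shows "x \<otimes>\<^bsub>PA\<^esub> \<one>\<^bsub>PA\<^esub> = x"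
proof (rule ext)
  fix q
  have "(x \<otimes>\<^bsub>PA\<^esub> \<one>\<^bsub>PA\<^esub>) q = (\<Sum>p\<in>tonal l n. \<Sum>p'\<in>tonal l n. if p' = identity_diagram n then
     (if p = q then x p else 0) else 0)"
    unfolding PA_simps
    by (intro sum.cong refl) (auto simp: basis_vec_def loops_identity_right[OF tonal_diagrams] compose_identity_right[OF tonal_diagrams])
  also have "\<dots> = x q" using assms by (simp add: finite_tonal identity_tonal PA_simps supported_on_def)
  finally show "(x \<otimes>\<^bsub>PA\<^esub> \<one>\<^bsub>PA\<^esub>) q = x q" .
qed

lemma PA_distrib:
  "(x \<oplus>\<^bsub>PA\<^esub> y) \<otimes>\<^bsub>PA\<^esub> z = (x \<otimes>\<^bsub>PA\<^esub> z) \<oplus>\<^bsub>PA\<^esub> (y \<otimes>\<^bsub>PA\<^esub> z)"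
  "z \<otimes>\<^bsub>PA\<^esub> (x \<oplus>\<^bsub>PA\<^esub> y) = (z \<otimes>\<^bsub>PA\<^esub> x) \<oplus>\<^bsub>PA\<^esub> (z \<otimes>\<^bsub>PA\<^esub> y)"
  unfolding PA_simps sum.distrib[symmetric]
  by (intro ext sum.cong refl; simp add: algebra_simps)+

lemma PA_scale:
  "(\<lambda>p. c * x p) \<otimes>\<^bsub>PA\<^esub> z = (\<lambda>p. c * (x \<otimes>\<^bsub>PA\<^esub> z) p)"
  "z \<otimes>\<^bsub>PA\<^esub> (\<lambda>p. c * x p) = (\<lambda>p. c * (z \<otimes>\<^bsub>PA\<^esub> x) p)"
  unfolding PA_simps sum_distrib_left
  by (intro ext sum.cong refl; simp add: algebra_simps)+

lemma PA_ring: "ring PA"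
proof (rule ringI)
  show "abelian_group PA"
  proof (rule abelian_groupI)
    fix x assume "x \<in> carrier PA"
    then show "\<exists>y\<in>carrier PA. y \<oplus>\<^bsub>PA\<^esub> x = \<zero>\<^bsub>PA\<^esub>"
      by (intro bexI[of _ "\<lambda>p. - x p"]) (auto simp: PA_simps supported_on_def)
  qed (auto simp: PA_simps supported_on_def)
  show "Group.monoid PA"
    by (rule monoidI) (simp_all add: PA_mult_closed PA_assoc PA_one_left PA_one_right,
      auto simp: PA_simps supported_on_def basis_vec_def identity_tonal)
qed (simp_all add: PA_distrib)

end

subsection \<open>Diagrams described by blocks\<close>

text \<open>One row of a diagram: labelled blocks \<open>T j\<close>, meant for propagating parts,
  and unlabelled blocks in \<open>U\<close>. Labels turn the matching of blocks between two rows
  into equality of indices.\<close>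

definition fam :: "'j set \<Rightarrow> ('j \<Rightarrow> nat set) \<Rightarrow> nat set set \<Rightarrow> nat set \<Rightarrow> bool" where
  "fam J T U A \<longleftrightarrow> partition_on A (T ` J \<union> U) \<and> inj_on T J \<and> T ` J \<inter> U = {}"

definition mk :: "'j set \<Rightarrow> ('j \<Rightarrow> nat set) \<Rightarrow> ('j \<Rightarrow> nat set) \<Rightarrow> nat set set \<Rightarrow> nat set set \<Rightarrow> diagram" where
  "mk J T B U L = (\<lambda>j. Top ` T j \<union> Bot ` B j) ` J \<union> (`) Top ` U \<union> (`) Bot ` L"

lemma famI:
  assumes "\<And>j. j \<in> J \<Longrightarrow> T j \<noteq> {}" "{} \<notin> U" "(\<Union>j\<in>J. T j) \<union> \<Union>U = A"
    and "\<And>j j' x. j \<in> J \<Longrightarrow> j' \<in> J \<Longrightarrow> x \<in> T j \<Longrightarrow> x \<in> T j' \<Longrightarrow> j = j'"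
    and "\<And>j u x. j \<in> J \<Longrightarrow> u \<in> U \<Longrightarrow> x \<in> T j \<Longrightarrow> x \<in> u \<Longrightarrow> False"
    and "\<And>u u' x. u \<in> U \<Longrightarrow> u' \<in> U \<Longrightarrow> x \<in> u \<Longrightarrow> x \<in> u' \<Longrightarrow> u = u'"
  shows "fam J T U A"
  unfolding fam_def
proof (intro conjI partition_onI)
  show "\<Union>(T ` J \<union> U) = A" using assms(3) by simp
  show "{} \<notin> T ` J \<union> U" using assms(1,2) by auto
  show "disjnt p q" if pq: "p \<in> T ` J \<union> U" "q \<in> T ` J \<union> U" "p \<noteq> q" for p q
  proof -
    have "p = q" if x: "x \<in> p" "x \<in> q" for x
    proof (cases "p \<in> U")
      case True
      show ?thesis
      proof (cases "q \<in> U")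
        case True then show ?thesis using assms(6) \<open>p \<in> U\<close> x by blast
      next
        case False
        then obtain j where "j \<in> J" "q = T j" using pq by blast
        then show ?thesis using assms(5)[of j p x] \<open>p \<in> U\<close> x by blast
      qed
    next
      case False
      then obtain j where j: "j \<in> J" "p = T j" using pq by blast
      show ?thesis
      proof (cases "q \<in> U")
        case True then show ?thesis using assms(5)[of j q x] j x by blast
      next
        case False
        then obtain j' where "j' \<in> J" "q = T j'" using pq by blast
        then show ?thesis using assms(4)[of j j' x] j x by blast
      qed
    qed
    then show ?thesis using pq(3) by (auto simp: disjnt_def)
  qed
  show "inj_on T J"
  proof (rule inj_onI)
    fix j j' assume j: "j \<in> J" "j' \<in> J" "T j = T j'"
    then obtain x where "x \<in> T j" using assms(1) by blast
    then show "j = j'" using assms(4)[of j j' x] j by simp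
  qed
  have "T j \<notin> U" if j: "j \<in> J" for j
  proof -
    obtain x where "x \<in> T j" using assms(1)[OF j] by blast
    then show ?thesis using assms(5)[OF j, of "T j" x] by blast
  qed
  then show "T ` J \<inter> U = {}" by blast
qed

lemma
  assumes "fam J T U A"
  shows fam_ne: "j \<in> J \<Longrightarrow> T j \<noteq> {}" and fam_ne': "{} \<notin> U"
    and fam_tableau_tuples: "j \<in> J \<Longrightarrow> j' \<in> J \<Longrightarrow> x \<in> T j \<Longrightarrow> x \<in> T j' \<Longrightarrow> j = j'"
    and fam_TU: "j \<in> J \<Longrightarrow> u \<in> U \<Longrightarrow> x \<in> T j \<Longrightarrow> x \<in> u \<Longrightarrow> False"
    and fam_UU: "u \<in> U \<Longrightarrow> u' \<in> U \<Longrightarrow> x \<in> u \<Longrightarrow> x \<in> u' \<Longrightarrow> u = u'"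
    and fam_Union: "(\<Union>j\<in>J. T j) \<union> \<Union>U = A"
proof -
  have P: "partition_on A (T ` J \<union> U)" "inj_on T J" "T ` J \<inter> U = {}" using assms by (auto simp: fam_def)
  have ne: "{} \<notin> T ` J \<union> U" using partition_onD3[OF P(1)] .
  show "j \<in> J \<Longrightarrow> T j \<noteq> {}" using ne by (metis UnI1 imageI)
  show "{} \<notin> U" using ne by blast
  show "j \<in> J \<Longrightarrow> j' \<in> J \<Longrightarrow> x \<in> T j \<Longrightarrow> x \<in> T j' \<Longrightarrow> j = j'"
    using partition_on_same[OF P(1), of "T j" "T j'" x] P(2) by (auto dest: inj_onD)
  show "j \<in> J \<Longrightarrow> u \<in> U \<Longrightarrow> x \<in> T j \<Longrightarrow> x \<in> u \<Longrightarrow> False"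
    using partition_on_same[OF P(1), of "T j" u x] P(3) by blast
  show "u \<in> U \<Longrightarrow> u' \<in> U \<Longrightarrow> x \<in> u \<Longrightarrow> x \<in> u' \<Longrightarrow> u = u'"
    using partition_on_same[OF P(1), of u u' x] by blast
  show "(\<Union>j\<in>J. T j) \<union> \<Union>U = A" using partition_onD1[OF P(1)] by simp
qed

lemma fam_sub: "fam J T U A \<Longrightarrow> j \<in> J \<Longrightarrow> T j \<subseteq> A"
  using fam_Union[of J T U A] by blast

lemma fam_cover: "fam J T U A \<Longrightarrow> x \<in> A \<Longrightarrow> (\<exists>j\<in>J. x \<in> T j) \<or> (\<exists>u\<in>U. x \<in> u)"
  using fam_Union[of J T U A] by blast

lemma fam_reindex:
  assumes "fam J T U A" "bij_betw f I J"
  shows "fam I (T \<circ> f) U A"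
  using assms unfolding fam_def bij_betw_def by (auto simp: image_comp[symmetric] comp_inj_on simp del: o_apply image_image)

lemma mk_reindex:
  assumes "bij_betw f I J"
  shows "mk I (T \<circ> f) (B \<circ> f) U L = mk J T B U L"
proof -
  have "J = f ` I" using assms by (simp add: bij_betw_def)
  then show ?thesis by (simp add: mk_def image_image)
qed

lemma vimage_Top_Bot [simp]:
  "Top -` Top ` X = X" "Bot -` Bot ` X = X" "Top -` Bot ` X = {}" "Bot -` Top ` X = {}"
  "Top ` X \<inter> range Top = Top ` X" "Bot ` X \<inter> range Bot = Bot ` X" "Top ` X \<inter> range Bot = {}" "Bot ` X \<inter> range Top = {}"
  by auto

lemma card_Top_Bot [simp]: "card (Top ` X) = card X" "card (Bot ` X) = card X"
  by (auto intro!: card_image simp: inj_on_def)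

lemma block_Int [simp]:
  "(Top ` X \<union> Bot ` Y) \<inter> range Top = Top ` X" "(Top ` X \<union> Bot ` Y) \<inter> range Bot = Bot ` Y"
  by auto

lemma propagating_block [simp]: "propagating (Top ` X \<union> Bot ` Y) \<longleftrightarrow> X \<noteq> {} \<and> Y \<noteq> {}"
  unfolding propagating_def block_Int by simp

lemma propagating_Top [simp]: "\<not> propagating (Top ` X)" and propagating_Bot [simp]: "\<not> propagating (Bot ` X)"
  by (simp_all add: propagating_def)

lemma is_tone_block [simp]:
  "is_tone l (Top ` X \<union> Bot ` Y) \<longleftrightarrow> [card X = card Y] (mod l)"
  "is_tone l (Top ` X) \<longleftrightarrow> l dvd card X" "is_tone l (Bot ` Y) \<longleftrightarrow> l dvd card Y"
  unfolding is_tone_def block_Int by (auto simp: cong_0_iff cong_sym_eq[of 0])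

lemma mk_diagrams:
  assumes T: "fam J T U {1..n}" and B: "fam J B L {1..m}"
  shows "mk J T B U L \<in> diagrams n m"
  unfolding diagrams_def mem_Collect_eq
proof (rule partition_onI)
  show "\<Union>(mk J T B U L) = Top ` {1..n} \<union> Bot ` {1..m}"
  proof -
    have "\<Union>(mk J T B U L) = Top ` ((\<Union>j\<in>J. T j) \<union> \<Union>U) \<union> Bot ` ((\<Union>j\<in>J. B j) \<union> \<Union>L)"
      by (auto simp: mk_def)
    then show ?thesis by (simp only: fam_Union[OF T] fam_Union[OF B])
  qed
  show "{} \<notin> mk J T B U L"
    using fam_ne[OF T] fam_ne'[OF T] fam_ne'[OF B] by (auto simp: mk_def)
  show "disjnt p q" if pq: "p \<in> mk J T B U L" "q \<in> mk J T B U L" "p \<noteq> q" for p q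
  proof -
    have "p = q" if x: "x \<in> p" "x \<in> q" for x
    proof (cases x)
      case (Top i)
      have "(\<exists>j\<in>J. p = Top ` T j \<union> Bot ` B j \<and> i \<in> T j) \<or> (\<exists>u\<in>U. p = Top ` u \<and> i \<in> u)"
        "(\<exists>j\<in>J. q = Top ` T j \<union> Bot ` B j \<and> i \<in> T j) \<or> (\<exists>u\<in>U. q = Top ` u \<and> i \<in> u)"
        using pq(1,2) x Top by (auto simp: mk_def)
      then show ?thesis using fam_tableau_tuples[OF T] fam_TU[OF T] fam_UU[OF T] by metis
    next
      case (Bot i)
      have "(\<exists>j\<in>J. p = Top ` T j \<union> Bot ` B j \<and> i \<in> B j) \<or> (\<exists>u\<in>L. p = Bot ` u \<and> i \<in> u)"
        "(\<exists>j\<in>J. q = Top ` T j \<union> Bot ` B j \<and> i \<in> B j) \<or> (\<exists>u\<in>L. q = Bot ` u \<and> i \<in> u)"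
        using pq(1,2) x Bot by (auto simp: mk_def)
      then show ?thesis using fam_tableau_tuples[OF B] fam_TU[OF B] fam_UU[OF B] by metis
    next
      case (Mid i)
      then show ?thesis using x pq by (auto simp: mk_def)
    qed
    then show ?thesis using pq(3) by (auto simp: disjnt_def)
  qed
qed

lemma mk_tonal:
  assumes "fam J T U {1..n}" "fam J B L {1..n}" "\<And>j. j \<in> J \<Longrightarrow> [card (T j) = card (B j)] (mod l)"
    and "\<And>u. u \<in> U \<Longrightarrow> l dvd card u" "\<And>u. u \<in> L \<Longrightarrow> l dvd card u"
  shows "mk J T B U L \<in> tonal l n"
  using mk_diagrams[OF assms(1,2)] assms(3-) by (auto simp: tonal_def mk_def)

lemma flip_mk: "flip (mk J T B U L) = mk J B T L U"
  by (simp add: flip_def mk_def image_Un image_image Un_ac)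

text \<open>Both factors cut the middle row in the same way, so no chains of blocks arise: blocks
  with equal labels are joined, and each member of \<open>L\<close> becomes a loop.\<close>

lemma
  assumes T: "fam J T U {1..n}" and M: "fam J M L {1..m}" and B: "fam J B L' {1..r}"
  shows compose_mk: "compose n m r (mk J T M U L) (mk J M B L L') = mk J T B U L'"
    and loops_mk: "loops n m r (mk J T M U L) (mk J M B L L') = card L"
proof -
  let ?p = "mk J T M U L" and ?p' = "mk J M B L L'"
  note p = mk_diagrams[OF T M] and p' = mk_diagrams[OF M B]
  let ?g = "\<lambda>j. Top ` T j \<union> Mid ` M j \<union> Bot ` B j"
  let ?Q = "?g ` J \<union> (`) Top ` U \<union> (`) Mid ` L \<union> (`) Bot ` L'"
  have e: "edges ?p ?p' = (\<lambda>j. Top ` T j \<union> Mid ` M j) ` J \<union> (`) Top ` U \<union> (`) Mid ` L \<union>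
     ((\<lambda>j. Mid ` M j \<union> Bot ` B j) ` J \<union> (`) Bot ` L')"
    unfolding edges_def mk_def image_Un by (simp add: image_image image_Un Un_ac)
  have "comps (edges ?p ?p') = ?Q"
  proof (rule comps_eqI)
    show "partition_on (\<Union>(edges ?p ?p')) ?Q"
      unfolding Union_edges[OF p p']
    proof (rule partition_onI)
      have "\<Union>?Q = Top ` ((\<Union>j\<in>J. T j) \<union> \<Union>U) \<union> Mid ` ((\<Union>j\<in>J. M j) \<union> \<Union>L) \<union> Bot ` ((\<Union>j\<in>J. B j) \<union> \<Union>L')"
        by auto
      then show "\<Union>?Q = Top ` {1..n} \<union> Mid ` {1..m} \<union> Bot ` {1..r}"
        by (simp only: fam_Union[OF T] fam_Union[OF M] fam_Union[OF B])
      show "{} \<notin> ?Q"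
        using fam_ne[OF T] fam_ne'[OF T] fam_ne'[OF B] fam_ne'[OF M] by auto
      show "disjnt p q" if pq: "p \<in> ?Q" "q \<in> ?Q" "p \<noteq> q" for p q
      proof -
        have "p = q" if x: "x \<in> p" "x \<in> q" for x
        proof (cases x)
          case (Top i)
          have "(\<exists>j\<in>J. p = ?g j \<and> i \<in> T j) \<or> (\<exists>u\<in>U. p = Top ` u \<and> i \<in> u)"
            "(\<exists>j\<in>J. q = ?g j \<and> i \<in> T j) \<or> (\<exists>u\<in>U. q = Top ` u \<and> i \<in> u)"
            using pq(1,2) x Top by auto
          then show ?thesis using fam_tableau_tuples[OF T] fam_TU[OF T] fam_UU[OF T] by metis
        next
          case (Mid i)
          have "(\<exists>j\<in>J. p = ?g j \<and> i \<in> M j) \<or> (\<exists>u\<in>L. p = Mid ` u \<and> i \<in> u)"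
            "(\<exists>j\<in>J. q = ?g j \<and> i \<in> M j) \<or> (\<exists>u\<in>L. q = Mid ` u \<and> i \<in> u)"
            using pq(1,2) x Mid by auto
          then show ?thesis using fam_tableau_tuples[OF M] fam_TU[OF M] fam_UU[OF M] by metis
        next
          case (Bot i)
          have "(\<exists>j\<in>J. p = ?g j \<and> i \<in> B j) \<or> (\<exists>u\<in>L'. p = Bot ` u \<and> i \<in> u)"
            "(\<exists>j\<in>J. q = ?g j \<and> i \<in> B j) \<or> (\<exists>u\<in>L'. q = Bot ` u \<and> i \<in> u)"
            using pq(1,2) x Bot by auto
          then show ?thesis using fam_tableau_tuples[OF B] fam_TU[OF B] fam_UU[OF B] by metis
        qed
        then show ?thesis using pq(3) by (auto simp: disjnt_def)
      qed
    qed
  next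
    fix s assume "s \<in> edges ?p ?p'"
    then have "s \<in> (\<lambda>j. Top ` T j \<union> Mid ` M j) ` J \<or> s \<in> (\<lambda>j. Mid ` M j \<union> Bot ` B j) ` J \<or>
       s \<in> (`) Top ` U \<union> (`) Mid ` L \<union> (`) Bot ` L'" by (simp only: e Un_iff) argo
    then show "\<exists>t\<in>?Q. s \<subseteq> t"
    proof (elim disjE)
      assume "s \<in> (\<lambda>j. Top ` T j \<union> Mid ` M j) ` J"
      then obtain j where "j \<in> J" "s = Top ` T j \<union> Mid ` M j" by (rule imageE)
      then show ?thesis by (intro bexI[of _ "?g j"]) auto
    next
      assume "s \<in> (\<lambda>j. Mid ` M j \<union> Bot ` B j) ` J"
      then obtain j where "j \<in> J" "s = Mid ` M j \<union> Bot ` B j" by (rule imageE)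
      then show ?thesis by (intro bexI[of _ "?g j"]) auto
    next
      assume "s \<in> (`) Top ` U \<union> (`) Mid ` L \<union> (`) Bot ` L'"
      then show ?thesis by (intro bexI[of _ s]) auto
    qed
  next
    fix t x y assume t: "t \<in> ?Q" "x \<in> t" "y \<in> t"
    show "conn (edges ?p ?p') x y"
    proof (cases "t \<in> ?g ` J")
      case True
      then obtain j where j: "j \<in> J" "t = ?g j" by blast
      obtain i where i: "i \<in> M j" using fam_ne[OF M j(1)] by blast
      have e12: "Top ` T j \<union> Mid ` M j \<in> edges ?p ?p'" "Mid ` M j \<union> Bot ` B j \<in> edges ?p ?p'"
        unfolding e using j(1) by blast+
      have c: "conn (edges ?p ?p') z (Mid i)" if "z \<in> t" for z
      proof (cases "z \<in> Top ` T j \<union> Mid ` M j")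
        case True then show ?thesis using conn_edge[OF e12(1)] i by blast
      next
        case False
        then have "z \<in> Mid ` M j \<union> Bot ` B j" using that j by blast
        then show ?thesis using conn_edge[OF e12(2)] i by blast
      qed
      show ?thesis using conn_trans[OF c[OF t(2)] conn_sym[OF c[OF t(3)]]] .
    next
      case False
      then have "t \<in> edges ?p ?p'" unfolding e using t(1) by blast
      then show ?thesis using conn_edge t by metis
    qed
  qed
  then have st: "stack n m r ?p ?p' = ?Q" by (simp only: stack_eq[OF p p'])
  have g: "?g j - range Mid = Top ` T j \<union> Bot ` B j" for j by auto
  have t: "Top ` u - range Mid = Top ` u" "Bot ` u - range Mid = Bot ` u" "Mid ` u - range Mid = {}" for u by auto
  have "(\<lambda>s. s - range Mid) ` ?Q = mk J T B U L' \<union> (\<lambda>u. {}) ` L"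
    unfolding mk_def image_Un image_image g t by (simp add: Un_ac)
  moreover have "{} \<notin> mk J T B U L'" using diagrams_nonempty[OF mk_diagrams[OF T B]] by blast
  ultimately show "compose n m r ?p ?p' = mk J T B U L'"
    unfolding compose_erase[OF p p'] st erase_def by auto
  have "{s \<in> ?Q. s \<subseteq> range Mid} = (`) Mid ` L"
  proof (intro equalityI subsetI)
    have n1: "\<not> ?g j \<subseteq> range Mid" if "j \<in> J" for j
      using fam_ne[OF T that] by auto
    have n2: "\<not> Top ` u \<subseteq> range Mid" if "u \<in> U" for u
      using fam_ne'[OF T] that by (cases "u = {}") auto
    have n3: "\<not> Bot ` u \<subseteq> range Mid" if "u \<in> L'" for u
      using fam_ne'[OF B] that by (cases "u = {}") auto
    fix s assume s: "s \<in> {s \<in> ?Q. s \<subseteq> range Mid}"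
    then have "s \<in> ?g ` J \<or> s \<in> (`) Top ` U \<or> s \<in> (`) Mid ` L \<or> s \<in> (`) Bot ` L'"
      by (simp only: mem_Collect_eq Un_iff) argo
    moreover have sM: "s \<subseteq> range Mid" using s by simp
    ultimately show "s \<in> (`) Mid ` L"
    proof (elim disjE)
      assume "s \<in> ?g ` J"
      then obtain j where "j \<in> J" "s = ?g j" by (rule imageE)
      then show ?thesis using n1[of j] sM by simp
    next
      assume "s \<in> (`) Top ` U"
      then obtain u where "u \<in> U" "s = Top ` u" by (rule imageE)
      then show ?thesis using n2[of u] sM by simp
    next
      assume "s \<in> (`) Bot ` L'"
      then obtain u where "u \<in> L'" "s = Bot ` u" by (rule imageE)
      then show ?thesis using n3[of u] sM by simp
    qed
  next
    fix s assume "s \<in> (`) Mid ` L"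
    then show "s \<in> {s \<in> ?Q. s \<subseteq> range Mid}" by auto
  qed
  then show "loops n m r ?p ?p' = card L"
    unfolding loops_eq[OF p p'] st by (simp add: card_image inj_on_def inj_image_eq_iff)
qed

section \<open>Recovering the blocks of a given diagram\<close>

lemma diagram_block:
  assumes "p \<in> diagrams n m" "s \<in> p"
  shows "s = Top ` (Top -` s) \<union> Bot ` (Bot -` s)"
  using diagrams_part'[OF assms] by auto

lemma nonprop_bottom_part:
  assumes "p \<in> diagrams n m" "s \<in> nonprop_bottom p"
  shows "s = Bot ` (Bot -` s)" "Bot -` s \<noteq> {}" "s \<in> p"
proof -
  have s: "s \<in> p" "\<not> propagating s" "s \<inter> range Bot \<noteq> {}" using assms(2) by (auto simp: nonprop_bottom_def)
  then show "s = Bot ` (Bot -` s)" "Bot -` s \<noteq> {}" "s \<in> p"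
    using diagrams_part'[OF assms(1) s(1)] by (auto simp: propagating_def)
qed

text \<open>A bottom block that is not listed among the non-propagating parts must belong to a
  propagating part, and its label names that part. The upper blocks are then read off from
  \<open>p\<close>.\<close>

lemma mk_of_bottom:
  assumes p: "p \<in> diagrams n m" and B: "fam J B L {1..m}"
    and br: "bottom_restriction p = (\<lambda>j. Bot ` B j) ` J \<union> (`) Bot ` L" and nb: "nonprop_bottom p = (`) Bot ` L"
  shows "\<exists>T U. p = mk J T B U L \<and> fam J T U {1..n}"
proof -
  have "\<exists>s\<in>p. s \<inter> range Bot = Bot ` B j \<and> propagating s" if j: "j \<in> J" for j
  proof -
    have "Bot ` B j \<in> bottom_restriction p" unfolding br using j by blast
    then obtain s where s: "s \<in> p" "s \<inter> range Bot = Bot ` B j" by (auto simp: bottom_restriction_def)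
    have "propagating s"
    proof (rule ccontr)
      assume np: "\<not> propagating s"
      then have "s \<in> nonprop_bottom p" using s fam_ne[OF B j] by (auto simp: nonprop_bottom_def)
      then obtain u where "u \<in> L" "s = Bot ` u" unfolding nb by blast
      then have "B j = u" using s(2) by (metis vimage_Top_Bot(2,6))
      then show False using fam_TU[OF B j \<open>u \<in> L\<close>] fam_ne[OF B j] by blast
    qed
    then show ?thesis using s by blast
  qed
  then obtain S where S: "\<And>j. j \<in> J \<Longrightarrow> S j \<in> p \<and> S j \<inter> range Bot = Bot ` B j \<and> propagating (S j)" by metis
  define T where "T = (\<lambda>j. Top -` S j)"
  define U where "U = (\<lambda>s. Top -` s) ` {s \<in> p. s \<inter> range Bot = {}}"
  have Sj: "S j = Top ` T j \<union> Bot ` B j" if "j \<in> J" for j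
  proof -
    have "Bot -` S j = B j" using S[OF that] by auto
    then show ?thesis using diagram_block[OF p, of "S j"] S[OF that] by (simp add: T_def)
  qed
  have UT: "Top ` u \<in> p" if Uu: "u \<in> U" for u
  proof -
    obtain s where s: "s \<in> p" "s \<inter> range Bot = {}" "u = Top -` s" using Uu by (auto simp: U_def)
    then have "s = Top ` u" using diagrams_part'[OF p s(1)] by auto
    then show ?thesis using s by simp
  qed
  have eq: "p = mk J T B U L"
  proof
    show "p \<subseteq> mk J T B U L"
    proof
      fix s assume s: "s \<in> p"
      show "s \<in> mk J T B U L"
      proof (cases "s \<inter> range Bot = {}")
        case True
        then have "s = Top ` (Top -` s)" using diagrams_part'[OF p s] by auto
        moreover have "Top -` s \<in> U" using s True by (auto simp: U_def)
        ultimately show ?thesis unfolding mk_def by blast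
      next
        case False
        then have "s \<inter> range Bot \<in> bottom_restriction p" using s by (auto simp: bottom_restriction_def)
        then consider j where "j \<in> J" "s \<inter> range Bot = Bot ` B j" | u where "u \<in> L" "s \<inter> range Bot = Bot ` u"
          unfolding br by blast
        then show ?thesis
        proof cases
          case 1
          obtain x where "x \<in> s \<inter> range Bot" using False by blast
          then have "s = S j" using diagrams_same[OF p s, of "S j" x] S[OF 1(1)] 1(2) by blast
          then show ?thesis using Sj[OF 1(1)] 1(1) by (auto simp: mk_def)
        next
          case 2
          have "Bot ` u \<in> nonprop_bottom p" unfolding nb using 2 by blast
          then have u: "Bot ` u \<in> p" by (simp add: nonprop_bottom_def)
          obtain x where "x \<in> s \<inter> range Bot" using False by blast
          then have "s = Bot ` u" using diagrams_same[OF p s u, of x] 2(2) by blast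
          then show ?thesis using 2 by (auto simp: mk_def)
        qed
      qed
    qed
    show "mk J T B U L \<subseteq> p"
    proof
      fix s assume "s \<in> mk J T B U L"
      then consider j where "j \<in> J" "s = Top ` T j \<union> Bot ` B j" | u where "u \<in> U" "s = Top ` u" | u where "u \<in> L" "s = Bot ` u"
        by (auto simp: mk_def)
      then show "s \<in> p"
      proof cases
        case 1 then show ?thesis using Sj[OF 1(1)] S[OF 1(1)] by simp
      next
        case 2 then show ?thesis using UT by simp
      next
        case 3
        then have "s \<in> nonprop_bottom p" unfolding nb by blast
        then show ?thesis by (simp add: nonprop_bottom_def)
      qed
    qed
  qed
  have "fam J T U {1..n}"
  proof (rule famI)
    show "T j \<noteq> {}" if "j \<in> J" for j using S[OF that] by (auto simp: T_def propagating_def)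
    show "{} \<notin> U" using UT diagrams_nonempty[OF p] by blast
    have "Top ` ((\<Union>j\<in>J. T j) \<union> \<Union>U) = \<Union>p \<inter> range Top"
      unfolding eq by (auto simp: mk_def)
    also have "\<dots> = Top ` {1..n}" unfolding diagrams_Union[OF p] by auto
    finally show "(\<Union>j\<in>J. T j) \<union> \<Union>U = {1..n}" by (simp add: inj_image_eq_iff inj_def)
  next
    fix j j' x assume j: "j \<in> J" "j' \<in> J" "x \<in> T j" "x \<in> T j'"
    then have "S j = S j'" using diagrams_same[OF p, of "S j" "S j'" "Top x"] S by (auto simp: T_def)
    then have "Bot ` B j = Bot ` B j'" using S[OF j(1)] S[OF j(2)] by simp
    then have "B j = B j'" by (metis vimage_Top_Bot(2))
    then show "j = j'" using fam_tableau_tuples[OF B j(1,2)] fam_ne[OF B j(1)] by blast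
  next
    fix j u x assume j: "j \<in> J" "u \<in> U" "x \<in> T j" "x \<in> u"
    then have "S j = Top ` u" using diagrams_same[OF p, of "S j" "Top ` u" "Top x"] S UT by (auto simp: T_def)
    then show False using S[OF j(1)] by simp
  next
    fix u u' x assume u: "u \<in> U" "u' \<in> U" "x \<in> u" "x \<in> u'"
    then have "Top ` u = Top ` u'" using diagrams_same[OF p, of "Top ` u" "Top ` u'" "Top x"] UT by auto
    then show "u = u'" by (metis vimage_Top_Bot(1))
  qed
  then show ?thesis using eq by blast
qed

lemma
  assumes T: "fam J T U {1..n}" and B: "fam J B L {1..m}"
  shows bottom_restriction_mk: "bottom_restriction (mk J T B U L) = (\<lambda>j. Bot ` B j) ` J \<union> (`) Bot ` L"
    and nonprop_bottom_mk: "nonprop_bottom (mk J T B U L) = (`) Bot ` L"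
    and propagating_mk: "{s \<in> mk J T B U L. propagating s} = (\<lambda>j. Top ` T j \<union> Bot ` B j) ` J"
    and inj_on_mk: "inj_on (\<lambda>j. Top ` T j \<union> Bot ` B j) J"
proof -
  have "(\<lambda>s. s \<inter> range Bot) ` mk J T B U L = (\<lambda>j. Bot ` B j) ` J \<union> (\<lambda>u. {}) ` U \<union> (`) Bot ` L"
    unfolding mk_def image_Un image_image block_Int by simp
  moreover have "{} \<notin> (\<lambda>j. Bot ` B j) ` J \<union> (`) Bot ` L" using fam_ne[OF B] fam_ne'[OF B] by auto
  ultimately show "bottom_restriction (mk J T B U L) = (\<lambda>j. Bot ` B j) ` J \<union> (`) Bot ` L"
    unfolding bottom_restriction_def by auto
  show "nonprop_bottom (mk J T B U L) = (`) Bot ` L"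
    using fam_ne[OF B] fam_ne[OF T] fam_ne'[OF B] by (auto simp: nonprop_bottom_def mk_def)
  show "{s \<in> mk J T B U L. propagating s} = (\<lambda>j. Top ` T j \<union> Bot ` B j) ` J"
    using fam_ne[OF B] fam_ne[OF T] by (auto simp: mk_def)
  show "inj_on (\<lambda>j. Top ` T j \<union> Bot ` B j) J"
  proof (rule inj_onI)
    fix j j' assume j: "j \<in> J" "j' \<in> J" "Top ` T j \<union> Bot ` B j = Top ` T j' \<union> Bot ` B j'"
    then have "T j = T j'" by (metis block_Int(1) vimage_Top_Bot(1))
    then show "j = j'" using fam_tableau_tuples[OF T j(1,2)] fam_ne[OF T j(1)] by blast
  qed
qed

text \<open>The bottom blocks are fixed and pairwise distinct, so each of them identifies the
  propagating part to which it is attached.\<close>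

lemma mk_inject:
  assumes T: "fam J T U {1..n}" and T': "fam J T' U' {1..n}" and B: "fam J B L {1..m}"
    and e: "mk J T B U L = mk J T' B U' L" and j: "j \<in> J"
  shows "T j = T' j"
proof -
  have "(\<lambda>j. Top ` T j \<union> Bot ` B j) ` J = (\<lambda>j. Top ` T' j \<union> Bot ` B j) ` J"
    using propagating_mk[OF T B] propagating_mk[OF T' B] by (simp only: e)
  then have "Top ` T j \<union> Bot ` B j \<in> (\<lambda>j. Top ` T' j \<union> Bot ` B j) ` J" using j by blast
  then obtain j' where j': "j' \<in> J" "Top ` T j \<union> Bot ` B j = Top ` T' j' \<union> Bot ` B j'" by blast
  then have "B j = B j'" "T j = T' j'" by (metis block_Int vimage_Top_Bot(1,2))+
  then show ?thesis using fam_tableau_tuples[OF B j j'(1)] fam_ne[OF B j] by blast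
qed

text \<open>The propagating parts serve as their own labels; relabelling comes later through
  \<open>mk_reindex\<close>.\<close>

lemma mk_of_diagram:
  assumes p: "p \<in> diagrams n m"
  shows "\<exists>T B U L. p = mk {s \<in> p. propagating s} T B U L \<and> fam {s \<in> p. propagating s} T U {1..n} \<and>
    fam {s \<in> p. propagating s} B L {1..m}"
proof -
  let ?J = "{s \<in> p. propagating s}"
  define B where "B = (\<lambda>s. Bot -` s)"
  define L where "L = (\<lambda>s. Bot -` s) ` nonprop_bottom p"
  have nb: "nonprop_bottom p = (`) Bot ` L"
    unfolding L_def image_image using nonprop_bottom_part[OF p] by (simp cong: image_cong)
  have Bs: "Bot ` B s = s \<inter> range Bot" for s by (auto simp: B_def)
  have fam: "fam ?J B L {1..m}"
  proof (rule famI)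
    show "B s \<noteq> {}" if "s \<in> ?J" for s using that by (auto simp: B_def propagating_def)
    show "{} \<notin> L" using nonprop_bottom_part(2)[OF p] by (auto simp: L_def)
    have "Bot ` ((\<Union>s\<in>?J. B s) \<union> \<Union>L) = \<Union>p \<inter> range Bot"
      unfolding L_def B_def by (fastforce simp: nonprop_bottom_def)
    also have "\<dots> = Bot ` {1..m}" unfolding diagrams_Union[OF p] by auto
    finally show "(\<Union>s\<in>?J. B s) \<union> \<Union>L = {1..m}" by (simp add: inj_image_eq_iff inj_def)
    show "s = s'" if "s \<in> ?J" "s' \<in> ?J" "x \<in> B s" "x \<in> B s'" for s s' x
      using that diagrams_same[OF p, of s s' "Bot x"] by (auto simp: B_def)
    show False if "s \<in> ?J" "u \<in> L" "x \<in> B s" "x \<in> u" for s u x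
    proof -
      obtain t where t: "t \<in> nonprop_bottom p" "u = Bot -` t" using \<open>u \<in> L\<close> by (auto simp: L_def)
      then have "s = t" using that diagrams_same[OF p, of s t "Bot x"] by (auto simp: B_def nonprop_bottom_def)
      then show False using t that by (auto simp: nonprop_bottom_def)
    qed
    show "u = u'" if "u \<in> L" "u' \<in> L" "x \<in> u" "x \<in> u'" for u u' x
    proof -
      obtain t t' where t: "t \<in> nonprop_bottom p" "u = Bot -` t" "t' \<in> nonprop_bottom p" "u' = Bot -` t'"
        using \<open>u \<in> L\<close> \<open>u' \<in> L\<close> by (auto simp: L_def)
      then show ?thesis using that diagrams_same[OF p, of t t' "Bot x"] by (auto simp: nonprop_bottom_def)
    qed
  qed
  have "bottom_restriction p = (\<lambda>j. Bot ` B j) ` ?J \<union> (`) Bot ` L"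
  proof -
    have 1: "s \<inter> range Bot \<in> (\<lambda>j. Bot ` B j) ` ?J \<union> (`) Bot ` L" if "s \<in> p" "s \<inter> range Bot \<noteq> {}" for s
    proof (cases "propagating s")
      case True then show ?thesis using that by (auto simp: Bs)
    next
      case False
      then have "s \<in> nonprop_bottom p" using that by (simp add: nonprop_bottom_def)
      moreover from this have "s \<inter> range Bot = s" using nonprop_bottom_part(1)[OF p] by (metis vimage_Top_Bot(6))
      ultimately show ?thesis unfolding nb by simp
    qed
    have 2: "s \<inter> range Bot \<in> bottom_restriction p" if "s \<in> ?J" for s
      using that by (auto simp: bottom_restriction_def propagating_def)
    have 3: "s \<in> bottom_restriction p" if s: "s \<in> nonprop_bottom p" for s
    proof -
      have "s \<inter> range Bot = s" using nonprop_bottom_part(1)[OF p s] by (metis vimage_Top_Bot(6))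
      then show ?thesis using s unfolding bottom_restriction_def nonprop_bottom_def by (auto intro: rev_image_eqI)
    qed
    show ?thesis
    proof
      show "bottom_restriction p \<subseteq> (\<lambda>j. Bot ` B j) ` ?J \<union> (`) Bot ` L"
        using 1 unfolding bottom_restriction_def by blast
      show "(\<lambda>j. Bot ` B j) ` ?J \<union> (`) Bot ` L \<subseteq> bottom_restriction p"
        using 2 3 unfolding Bs nb[symmetric] by blast
    qed
  qed
  then show ?thesis using mk_of_bottom[OF p fam _ nb] fam by blast
qed

subsection \<open>The diagrams \<open>a\<^sup>m\<close> and the half basis in terms of blocks\<close>

definition offset :: "nat \<Rightarrow> (nat \<Rightarrow> nat) \<Rightarrow> nat \<Rightarrow> nat \<Rightarrow> nat" where
  "offset l m i j = (\<Sum>k=Suc i..l. k * m k) + (j - 1) * i"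

definition blk :: "nat \<Rightarrow> (nat \<Rightarrow> nat) \<Rightarrow> nat \<times> nat \<Rightarrow> nat set" where
  "blk l m x = {offset l m (fst x) (snd x) + 1..offset l m (fst x) (snd x) + fst x}"

text \<open>Labels of the factors b^i of a^m: the size, then the position among the factors of that
  size, counted from 1.\<close>

definition idx :: "nat \<Rightarrow> (nat \<Rightarrow> nat) \<Rightarrow> (nat \<times> nat) set" where
  "idx l m = (SIGMA i:{1..l}. {1..m i})"

text \<open>One row of the trailing factors w w^* of a^m; these blocks are never permuted.\<close>

definition rest :: "nat \<Rightarrow> nat \<Rightarrow> (nat \<Rightarrow> nat) \<Rightarrow> nat set set" where
  "rest l n m = (\<lambda>j. {rsum l m + j * l + 1..rsum l m + j * l + l}) ` {..<(n - rsum l m) div l}"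

definition perm_idx :: "(nat \<Rightarrow> nat \<Rightarrow> nat) \<Rightarrow> nat \<times> nat \<Rightarrow> nat \<times> nat" where
  "perm_idx \<sigma> x = (fst x, \<sigma> (fst x) (snd x))"

lemma bottom_block_blk: "bottom_block l m i j = Bot ` blk l m (i, j)"
  by (simp add: bottom_block_def blk_def offset_def Let_def)

lemma shift_shift: "shift a b (shift c d v) = shift (a + c) (b + d) v"
  by (cases v) (auto simp: add.assoc)

lemma shift_0 [simp]: "shift 0 0 v = v"
  by (cases v) auto

lemma shift_Top_Bot [simp]: "shift a b ` Top ` X = Top ` (+) a ` X" "shift a b ` Bot ` X = Bot ` (+) b ` X"
  by (auto simp: image_image)

lemma juxtapose_list_append:
  "juxtapose_list (xs @ ys) = juxtapose_list xs \<union>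
     (`) (shift (sum_list (map fst xs)) (sum_list (map fst xs))) ` juxtapose_list ys"
proof (induction xs)
  case Nil
  then show ?case by simp
next
  case (Cons x xs)
  then show ?case by (cases x) (simp add: juxtapose_def image_Un image_image shift_shift Un_assoc)
qed

lemma juxtapose_list_replicate:
  "juxtapose_list (replicate k (i, p)) = (\<Union>j<k. (`) (shift (j * i) (j * i)) ` p)"
proof (induction k)
  case (Suc k)
  have "juxtapose_list (replicate (Suc k) (i, p)) = p \<union> (\<Union>j<k. (`) (shift (Suc j * i) (Suc j * i)) ` p)"
    by (simp add: Suc juxtapose_def image_UN image_image shift_shift)
  also have "\<dots> = (\<Union>j<Suc k. (`) (shift (j * i) (j * i)) ` p)"
    unfolding lessThan_Suc_eq_insert_0 by (simp add: image_image)
  finally show ?case .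
qed simp

lemma offset_Suc: "i \<le> l \<Longrightarrow> offset (Suc l) m i j = Suc l * m (Suc l) + offset l m i j"
  by (simp add: offset_def)

text \<open>Induction on \<open>l\<close>: the largest size stands leftmost, so a new size
  \<open>Suc l\<close> puts its own blocks first and shifts all earlier ones by
  \<open>m (Suc l) * Suc l\<close>.\<close>

lemma juxtapose_blocks:
  "juxtapose_list (concat (map (\<lambda>i. replicate (m i) (i, b_diag i)) (rev [1..<Suc l]))) =
     (\<lambda>x. Top ` blk l m x \<union> Bot ` blk l m x) ` idx l m"
proof (induction l)
  case 0
  then show ?case by (simp add: idx_def)
next
  case (Suc l)
  let ?xs = "replicate (m (Suc l)) (Suc l, b_diag (Suc l))"
  let ?ys = "concat (map (\<lambda>i. replicate (m i) (i, b_diag i)) (rev [1..<Suc l]))"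
  let ?s = "m (Suc l) * Suc l"
  have "[1..<Suc (Suc l)] = [1..<Suc l] @ [Suc l]" by simp
  then have list: "concat (map (\<lambda>i. replicate (m i) (i, b_diag i)) (rev [1..<Suc (Suc l)])) = ?xs @ ?ys"
    by (simp only: rev_append map_append concat_append) simp
  have sum: "sum_list (map fst ?xs) = ?s" by (simp add: sum_list_replicate)
  have add: "(+) s ` {a + 1..a + i} = {s + a + 1..s + a + i}" for s a i :: nat
    by (simp add: image_add_atLeastAtMost add.assoc)
  have add0: "(+) s ` {1..i} = {s + 1..s + i}" for s i :: nat
    by (simp add: image_add_atLeastAtMost)
  have "juxtapose_list ?xs = (\<Union>j<m (Suc l). {Top ` {j * Suc l + 1..j * Suc l + Suc l} \<union> Bot ` {j * Suc l + 1..j * Suc l + Suc l}})"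
    unfolding juxtapose_list_replicate b_diag_def
    by (intro SUP_cong refl) (simp only: image_insert image_empty image_Un shift_Top_Bot add0)
  also have "\<dots> = (\<lambda>x. Top ` blk (Suc l) m x \<union> Bot ` blk (Suc l) m x) ` ({Suc l} \<times> {1..m (Suc l)})"
  proof -
    have e: "{Suc l} \<times> {1..m (Suc l)} = (\<lambda>j. (Suc l, Suc j)) ` {..<m (Suc l)}"
    proof -
      have "{1..m (Suc l)} = Suc ` {..<m (Suc l)}" by (simp add: image_Suc_lessThan)
      then show ?thesis by auto
    qed
    show ?thesis unfolding e image_image by (simp add: blk_def offset_def UNION_singleton_eq_range)
  qed
  finally have 1: "juxtapose_list ?xs = (\<lambda>x. Top ` blk (Suc l) m x \<union> Bot ` blk (Suc l) m x) ` ({Suc l} \<times> {1..m (Suc l)})" .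
  have b: "(+) ?s ` blk l m x = blk (Suc l) m x" if "x \<in> idx l m" for x
    using that unfolding blk_def add by (simp add: idx_def offset_Suc mult.commute split: prod.splits) (auto simp: offset_Suc algebra_simps)
  have 2: "(`) (shift ?s ?s) ` juxtapose_list ?ys = (\<lambda>x. Top ` blk (Suc l) m x \<union> Bot ` blk (Suc l) m x) ` idx l m"
    unfolding Suc image_image by (intro image_cong refl) (simp only: image_Un shift_Top_Bot b)
  have "idx (Suc l) m = {Suc l} \<times> {1..m (Suc l)} \<union> idx l m"
    by (auto simp: idx_def le_Suc_eq)
  then show ?case unfolding list juxtapose_list_append sum 1 2 by (simp only: image_Un)
qed

lemma compose_w:
  assumes "l \<ge> 1"
  shows "compose l 0 l (w_diag l) (w_star l) = {Top ` {1..l}, Bot ` {1..l}}"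
proof -
  have f: "fam ({} :: nat set) (\<lambda>_. {}) {{1..l}} {1..l}" "fam ({} :: nat set) (\<lambda>_. {}) {} {1..0}"
    using assms by (auto intro!: famI)
  have "w_diag l = mk ({} :: nat set) (\<lambda>_. {}) (\<lambda>_. {}) {{1..l}} {}" "w_star l = mk ({} :: nat set) (\<lambda>_. {}) (\<lambda>_. {}) {} {{1..l}}"
    by (simp_all add: w_diag_def w_star_def mk_def)
  then have "compose l 0 l (w_diag l) (w_star l) = mk ({} :: nat set) (\<lambda>_. {}) (\<lambda>_. {}) {{1..l}} {{1..l}}"
    using compose_mk[OF f(1,2,1)] by simp
  then show ?thesis by (auto simp: mk_def)
qed

lemma a_diag_mk:
  assumes "l \<ge> 1"
  shows "a_diag l n m = mk (idx l m) (blk l m) (blk l m) (rest l n m) (rest l n m)"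
proof -
  let ?xs = "concat (map (\<lambda>i. replicate (m i) (i, b_diag i)) (rev [1..<Suc l]))"
  let ?k = "(n - rsum l m) div l"
  have "sum_list (map fst ?xs) = (\<Sum>i\<leftarrow>rev [1..<Suc l]. i * m i)"
  proof -
    have "sum_list (map fst (concat (map (\<lambda>i. replicate (m i) (i, b_diag i)) is))) = (\<Sum>i\<leftarrow>is. i * m i)" for "is"
      by (induction "is") (simp_all add: sum_list_replicate)
    then show ?thesis .
  qed
  also have "\<dots> = (\<Sum>i\<leftarrow>[1..<Suc l]. i * m i)" by (simp only: rev_map[symmetric] sum_list_rev)
  also have "\<dots> = rsum l m" by (simp only: rsum_def interv_sum_list_conv_sum_set_nat set_upt atLeastLessThanSuc_atLeastAtMost)
  finally have s: "sum_list (map fst ?xs) = rsum l m" .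
  have add: "(+) s ` {1..i} = {s + 1..s + i}" for s i :: nat
    by (simp add: image_add_atLeastAtMost)
  have "(`) (shift (rsum l m) (rsum l m)) ` juxtapose_list (replicate ?k (l, compose l 0 l (w_diag l) (w_star l))) =
     (\<Union>j<?k. {Top ` {rsum l m + j * l + 1..rsum l m + j * l + l}, Bot ` {rsum l m + j * l + 1..rsum l m + j * l + l}})"
    unfolding juxtapose_list_replicate compose_w[OF assms] image_UN image_image
    by (intro SUP_cong refl) (simp only: shift_shift image_insert image_empty shift_Top_Bot add)
  also have "\<dots> = (`) Top ` rest l n m \<union> (`) Bot ` rest l n m"
    unfolding rest_def image_image by blast
  finally show ?thesis unfolding a_diag_def juxtapose_list_append s juxtapose_blocks mk_def by (simp only: Un_assoc)
qed

lemma offset_less: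
  assumes "x \<in> idx l m" "y \<in> idx l m" "x \<noteq> y"
  shows "offset l m (fst x) (snd x) + fst x \<le> offset l m (fst y) (snd y) \<or>
    offset l m (fst y) (snd y) + fst y \<le> offset l m (fst x) (snd x)"
proof -
  have up: "offset l m i j + i \<le> (\<Sum>k=i..l. k * m k)" if "(i, j) \<in> idx l m" for i j
  proof -
    have ij: "i \<le> l" "1 \<le> j" "j \<le> m i" using that by (auto simp: idx_def)
    then have "(j - 1) * i + i = j * i" by (cases j) auto
    moreover have "j * i \<le> i * m i" using ij by (simp add: mult.commute)
    ultimately show ?thesis using ij by (simp add: offset_def sum.atLeast_Suc_atMost)
  qed
  have lt: "offset l m i j + i \<le> offset l m i' j'" if "(i, j) \<in> idx l m" "i' < i" for i j i' j'
  proof -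
    have "(\<Sum>k=i..l. k * m k) \<le> (\<Sum>k=Suc i'..l. k * m k)" using that by (intro sum_mono2) auto
    then show ?thesis using up[OF that(1)] by (simp add: offset_def)
  qed
  have eq: "offset l m i j + i \<le> offset l m i j'" if "1 \<le> j" "j < j'" for i j j'
  proof -
    have "(j - 1) * i + i = j * i" using that by (cases j) auto
    also have "\<dots> \<le> (j' - 1) * i" using that by (intro mult_le_mono1) auto
    finally show ?thesis by (simp add: offset_def)
  qed
  obtain i j i' j' where xy: "x = (i, j)" "y = (i', j')" by fastforce
  consider "i' < i" | "i < i'" | "i = i'" "j < j'" | "i = i'" "j' < j" using assms(3) xy by fastforce
  then show ?thesis
  proof cases
    case 1 then show ?thesis using lt[of i j i' j'] assms xy by simp
  next
    case 2 then show ?thesis using lt[of i' j' i j] assms xy by simp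
  next
    case 3 then show ?thesis using eq[of j j' i] assms xy by (simp add: idx_def)
  next
    case 4 then show ?thesis using eq[of j' j i] assms xy by (simp add: idx_def)
  qed
qed

lemma offset_rsum:
  assumes "x \<in> idx l m"
  shows "offset l m (fst x) (snd x) + fst x \<le> rsum l m"
proof -
  obtain i j where x: "x = (i, j)" by fastforce
  have ij: "1 \<le> i" "i \<le> l" "1 \<le> j" "j \<le> m i" using assms x by (auto simp: idx_def)
  then have "(j - 1) * i + i = j * i" by (cases j) auto
  moreover have "j * i \<le> i * m i" using ij by (simp add: mult.commute)
  ultimately have "offset l m i j + i \<le> (\<Sum>k=i..l. k * m k)" using ij by (simp add: offset_def sum.atLeast_Suc_atMost)
  also have "\<dots> \<le> rsum l m" unfolding rsum_def using ij by (intro sum_mono2) auto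
  finally show ?thesis using x by simp
qed

lemma card_blk [simp]: "card (blk l m x) = fst x"
  by (simp add: blk_def)

lemma finite_idx [simp]: "finite (idx l m)"
  by (simp add: idx_def)

lemma card_rest: "u \<in> rest l n m \<Longrightarrow> card u = l"
  by (auto simp: rest_def)

lemma card_idx: "card {x \<in> idx l m. fst x = i} = (if i \<in> {1..l} then m i else 0)"
proof -
  have "{x \<in> idx l m. fst x = i} = (if i \<in> {1..l} then Pair i ` {1..m i} else {})" by (auto simp: idx_def)
  then show ?thesis by (simp add: card_image inj_on_def)
qed

text \<open>That the blocks cover the row is shown by counting: they are disjoint, lie in
  \<open>{1..n}\<close>, and their sizes add up to \<open>rsum l m\<close> for the labelled ones and
  \<open>n - rsum l m\<close> for the others.\<close>

lemma fam_blk: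
  assumes l: "l \<ge> 1" and m: "m \<in> gamma l n"
  shows "fam (idx l m) (blk l m) (rest l n m) {1..n}"
proof (rule famI)
  let ?k = "(n - rsum l m) div l" and ?r = "rsum l m"
  let ?R = "\<lambda>j. {?r + j * l + 1..?r + j * l + l}"
  have rn: "?r \<le> n" "?r + ?k * l = n" using m by (auto simp: gamma_def)
  show ne: "blk l m j \<noteq> {}" if "j \<in> idx l m" for j using that by (auto simp: blk_def idx_def)
  show "{} \<notin> rest l n m" using l by (auto simp: rest_def)
  show bb: "j = j'" if "j \<in> idx l m" "j' \<in> idx l m" "x \<in> blk l m j" "x \<in> blk l m j'" for j j' x
    using offset_less[OF that(1,2)] that(3,4) by (force simp: blk_def)
  show bu: False if "j \<in> idx l m" "u \<in> rest l n m" "x \<in> blk l m j" "x \<in> u" for j u x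
    using offset_rsum[OF that(1)] that(2-4) by (auto simp: blk_def rest_def)
  have RR: "i = i'" if "x \<in> ?R i" "x \<in> ?R i'" for x i i'
  proof -
    have "\<not> i < i'" if "x \<in> ?R i" "x \<in> ?R i'" for i i'
    proof
      assume "i < i'"
      then have "Suc i * l \<le> i' * l" by (intro mult_le_mono1) simp
      then show False using that by simp
    qed
    then show ?thesis using that by (meson linorder_neqE_nat)
  qed
  show "u = u'" if uu: "u \<in> rest l n m" "u' \<in> rest l n m" "x \<in> u" "x \<in> u'" for u u' x
  proof -
    obtain i i' where "u = ?R i" "u' = ?R i'" using uu(1,2) by (auto simp: rest_def)
    then show ?thesis using RR[of x i i'] uu(3,4) by simp
  qed
  have sub: "(\<Union>j\<in>idx l m. blk l m j) \<union> \<Union>(rest l n m) \<subseteq> {1..n}"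
  proof -
    have "x \<in> {1..n}" if "j \<in> idx l m" "x \<in> blk l m j" for j x
      using offset_rsum[OF that(1)] that(2) rn by (auto simp: blk_def)
    moreover have "x \<in> {1..n}" if "j < ?k" "x \<in> ?R j" for j x
    proof -
      have "Suc j * l \<le> ?k * l" using that by (intro mult_le_mono1) simp
      then show ?thesis using that rn by simp
    qed
    ultimately show ?thesis by (auto simp: rest_def)
  qed
  have "card (\<Union>j\<in>idx l m. blk l m j) = (\<Sum>j\<in>idx l m. card (blk l m j))"
  proof (rule card_UN_disjoint)
    show "\<forall>i\<in>idx l m. \<forall>j\<in>idx l m. i \<noteq> j \<longrightarrow> blk l m i \<inter> blk l m j = {}" using bb by blast
  qed (simp_all add: blk_def)
  also have "\<dots> = (\<Sum>j\<in>idx l m. fst j)" by simp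
  also have "\<dots> = (\<Sum>(i, j)\<in>idx l m. i)" by (intro sum.cong) auto
  also have "\<dots> = ?r"
    unfolding idx_def by (subst sum.Sigma[symmetric]) (simp_all add: rsum_def mult.commute)
  finally have c1: "card (\<Union>j\<in>idx l m. blk l m j) = ?r" .
  have "card (\<Union>(rest l n m)) = (\<Sum>j<?k. card (?R j))"
    unfolding rest_def
  proof (rule card_UN_disjoint)
    show "\<forall>i\<in>{..<?k}. \<forall>j\<in>{..<?k}. i \<noteq> j \<longrightarrow> ?R i \<inter> ?R j = {}" using RR by blast
  qed simp_all
  then have c2: "card (\<Union>(rest l n m)) = ?k * l" by simp
  have "card ((\<Union>j\<in>idx l m. blk l m j) \<union> \<Union>(rest l n m)) = n"
  proof (subst card_Un_disjoint)
    show "(\<Union>j\<in>idx l m. blk l m j) \<inter> \<Union>(rest l n m) = {}" using bu by blast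
  qed (use c1 c2 rn in \<open>simp_all, simp_all add: blk_def rest_def\<close>)
  then show "(\<Union>j\<in>idx l m. blk l m j) \<union> \<Union>(rest l n m) = {1..n}"
    using sub by (intro card_subset_eq) auto
qed

lemma cong_l_iff: "i \<in> {1..l} \<Longrightarrow> j \<in> {1..l} \<Longrightarrow> [i = j] (mod l) \<longleftrightarrow> i = (j::nat)"
proof
  assume a: "i \<in> {1..l}" "j \<in> {1..l}" "[i = j] (mod l)"
  then have "int l dvd int i - int j" by (simp only: cong_int_iff[symmetric] cong_iff_dvd_diff)
  moreover have "\<bar>int i - int j\<bar> < int l" using a by auto
  ultimately show "i = j" using dvd_imp_le_int[of "int i - int j" "int l"] by (cases "i = j") auto
qed simp

context
  fixes l n :: nat and m :: "nat \<Rightarrow> nat"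
  assumes l: "l \<ge> 1" and m: "m \<in> gamma l n"
begin

abbreviation "J \<equiv> idx l m"
abbreviation "Bk \<equiv> blk l m"
abbreviation "Rs \<equiv> rest l n m"

text \<open>All diagrams of the half basis have the same lower half, so the upper half is a complete
  parameter.\<close>

definition "hdiag T U = mk J T Bk U Rs"

text \<open>The conditions on an upper half under which \<open>hdiag T U\<close> is tonal: the
  bottom block with label \<open>x\<close> has size \<open>fst x\<close>, and the unlabelled bottom
  blocks have size \<open>l\<close>.\<close>

definition "half_data T U \<longleftrightarrow> fam J T U {1..n} \<and> (\<forall>x\<in>J. [card (T x) = fst x] (mod l)) \<and> (\<forall>u\<in>U. l dvd card u)"

lemmas famB = fam_blk[OF l m]

lemma half_data_blk: "half_data Bk Rs"
  using famB card_rest by (auto simp: half_data_def)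

lemma a_hdiag: "a_diag l n m = hdiag Bk Rs"
  unfolding hdiag_def by (rule a_diag_mk[OF l])

lemma J_fst: "x \<in> J \<Longrightarrow> fst x \<in> {1..l}"
  by (auto simp: idx_def)

text \<open>The numbers 1 to \<open>l\<close> are pairwise incongruent modulo \<open>l\<close>, so
  the parts counted by \<open>prop_vec\<close> at \<open>i\<close> are those whose label has first
  component \<open>i\<close>.\<close>

lemma hdiag_half_basis:
  assumes "half_data T U"
  shows "hdiag T U \<in> half_basis l n m"
proof -
  have f: "fam J T U {1..n}" and c: "\<And>x. x \<in> J \<Longrightarrow> [card (T x) = fst x] (mod l)" and u: "\<And>u. u \<in> U \<Longrightarrow> l dvd card u"
    using assms by (auto simp: half_data_def)
  have "hdiag T U \<in> tonal l n" unfolding hdiag_def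
    by (rule mk_tonal[OF f famB]) (use c u card_rest in auto)
  moreover have "prop_vec l (hdiag T U) = m"
  proof
    fix i
    show "prop_vec l (hdiag T U) i = m i"
    proof (cases "i \<in> {1..l}")
      case True
      let ?S = "\<lambda>x. Top ` T x \<union> Bot ` Bk x"
      have "{s \<in> hdiag T U. propagating s \<and> [card (s \<inter> range Top) = i] (mod l)} =
        {s \<in> ?S ` J. [card (s \<inter> range Top) = i] (mod l)}"
        using propagating_mk[OF f famB] unfolding hdiag_def by blast
      also have "\<dots> = ?S ` {x \<in> J. [card (T x) = i] (mod l)}" by auto
      also have "{x \<in> J. [card (T x) = i] (mod l)} = {x \<in> J. fst x = i}"
      proof -
        have "[card (T x) = i] (mod l) \<longleftrightarrow> fst x = i" if "x \<in> J" for x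
          using c[OF that] cong_l_iff[OF J_fst[OF that] True] by (metis cong_sym cong_trans)
        then show ?thesis by blast
      qed
      finally have "card {s \<in> hdiag T U. propagating s \<and> [card (s \<inter> range Top) = i] (mod l)} = card {x \<in> J. fst x = i}"
        using inj_on_mk[OF f famB] by (simp add: card_image inj_on_subset)
      then show ?thesis using True by (simp add: prop_vec_def card_idx)
    next
      case False
      then show ?thesis using m unfolding prop_vec_def gamma_def by auto
    qed
  qed
  ultimately show ?thesis
    unfolding half_basis_def a_hdiag hdiag_def
    by (simp add: bottom_restriction_mk[OF f famB] bottom_restriction_mk[OF famB famB] nonprop_bottom_mk[OF f famB] nonprop_bottom_mk[OF famB famB])
qed

text \<open>Tonality carries the sizes of the bottom blocks over to the tops modulo
  \<open>l\<close>; the shape of the bottom row thus decides membership in the half basis.\<close>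

lemma half_basisI:
  assumes p: "p \<in> tonal l n" and br: "bottom_restriction p = bottom_restriction (a_diag l n m)"
    and nb: "nonprop_bottom p = nonprop_bottom (a_diag l n m)"
  shows "\<exists>T U. half_data T U \<and> p = hdiag T U"
proof -
  have "\<exists>T U. p = mk J T Bk U Rs \<and> fam J T U {1..n}"
    using mk_of_bottom[OF tonal_diagrams[OF p] famB] br nb
    unfolding a_hdiag hdiag_def bottom_restriction_mk[OF famB famB] nonprop_bottom_mk[OF famB famB] by blast
  then obtain T U where TU: "p = mk J T Bk U Rs" "fam J T U {1..n}" by blast
  have t: "\<And>s. s \<in> p \<Longrightarrow> is_tone l s" using p by (simp add: tonal_def)
  have "[card (T x) = fst x] (mod l)" if "x \<in> J" for x
  proof -
    have "Top ` T x \<union> Bot ` Bk x \<in> p" using that by (auto simp: TU(1) mk_def)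
    then show ?thesis using t[of "Top ` T x \<union> Bot ` Bk x"] by simp
  qed
  moreover have "l dvd card u" if "u \<in> U" for u
  proof -
    have "Top ` u \<in> p" using that by (auto simp: TU(1) mk_def)
    then show ?thesis using t[of "Top ` u"] by simp
  qed
  ultimately have "half_data T U" using TU(2) by (auto simp: half_data_def)
  then show ?thesis using TU(1) by (intro exI[of _ T] exI[of _ U]) (simp add: hdiag_def)
qed

lemma half_basis_iff: "p \<in> half_basis l n m \<longleftrightarrow> (\<exists>T U. half_data T U \<and> p = hdiag T U)"
  using half_basisI[of p] hdiag_half_basis unfolding half_basis_def by blast

lemma half_basis_tonal: "p \<in> half_basis l n m \<Longrightarrow> p \<in> tonal l n"
  by (simp add: half_basis_def)

lemma a_half_basis: "a_diag l n m \<in> half_basis l n m"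
  unfolding a_hdiag by (rule hdiag_half_basis[OF half_data_blk])

lemma finite_half_basis: "finite (half_basis l n m)"
  using finite_tonal[of l n] by (auto simp: half_basis_def)

section \<open>The symmetric groups acting on upper halves\<close>

lemma perm_idx_bij:
  assumes "\<sigma> \<in> carrier (sym_product l m)"
  shows "bij_betw (perm_idx \<sigma>) J J"
proof -
  have p: "\<sigma> i permutes {1..m i}" if "i \<in> {1..l}" for i
    using assms that by (auto simp: sym_product_def sym_group_def)
  have "inj_on (perm_idx \<sigma>) J"
  proof (rule inj_onI)
    fix x y assume xy: "x \<in> J" "y \<in> J" "perm_idx \<sigma> x = perm_idx \<sigma> y"
    have f1: "fst x = fst y" using arg_cong[OF xy(3), of fst] by (simp add: perm_idx_def)
    then have f: "fst x = fst y" "\<sigma> (fst x) (snd x) = \<sigma> (fst x) (snd y)"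
      using arg_cong[OF xy(3), of snd] by (simp_all add: perm_idx_def)
    have "inj (\<sigma> (fst x))" by (rule permutes_inj[OF p[OF J_fst[OF xy(1)]]])
    then have "snd x = snd y" using f(2) by (rule injD)
    then show "x = y" using f(1) by (rule prod_eqI[rotated])
  qed
  moreover have "perm_idx \<sigma> ` J \<subseteq> J"
  proof
    fix y assume "y \<in> perm_idx \<sigma> ` J"
    then obtain i j where ij: "(i, j) \<in> J" "y = (i, \<sigma> i j)" by (auto simp: perm_idx_def)
    then have "i \<in> {1..l}" "j \<in> {1..m i}" by (auto simp: idx_def)
    then show "y \<in> J" using permutes_in_image[OF p[of i], of j] ij(2) by (simp add: idx_def)
  qed
  ultimately show ?thesis by (simp add: bij_betw_def endo_inj_surj)
qed

lemma half_data_perm: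
  assumes "half_data T U" "\<sigma> \<in> carrier (sym_product l m)"
  shows "half_data (T \<circ> perm_idx \<sigma>) U"
proof -
  note b = perm_idx_bij[OF assms(2)]
  have f: "fam J T U {1..n}" "\<And>x. x \<in> J \<Longrightarrow> [card (T x) = fst x] (mod l)" "\<forall>u\<in>U. l dvd card u"
    using assms(1) by (auto simp: half_data_def)
  have "[card ((T \<circ> perm_idx \<sigma>) x) = fst x] (mod l)" if "x \<in> J" for x
    using f(2)[OF bij_betw_apply[OF b that]] by (simp add: perm_idx_def)
  then show ?thesis unfolding half_data_def by (intro conjI ballI fam_reindex[OF f(1) b]) (use f(3) in auto)
qed

text \<open>The part whose bottom block has the label \<open>perm_idx \<sigma> x\<close> is
  reattached to the block with label \<open>x\<close>; with the lower half held fixed this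
  precomposes the upper blocks with \<open>perm_idx \<sigma>\<close>.\<close>

lemma permute_blocks_hdiag:
  assumes h: "half_data T U" and \<sigma>: "\<sigma> \<in> carrier (sym_product l m)"
  shows "permute_blocks l m (hdiag T U) \<sigma> = hdiag (T \<circ> perm_idx \<sigma>) U"
proof -
  have f: "fam J T U {1..n}" using h by (simp add: half_data_def)
  note b = perm_idx_bij[OF \<sigma>]
  have np: "{s \<in> hdiag T U. \<not> propagating s} = (`) Top ` U \<union> (`) Bot ` Rs"
    using fam_ne[OF f] fam_ne[OF famB] by (auto simp: hdiag_def mk_def)
  have "{(s \<inter> range Top) \<union> bottom_block l m i j | s i j.
        s \<in> hdiag T U \<and> propagating s \<and> i \<in> {1..l} \<and> j \<in> {1..m i} \<and>
        s \<inter> range Bot = bottom_block l m i (\<sigma> i j)} = (\<lambda>x. Top ` T (perm_idx \<sigma> x) \<union> Bot ` Bk x) ` J" (is "?L = ?R")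
  proof
    show "?L \<subseteq> ?R"
    proof
      fix t assume "t \<in> ?L"
      then obtain s i j where s: "t = (s \<inter> range Top) \<union> bottom_block l m i j" "s \<in> {s \<in> hdiag T U. propagating s}"
        "i \<in> {1..l}" "j \<in> {1..m i}" "s \<inter> range Bot = bottom_block l m i (\<sigma> i j)" by blast
      then obtain x where x: "x \<in> J" "s = Top ` T x \<union> Bot ` Bk x"
        unfolding hdiag_def propagating_mk[OF f famB] by blast
      have ij: "(i, j) \<in> J" using s by (simp add: idx_def)
      then have p: "perm_idx \<sigma> (i, j) \<in> J" using b by (rule bij_betw_apply[rotated])
      have "Bot ` Bk x = Bot ` Bk (perm_idx \<sigma> (i, j))"
        using s(5) unfolding x(2) block_Int bottom_block_blk by (simp add: perm_idx_def)
      then have "Bk x = Bk (perm_idx \<sigma> (i, j))" by (metis vimage_Top_Bot(2))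
      then have "x = perm_idx \<sigma> (i, j)" using fam_tableau_tuples[OF famB x(1) p] fam_ne[OF famB x(1)] by blast
      then have "t = Top ` T (perm_idx \<sigma> (i, j)) \<union> Bot ` Bk (i, j)"
        unfolding s(1) x(2) block_Int bottom_block_blk by simp
      then show "t \<in> ?R" by (rule image_eqI[OF _ ij])
    qed
    show "?R \<subseteq> ?L"
    proof
      fix t assume "t \<in> ?R"
      then obtain i j where ij: "(i, j) \<in> J" "t = Top ` T (perm_idx \<sigma> (i, j)) \<union> Bot ` Bk (i, j)" by auto
      let ?s = "Top ` T (perm_idx \<sigma> (i, j)) \<union> Bot ` Bk (perm_idx \<sigma> (i, j))"
      have p: "perm_idx \<sigma> (i, j) \<in> J" using b ij(1) by (rule bij_betw_apply)
      have "?s \<in> {s \<in> hdiag T U. propagating s}" unfolding hdiag_def propagating_mk[OF f famB] using p by blast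
      then have "?s \<in> hdiag T U" "propagating ?s" by blast+
      moreover have "t = (?s \<inter> range Top) \<union> bottom_block l m i j" unfolding block_Int bottom_block_blk ij(2) ..
      moreover have "?s \<inter> range Bot = bottom_block l m i (\<sigma> i j)" unfolding block_Int bottom_block_blk by (simp add: perm_idx_def)
      moreover have "i \<in> {1..l}" "j \<in> {1..m i}" using ij(1) by (auto simp: idx_def)
      ultimately show "t \<in> ?L" unfolding mem_Collect_eq by (intro exI[of _ ?s] exI[of _ i] exI[of _ j] conjI)
    qed
  qed
  then show ?thesis unfolding permute_blocks_def np by (simp add: hdiag_def mk_def Un_ac)
qed

lemma hdiag_inject:
  assumes "half_data T U" "half_data T' U'" "hdiag T U = hdiag T' U'" "x \<in> J"
  shows "T x = T' x"
proof -
  have f: "fam J T U {1..n}" "fam J T' U' {1..n}" using assms(1,2) by (auto simp: half_data_def)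
  show ?thesis by (rule mk_inject[OF f famB assms(3)[unfolded hdiag_def] assms(4)])
qed

end

subsection \<open>Propagating parts of a product\<close>

definition nprop :: "diagram \<Rightarrow> nat" where
  "nprop p = card {s \<in> p. propagating s}"

text \<open>If no propagating part of \<open>p\<close> lay in \<open>t\<close>, no edge would lead
  from a top vertex of \<open>t\<close> to a vertex of another row, and \<open>t\<close> could not
  reach the bottom. The claim about \<open>p'\<close> is the mirror image.\<close>

lemma
  assumes p: "p \<in> diagrams n m" and p': "p' \<in> diagrams m r" and t: "t \<in> stack n m r p p'" "propagating t"
  shows stack_prop_top: "\<exists>s\<in>p. propagating s \<and> bot_to_mid ` s \<subseteq> t"
    and stack_prop_bot: "\<exists>s\<in>p'. propagating s \<and> top_to_mid ` s \<subseteq> t"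
proof -
  have tc: "t \<in> comps (edges p p')" using t(1) by (simp add: stack_eq[OF p p'])
  obtain x y where xy: "x \<in> t" "x \<in> range Top" "y \<in> t" "y \<in> range Bot"
    using t(2) unfolding propagating_def by blast
  have c: "conn (edges p p') x y" "conn (edges p p') y x" using comps_connD[OF tc] xy by blast+
  show "\<exists>s\<in>p. propagating s \<and> bot_to_mid ` s \<subseteq> t"
  proof (rule ccontr)
    assume no: "\<not> ?thesis"
    have "y \<in> t \<inter> range Top"
    proof (rule conn_closed[OF c(1)])
      show "x \<in> t \<inter> range Top" using xy by blast
      fix e assume e: "e \<in> edges p p'" "e \<inter> (t \<inter> range Top) \<noteq> {}"
      have et: "e \<subseteq> t" using comps_edge[OF tc e(1)] e(2) by blast
      show "e \<subseteq> t \<inter> range Top"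
      proof (cases "e \<in> (`) bot_to_mid ` p")
        case True
        then obtain s where s: "s \<in> p" "e = bot_to_mid ` s" by blast
        have "s \<inter> range Top \<noteq> {}" using e(2) bot_to_mid_Top[OF diagrams_part[OF p s(1)]] s(2) by blast
        then have "s \<inter> range Bot = {}" using no s et by (auto simp: propagating_def)
        then have "{Mid i | i. Bot i \<in> s} = {}" by auto
        then show ?thesis using et bot_to_mid_image[OF diagrams_part[OF p s(1)]] s(2) by auto
      next
        case False
        then obtain s where s: "s \<in> p'" "e = top_to_mid ` s" using e(1) by (auto simp: edges_def)
        then show ?thesis using top_to_mid_Top[OF diagrams_part[OF p' s(1)]] e(2) by blast
      qed
    qed
    then show False using xy by auto
  qed
  show "\<exists>s\<in>p'. propagating s \<and> top_to_mid ` s \<subseteq> t"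
  proof (rule ccontr)
    assume no: "\<not> ?thesis"
    have "x \<in> t \<inter> range Bot"
    proof (rule conn_closed[OF c(2)])
      show "y \<in> t \<inter> range Bot" using xy by blast
      fix e assume e: "e \<in> edges p p'" "e \<inter> (t \<inter> range Bot) \<noteq> {}"
      have et: "e \<subseteq> t" using comps_edge[OF tc e(1)] e(2) by blast
      show "e \<subseteq> t \<inter> range Bot"
      proof (cases "e \<in> (`) top_to_mid ` p'")
        case True
        then obtain s where s: "s \<in> p'" "e = top_to_mid ` s" by blast
        have "s \<inter> range Bot \<noteq> {}" using e(2) top_to_mid_Bot[OF diagrams_part[OF p' s(1)]] s(2) by blast
        then have "s \<inter> range Top = {}" using no s et by (auto simp: propagating_def)
        then have "{Mid i | i. Top i \<in> s} = {}" by auto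
        then show ?thesis using et top_to_mid_image[OF diagrams_part[OF p' s(1)]] s(2) by auto
      next
        case False
        then obtain s where s: "s \<in> p" "e = bot_to_mid ` s" using e(1) by (auto simp: edges_def)
        then show ?thesis using bot_to_mid_Bot[OF diagrams_part[OF p s(1)]] e(2) by blast
      qed
    qed
    then show False using xy by auto
  qed
qed

lemma minus_Mid_Int [simp]:
  "(t - range Mid) \<inter> range Top = t \<inter> range Top" "(t - range Mid) \<inter> range Bot = t \<inter> range Bot"
  "propagating (t - range Mid) \<longleftrightarrow> propagating t"
proof -
  show 1: "(t - range Mid) \<inter> range Top = t \<inter> range Top" and 2: "(t - range Mid) \<inter> range Bot = t \<inter> range Bot" by auto
  show "propagating (t - range Mid) \<longleftrightarrow> propagating t" unfolding propagating_def 1 2 ..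
qed

lemma
  assumes p: "p \<in> diagrams n m" and p': "p' \<in> diagrams m r"
  shows propagating_compose: "{s \<in> compose n m r p p'. propagating s} = (\<lambda>t. t - range Mid) ` {t \<in> stack n m r p p'. propagating t}"
    and inj_on_minus_Mid: "inj_on (\<lambda>t. t - range Mid) {t \<in> stack n m r p p'. propagating t}"
    and nprop_compose: "nprop (compose n m r p p') = card {t \<in> stack n m r p p'. propagating t}"
proof -
  show 1: "{s \<in> compose n m r p p'. propagating s} = (\<lambda>t. t - range Mid) ` {t \<in> stack n m r p p'. propagating t}"
  proof
    show "{s \<in> compose n m r p p'. propagating s} \<subseteq> (\<lambda>t. t - range Mid) ` {t \<in> stack n m r p p'. propagating t}"
      unfolding compose_erase[OF p p'] by (auto elim!: eraseE)
    show "(\<lambda>t. t - range Mid) ` {t \<in> stack n m r p p'. propagating t} \<subseteq> {s \<in> compose n m r p p'. propagating s}"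
    proof (rule image_subsetI)
      fix t assume t: "t \<in> {t \<in> stack n m r p p'. propagating t}"
      then have "\<not> t \<subseteq> range Mid" by (auto simp: propagating_def)
      then show "t - range Mid \<in> {s \<in> compose n m r p p'. propagating s}"
        using t erase_mem[of t "stack n m r p p'" "range Mid"] by (simp add: compose_erase[OF p p'])
    qed
  qed
  show 2: "inj_on (\<lambda>t. t - range Mid) {t \<in> stack n m r p p'. propagating t}"
  proof (rule inj_onI)
    fix t u assume t: "t \<in> {t \<in> stack n m r p p'. propagating t}" "u \<in> {t \<in> stack n m r p p'. propagating t}"
      "t - range Mid = u - range Mid"
    then obtain x where x: "x \<in> t" "x \<in> range Top" unfolding propagating_def by blast
    then have "x \<in> u" using t(3) by auto
    then show "t = u" using stack_same[OF p p', of t u x] t x by blast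
  qed
  show "nprop (compose n m r p p') = card {t \<in> stack n m r p p'. propagating t}"
    unfolding nprop_def 1 by (rule card_image[OF 2])
qed

text \<open>Disjointness of the components makes any choice of one propagating part per component
  injective. This is why composition creates no new propagating parts.\<close>

lemma stack_bot_choice:
  assumes p: "p \<in> diagrams n m" and p': "p' \<in> diagrams m r"
  shows "\<exists>\<phi>. inj_on \<phi> {t \<in> stack n m r p p'. propagating t} \<and> \<phi> ` {t \<in> stack n m r p p'. propagating t} \<subseteq> {s \<in> p'. propagating s} \<and>
    (\<forall>t\<in>{t \<in> stack n m r p p'. propagating t}. top_to_mid ` \<phi> t \<subseteq> t)"
proof -
  have "\<forall>t\<in>{t \<in> stack n m r p p'. propagating t}. \<exists>s. s \<in> p' \<and> propagating s \<and> top_to_mid ` s \<subseteq> t"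
    using stack_prop_bot[OF p p'] by blast
  then obtain \<phi> where \<phi>: "\<And>t. t \<in> stack n m r p p' \<Longrightarrow> propagating t \<Longrightarrow> \<phi> t \<in> p' \<and> propagating (\<phi> t) \<and> top_to_mid ` \<phi> t \<subseteq> t"
    by (metis (no_types, lifting) mem_Collect_eq)
  have "inj_on \<phi> {t \<in> stack n m r p p'. propagating t}"
  proof (rule inj_onI)
    fix t u assume t: "t \<in> {t \<in> stack n m r p p'. propagating t}" "u \<in> {t \<in> stack n m r p p'. propagating t}" "\<phi> t = \<phi> u"
    then obtain x where "x \<in> \<phi> t" using \<phi>[of t] by (auto simp: propagating_def)
    then have "top_to_mid x \<in> t" "top_to_mid x \<in> u" using \<phi>[of t] \<phi>[of u] t by auto
    then show "t = u" using stack_same[OF p p', of t u] t by blast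
  qed
  then show ?thesis using \<phi> by (intro exI[of _ \<phi>]) auto
qed

lemma nprop_compose_right:
  assumes p: "p \<in> diagrams n m" and p': "p' \<in> diagrams m r"
  shows "nprop (compose n m r p p') \<le> nprop p'"
proof -
  obtain \<phi> where "inj_on \<phi> {t \<in> stack n m r p p'. propagating t}" "\<phi> ` {t \<in> stack n m r p p'. propagating t} \<subseteq> {s \<in> p'. propagating s}"
    using stack_bot_choice[OF p p'] by blast
  then show ?thesis unfolding nprop_compose[OF p p'] using finite_diagram[OF p']
    by (simp add: nprop_def card_inj_on_le)
qed

lemma nprop_flip: "nprop (flip p) = nprop p"
proof -
  have "propagating (flip_vertex ` s) \<longleftrightarrow> propagating s" for s
  proof -
    have "flip_vertex ` s \<inter> range Top \<noteq> {} \<longleftrightarrow> s \<inter> range Bot \<noteq> {}"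
    proof
      assume "flip_vertex ` s \<inter> range Top \<noteq> {}"
      then obtain v i where "v \<in> s" "flip_vertex v = Top i" by auto
      then show "s \<inter> range Bot \<noteq> {}" by (cases v) auto
    qed force
    moreover have "flip_vertex ` s \<inter> range Bot \<noteq> {} \<longleftrightarrow> s \<inter> range Top \<noteq> {}"
    proof
      assume "flip_vertex ` s \<inter> range Bot \<noteq> {}"
      then obtain v i where "v \<in> s" "flip_vertex v = Bot i" by auto
      then show "s \<inter> range Top \<noteq> {}" by (cases v) auto
    qed force
    ultimately show ?thesis by (auto simp: propagating_def)
  qed
  then have "{s \<in> flip p. propagating s} = (`) flip_vertex ` {s \<in> p. propagating s}" by (auto simp: flip_def)
  moreover have "inj_on ((`) flip_vertex) A" for A using inj_flip_vertex by (auto simp: inj_on_def inj_image_eq_iff)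
  ultimately show ?thesis by (simp add: nprop_def card_image)
qed

lemma nprop_compose_left:
  assumes p: "p \<in> diagrams n m" and p': "p' \<in> diagrams m r"
  shows "nprop (compose n m r p p') \<le> nprop p"
  using nprop_compose_right[OF flip_diagrams[OF p'] flip_diagrams[OF p]] compose_flip[OF p p'] by (simp add: nprop_flip)

text \<open>If none of the propagating parts of \<open>h\<close> is lost, the injective choice of
  \<open>stack_bot_choice\<close> is a bijection. Every propagating part of \<open>h\<close> then
  has a propagating component to itself, so neither merging nor cutting changes the bottom
  row.\<close>

lemma
  assumes p: "p \<in> diagrams n m" and h: "h \<in> diagrams m r" and eq: "nprop (compose n m r p h) = nprop h"
  shows bottom_restriction_compose: "bottom_restriction (compose n m r p h) = bottom_restriction h"
    and nonprop_bottom_compose: "nonprop_bottom (compose n m r p h) = nonprop_bottom h"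
proof -
  let ?S = "stack n m r p h" and ?P = "{t \<in> stack n m r p h. propagating t}" and ?H = "{s \<in> h. propagating s}"
  obtain \<phi> where \<phi>': "inj_on \<phi> ?P \<and> \<phi> ` ?P \<subseteq> ?H \<and> (\<forall>t\<in>?P. top_to_mid ` \<phi> t \<subseteq> t)"
    using stack_bot_choice[OF p h] by (rule exE)
  have \<phi>: "inj_on \<phi> ?P" "\<phi> ` ?P \<subseteq> ?H" "\<And>t. t \<in> ?P \<Longrightarrow> top_to_mid ` \<phi> t \<subseteq> t"
    using \<phi>' by (simp_all only:)
  have "card (\<phi> ` ?P) = card ?H" using eq \<phi>(1) unfolding nprop_compose[OF p h] by (simp add: card_image nprop_def)
  then have surj: "\<phi> ` ?P = ?H" using \<phi>(2) finite_diagram[OF h] by (intro card_subset_eq) auto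
  have ex: "\<exists>t\<in>?P. s = \<phi> t" if "s \<in> ?H" for s using surj that by blast
  \<comment> \<open>Since \<open>\<phi>\<close> is onto, a component contains no propagating part of
    \<open>h\<close> other than the one chosen for it.\<close>
  have uniq: "s = \<phi> t \<and> propagating t" if s: "s \<in> ?H" "t \<in> ?S" "top_to_mid ` s \<subseteq> t" for s t
  proof -
    obtain u where u: "u \<in> ?P" "s = \<phi> u" using ex[OF s(1)] by blast
    obtain x where "x \<in> s" using s(1) by (auto simp: propagating_def)
    then have "top_to_mid x \<in> t" "top_to_mid x \<in> u" using s(3) \<phi>(3)[OF u(1)] u(2) by auto
    then have "t = u" using stack_same[OF p h s(2)] u(1) by blast
    then show ?thesis using u by blast
  qed
  \<comment> \<open>A part of \<open>h\<close> inside the bottom row meets no other edge and is a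
    component of its own.\<close>
  have np: "s = t" if s: "s \<in> h" "\<not> propagating s" "s \<inter> range Bot \<noteq> {}" "t \<in> ?S" "top_to_mid ` s \<subseteq> t" for s t
  proof -
    have "s \<inter> range Top = {}" using s(2,3) by (auto simp: propagating_def)
    then have sB: "s \<subseteq> range Bot" using diagrams_part'[OF h s(1)] by blast
    then have ss: "top_to_mid ` s = s" by (force simp: image_iff)
    obtain x where x: "x \<in> s" using s(3) by blast
    have "y \<in> s" if "y \<in> t" for y
    proof (rule conn_closed[of "edges p h" x])
      have "t \<in> comps (edges p h)" using s(4) by (simp add: stack_eq[OF p h])
      then show "conn (edges p h) x y" using x s(5) ss that comps_connD[of t "edges p h" x y] by blast
      show "x \<in> s" by (rule x)
      fix e assume e: "e \<in> edges p h" "e \<inter> s \<noteq> {}"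
      then obtain z where z: "z \<in> e" "z \<in> s" by blast
      have "z \<in> range Bot" using z sB by blast
      show "e \<subseteq> s"
      proof (cases "e \<in> (`) top_to_mid ` h")
        case True
        then obtain s' where s': "s' \<in> h" "e = top_to_mid ` s'" by blast
        have "z \<in> s'" using top_to_mid_Bot[OF diagrams_part[OF h s'(1)]] z s'(2) \<open>z \<in> range Bot\<close> by blast
        then have "s' = s" using diagrams_same[OF h s'(1) s(1), of z] z by blast
        then show ?thesis using s' ss by simp
      next
        case False
        then obtain s' where s': "s' \<in> p" "e = bot_to_mid ` s'" using e(1) by (auto simp: edges_def)
        then show ?thesis using bot_to_mid_Bot[OF diagrams_part[OF p s'(1)]] z \<open>z \<in> range Bot\<close> by blast
      qed
    qed
    then show ?thesis using s(5) ss by blast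
  qed
  have inB: "s \<inter> range Bot \<subseteq> t" if "s \<in> h" "top_to_mid ` s \<subseteq> t" for s t
    using top_to_mid_Bot[OF diagrams_part[OF h that(1)]] that(2) by blast
  have star: "\<exists>s\<in>h. t \<inter> range Bot = s \<inter> range Bot \<and> (propagating s \<longleftrightarrow> propagating t) \<and> (\<not> propagating s \<longrightarrow> t = s)"
    if t: "t \<in> ?S" "t \<inter> range Bot \<noteq> {}" for t
  proof -
    have cov: "\<exists>s\<in>h. y \<in> s \<and> top_to_mid ` s \<subseteq> t" if y: "y \<in> t" "y \<in> range Bot" for y
    proof -
      have "y \<in> Top ` {1..m} \<union> Bot ` {1..r}" using stack_part[OF p h t(1)] y by auto
      then obtain s where s: "s \<in> h" "y \<in> s" using diagrams_cover[OF h] by blast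
      then have "y \<in> top_to_mid ` s" using top_to_mid_Bot[OF diagrams_part[OF h s(1)]] y by blast
      then show ?thesis using stack_edge_bot[OF p h t(1) s(1)] s y by blast
    qed
    obtain y where y: "y \<in> t" "y \<in> range Bot" using t(2) by blast
    obtain s where s: "s \<in> h" "y \<in> s" "top_to_mid ` s \<subseteq> t" using cov[OF y] by blast
    show ?thesis
    proof (cases "propagating s")
      case False
      then have "s = t" using np[of s t] s t(1) y by blast
      then show ?thesis using s(1) by blast
    next
      case True
      then have st: "s = \<phi> t" "propagating t" using uniq[of s t] s t(1) by blast+
      have "t \<inter> range Bot = s \<inter> range Bot"
      proof
        show "s \<inter> range Bot \<subseteq> t \<inter> range Bot" using inB[OF s(1,3)] by blast
        show "t \<inter> range Bot \<subseteq> s \<inter> range Bot"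
        proof
          fix z assume z: "z \<in> t \<inter> range Bot"
          then obtain s' where s': "s' \<in> h" "z \<in> s'" "top_to_mid ` s' \<subseteq> t" using cov[of z] by blast
          show "z \<in> s \<inter> range Bot"
          proof (cases "propagating s'")
            case True
            then show ?thesis using uniq[of s' t] s' t(1) st(1) z by blast
          next
            case False
            then have "s' = t" using np[of s' t] s' t(1) z by blast
            then show ?thesis using False st(2) by simp
          qed
        qed
      qed
      then show ?thesis using s(1) True st(2) by blast
    qed
  qed
  have conv: "\<exists>t\<in>?S. top_to_mid ` s \<subseteq> t" if sh: "s \<in> h" for s
  proof -
    obtain x where x: "x \<in> s" using diagrams_nonempty[OF h sh] by blast
    have "top_to_mid ` s \<in> edges p h" using sh by (simp add: edges_def)
    then show ?thesis using comps_edge_ex[of "top_to_mid ` s" "edges p h"] x by (auto simp: stack_eq[OF p h])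
  qed
  have star': "\<exists>t\<in>?S. t \<inter> range Bot = s \<inter> range Bot \<and> (propagating s \<longleftrightarrow> propagating t) \<and> (\<not> propagating s \<longrightarrow> t = s)"
    if s: "s \<in> h" "s \<inter> range Bot \<noteq> {}" for s
  proof -
    obtain t where t: "t \<in> ?S" "top_to_mid ` s \<subseteq> t" using conv[OF s(1)] by blast
    have "t \<inter> range Bot \<noteq> {}" using inB[OF s(1) t(2)] s(2) by blast
    then obtain s' where s': "s' \<in> h" "t \<inter> range Bot = s' \<inter> range Bot" "propagating s' \<longleftrightarrow> propagating t" "\<not> propagating s' \<longrightarrow> t = s'"
      using star[OF t(1)] by blast
    have "s = s'"
    proof -
      obtain x where "x \<in> s" "x \<in> range Bot" using s(2) by blast
      then have "x \<in> s'" using inB[OF s(1) t(2)] s'(2) by blast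
      then show ?thesis using diagrams_same[OF h s(1) s'(1)] \<open>x \<in> s\<close> by blast
    qed
    then show ?thesis using t(1) s' by blast
  qed
  have br: "u \<in> bottom_restriction (compose n m r p h) \<longleftrightarrow> u \<noteq> {} \<and> (\<exists>t\<in>?S. u = t \<inter> range Bot)" for u
  proof
    assume "u \<in> bottom_restriction (compose n m r p h)"
    then show "u \<noteq> {} \<and> (\<exists>t\<in>?S. u = t \<inter> range Bot)"
      unfolding bottom_restriction_def compose_erase[OF p h] erase_def by auto
  next
    assume "u \<noteq> {} \<and> (\<exists>t\<in>?S. u = t \<inter> range Bot)"
    then obtain t where t: "t \<in> ?S" "u = t \<inter> range Bot" "u \<noteq> {}" by blast
    then have "t - range Mid \<in> compose n m r p h" unfolding compose_erase[OF p h] by (intro erase_mem) auto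
    then have "(t - range Mid) \<inter> range Bot \<in> (\<lambda>s. s \<inter> range Bot) ` compose n m r p h" by (rule imageI)
    then show "u \<in> bottom_restriction (compose n m r p h)" using t by (simp add: bottom_restriction_def)
  qed
  have brh: "u \<in> bottom_restriction h \<longleftrightarrow> u \<noteq> {} \<and> (\<exists>s\<in>h. u = s \<inter> range Bot)" for u
    by (auto simp: bottom_restriction_def)
  show "bottom_restriction (compose n m r p h) = bottom_restriction h"
  proof (rule Set.set_eqI)
    fix u show "u \<in> bottom_restriction (compose n m r p h) \<longleftrightarrow> u \<in> bottom_restriction h"
    proof
      assume "u \<in> bottom_restriction (compose n m r p h)"
      then obtain t where t: "u \<noteq> {}" "t \<in> ?S" "u = t \<inter> range Bot" unfolding br by blast
      then obtain s where "s \<in> h" "t \<inter> range Bot = s \<inter> range Bot" using star[of t] by blast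
      then show "u \<in> bottom_restriction h" unfolding brh using t by blast
    next
      assume "u \<in> bottom_restriction h"
      then obtain s where s: "u \<noteq> {}" "s \<in> h" "u = s \<inter> range Bot" unfolding brh by blast
      then obtain t where "t \<in> ?S" "t \<inter> range Bot = s \<inter> range Bot" using star'[of s] by blast
      then show "u \<in> bottom_restriction (compose n m r p h)" unfolding br using s by blast
    qed
  qed
  have nonmid: "s - range Mid = s" if "s \<in> h" for s using diagrams_part'[OF h that] by auto
  show "nonprop_bottom (compose n m r p h) = nonprop_bottom h"
  proof
    show "nonprop_bottom (compose n m r p h) \<subseteq> nonprop_bottom h"
    proof
      fix u assume "u \<in> nonprop_bottom (compose n m r p h)"
      then have u: "u \<in> erase (range Mid) ?S" "\<not> propagating u" "u \<inter> range Bot \<noteq> {}"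
        unfolding nonprop_bottom_def compose_erase[OF p h] by simp_all
      from u(1) obtain t where tS: "t \<in> ?S" "u = t - range Mid" unfolding erase_iff by blast
      have t: "t \<in> ?S" "u = t - range Mid" "\<not> propagating t" "t \<inter> range Bot \<noteq> {}"
        using tS u(2,3) by simp_all
      then obtain s where "s \<in> h" "t = s" "\<not> propagating s" using star[OF t(1,4)] by blast
      then show "u \<in> nonprop_bottom h" using t nonmid by (simp add: nonprop_bottom_def)
    qed
    show "nonprop_bottom h \<subseteq> nonprop_bottom (compose n m r p h)"
    proof
      fix s assume s: "s \<in> nonprop_bottom h"
      then have s': "s \<in> h" "\<not> propagating s" "s \<inter> range Bot \<noteq> {}" by (auto simp: nonprop_bottom_def)
      then have "s \<in> ?S" using star'[OF s'(1,3)] by blast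
      then have "s - range Mid \<in> compose n m r p h" unfolding compose_erase[OF p h] using s'(3) by (intro erase_mem) auto
      then show "s \<in> nonprop_bottom (compose n m r p h)" using s' nonmid by (simp add: nonprop_bottom_def)
    qed
  qed
qed

subsection \<open>The order on propagating vectors\<close>

definition cone :: "nat \<Rightarrow> (nat \<Rightarrow> int) set" where
  "cone l = {x. \<exists>c :: nat \<Rightarrow> nat \<Rightarrow> nat. \<forall>k. x k = (\<Sum>j=1..l. \<Sum>i=1..j. int (c i j) * v_vec l i j k)}"

lemma cone_zero: "(\<lambda>k. 0) \<in> cone l"
  unfolding cone_def by (intro CollectI exI[of _ "\<lambda>i j. 0"]) simp

lemma cone_add: "x \<in> cone l \<Longrightarrow> y \<in> cone l \<Longrightarrow> (\<lambda>k. x k + y k) \<in> cone l"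
proof -
  assume "x \<in> cone l" "y \<in> cone l"
  then obtain c d :: "nat \<Rightarrow> nat \<Rightarrow> nat" where
    "\<And>k. x k = (\<Sum>j=1..l. \<Sum>i=1..j. int (c i j) * v_vec l i j k)" "\<And>k. y k = (\<Sum>j=1..l. \<Sum>i=1..j. int (d i j) * v_vec l i j k)"
    unfolding cone_def by blast
  then show ?thesis unfolding cone_def
    by (intro CollectI exI[of _ "\<lambda>i j. c i j + d i j"]) (simp add: distrib_right sum.distrib)
qed

lemma cone_sum: "finite A \<Longrightarrow> (\<And>a. a \<in> A \<Longrightarrow> f a \<in> cone l) \<Longrightarrow> (\<lambda>k. \<Sum>a\<in>A. f a k) \<in> cone l"
  by (induction A rule: finite_induct) (auto simp: cone_zero intro!: cone_add)

lemma cone_v: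
  assumes "i \<in> {1..l}" "j \<in> {1..l}"
  shows "v_vec l i j \<in> cone l"
proof -
  have *: "v_vec l i j \<in> cone l" if "i \<in> {1..l}" "j \<in> {1..l}" "i \<le> j" for i j
  proof -
    let ?c = "\<lambda>i' j'. if i' = i \<and> j' = j then 1 else 0 :: nat"
    have "(\<Sum>j'=1..l. \<Sum>i'=1..j'. int (?c i' j') * v_vec l i' j' k) = v_vec l i j k" for k
    proof -
      have "(\<Sum>i'=1..j'. int (?c i' j') * v_vec l i' j' k) = (if j' = j then v_vec l i j k else 0)" for j'
      proof (cases "j' = j")
        case True
        have "(\<Sum>i'=1..j. int (?c i' j) * v_vec l i' j k) = (\<Sum>i'=1..j. if i' = i then v_vec l i j k else 0)"
          by (intro sum.cong) auto
        then show ?thesis using True that by simp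
      qed simp
      then show ?thesis using that by simp
    qed
    then show ?thesis unfolding cone_def by (intro CollectI exI[of _ ?c]) simp
  qed
  have "v_vec l i j = v_vec l j i" by (rule ext) (simp add: v_vec_def add.commute)
  then show ?thesis using *[of i j] *[of j i] assms by (cases "i \<le> j") auto
qed

lemma residue_index_mem: "l \<ge> 1 \<Longrightarrow> residue_index l k \<in> {1..l}"
  by (auto simp: residue_index_def Suc_le_eq)

lemma residue_index_cong: "k \<ge> 1 \<Longrightarrow> [residue_index l k = k] (mod l)"
proof -
  assume "k \<ge> 1"
  have "[(k - 1) mod l + 1 = (k - 1) + 1] (mod l)" by (intro cong_add) simp_all
  then show ?thesis using \<open>k \<ge> 1\<close> by (simp add: residue_index_def)
qed

lemma residue_index_eq: "l \<ge> 1 \<Longrightarrow> i \<in> {1..l} \<Longrightarrow> k \<ge> 1 \<Longrightarrow> [k = i] (mod l) \<longleftrightarrow> residue_index l k = i"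
  using residue_index_cong[of k l] cong_l_iff[OF residue_index_mem, of l i k] by (metis cong_sym cong_trans)

lemma residue_index_eqI: "l \<ge> 1 \<Longrightarrow> k \<ge> 1 \<Longrightarrow> k' \<ge> 1 \<Longrightarrow> [k = k'] (mod l) \<Longrightarrow> residue_index l k = residue_index l k'"
  using residue_index_eq[OF _ residue_index_mem] residue_index_cong by (metis cong_sym cong_trans)

text \<open>Here 2 l is congruent to l, so this is the generator with both indices \<open>l\<close>.
  It removes a merged group of parts that no longer propagates: such a group has a total divisible
  by \<open>l\<close> and is first collapsed to the unit vector at \<open>l\<close>.\<close>

lemma cone_neg: "l \<ge> 1 \<Longrightarrow> (\<lambda>k. - unit_vec l k) \<in> cone l"
proof -
  assume l: "l \<ge> 1"
  have "residue_index l (l + l) = l" using residue_index_eq[OF l, of l "l + l"] l by (simp add: cong_def)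
  then have "(\<lambda>k. - unit_vec l k) = v_vec l l l" by (simp add: v_vec_def fun_eq_iff)
  then show ?thesis using cone_v[of l l l] l by simp
qed

text \<open>Parts are merged one at a time: joining a part of residue \<open>c b\<close> to a group
  of residue \<open>r\<close> replaces two unit vectors by one, which is the generator
  \<open>v_vec l (c b) r\<close>.\<close>

lemma cone_group:
  assumes l: "l \<ge> 1" and "finite F" "F \<noteq> {}" "\<And>b. b \<in> F \<Longrightarrow> c b \<in> {1..l}"
  shows "(\<lambda>k. unit_vec (residue_index l (\<Sum>b\<in>F. c b)) k - (\<Sum>b\<in>F. unit_vec (c b) k)) \<in> cone l"
  using assms(2-)
proof (induction F rule: finite_ne_induct)
  case (singleton b)
  then have "residue_index l (c b) = c b" using residue_index_eq[OF l, of "c b" "c b"] by auto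
  then show ?case by (simp add: cone_zero)
next
  case (insert b F)
  let ?s = "\<Sum>b\<in>F. c b" and ?r = "residue_index l (\<Sum>b\<in>F. c b)"
  have cb: "c b \<in> {1..l}" using insert by simp
  have "?s \<ge> 1"
  proof -
    obtain d where "d \<in> F" using insert by blast
    then have "c d \<le> ?s" "c d \<ge> 1" using insert by (auto intro: member_le_sum)
    then show ?thesis by linarith
  qed
  then have "residue_index l (c b + ?r) = residue_index l (c b + ?s)"
    using residue_index_cong[of ?s l] cb residue_index_mem[OF l, of ?s]
    by (intro residue_index_eqI[OF l]) (auto intro: cong_add)
  then have "unit_vec (residue_index l (\<Sum>b\<in>insert b F. c b)) k - (\<Sum>b\<in>insert b F. unit_vec (c b) k) =
     v_vec l (c b) ?r k + (unit_vec ?r k - (\<Sum>b\<in>F. unit_vec (c b) k))" for k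
    using insert by (simp add: v_vec_def)
  moreover have "(\<lambda>k. v_vec l (c b) ?r k + (unit_vec ?r k - (\<Sum>b\<in>F. unit_vec (c b) k))) \<in> cone l"
    using insert by (intro cone_add cone_v cb residue_index_mem[OF l]) auto
  ultimately show ?case by simp
qed

lemma index_le_cone: "index_le l m' m \<longleftrightarrow> (\<lambda>k. int (m' k) - int (m k)) \<in> cone l"
  by (simp add: index_le_def cone_def)

text \<open>Each generator trades two unit vectors for one and so has coordinate sum -1. The
  coordinate sum of a cone element is minus the number of generators used; consequently the order is
  strict in the number of propagating parts.\<close>

lemma cone_sum_nonpos:
  assumes l: "l \<ge> 1" and "x \<in> cone l"
  shows "(\<Sum>k=1..l. x k) \<le> 0" "(\<Sum>k=1..l. x k) = 0 \<Longrightarrow> k \<in> {1..l} \<Longrightarrow> x k = 0"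
proof -
  obtain c :: "nat \<Rightarrow> nat \<Rightarrow> nat" where c: "\<And>k. x k = (\<Sum>j=1..l. \<Sum>i=1..j. int (c i j) * v_vec l i j k)"
    using assms(2) unfolding cone_def by blast
  have v: "(\<Sum>k=1..l. v_vec l i j k) = -1" if "i \<in> {1..l}" "j \<in> {1..l}" for i j
  proof -
    have "(\<Sum>k=1..l. unit_vec r k) = 1" if "r \<in> {1..l}" for r
      using that by (simp add: unit_vec_def)
    then show ?thesis using that residue_index_mem[OF l, of "i + j"] by (simp add: v_vec_def sum_subtractf)
  qed
  have "(\<Sum>k=1..l. x k) = (\<Sum>k=1..l. \<Sum>j=1..l. \<Sum>i=1..j. int (c i j) * v_vec l i j k)" by (simp add: c)
  also have "\<dots> = (\<Sum>j=1..l. \<Sum>k=1..l. \<Sum>i=1..j. int (c i j) * v_vec l i j k)" by (rule sum.swap)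
  also have "\<dots> = (\<Sum>j=1..l. \<Sum>i=1..j. \<Sum>k=1..l. int (c i j) * v_vec l i j k)"
    by (rule sum.cong[OF refl]) (rule sum.swap)
  also have "\<dots> = (\<Sum>j=1..l. \<Sum>i=1..j. - int (c i j))"
  proof (intro sum.cong refl)
    fix j i assume "j \<in> {1..l}" "i \<in> {1..j}"
    then have "(\<Sum>k=1..l. v_vec l i j k) = -1" by (intro v) auto
    then show "(\<Sum>k=1..l. int (c i j) * v_vec l i j k) = - int (c i j)"
      unfolding sum_distrib_left[symmetric] by simp
  qed
  finally have s: "(\<Sum>k=1..l. x k) = - (\<Sum>j=1..l. \<Sum>i=1..j. int (c i j))" by (simp add: sum_negf)
  moreover have nn: "(\<Sum>j=1..l. \<Sum>i=1..j. int (c i j)) \<ge> 0" by (intro sum_nonneg) simp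
  ultimately show "(\<Sum>k=1..l. x k) \<le> 0" by simp
  assume "(\<Sum>k=1..l. x k) = 0"
  then have "(\<Sum>j=1..l. \<Sum>i=1..j. int (c i j)) = 0" using s by simp
  then have "(\<Sum>i=1..j. int (c i j)) = 0" if "j \<in> {1..l}" for j
    using that by (subst (asm) sum_nonneg_eq_0_iff) (auto intro: sum_nonneg)
  then have "c i j = 0" if "j \<in> {1..l}" "i \<in> {1..j}" for i j
    using that by (subst (asm) sum_nonneg_eq_0_iff) auto
  then show "x k = 0" unfolding c by (intro sum.neutral ballI) simp
qed

lemma prop_vec_sum:
  assumes l: "l \<ge> 1" and p: "p \<in> diagrams n r"
  shows "int (prop_vec l p k) = (\<Sum>s\<in>{s \<in> p. propagating s}. unit_vec (residue_index l (card (s \<inter> range Top))) k)"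
proof (cases "k \<in> {1..l}")
  case True
  have c1: "card (s \<inter> range Top) \<ge> 1" if "s \<in> p" "propagating s" for s
    using that finite_diagram_part[OF p that(1)] by (simp add: propagating_def Suc_le_eq card_gt_0_iff)
  have "prop_vec l p k = card {s \<in> {s \<in> p. propagating s}. residue_index l (card (s \<inter> range Top)) = k}"
  proof -
    have "{s \<in> p. propagating s \<and> [card (s \<inter> range Top) = k] (mod l)} =
      {s \<in> {s \<in> p. propagating s}. residue_index l (card (s \<inter> range Top)) = k}"
      using residue_index_eq[OF l True] c1 by blast
    then show ?thesis using True by (simp add: prop_vec_def)
  qed
  also have "int \<dots> = (\<Sum>s\<in>{s \<in> p. propagating s}. if residue_index l (card (s \<inter> range Top)) = k then 1 else 0)"
    using finite_diagram[OF p] by (simp add: sum.If_cases Int_def)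
  finally show ?thesis by (simp add: unit_vec_def eq_commute)
next
  case False
  have "unit_vec (residue_index l j) k = 0" for j
    using residue_index_mem[OF l, of j] False by (auto simp: unit_vec_def)
  moreover have "prop_vec l p k = 0" using False unfolding prop_vec_def by auto
  ultimately show ?thesis by simp
qed

lemma nprop_prop_vec:
  assumes l: "l \<ge> 1" and p: "p \<in> diagrams n r"
  shows "(\<Sum>k=1..l. prop_vec l p k) = nprop p"
proof -
  have "int (\<Sum>k=1..l. prop_vec l p k) = (\<Sum>k=1..l. \<Sum>s\<in>{s \<in> p. propagating s}. unit_vec (residue_index l (card (s \<inter> range Top))) k)"
    by (simp add: prop_vec_sum[OF l p])
  also have "\<dots> = (\<Sum>s\<in>{s \<in> p. propagating s}. \<Sum>k=1..l. unit_vec (residue_index l (card (s \<inter> range Top))) k)" by (rule sum.swap)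
  also have "\<dots> = (\<Sum>s\<in>{s \<in> p. propagating s}. 1)"
    using residue_index_mem[OF l] by (intro sum.cong refl) (simp add: unit_vec_def)
  finally have "int (\<Sum>k=1..l. prop_vec l p k) = int (nprop p)" by (simp add: nprop_def)
  then show ?thesis by (simp only: of_nat_eq_iff)
qed

text \<open>The propagating parts of \<open>h\<close> are grouped by the component of the stack that
  contains them. A propagating component merges its group into one part, any other component makes
  its group disappear; either change lies in the cone.\<close>

lemma index_le_compose:
  assumes l: "l \<ge> 1" and p: "p \<in> tonal l n" and h: "h \<in> tonal l n"
  shows "index_le l (prop_vec l (compose n n n p h)) (prop_vec l h)"
proof -
  note d = tonal_diagrams[OF p] tonal_diagrams[OF h]
  note q = compose_diagrams[OF d]
  let ?S = "stack n n n p h" and ?H = "{s \<in> h. propagating s}"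
  let ?B = "\<lambda>t. {s \<in> ?H. top_to_mid ` s \<subseteq> t}"
  define c where "c s = residue_index l (card (s \<inter> range Top))" for s
  have finH: "finite ?H" using finite_diagram[OF d(2)] by simp
  have c1: "card (s \<inter> range Top) \<ge> 1" if "s \<in> ?H" for s
    using that finite_diagram_part[OF d(2), of s] by (simp add: propagating_def Suc_le_eq card_gt_0_iff)
  have tq: "[card (t \<inter> range Top) = (\<Sum>s\<in>?B t. c s)] (mod l)" if t: "t \<in> ?S" for t
  proof -
    have 1: "[card (t \<inter> range Top) = card (t \<inter> range Mid)] (mod l)"
      unfolding card_stack_top[OF d t] card_stack_mid[OF d t]
      using p by (intro cong_sum) (auto simp: tonal_def is_tone_def)
    \<comment> \<open>A part that does not propagate misses one of the rows, so tonality makes its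
      top size divisible by \<open>l\<close>.\<close>
    have 2: "[(\<Sum>s\<in>{s \<in> h. top_to_mid ` s \<subseteq> t}. card (s \<inter> range Top)) = (\<Sum>s\<in>{s \<in> h. top_to_mid ` s \<subseteq> t}. if propagating s then c s else 0)] (mod l)"
    proof (rule cong_sum)
      fix s assume s: "s \<in> {s \<in> h. top_to_mid ` s \<subseteq> t}"
      show "[card (s \<inter> range Top) = (if propagating s then c s else 0)] (mod l)"
      proof (cases "propagating s")
        case True
        then show ?thesis using c1[of s] s by (simp add: c_def cong_sym[OF residue_index_cong])
      next
        case False
        have "[card (s \<inter> range Top) = card (s \<inter> range Bot)] (mod l)" using s h by (simp add: tonal_def is_tone_def)
        moreover have "card (s \<inter> range Top) = 0 \<or> card (s \<inter> range Bot) = 0" using False by (auto simp: propagating_def)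
        ultimately show ?thesis using False by auto
      qed
    qed
    have 3: "(\<Sum>s\<in>{s \<in> h. top_to_mid ` s \<subseteq> t}. if propagating s then c s else 0) = (\<Sum>s\<in>?B t. c s)"
    proof -
      have "{s \<in> h. top_to_mid ` s \<subseteq> t} \<inter> {s. propagating s} = ?B t" by blast
      then show ?thesis using finite_diagram[OF d(2)] by (simp add: sum.If_cases)
    qed
    show ?thesis using cong_trans[OF 1[unfolded card_stack_mid'[OF d t]] 2] unfolding 3 .
  qed
  have part: "(\<lambda>k. (if propagating t then unit_vec (residue_index l (card (t \<inter> range Top))) k else 0) - (\<Sum>s\<in>?B t. unit_vec (c s) k)) \<in> cone l"
    if t: "t \<in> ?S" for t
  proof (cases "?B t = {}")
    case True
    then have "\<not> propagating t" using stack_prop_bot[OF d t] by blast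
    then show ?thesis unfolding True using cone_zero[of l] by simp
  next
    case False
    have finB: "finite (?B t)" by (rule finite_subset[OF _ finH]) blast
    have cm: "c s \<in> {1..l}" for s using residue_index_mem[OF l] by (simp add: c_def)
    have g: "(\<lambda>k. unit_vec (residue_index l (\<Sum>s\<in>?B t. c s)) k - (\<Sum>s\<in>?B t. unit_vec (c s) k)) \<in> cone l"
      by (rule cone_group[OF l finB False cm])
    have pos: "(\<Sum>s\<in>?B t. c s) \<ge> 1"
    proof -
      obtain s where s: "s \<in> ?B t" using False by blast
      then have "c s \<le> (\<Sum>s\<in>?B t. c s)" using finB by (intro member_le_sum) auto
      then show ?thesis using cm[of s] by simp
    qed
    have ft: "finite t" using stack_part[OF d t] by (rule finite_subset) auto
    show ?thesis
    proof (cases "propagating t")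
      case True
      then have "card (t \<inter> range Top) \<ge> 1" using ft by (simp add: propagating_def Suc_le_eq card_gt_0_iff)
      then have "residue_index l (card (t \<inter> range Top)) = residue_index l (\<Sum>s\<in>?B t. c s)"
        by (intro residue_index_eqI[OF l _ pos tq[OF t]])
      then show ?thesis using g True by simp
    next
      \<comment> \<open>The group reaches the bottom row, so a component that does not propagate
        misses the top row, and the residues of its group add up to 0 modulo
        \<open>l\<close>.\<close>
      case False
      obtain s where s: "s \<in> h" "propagating s" "top_to_mid ` s \<subseteq> t" using \<open>?B t \<noteq> {}\<close> by blast
      have "t \<inter> range Bot \<noteq> {}"
        using top_to_mid_Bot[OF diagrams_part[OF d(2) s(1)]] s(2,3) by (auto simp: propagating_def)
      then have "t \<inter> range Top = {}" using False by (auto simp: propagating_def)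
      then have "[(\<Sum>s\<in>?B t. c s) = l] (mod l)" using tq[OF t] by (simp add: cong_def)
      then have "residue_index l (\<Sum>s\<in>?B t. c s) = l" using residue_index_eq[OF l _ pos, of l] l by simp
      then show ?thesis using cone_add[OF g cone_neg[OF l]] False by simp
    qed
  qed
  have "(\<lambda>k. \<Sum>t\<in>?S. (if propagating t then unit_vec (residue_index l (card (t \<inter> range Top))) k else 0) - (\<Sum>s\<in>?B t. unit_vec (c s) k)) \<in> cone l"
    by (intro cone_sum finite_stack[OF d] part)
  moreover have "(\<Sum>t\<in>?S. (if propagating t then unit_vec (residue_index l (card (t \<inter> range Top))) k else 0) - (\<Sum>s\<in>?B t. unit_vec (c s) k)) =
    int (prop_vec l (compose n n n p h) k) - int (prop_vec l h k)" for k
  proof -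
    have "(\<Sum>t\<in>?S. if propagating t then unit_vec (residue_index l (card (t \<inter> range Top))) k else 0) =
      (\<Sum>t\<in>{t \<in> ?S. propagating t}. unit_vec (residue_index l (card (t \<inter> range Top))) k)"
      using finite_stack[OF d] by (simp add: sum.inter_filter)
    also have "\<dots> = (\<Sum>s\<in>{s \<in> compose n n n p h. propagating s}. unit_vec (residue_index l (card (s \<inter> range Top))) k)"
      unfolding propagating_compose[OF d] sum.reindex[OF inj_on_minus_Mid[OF d]] by simp
    also have "\<dots> = int (prop_vec l (compose n n n p h) k)" by (rule prop_vec_sum[OF l q, symmetric])
    finally have 1: "(\<Sum>t\<in>?S. if propagating t then unit_vec (residue_index l (card (t \<inter> range Top))) k else 0) =
      int (prop_vec l (compose n n n p h) k)" .
    \<comment> \<open>Every propagating part of \<open>h\<close> lies in exactly one component, so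
      the double sum counts it once.\<close>
    have "(\<Sum>t\<in>?S. \<Sum>s\<in>?B t. unit_vec (c s) k) = (\<Sum>s\<in>?H. \<Sum>t\<in>{t \<in> ?S. top_to_mid ` s \<subseteq> t}. unit_vec (c s) k)"
      by (rule sum.swap_restrict[OF finite_stack[OF d] finH])
    also have "\<dots> = (\<Sum>s\<in>?H. unit_vec (c s) k)"
    proof (rule sum.cong[OF refl])
      fix s assume s: "s \<in> ?H"
      obtain x where x: "x \<in> s" using s by (auto simp: propagating_def)
      have "top_to_mid ` s \<in> edges p h" using s by (simp add: edges_def)
      then obtain t where t: "t \<in> ?S" "top_to_mid ` s \<subseteq> t"
        using comps_edge_ex[of "top_to_mid ` s" "edges p h"] x by (auto simp: stack_eq[OF d])
      have "u = t" if "u \<in> ?S" "top_to_mid ` s \<subseteq> u" for u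
        using stack_same[OF d that(1) t(1), of "top_to_mid x"] that(2) t(2) x by blast
      then have "{t \<in> ?S. top_to_mid ` s \<subseteq> t} = {t}" using t by blast
      then show "(\<Sum>t\<in>{t \<in> ?S. top_to_mid ` s \<subseteq> t}. unit_vec (c s) k) = unit_vec (c s) k" by simp
    qed
    also have "\<dots> = int (prop_vec l h k)" unfolding prop_vec_sum[OF l d(2)] c_def ..
    finally show ?thesis using 1 by (simp add: sum_subtractf)
  qed
  ultimately show ?thesis unfolding index_le_cone by simp
qed

text \<open>The second claim cuts an arbitrary tonal diagram along the index set of the
  \<open>a_diag\<close> with its own propagating vector; the factorisation of the diagram through
  that \<open>a_diag\<close> rests on it.\<close>

lemma prop_vec_gamma:
  assumes l: "l \<ge> 1" and q: "q \<in> tonal l n"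
  shows "prop_vec l q \<in> gamma l n"
    and "\<exists>T B U L. q = mk (idx l (prop_vec l q)) T B U L \<and> fam (idx l (prop_vec l q)) T U {1..n} \<and>
       fam (idx l (prop_vec l q)) B L {1..n} \<and> (\<forall>x\<in>idx l (prop_vec l q). [card (T x) = fst x] (mod l)) \<and>
       (\<forall>x\<in>idx l (prop_vec l q). [card (B x) = fst x] (mod l)) \<and> (\<forall>u\<in>U. l dvd card u) \<and> (\<forall>u\<in>L. l dvd card u)"
proof -
  note d = tonal_diagrams[OF q]
  let ?m = "prop_vec l q"
  let ?P = "{s \<in> q. propagating s}"
  obtain T B U L where mk: "q = mk ?P T B U L" "fam ?P T U {1..n}" "fam ?P B L {1..n}"
    using mk_of_diagram[OF d] by blast
  have tone: "is_tone l s" if "s \<in> q" for s using q that by (simp add: tonal_def)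
  have TB: "[card (T s) = card (B s)] (mod l)" if "s \<in> ?P" for s
  proof -
    have "Top ` T s \<union> Bot ` B s \<in> mk ?P T B U L" using that unfolding mk_def by blast
    then show ?thesis using tone[of "Top ` T s \<union> Bot ` B s"] mk(1) by simp
  qed
  have Ud: "l dvd card u" if "u \<in> U" for u
  proof -
    have "Top ` u \<in> mk ?P T B U L" using that unfolding mk_def by blast
    then show ?thesis using tone[of "Top ` u"] mk(1) by simp
  qed
  have Ld: "l dvd card u" if "u \<in> L" for u
  proof -
    have "Bot ` u \<in> mk ?P T B U L" using that unfolding mk_def by blast
    then show ?thesis using tone[of "Bot ` u"] mk(1) by simp
  qed
  have finP: "finite ?P" using finite_diagram[OF d] by simp
  have finT: "finite (T s)" if "s \<in> ?P" for s using fam_sub[OF mk(2) that] by (rule finite_subset) simp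
  define r where "r s = residue_index l (card (T s))" for s
  have T1: "card (T s) \<ge> 1" if "s \<in> ?P" for s
    using fam_ne[OF mk(2) that] finT[OF that] by (simp add: Suc_le_eq card_gt_0_iff)
  have rT: "[card (T s) = r s] (mod l)" if "s \<in> ?P" for s
    unfolding r_def by (rule cong_sym[OF residue_index_cong[OF T1[OF that]]])
  have card_r: "card {s \<in> ?P. r s = i} = ?m i" if i: "i \<in> {1..l}" for i
  proof -
    let ?g = "\<lambda>s. Top ` T s \<union> Bot ` B s"
    have "{s \<in> q. propagating s \<and> [card (s \<inter> range Top) = i] (mod l)} = {s \<in> ?g ` ?P. [card (s \<inter> range Top) = i] (mod l)}"
      using propagating_mk[OF mk(2,3)] unfolding mk(1)[symmetric] by blast
    also have "\<dots> = ?g ` {s \<in> ?P. [card (T s) = i] (mod l)}" by auto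
    also have "{s \<in> ?P. [card (T s) = i] (mod l)} = {s \<in> ?P. r s = i}"
      using residue_index_eq[OF l i T1] unfolding r_def by blast
    finally have "card {s \<in> q. propagating s \<and> [card (s \<inter> range Top) = i] (mod l)} = card {s \<in> ?P. r s = i}"
      using card_image[OF inj_on_subset[OF inj_on_mk[OF mk(2,3)], of "{s \<in> ?P. r s = i}"]] by auto
    then show ?thesis using i by (simp add: prop_vec_def)
  qed
  \<comment> \<open>There are \<open>?m i\<close> propagating parts of residue \<open>i\<close>;
    numbering them from 1 gives them the labels of \<open>idx\<close>.\<close>
  have "\<exists>f. bij_betw f {1..?m i} {s \<in> ?P. r s = i}" if "i \<in> {1..l}" for i
  proof -
    have "finite {s \<in> ?P. r s = i}" by (rule finite_subset[OF _ finP]) blast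
    then show ?thesis using card_r[OF that] by (intro finite_same_card_bij) simp_all
  qed
  then obtain f where f: "\<And>i. i \<in> {1..l} \<Longrightarrow> bij_betw (f i) {1..?m i} {s \<in> ?P. r s = i}" by metis
  define g where "g x = f (fst x) (snd x)" for x
  have gx: "g x \<in> ?P \<and> r (g x) = fst x" if "x \<in> idx l ?m" for x
  proof -
    have "fst x \<in> {1..l}" "snd x \<in> {1..?m (fst x)}" using that by (auto simp: idx_def)
    then show ?thesis using bij_betw_apply[OF f, of "fst x" "snd x"] by (simp add: g_def)
  qed
  have bij: "bij_betw g (idx l ?m) ?P"
  proof (rule bij_betw_imageI)
    show "inj_on g (idx l ?m)"
    proof (rule inj_onI)
      fix x y assume xy: "x \<in> idx l ?m" "y \<in> idx l ?m" "g x = g y"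
      then have e: "fst x = fst y" using gx[of x] gx[of y] by simp
      have "fst x \<in> {1..l}" "snd x \<in> {1..?m (fst x)}" "snd y \<in> {1..?m (fst x)}" using xy e by (auto simp: idx_def)
      then have "snd x = snd y" using f[of "fst x"] xy(3) e unfolding g_def bij_betw_def by (metis inj_onD)
      then show "x = y" using e by (simp add: prod_eq_iff)
    qed
    show "g ` idx l ?m = ?P"
    proof
      show "g ` idx l ?m \<subseteq> ?P" using gx by blast
      show "?P \<subseteq> g ` idx l ?m"
      proof
        fix s assume s: "s \<in> ?P"
        have rs: "r s \<in> {1..l}" unfolding r_def by (rule residue_index_mem[OF l])
        then have "s \<in> f (r s) ` {1..?m (r s)}" using f[OF rs] s by (simp add: bij_betw_def)
        then obtain j where "j \<in> {1..?m (r s)}" "s = f (r s) j" by blast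
        then show "s \<in> g ` idx l ?m" using rs by (intro image_eqI[of _ _ "(r s, j)"]) (auto simp: g_def idx_def)
      qed
    qed
  qed
  have q': "q = mk (idx l ?m) (T \<circ> g) (B \<circ> g) U L" using mk(1) mk_reindex[OF bij] by metis
  note fT = fam_reindex[OF mk(2) bij] and fB = fam_reindex[OF mk(3) bij]
  have cT: "[card ((T \<circ> g) x) = fst x] (mod l)" if "x \<in> idx l ?m" for x
    using rT[of "g x"] gx[OF that] by simp
  have cB: "[card ((B \<circ> g) x) = fst x] (mod l)" if "x \<in> idx l ?m" for x
    using cT[OF that] TB[of "g x"] gx[OF that] by (metis cong_sym cong_trans o_apply)
  show "\<exists>T B U L. q = mk (idx l ?m) T B U L \<and> fam (idx l ?m) T U {1..n} \<and>
       fam (idx l ?m) B L {1..n} \<and> (\<forall>x\<in>idx l ?m. [card (T x) = fst x] (mod l)) \<and>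
       (\<forall>x\<in>idx l ?m. [card (B x) = fst x] (mod l)) \<and> (\<forall>u\<in>U. l dvd card u) \<and> (\<forall>u\<in>L. l dvd card u)"
    using q' fT fB cT cB Ud Ld by (intro exI[of _ "T \<circ> g"] exI[of _ "B \<circ> g"] exI[of _ U] exI[of _ L]) blast
  have fin: "finite u" if "u \<in> U" for u
  proof -
    have "u \<subseteq> {1..n}" using fam_Union[OF mk(2)] that by blast
    then show ?thesis by (rule finite_subset) simp
  qed
  have finU: "finite U"
  proof (rule finite_subset)
    show "U \<subseteq> Pow {1..n}" using fam_Union[OF mk(2)] by blast
  qed simp
  have "n = card ((\<Union>s\<in>?P. T s) \<union> \<Union>U)" using fam_Union[OF mk(2)] by simp
  also have "\<dots> = card (\<Union>s\<in>?P. T s) + card (\<Union>U)"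
  proof (rule card_Un_disjoint)
    show "(\<Union>s\<in>?P. T s) \<inter> \<Union>U = {}" using fam_TU[OF mk(2)] by blast
  qed (use finP finT fin finU in auto)
  also have "card (\<Union>s\<in>?P. T s) = (\<Sum>s\<in>?P. card (T s))"
  proof (rule card_UN_disjoint)
    show "\<forall>i\<in>?P. \<forall>j\<in>?P. i \<noteq> j \<longrightarrow> T i \<inter> T j = {}" using fam_tableau_tuples[OF mk(2)] by blast
  qed (use finP finT in auto)
  also have "card (\<Union>U) = (\<Sum>u\<in>U. card u)"
    using fam_UU[OF mk(2)] fin by (intro card_Union_disjoint) (auto simp: pairwise_def disjnt_iff)
  finally have n: "n = (\<Sum>s\<in>?P. card (T s)) + (\<Sum>u\<in>U. card u)" .
  have rs: "rsum l ?m = (\<Sum>s\<in>?P. r s)"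
  proof -
    have "(\<Sum>s\<in>?P. r s) = (\<Sum>x\<in>idx l ?m. r (g x))" using sum.reindex_bij_betw[OF bij, of r] by simp
    also have "\<dots> = (\<Sum>(i, j)\<in>idx l ?m. i)" using gx by (intro sum.cong) auto
    also have "\<dots> = rsum l ?m" unfolding idx_def by (subst sum.Sigma[symmetric]) (simp_all add: rsum_def mult.commute)
    finally show ?thesis by simp
  qed
  \<comment> \<open>The top of a propagating part exceeds its residue by a multiple of
    \<open>l\<close>, and the non-propagating tops are multiples of \<open>l\<close>; so
    \<open>n\<close> exceeds the sum of the residues by a multiple of \<open>l\<close>.\<close>
  have rle: "r s \<le> card (T s) \<and> l dvd card (T s) - r s" if "s \<in> ?P" for s
  proof
    have "r s = (card (T s) - 1) mod l + 1" by (simp add: r_def residue_index_def)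
    then have "r s \<le> (card (T s) - 1) + 1" by simp
    then show "r s \<le> card (T s)" using T1[OF that] by simp
    then show "l dvd card (T s) - r s" using rT[OF that] by (simp add: cong_altdef_nat)
  qed
  have le: "rsum l ?m \<le> (\<Sum>s\<in>?P. card (T s))" unfolding rs using rle by (intro sum_mono) blast
  have diff: "(\<Sum>s\<in>?P. card (T s)) - rsum l ?m = (\<Sum>s\<in>?P. card (T s) - r s)"
    unfolding rs using rle by (intro sum_subtractf_nat[symmetric]) blast
  have d1: "l dvd (\<Sum>s\<in>?P. card (T s)) - rsum l ?m" unfolding diff using rle by (intro dvd_sum) blast
  have d2: "l dvd (\<Sum>u\<in>U. card u)" using Ud by (intro dvd_sum) blast
  have "n - rsum l ?m = ((\<Sum>s\<in>?P. card (T s)) - rsum l ?m) + (\<Sum>u\<in>U. card u)" using n le by linarith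
  then have "l dvd n - rsum l ?m" using dvd_add[OF d1 d2] by simp
  moreover have "rsum l ?m \<le> n" using n le by linarith
  moreover have "?m i = 0" if "i \<notin> {1..l}" for i using that unfolding prop_vec_def by auto
  ultimately show "?m \<in> gamma l n" unfolding gamma_def by blast
qed

subsection \<open>Tabloids and the combinatorial lemma\<close>

lemma cells_Sigma: "cells \<mu> = (SIGMA r:{..<length \<mu>}. {..<\<mu> ! r})"
  by (auto simp: cells_def)

lemma finite_cells [simp]: "finite (cells \<mu>)"
  by (simp add: cells_Sigma)

lemma card_cells: "card (cells \<mu>) = sum_list \<mu>"
  by (simp add: cells_Sigma sum_list_sum_nth lessThan_atLeast0)

lemma tableaux_nonempty: "tableaux \<mu> \<noteq> {}"
proof -
  obtain h where h: "bij_betw h (cells \<mu>) {1..sum_list \<mu>}"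
    using finite_same_card_bij[of "cells \<mu>" "{1..sum_list \<mu>}"] card_cells by auto
  then have "bij_betw (restrict h (cells \<mu>)) (cells \<mu>) {1..sum_list \<mu>}"
    by (metis bij_betw_cong restrict_apply')
  then show ?thesis by (auto simp: tableaux_def)
qed

lemma tableauxD: "t \<in> tableaux \<mu> \<Longrightarrow> bij_betw t (cells \<mu>) {1..sum_list \<mu>}"
  by (simp add: tableaux_def)

lemma finite_tableaux: "finite (tableaux \<mu>)"
proof (rule finite_subset)
  show "tableaux \<mu> \<subseteq> (\<Pi>\<^sub>E x\<in>cells \<mu>. {1..sum_list \<mu>})"
  proof
    fix t assume t: "t \<in> tableaux \<mu>"
    then show "t \<in> (\<Pi>\<^sub>E x\<in>cells \<mu>. {1..sum_list \<mu>})"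
      using bij_betw_apply[OF tableauxD[OF t]] by (auto simp: PiE_iff tableaux_def)
  qed
qed (intro finite_PiE, auto)

lemma tableaux_inj: "t \<in> tableaux \<mu> \<Longrightarrow> x \<in> cells \<mu> \<Longrightarrow> y \<in> cells \<mu> \<Longrightarrow> t x = t y \<Longrightarrow> x = y"
  using tableauxD[of t \<mu>] by (auto simp: bij_betw_def inj_on_def)

lemma tableaux_onto: "t \<in> tableaux \<mu> \<Longrightarrow> a \<in> {1..sum_list \<mu>} \<Longrightarrow> \<exists>x\<in>cells \<mu>. a = t x"
  using tableauxD[of t \<mu>] by (auto simp: bij_betw_def)

lemma tabloid_of_cong: "(\<And>x. x \<in> cells \<mu> \<Longrightarrow> t x = u x) \<Longrightarrow> tabloid_of \<mu> t = tabloid_of \<mu> u"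
  unfolding tabloid_of_def by (intro ext image_cong) auto

lemma tabloid_of_comp: "tabloid_of \<mu> (\<pi> \<circ> t) = (\<lambda>r. \<pi> ` tabloid_of \<mu> t r)"
  by (auto simp: tabloid_of_def image_comp)

lemma column_stabilizer_permutes: "\<pi> \<in> column_stabilizer \<mu> t \<Longrightarrow> \<pi> permutes {1..sum_list \<mu>}"
  by (simp add: column_stabilizer_def)

text \<open>A permutation is injective and columns are finite, so mapping every column into itself
  already maps it onto itself.\<close>

lemma column_stabilizer_iff:
  assumes t: "t \<in> tableaux \<mu>" and \<pi>: "\<pi> permutes {1..sum_list \<mu>}"
  shows "\<pi> \<in> column_stabilizer \<mu> t \<longleftrightarrow> (\<forall>x\<in>cells \<mu>. \<exists>y\<in>cells \<mu>. snd y = snd x \<and> \<pi> (t x) = t y)"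
proof
  assume "\<pi> \<in> column_stabilizer \<mu> t"
  then have e: "\<pi> ` t ` {x \<in> cells \<mu>. snd x = c} = t ` {x \<in> cells \<mu>. snd x = c}" for c
    by (simp add: column_stabilizer_def)
  show "\<forall>x\<in>cells \<mu>. \<exists>y\<in>cells \<mu>. snd y = snd x \<and> \<pi> (t x) = t y"
  proof
    fix x assume "x \<in> cells \<mu>"
    then have "\<pi> (t x) \<in> \<pi> ` t ` {y \<in> cells \<mu>. snd y = snd x}" by blast
    then show "\<exists>y\<in>cells \<mu>. snd y = snd x \<and> \<pi> (t x) = t y" unfolding e by blast
  qed
next
  assume a: "\<forall>x\<in>cells \<mu>. \<exists>y\<in>cells \<mu>. snd y = snd x \<and> \<pi> (t x) = t y"
  have "\<pi> ` t ` {x \<in> cells \<mu>. snd x = c} = t ` {x \<in> cells \<mu>. snd x = c}" for c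
  proof (rule card_subset_eq)
    show "\<pi> ` t ` {x \<in> cells \<mu>. snd x = c} \<subseteq> t ` {x \<in> cells \<mu>. snd x = c}" using a by auto
    show "card (\<pi> ` t ` {x \<in> cells \<mu>. snd x = c}) = card (t ` {x \<in> cells \<mu>. snd x = c})"
      using permutes_inj_on[OF \<pi>] by (rule card_image)
  qed simp
  then show "\<pi> \<in> column_stabilizer \<mu> t" using \<pi> by (simp add: column_stabilizer_def)
qed

lemma id_column_stabilizer: "id \<in> column_stabilizer \<mu> t"
  by (simp add: column_stabilizer_def permutes_id)

lemma column_stabilizer_comp:
  assumes "\<pi> \<in> column_stabilizer \<mu> t" "\<rho> \<in> column_stabilizer \<mu> t"
  shows "\<pi> \<circ> \<rho> \<in> column_stabilizer \<mu> t"
proof -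
  have "(\<pi> \<circ> \<rho>) ` t ` X = \<pi> ` \<rho> ` t ` X" for X by (simp only: image_comp comp_assoc)
  then show ?thesis using assms permutes_compose[of \<rho> "{1..sum_list \<mu>}" \<pi>] by (simp add: column_stabilizer_def del: o_apply)
qed

lemma column_stabilizer_inv:
  assumes "\<pi> \<in> column_stabilizer \<mu> t"
  shows "inv_into UNIV \<pi> \<in> column_stabilizer \<mu> t"
proof -
  have p: "\<pi> permutes {1..sum_list \<mu>}" using assms by (rule column_stabilizer_permutes)
  have "inv_into UNIV \<pi> ` t ` {x \<in> cells \<mu>. snd x = c} = t ` {x \<in> cells \<mu>. snd x = c}" for c
  proof -
    have "\<pi> ` t ` {x \<in> cells \<mu>. snd x = c} = t ` {x \<in> cells \<mu>. snd x = c}"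
      using assms by (simp add: column_stabilizer_def)
    then have "inv_into UNIV \<pi> ` t ` {x \<in> cells \<mu>. snd x = c} = inv_into UNIV \<pi> ` \<pi> ` t ` {x \<in> cells \<mu>. snd x = c}" by simp
    also have "\<dots> = t ` {x \<in> cells \<mu>. snd x = c}" using permutes_inj[OF p] by (rule image_inv_f_f)
    finally show ?thesis .
  qed
  then show ?thesis using permutes_inv[OF p] by (simp add: column_stabilizer_def)
qed

lemma finite_column_stabilizer: "finite (column_stabilizer \<mu> t)"
  by (rule finite_subset[OF _ finite_permutations[of "{1..sum_list \<mu>}"]]) (auto simp: column_stabilizer_def)

text \<open>An entry that keeps both its row and its column keeps its cell.\<close>

lemma column_stabilizer_trivial:
  assumes t: "t \<in> tableaux \<mu>" and \<pi>: "\<pi> \<in> column_stabilizer \<mu> t"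
    and e: "tabloid_of \<mu> (\<pi> \<circ> t) = tabloid_of \<mu> t"
  shows "\<pi> = id"
proof
  fix a
  note p = column_stabilizer_permutes[OF \<pi>]
  show "\<pi> a = id a"
  proof (cases "a \<in> {1..sum_list \<mu>}")
    case True
    then obtain x where x: "x \<in> cells \<mu>" "a = t x" using tableaux_onto[OF t] by blast
    obtain y where y: "y \<in> cells \<mu>" "snd y = snd x" "\<pi> (t x) = t y"
      using \<pi> x(1) unfolding column_stabilizer_iff[OF t p] by blast
    have "\<pi> (t x) \<in> tabloid_of \<mu> (\<pi> \<circ> t) (fst x)" using x by (auto simp: tabloid_of_def)
    then obtain z where z: "z \<in> cells \<mu>" "fst z = fst x" "\<pi> (t x) = t z" unfolding e by (auto simp: tabloid_of_def)
    have "y = z" using tableaux_inj[OF t y(1) z(1)] y(3) z(3) by simp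
    then have "y = x" using y(2) z(2) by (simp add: prod_eq_iff)
    then show ?thesis using x y by simp
  next
    case False
    then show ?thesis using p by (simp add: permutes_def)
  qed
qed

lemma column_down: "integer_partition \<mu> k \<Longrightarrow> (r, c) \<in> cells \<mu> \<Longrightarrow> r' \<le> r \<Longrightarrow> (r', c) \<in> cells \<mu>"
proof (cases "r' = r")
  assume a: "integer_partition \<mu> k" "(r, c) \<in> cells \<mu>" "r' \<le> r"
  case False
  then have "\<mu> ! r \<le> \<mu> ! r'" using a by (auto simp: cells_def integer_partition_def sorted_wrt_iff_nth_less)
  then show ?thesis using a by (auto simp: cells_def)
qed simp

lemma column_eq:
  assumes "integer_partition \<mu> k"
  shows "{r. (r, c) \<in> cells \<mu>} = {..<card {r. (r, c) \<in> cells \<mu>}}"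
proof -
  let ?D = "{r. (r, c) \<in> cells \<mu>}"
  have fin: "finite ?D" by (rule finite_subset[of _ "{..<length \<mu>}"]) (auto simp: cells_def)
  have sub: "{..<j} \<subseteq> ?D" if nsub: "\<not> ?D \<subseteq> {..<j}" for j
  proof -
    obtain r where "r \<in> ?D" "r \<notin> {..<j}" using nsub by blast
    then show ?thesis using column_down[OF assms, of r c] by auto
  qed
  show ?thesis
  proof (cases "?D \<subseteq> {..<card ?D}")
    case True then show ?thesis by (intro card_subset_eq) auto
  next
    case False
    then have "{..<card ?D} \<subseteq> ?D" using sub[of "card ?D"] by simp
    then show ?thesis using fin by (intro card_subset_eq[symmetric]) auto
  qed
qed

text \<open>If no two entries lie in a common row of \<open>u\<close> and a common column of \<open>t\<close>, comparing the sizes of the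
  first rows column by column shows that moving each entry of \<open>t\<close> vertically to its row in \<open>u\<close>
  stays inside the diagram.\<close>

lemma column_straightening:
  assumes ip: "integer_partition \<mu> k" and t: "t \<in> tableaux \<mu>" and u: "u \<in> tableaux \<mu>"
    and distinct: "\<And>x y x' y'. \<lbrakk>x \<in> cells \<mu>; y \<in> cells \<mu>; snd x = snd y; x' \<in> cells \<mu>; y' \<in> cells \<mu>; fst x' = fst y';
      t x = u x'; t y = u y'\<rbrakk> \<Longrightarrow> x = y"
  shows "\<exists>\<pi>\<in>column_stabilizer \<mu> t. tabloid_of \<mu> (\<pi> \<circ> t) = tabloid_of \<mu> u"
proof -
  let ?C = "cells \<mu>"
  \<comment> \<open>The cell of \<open>u\<close> that holds the entry \<open>t x\<close>.\<close>
  define \<phi> where "\<phi> = (\<lambda>x. inv_into ?C u (t x))"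
  have \<phi>: "bij_betw \<phi> ?C ?C" unfolding \<phi>_def
    using bij_betw_trans[OF tableauxD[OF t] bij_betw_inv_into[OF tableauxD[OF u]]] by (simp add: comp_def)
  have u\<phi>: "u (\<phi> x) = t x" if "x \<in> ?C" for x
    unfolding \<phi>_def using tableauxD[OF t] tableauxD[OF u] that by (metis bij_betw_apply bij_betw_inv_into_right)
  have \<phi>C: "\<phi> x \<in> ?C" if "x \<in> ?C" for x using \<phi> that by (rule bij_betw_apply)
  have inj\<rho>: "x = y" if "x \<in> ?C" "y \<in> ?C" "snd x = snd y" "fst (\<phi> x) = fst (\<phi> y)" for x y
    using distinct[OF that(1-3) \<phi>C[OF that(1)] \<phi>C[OF that(2)] that(4)] u\<phi> that by simp
  \<comment> \<open>The column is taken from \<open>t\<close> and the row from \<open>u\<close>; the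
    work is to see that this cell exists.\<close>
  define \<psi> where "\<psi> = (\<lambda>x. (fst (\<phi> x), snd x))"
  have \<psi>C: "\<psi> x \<in> ?C" if x: "x \<in> ?C" for x
  proof -
    let ?col = "\<lambda>c. {y \<in> ?C. snd y = c}"
    have card_col: "card (?col c) = card {r. (r, c) \<in> ?C}" for c
      by (rule bij_betw_same_card[of fst]) (auto simp: bij_betw_def inj_on_def image_iff)
    \<comment> \<open>The height of the column of \<open>x\<close>. Among the cells sent by
      \<open>\<phi>\<close> into the first \<open>R\<close> rows, each column has at most
      \<open>min R h\<close> members, \<open>h\<close> being its height, since rows are distinct
      within a column. The cells of the first \<open>R\<close> rows attain these bounds and have the
      same total, so equality holds columnwise, and the whole column of \<open>x\<close> goes into
      the first \<open>R\<close> rows.\<close>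
    define R where "R = card {r. (r, snd x) \<in> ?C}"
    let ?A = "{y \<in> ?C. fst (\<phi> y) < R}" and ?B = "{y \<in> ?C. fst y < R}"
    have AB: "card ?A = card ?B"
    proof (rule bij_betw_same_card[of \<phi>], rule bij_betw_imageI)
      show "inj_on \<phi> ?A" using \<phi> by (auto simp: bij_betw_def intro: inj_on_subset)
      show "\<phi> ` ?A = ?B"
      proof safe
        fix r c assume "(r, c) \<in> ?C" "fst (r, c) < R"
        moreover have "?C = \<phi> ` ?C" using \<phi> by (simp add: bij_betw_def)
        ultimately obtain y where "y \<in> ?C" "(r, c) = \<phi> y" by blast
        then show "(r, c) \<in> \<phi> ` ?A" using \<open>fst (r, c) < R\<close> by auto
      qed (use \<phi>C in auto)
    qed
    have cardB: "card (?B \<inter> ?col c) = min R (card (?col c))" for c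
    proof -
      have "card (?B \<inter> ?col c) = card ({..<R} \<inter> {r. (r, c) \<in> ?C})"
        by (rule bij_betw_same_card[of fst]) (force simp: bij_betw_def inj_on_def image_iff)
      also have "{r. (r, c) \<in> ?C} = {..<card {r. (r, c) \<in> ?C}}" by (rule column_eq[OF ip])
      also have "{..<R} \<inter> {..<card {r. (r, c) \<in> ?C}} = {..<min R (card {r. (r, c) \<in> ?C})}" by auto
      finally show ?thesis by (simp add: card_col)
    qed
    have cardA: "card (?A \<inter> ?col c) \<le> min R (card (?col c))" for c
    proof (intro min.boundedI)
      have "inj_on (\<lambda>y. fst (\<phi> y)) (?A \<inter> ?col c)" using inj\<rho> by (auto intro!: inj_onI)
      moreover have "(\<lambda>y. fst (\<phi> y)) ` (?A \<inter> ?col c) \<subseteq> {..<R}" by auto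
      ultimately show "card (?A \<inter> ?col c) \<le> R"         using card_inj_on_le[of "\<lambda>y. fst (\<phi> y)" "?A \<inter> ?col c" "{..<R}"] by simp
      show "card (?A \<inter> ?col c) \<le> card (?col c)" by (intro card_mono) auto
    qed
    have sum_cols: "card X = (\<Sum>c\<in>snd ` ?C. card (X \<inter> ?col c))" if "X \<subseteq> ?C" for X
    proof -
      have "finite X" using finite_subset[OF that] by simp
      then have "card X = (\<Sum>c\<in>snd ` ?C. card {y \<in> X. snd y = c})"
        using that by (intro sum.group[of X "snd ` ?C" snd "\<lambda>_. 1::nat", simplified, symmetric]) auto
      also have "\<dots> = (\<Sum>c\<in>snd ` ?C. card (X \<inter> ?col c))"
        using that by (intro sum.cong refl arg_cong[of _ _ card]) auto
      finally show ?thesis .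
    qed
    have "card (?A \<inter> ?col (snd x)) = card (?B \<inter> ?col (snd x))"
    proof (rule ccontr)
      assume "card (?A \<inter> ?col (snd x)) \<noteq> card (?B \<inter> ?col (snd x))"
      moreover have "card (?A \<inter> ?col (snd x)) \<le> card (?B \<inter> ?col (snd x))"
        using cardA[of "snd x"] by (simp only: cardB)
      ultimately have "card (?A \<inter> ?col (snd x)) < card (?B \<inter> ?col (snd x))" by (rule le_neq_implies_less[rotated])
      then have "(\<Sum>c\<in>snd ` ?C. card (?A \<inter> ?col c)) < (\<Sum>c\<in>snd ` ?C. card (?B \<inter> ?col c))"
        using x cardA cardB by (intro sum_strict_mono_ex1) (auto simp del: min.bounded_iff)
      then show False using AB sum_cols[of ?A] sum_cols[of ?B] by simp
    qed
    then have "card (?A \<inter> ?col (snd x)) = card (?col (snd x))" using cardB[of "snd x"] card_col[of "snd x"] by (simp add: R_def)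
    then have "?A \<inter> ?col (snd x) = ?col (snd x)" by (intro card_subset_eq) auto
    then have "fst (\<phi> x) < R" using x by blast
    then have "fst (\<phi> x) \<in> {..<card {r. (r, snd x) \<in> ?C}}" by (simp add: R_def)
    then have "fst (\<phi> x) \<in> {r. (r, snd x) \<in> ?C}" by (rule column_eq[OF ip, THEN equalityD2, THEN subsetD])
    then show ?thesis by (simp add: \<psi>_def)
  qed
  have "inj_on \<psi> ?C" using inj\<rho> by (auto simp: \<psi>_def intro!: inj_onI)
  moreover from this have "\<psi> ` ?C = ?C" using \<psi>C by (intro endo_inj_surj) auto
  ultimately have \<psi>: "bij_betw \<psi> ?C ?C" by (simp add: bij_betw_def)
  \<comment> \<open>Built so that \<open>\<pi> \<circ> t\<close> has the entry \<open>t x\<close> in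
    the cell \<open>\<psi> x\<close>, that is, in the row where \<open>u\<close> has it.\<close>
  define g where "g = (\<lambda>a. t (inv_into ?C \<psi> (inv_into ?C t a)))"
  define \<pi> where "\<pi> = (\<lambda>a. if a \<in> {1..sum_list \<mu>} then g a else a)"
  have "bij_betw g {1..sum_list \<mu>} {1..sum_list \<mu>}"
    using bij_betw_trans[OF bij_betw_trans[OF bij_betw_inv_into[OF tableauxD[OF t]] bij_betw_inv_into[OF \<psi>]] tableauxD[OF t]]
    by (simp add: g_def comp_def)
  then have "bij_betw \<pi> {1..sum_list \<mu>} {1..sum_list \<mu>}"
    by (subst bij_betw_cong[where g=g]) (auto simp: \<pi>_def)
  then have p: "\<pi> permutes {1..sum_list \<mu>}" by (rule bij_imp_permutes) (auto simp: \<pi>_def)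
  have \<pi>\<psi>: "\<pi> (t (\<psi> x)) = t x" if "x \<in> ?C" for x
  proof -
    have "t (\<psi> x) \<in> {1..sum_list \<mu>}" using \<psi>C[OF that] tableauxD[OF t] by (auto simp: bij_betw_def)
    then show ?thesis using that \<psi>C[OF that] bij_betw_inv_into_left[OF tableauxD[OF t]] bij_betw_inv_into_left[OF \<psi>]
      by (simp add: \<pi>_def g_def)
  qed
  have \<psi>on: "\<exists>x\<in>?C. y = \<psi> x" if "y \<in> ?C" for y using \<psi> that by (auto simp: bij_betw_def)
  have "\<exists>z\<in>?C. snd z = snd y \<and> \<pi> (t y) = t z" if y: "y \<in> ?C" for y
  proof -
    obtain x where "x \<in> ?C" "y = \<psi> x" using \<psi>on[OF y] by blast
    then show ?thesis using \<pi>\<psi>[of x] by (intro bexI[of _ x]) (auto simp: \<psi>_def)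
  qed
  then have "\<pi> \<in> column_stabilizer \<mu> t" unfolding column_stabilizer_iff[OF t p] by blast
  moreover have "tabloid_of \<mu> (\<pi> \<circ> t) = tabloid_of \<mu> u"
  proof
    fix r
    have "tabloid_of \<mu> (\<pi> \<circ> t) r = (\<pi> \<circ> t) ` \<psi> ` {x \<in> ?C. fst (\<phi> x) = r}"
    proof -
      have "{y \<in> ?C. fst y = r} = \<psi> ` {x \<in> ?C. fst (\<phi> x) = r}"
        using \<psi>on \<psi>C by (force simp: \<psi>_def)
      then show ?thesis by (simp add: tabloid_of_def)
    qed
    also have "\<dots> = u ` \<phi> ` {x \<in> ?C. fst (\<phi> x) = r}"
      unfolding image_image using \<pi>\<psi> u\<phi> by (intro image_cong) auto
    also have "\<phi> ` {x \<in> ?C. fst (\<phi> x) = r} = {y \<in> ?C. fst y = r}"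
    proof safe
      fix a b assume ab: "(a, b) \<in> ?C" "r = fst (a, b)"
      moreover have "?C = \<phi> ` ?C" using \<phi> by (simp add: bij_betw_def)
      ultimately obtain y where "y \<in> ?C" "(a, b) = \<phi> y" by blast
      then show "(a, b) \<in> \<phi> ` {x \<in> ?C. fst (\<phi> x) = fst (a, b)}" by force
    qed (use \<phi>C in auto)
    finally show "tabloid_of \<mu> (\<pi> \<circ> t) r = tabloid_of \<mu> u r" by (simp add: tabloid_of_def)
  qed
  ultimately show ?thesis by blast
qed

section \<open>Polytabloids under the symmetric group\<close>

lemma polytabloid_self:
  assumes "t \<in> tableaux \<mu>"
  shows "polytabloid \<mu> t (tabloid_of \<mu> t) = 1"
proof -
  have "polytabloid \<mu> t (tabloid_of \<mu> t) = (\<Sum>\<pi>\<in>column_stabilizer \<mu> t. if \<pi> = id then 1 else 0)"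
    unfolding polytabloid_def
    by (intro sum.cong refl) (auto simp: basis_vec_def sign_id dest: column_stabilizer_trivial[OF assms] sym)
  then show ?thesis by (simp add: finite_column_stabilizer id_column_stabilizer)
qed

text \<open>The restriction keeps the result extensional, as membership in \<open>tableaux\<close>
  demands.\<close>

definition move :: "nat list \<Rightarrow> (nat \<Rightarrow> nat) \<Rightarrow> (nat \<times> nat \<Rightarrow> nat) \<Rightarrow> (nat \<times> nat \<Rightarrow> nat)" where
  "move \<mu> \<sigma> t = restrict (\<sigma> \<circ> t) (cells \<mu>)"

lemma move_tableaux:
  assumes "t \<in> tableaux \<mu>" "\<sigma> permutes {1..sum_list \<mu>}"
  shows "move \<mu> \<sigma> t \<in> tableaux \<mu>"
proof -
  have "bij_betw (\<sigma> \<circ> t) (cells \<mu>) {1..sum_list \<mu>}"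
    using bij_betw_trans[OF tableauxD[OF assms(1)] permutes_imp_bij[OF assms(2)]] .
  then have "bij_betw (restrict (\<sigma> \<circ> t) (cells \<mu>)) (cells \<mu>) {1..sum_list \<mu>}"
    by (metis bij_betw_cong restrict_apply')
  then show ?thesis by (simp add: move_def tableaux_def)
qed

lemma vimage_eq_iff_image:
  assumes "\<sigma> permutes A"
  shows "\<sigma> -` X = Y \<longleftrightarrow> X = \<sigma> ` Y"
  using permutes_bij[OF assms] by (metis bij_def inj_vimage_image_eq surj_image_vimage_eq)

text \<open>Conjugation by \<open>\<sigma>\<close> carries the column stabilizer of \<open>t\<close>
  to that of the moved tableau and preserves signs. The preimage on the left is the action of
  \<open>\<sigma>\<close> on functions.\<close>

lemma polytabloid_move:
  assumes t: "t \<in> tableaux \<mu>" and \<sigma>: "\<sigma> permutes {1..sum_list \<mu>}"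
  shows "polytabloid \<mu> t (\<lambda>r. \<sigma> -` T r) = polytabloid \<mu> (move \<mu> \<sigma> t) T"
proof -
  note t' = move_tableaux[OF t \<sigma>]
  have \<sigma>i: "inv_into UNIV \<sigma> permutes {1..sum_list \<mu>}" using \<sigma> by (rule permutes_inv)
  have inv1: "\<sigma> \<circ> inv_into UNIV \<sigma> = id" "inv_into UNIV \<sigma> \<circ> \<sigma> = id" "inv_into UNIV \<sigma> (\<sigma> a) = a" "\<sigma> (inv_into UNIV \<sigma> a) = a" for a
    using permutes_inv_o[OF \<sigma>] permutes_inverses[OF \<sigma>] by auto
  have "polytabloid \<mu> (move \<mu> \<sigma> t) T =
     (\<Sum>\<pi>\<in>column_stabilizer \<mu> (move \<mu> \<sigma> t). of_int (sign \<pi>) * basis_vec (tabloid_of \<mu> (\<pi> \<circ> move \<mu> \<sigma> t)) T)"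
    by (simp add: polytabloid_def)
  also have "\<dots> = (\<Sum>\<pi>\<in>column_stabilizer \<mu> t. of_int (sign \<pi>) * basis_vec (tabloid_of \<mu> (\<pi> \<circ> t)) (\<lambda>r. \<sigma> -` T r))"
  proof (rule sum.reindex_bij_witness[of _ "\<lambda>\<pi>. \<sigma> \<circ> \<pi> \<circ> inv_into UNIV \<sigma>" "\<lambda>\<pi>. inv_into UNIV \<sigma> \<circ> \<pi> \<circ> \<sigma>"])
    fix \<pi> assume \<pi>: "\<pi> \<in> column_stabilizer \<mu> (move \<mu> \<sigma> t)"
    note p = column_stabilizer_permutes[OF \<pi>]
    show "\<sigma> \<circ> (inv_into UNIV \<sigma> \<circ> \<pi> \<circ> \<sigma>) \<circ> inv_into UNIV \<sigma> = \<pi>" by (simp add: fun_eq_iff inv1)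
    have p': "inv_into UNIV \<sigma> \<circ> \<pi> \<circ> \<sigma> permutes {1..sum_list \<mu>}" using permutes_compose[OF \<sigma> permutes_compose[OF p \<sigma>i]] by (simp add: comp_assoc)
    show "inv_into UNIV \<sigma> \<circ> \<pi> \<circ> \<sigma> \<in> column_stabilizer \<mu> t"
      unfolding column_stabilizer_iff[OF t p']
    proof
      fix x assume x: "x \<in> cells \<mu>"
      then obtain y where y: "y \<in> cells \<mu>" "snd y = snd x" "\<pi> (move \<mu> \<sigma> t x) = move \<mu> \<sigma> t y"
        using \<pi> unfolding column_stabilizer_iff[OF t' p] by blast
      then show "\<exists>y\<in>cells \<mu>. snd y = snd x \<and> (inv_into UNIV \<sigma> \<circ> \<pi> \<circ> \<sigma>) (t x) = t y"
        using x by (intro bexI[of _ y]) (auto simp: move_def inv1)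
    qed
    have "sign (inv_into UNIV \<sigma> \<circ> \<pi> \<circ> \<sigma>) = sign \<pi>"
    proof -
      have "permutation \<sigma>" "permutation \<pi>" "permutation (inv_into UNIV \<sigma>)"
        using \<sigma> \<sigma>i p by (auto simp: permutation_permutes)
      then have "sign (inv_into UNIV \<sigma> \<circ> \<pi> \<circ> \<sigma>) = sign \<sigma> * sign \<pi> * sign \<sigma>"
        by (simp add: sign_compose permutation_compose sign_inverse)
      then show ?thesis by (simp add: sign_def)
    qed
    moreover have "(\<lambda>r. \<sigma> -` T r) = tabloid_of \<mu> (inv_into UNIV \<sigma> \<circ> \<pi> \<circ> \<sigma> \<circ> t) \<longleftrightarrow> T = tabloid_of \<mu> (\<pi> \<circ> move \<mu> \<sigma> t)"
    proof -
      have "tabloid_of \<mu> (\<pi> \<circ> move \<mu> \<sigma> t) = tabloid_of \<mu> (\<sigma> \<circ> (inv_into UNIV \<sigma> \<circ> \<pi> \<circ> \<sigma> \<circ> t))"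
        by (rule tabloid_of_cong) (simp add: move_def inv1)
      then have e: "tabloid_of \<mu> (\<pi> \<circ> move \<mu> \<sigma> t) r = \<sigma> ` tabloid_of \<mu> (inv_into UNIV \<sigma> \<circ> \<pi> \<circ> \<sigma> \<circ> t) r" for r
        by (simp only: tabloid_of_comp[of \<mu> \<sigma>])
      have "(\<forall>r. \<sigma> -` T r = tabloid_of \<mu> (inv_into UNIV \<sigma> \<circ> \<pi> \<circ> \<sigma> \<circ> t) r) \<longleftrightarrow> (\<forall>r. T r = tabloid_of \<mu> (\<pi> \<circ> move \<mu> \<sigma> t) r)"
        unfolding e vimage_eq_iff_image[OF \<sigma>] ..
      then show ?thesis by (simp only: fun_eq_iff)
    qed
    ultimately show "of_int (sign (inv_into UNIV \<sigma> \<circ> \<pi> \<circ> \<sigma>)) * basis_vec (tabloid_of \<mu> (inv_into UNIV \<sigma> \<circ> \<pi> \<circ> \<sigma> \<circ> t)) (\<lambda>r. \<sigma> -` T r) =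
       of_int (sign \<pi>) * basis_vec (tabloid_of \<mu> (\<pi> \<circ> move \<mu> \<sigma> t)) T"
      by (simp add: basis_vec_def)
  next
    fix \<pi> assume \<pi>: "\<pi> \<in> column_stabilizer \<mu> t"
    note p = column_stabilizer_permutes[OF \<pi>]
    show "inv_into UNIV \<sigma> \<circ> (\<sigma> \<circ> \<pi> \<circ> inv_into UNIV \<sigma>) \<circ> \<sigma> = \<pi>" by (simp add: fun_eq_iff inv1)
    have p': "\<sigma> \<circ> \<pi> \<circ> inv_into UNIV \<sigma> permutes {1..sum_list \<mu>}" using permutes_compose[OF \<sigma>i permutes_compose[OF p \<sigma>]] by (simp add: comp_assoc)
    show "\<sigma> \<circ> \<pi> \<circ> inv_into UNIV \<sigma> \<in> column_stabilizer \<mu> (move \<mu> \<sigma> t)"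
      unfolding column_stabilizer_iff[OF t' p']
    proof
      fix x assume x: "x \<in> cells \<mu>"
      then obtain y where y: "y \<in> cells \<mu>" "snd y = snd x" "\<pi> (t x) = t y"
        using \<pi> unfolding column_stabilizer_iff[OF t p] by blast
      then show "\<exists>y\<in>cells \<mu>. snd y = snd x \<and> (\<sigma> \<circ> \<pi> \<circ> inv_into UNIV \<sigma>) (move \<mu> \<sigma> t x) = move \<mu> \<sigma> t y"
        using x by (intro bexI[of _ y]) (auto simp: move_def inv1)
    qed
  qed
  finally show ?thesis by (simp add: polytabloid_def)
qed

subsection \<open>Irreducibility of outer products of Specht modules\<close>

text \<open>Coefficients are attached to indices in \<open>A\<close>, where \<open>g\<close> may
  repeat values: one inclusion picks a preimage of each vector, the other adds up coefficients over
  the fibres.\<close>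

lemma cspan_image_finite:
  assumes "finite A"
  shows "cspan (g ` A) = {\<lambda>x. \<Sum>a\<in>A. c a * g a x | c. True}"
proof
  show "cspan (g ` A) \<subseteq> {\<lambda>x. \<Sum>a\<in>A. c a * g a x | c. True}"
  proof
    fix h assume "h \<in> cspan (g ` A)"
    then obtain F c where h: "finite F" "F \<subseteq> g ` A" "h = (\<lambda>x. \<Sum>f\<in>F. c f * f x)" by (auto simp: cspan_def)
    define B where "B = inv_into A g ` F"
    have BA: "B \<subseteq> A" using h(2) by (auto simp: B_def intro: inv_into_into)
    have "h x = (\<Sum>a\<in>A. (if a \<in> B then c (g a) else 0) * g a x)" for x
    proof -
      have "(\<Sum>a\<in>A. (if a \<in> B then c (g a) else 0) * g a x) = (\<Sum>a\<in>B. c (g a) * g a x)"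
        using BA assms by (intro sum.mono_neutral_cong_right) auto
      also have "\<dots> = (\<Sum>f\<in>F. c (g (inv_into A g f)) * g (inv_into A g f) x)"
        unfolding B_def by (rule sum.reindex[OF inj_on_inv_into[OF h(2)], unfolded comp_def])
      also have "\<dots> = h x"
      proof -
        have "g (inv_into A g f) = f" if "f \<in> F" for f using f_inv_into_f[of f g A] h(2) that by blast
        then show ?thesis unfolding h(3) by (intro sum.cong refl) simp
      qed
      finally show ?thesis by simp
    qed
    then have "h = (\<lambda>x. \<Sum>a\<in>A. (if a \<in> B then c (g a) else 0) * g a x)" by (rule ext)
    then show "h \<in> {\<lambda>x. \<Sum>a\<in>A. c a * g a x | c. True}"
      by (intro CollectI exI[of _ "\<lambda>a. if a \<in> B then c (g a) else 0"] conjI TrueI)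
  qed
  show "{\<lambda>x. \<Sum>a\<in>A. c a * g a x | c. True} \<subseteq> cspan (g ` A)"
  proof safe
    fix c
    have "(\<Sum>a\<in>A. c a * g a x) = (\<Sum>f\<in>g ` A. (\<Sum>a\<in>{a \<in> A. g a = f}. c a) * f x)" for x
    proof -
      have "(\<Sum>a\<in>A. c a * g a x) = (\<Sum>f\<in>g ` A. \<Sum>a\<in>{a \<in> A. g a = f}. c a * g a x)"
        by (rule sum.image_gen[OF assms])
      also have "\<dots> = (\<Sum>f\<in>g ` A. (\<Sum>a\<in>{a \<in> A. g a = f}. c a) * f x)"
        by (intro sum.cong refl) (simp add: sum_distrib_right)
      finally show ?thesis .
    qed
    then show "(\<lambda>x. \<Sum>a\<in>A. c a * g a x) \<in> cspan (g ` A)"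
      unfolding cspan_def using assms
      by (intro CollectI exI[of _ "g ` A"] exI[of _ "\<lambda>f. \<Sum>a\<in>{a \<in> A. g a = f}. c a"]) auto
  qed
qed

lemma cspan_mono: "A \<subseteq> B \<Longrightarrow> cspan A \<subseteq> cspan B"
  unfolding cspan_def by blast

context
  fixes l :: nat and m :: "nat \<Rightarrow> nat" and \<mu> :: "nat \<Rightarrow> nat list"
  assumes ip: "\<And>i. i \<in> {1..l} \<Longrightarrow> integer_partition (\<mu> i) (m i)"
begin

abbreviation "SG \<equiv> carrier (sym_product l m)"

definition "tableau_tuples = (\<Pi>\<^sub>E i\<in>{1..l}. tableaux (\<mu> i))"
definition "E t = (\<lambda>T. \<Prod>i=1..l. polytabloid (\<mu> i) (t i) (T i))"
definition "column_group t = (\<Pi>\<^sub>E i\<in>{1..l}. column_stabilizer (\<mu> i) (t i))"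
definition "tab t = (\<lambda>i. tabloid_of (\<mu> i) (t i))"
definition "sg \<pi> = (\<Prod>i=1..l. of_int (sign (\<pi> i)) :: complex)"
text \<open>The signed column sum known as \<kappa>_t in the theory of Specht modules, acting on
  functions of tabloid tuples.\<close>

definition "antisymmetrise t f = (\<lambda>T. \<Sum>\<pi>\<in>column_group t. sg \<pi> * f (\<lambda>i r. \<pi> i -` T i r))"
text \<open>Finitely many tuples, extensional outside \<open>{1..l}\<close>, on which the standard
  inner product of two functions is a finite sum.\<close>

definition "TB = (\<Pi>\<^sub>E i\<in>{1..l}. tabloid_of (\<mu> i) ` tableaux (\<mu> i))"
text \<open>Elements of the outer module are functions on all of
  \<open>nat \<Rightarrow> tabloid\<close>; this property allows the coordinates outside
  \<open>{1..l}\<close> to be changed at will.\<close>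

definition "local_fun f \<longleftrightarrow> (\<forall>T T'. (\<forall>i\<in>{1..l}. T i = T' i) \<longrightarrow> f T = f T')"
definition "SP = {\<lambda>T. \<Sum>t\<in>tableau_tuples. c t * E t T | c. True}"

lemma SP_I: "(\<And>T. f T = (\<Sum>t\<in>tableau_tuples. c t * E t T)) \<Longrightarrow> f \<in> SP"
  unfolding SP_def by (intro CollectI exI[of _ c] conjI TrueI ext)

lemma SP_E: "f \<in> SP \<Longrightarrow> (\<And>c. (\<And>T. f T = (\<Sum>t\<in>tableau_tuples. c t * E t T)) \<Longrightarrow> P) \<Longrightarrow> P"
  unfolding SP_def by blast

lemma sum_list_\<mu>: "i \<in> {1..l} \<Longrightarrow> sum_list (\<mu> i) = m i"
  using ip by (simp add: integer_partition_def)

lemma SG_iff: "\<sigma> \<in> SG \<longleftrightarrow> \<sigma> \<in> (\<Pi>\<^sub>E i\<in>{1..l}. {p. p permutes {1..m i}})"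
  by (simp add: sym_product_def sym_group_def)

lemma finite_SG: "finite SG"
  unfolding sym_product_def by (simp add: sym_group_def finite_permutations finite_PiE)

lemma finite_tableau_tuples: "finite tableau_tuples"
  unfolding tableau_tuples_def by (intro finite_PiE finite_tableaux) simp

lemma tableau_tuples_nonempty: "tableau_tuples \<noteq> {}"
  unfolding tableau_tuples_def using tableaux_nonempty by (auto simp: PiE_eq_empty_iff)

lemma tableau_tuples_mem: "t \<in> tableau_tuples \<Longrightarrow> i \<in> {1..l} \<Longrightarrow> t i \<in> tableaux (\<mu> i)"
  by (auto simp: tableau_tuples_def)

lemma column_group_SG: "column_group t \<subseteq> SG"
  unfolding column_group_def using column_stabilizer_permutes[of _ "\<mu> _" "t _"] sum_list_\<mu>
  by (fastforce simp: SG_iff PiE_iff)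

text \<open>A pure tensor of linear combinations is multiplied out by \<open>prod_sum_PiE\<close>
  into products of polytabloids, so these finitely many products span the module.\<close>

lemma carrier_outer: "carrier (outer_specht l m \<mu>) = SP"
proof -
  let ?G = "{\<lambda>T. \<Prod>i=1..l. f i (T i) | f. \<forall>i\<in>{1..l}. f i \<in> specht (\<mu> i)}"
  have gen: "g \<in> SP" if "g \<in> ?G" for g
  proof -
    obtain f where f: "g = (\<lambda>T. \<Prod>i=1..l. f i (T i))" "\<forall>i\<in>{1..l}. f i \<in> specht (\<mu> i)"
      using \<open>g \<in> ?G\<close> by blast
    have "\<forall>i\<in>{1..l}. \<exists>c. f i = (\<lambda>T. \<Sum>t\<in>tableaux (\<mu> i). c t * polytabloid (\<mu> i) t T)"
      using f(2) unfolding specht_def cspan_image_finite[OF finite_tableaux] by blast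
    then obtain c where c: "\<And>i. i \<in> {1..l} \<Longrightarrow> f i = (\<lambda>T. \<Sum>t\<in>tableaux (\<mu> i). c i t * polytabloid (\<mu> i) t T)"
      by metis
    have "g T = (\<Sum>t\<in>tableau_tuples. (\<Prod>i=1..l. c i (t i)) * E t T)" for T
    proof -
      have "g T = (\<Prod>i=1..l. \<Sum>t\<in>tableaux (\<mu> i). c i t * polytabloid (\<mu> i) t (T i))"
        unfolding f(1) by (intro prod.cong refl) (simp add: c)
      also have "\<dots> = (\<Sum>t\<in>tableau_tuples. \<Prod>i=1..l. c i (t i) * polytabloid (\<mu> i) (t i) (T i))"
        unfolding tableau_tuples_def by (intro prod_sum_PiE finite_tableaux) simp
      finally show ?thesis by (simp add: E_def prod.distrib)
    qed
    then show ?thesis by (rule SP_I)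
  qed
  have "cspan ?G \<subseteq> SP"
  proof
    fix h assume "h \<in> cspan ?G"
    then obtain F c where h: "finite F" "F \<subseteq> ?G" "h = (\<lambda>x. \<Sum>f\<in>F. c f * f x)" unfolding cspan_def by blast
    have "\<exists>d. \<forall>T. f T = (\<Sum>t\<in>tableau_tuples. d t * E t T)" if "f \<in> F" for f
    proof -
      have "f \<in> SP" by (rule gen) (rule subsetD[OF h(2) that])
      then show ?thesis by (elim SP_E) blast
    qed
    then obtain d where d: "\<And>f T. f \<in> F \<Longrightarrow> f T = (\<Sum>t\<in>tableau_tuples. d f t * E t T)" by metis
    have "h T = (\<Sum>t\<in>tableau_tuples. (\<Sum>f\<in>F. c f * d f t) * E t T)" for T
    proof -
      have "h T = (\<Sum>f\<in>F. c f * (\<Sum>t\<in>tableau_tuples. d f t * E t T))"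
        unfolding h(3) by (intro sum.cong refl) (simp only: d)
      also have "\<dots> = (\<Sum>f\<in>F. \<Sum>t\<in>tableau_tuples. c f * d f t * E t T)" by (simp add: sum_distrib_left mult.assoc)
      also have "\<dots> = (\<Sum>t\<in>tableau_tuples. \<Sum>f\<in>F. c f * d f t * E t T)" by (rule sum.swap)
      finally show ?thesis by (simp add: sum_distrib_right)
    qed
    then show "h \<in> SP" by (rule SP_I)
  qed
  moreover have "SP \<subseteq> cspan ?G"
  proof -
    have "polytabloid (\<mu> i) (t i) \<in> specht (\<mu> i)" if "t \<in> tableau_tuples" "i \<in> {1..l}" for t i
    proof -
      have "polytabloid (\<mu> i) (t i) = (\<lambda>T. \<Sum>u\<in>tableaux (\<mu> i). (if u = t i then 1 else 0) * polytabloid (\<mu> i) u T)"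
      proof
        fix T
        have "(\<Sum>u\<in>tableaux (\<mu> i). (if u = t i then 1 else 0) * polytabloid (\<mu> i) u T) =
           (\<Sum>u\<in>tableaux (\<mu> i). if u = t i then polytabloid (\<mu> i) u T else 0)" by (intro sum.cong) auto
        then show "polytabloid (\<mu> i) (t i) T = (\<Sum>u\<in>tableaux (\<mu> i). (if u = t i then 1 else 0) * polytabloid (\<mu> i) u T)"
          using tableau_tuples_mem[OF that] by (simp add: finite_tableaux)
      qed
      then show ?thesis unfolding specht_def cspan_image_finite[OF finite_tableaux]
        by (intro CollectI exI[of _ "\<lambda>u. if u = t i then 1 else 0"] conjI TrueI)
    qed
    then have "E t \<in> ?G" if "t \<in> tableau_tuples" for t
      unfolding E_def using that by (intro CollectI exI[of _ "\<lambda>i. polytabloid (\<mu> i) (t i)"]) auto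
    then have "E ` tableau_tuples \<subseteq> ?G" by (rule image_subsetI)
    then show ?thesis using cspan_mono[of "E ` tableau_tuples" ?G] unfolding cspan_image_finite[OF finite_tableau_tuples] SP_def by blast
  qed
  ultimately show ?thesis by (simp add: outer_specht_def)
qed

lemma SP_add: "f \<in> SP \<Longrightarrow> g \<in> SP \<Longrightarrow> (\<lambda>T. f T + g T) \<in> SP"
proof -
  assume "f \<in> SP" "g \<in> SP"
  then obtain c d where "\<And>T. f T = (\<Sum>t\<in>tableau_tuples. c t * E t T)" "\<And>T. g T = (\<Sum>t\<in>tableau_tuples. d t * E t T)"
    by (elim SP_E) blast
  then show ?thesis by (intro SP_I[of _ "\<lambda>t. c t + d t"]) (simp add: distrib_right sum.distrib)
qed

lemma SP_scale: "f \<in> SP \<Longrightarrow> (\<lambda>T. a * f T) \<in> SP"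
proof -
  assume "f \<in> SP"
  then obtain c where "\<And>T. f T = (\<Sum>t\<in>tableau_tuples. c t * E t T)" by (elim SP_E) blast
  then show ?thesis by (intro SP_I[of _ "\<lambda>t. a * c t"]) (simp add: sum_distrib_left mult.assoc)
qed

lemma SP_zero: "(\<lambda>_. 0) \<in> SP"
  by (rule SP_I[of _ "\<lambda>_. 0"]) simp

lemma SP_sum: "finite A \<Longrightarrow> (\<And>a. a \<in> A \<Longrightarrow> f a \<in> SP) \<Longrightarrow> (\<lambda>T. \<Sum>a\<in>A. f a T) \<in> SP"
  by (induction A rule: finite_induct) (auto simp: SP_zero intro!: SP_add)

lemma E_SP: "t \<in> tableau_tuples \<Longrightarrow> E t \<in> SP"
proof -
  assume t: "t \<in> tableau_tuples"
  have "E t T = (\<Sum>u\<in>tableau_tuples. (if u = t then 1 else 0) * E u T)" for T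
  proof -
    have "(\<Sum>u\<in>tableau_tuples. (if u = t then 1 else 0) * E u T) = (\<Sum>u\<in>tableau_tuples. if u = t then E u T else 0)" by (intro sum.cong) auto
    then show ?thesis using t by (simp add: finite_tableau_tuples)
  qed
  then show ?thesis by (rule SP_I)
qed

lemma local_E: "local_fun (E t)"
  unfolding local_fun_def E_def by (auto intro!: prod.cong)

lemma local_SP: "f \<in> SP \<Longrightarrow> local_fun f"
  using local_E unfolding SP_def local_fun_def by (auto intro!: sum.cong)

lemma local_funD: "local_fun f \<Longrightarrow> (\<And>i. i \<in> {1..l} \<Longrightarrow> T i = T' i) \<Longrightarrow> f T = f T'"
  unfolding local_fun_def by blast

lemma E_move:
  assumes t: "t \<in> tableau_tuples" and \<sigma>: "\<sigma> \<in> SG"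
  shows "(\<lambda>i\<in>{1..l}. move (\<mu> i) (\<sigma> i) (t i)) \<in> tableau_tuples"
    and "E t (\<lambda>i r. \<sigma> i -` T i r) = E (\<lambda>i\<in>{1..l}. move (\<mu> i) (\<sigma> i) (t i)) T"
proof -
  have p: "\<sigma> i permutes {1..sum_list (\<mu> i)}" if "i \<in> {1..l}" for i
    using \<sigma> that sum_list_\<mu>[OF that] by (auto simp: SG_iff)
  show "(\<lambda>i\<in>{1..l}. move (\<mu> i) (\<sigma> i) (t i)) \<in> tableau_tuples"
    unfolding tableau_tuples_def using move_tableaux[OF tableau_tuples_mem[OF t] p] by auto
  show "E t (\<lambda>i r. \<sigma> i -` T i r) = E (\<lambda>i\<in>{1..l}. move (\<mu> i) (\<sigma> i) (t i)) T"
    unfolding E_def using polytabloid_move[OF tableau_tuples_mem[OF t] p] by (intro prod.cong) auto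
qed

lemma SP_act:
  assumes "f \<in> SP" "\<sigma> \<in> SG"
  shows "(\<lambda>T. f (\<lambda>i r. \<sigma> i -` T i r)) \<in> SP"
proof -
  obtain c where f: "f = (\<lambda>T. \<Sum>t\<in>tableau_tuples. c t * E t T)" using assms(1) unfolding SP_def by blast
  have "(\<lambda>T. \<Sum>t\<in>tableau_tuples. c t * E (\<lambda>i\<in>{1..l}. move (\<mu> i) (\<sigma> i) (t i)) T) \<in> SP"
    by (intro SP_sum SP_scale E_SP E_move assms(2) finite_tableau_tuples)
  then show ?thesis unfolding f by (simp add: E_move(2)[OF _ assms(2)])
qed

lemma SP_smult:
  assumes "f \<in> SP"
  shows "(\<lambda>T. \<Sum>\<sigma>\<in>SG. \<alpha> \<sigma> * f (\<lambda>i r. \<sigma> i -` T i r)) \<in> SP"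
  by (intro SP_sum SP_scale SP_act assms finite_SG)

lemma support_E:
  assumes "t \<in> tableau_tuples" "i \<in> {1..l}" "T i \<notin> tabloid_of (\<mu> i) ` tableaux (\<mu> i)"
  shows "E t T = 0"
proof -
  have "T i \<noteq> tabloid_of (\<mu> i) (\<pi> \<circ> t i)" if "\<pi> \<in> column_stabilizer (\<mu> i) (t i)" for \<pi>
  proof -
    have "tabloid_of (\<mu> i) (\<pi> \<circ> t i) = tabloid_of (\<mu> i) (move (\<mu> i) \<pi> (t i))"
      by (rule tabloid_of_cong) (simp add: move_def)
    moreover have "move (\<mu> i) \<pi> (t i) \<in> tableaux (\<mu> i)"
      by (rule move_tableaux[OF tableau_tuples_mem[OF assms(1,2)] column_stabilizer_permutes[OF that]])
    ultimately show ?thesis using assms(3) by (metis imageI)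
  qed
  then have "polytabloid (\<mu> i) (t i) (T i) = 0"
    unfolding polytabloid_def basis_vec_def by (intro sum.neutral ballI) simp
  then show ?thesis unfolding E_def using assms(2) by (intro prod_zero) auto
qed

lemma support_SP:
  assumes "f \<in> SP" "i \<in> {1..l}" "T i \<notin> tabloid_of (\<mu> i) ` tableaux (\<mu> i)"
  shows "f T = 0"
  using assms(1) support_E[where i=i and T=T] assms(2,3) unfolding SP_def by (auto intro!: sum.neutral)

section \<open>Signed column sums\<close>

lemma column_group_mem: "\<pi> \<in> column_group t \<Longrightarrow> i \<in> {1..l} \<Longrightarrow> \<pi> i \<in> column_stabilizer (\<mu> i) (t i)"
  by (auto simp: column_group_def)

lemma sg_comp:
  assumes "\<rho> \<in> column_group t" "\<pi> \<in> column_group t"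
  shows "sg (\<lambda>i\<in>{1..l}. \<rho> i \<circ> \<pi> i) = sg \<rho> * sg \<pi>"
proof -
  have "sign (\<rho> i \<circ> \<pi> i) = sign (\<rho> i) * sign (\<pi> i)" if "i \<in> {1..l}" for i
    using column_stabilizer_permutes[OF column_group_mem[OF assms(1) that]] column_stabilizer_permutes[OF column_group_mem[OF assms(2) that]]
    by (intro sign_compose) (auto simp: permutation_permutes)
  then have "sg (\<lambda>i\<in>{1..l}. \<rho> i \<circ> \<pi> i) = (\<Prod>i=1..l. of_int (sign (\<rho> i)) * of_int (sign (\<pi> i)))"
    unfolding sg_def by (intro prod.cong) auto
  then show ?thesis by (simp add: sg_def prod.distrib)
qed

lemma column_group_inv: "\<rho> \<in> column_group t \<Longrightarrow> (\<lambda>i\<in>{1..l}. inv_into UNIV (\<rho> i)) \<in> column_group t"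
  unfolding column_group_def by (auto intro!: column_stabilizer_inv)

lemma column_group_comp: "\<rho> \<in> column_group t \<Longrightarrow> \<pi> \<in> column_group t \<Longrightarrow> (\<lambda>i\<in>{1..l}. \<rho> i \<circ> \<pi> i) \<in> column_group t"
  unfolding column_group_def by (auto intro!: column_stabilizer_comp simp: PiE_iff)

lemma column_group_inverses:
  assumes "\<rho> \<in> column_group t" "i \<in> {1..l}"
  shows "inv_into UNIV (\<rho> i) (\<rho> i a) = a" "\<rho> i (inv_into UNIV (\<rho> i) a) = a"
  using permutes_inverses[OF column_stabilizer_permutes[OF column_group_mem[OF assms]]] by auto

lemma column_group_ext: "\<pi> \<in> column_group t \<Longrightarrow> \<pi> \<in> extensional {1..l}"
  by (auto simp: column_group_def PiE_iff)

text \<open>Substitute \<rho> times \<pi> for \<pi> in the sum over the column group; only the sign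
  of \<rho> comes out.\<close>

lemma antisymmetrise_shift:
  assumes f: "local_fun f" and \<rho>: "\<rho> \<in> column_group t"
  shows "antisymmetrise t f (\<lambda>i r. \<rho> i ` T i r) = sg \<rho> * antisymmetrise t f T"
proof -
  have "antisymmetrise t f (\<lambda>i r. \<rho> i ` T i r) = (\<Sum>\<pi>\<in>column_group t. sg \<pi> * f (\<lambda>i r. \<pi> i -` \<rho> i ` T i r))"
    by (simp add: antisymmetrise_def)
  also have "\<dots> = (\<Sum>\<pi>\<in>column_group t. sg \<rho> * sg \<pi> * f (\<lambda>i r. \<pi> i -` T i r))"
  proof (rule sum.reindex_bij_witness[of _ "\<lambda>\<pi>. \<lambda>i\<in>{1..l}. \<rho> i \<circ> \<pi> i" "\<lambda>\<pi>. \<lambda>i\<in>{1..l}. (\<lambda>i\<in>{1..l}. inv_into UNIV (\<rho> i)) i \<circ> \<pi> i"])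
    fix \<pi> assume \<pi>: "\<pi> \<in> column_group t"
    let ?\<rho>' = "\<lambda>i\<in>{1..l}. inv_into UNIV (\<rho> i)"
    let ?\<pi>' = "\<lambda>i\<in>{1..l}. ?\<rho>' i \<circ> \<pi> i"
    show 1: "(\<lambda>i\<in>{1..l}. \<rho> i \<circ> ?\<pi>' i) = \<pi>"
      by (rule extensionalityI[of _ "{1..l}"]) (use column_group_ext[OF \<pi>] column_group_inverses[OF \<rho>] in \<open>auto simp: fun_eq_iff\<close>)
    show \<pi>': "?\<pi>' \<in> column_group t" by (rule column_group_comp[OF column_group_inv[OF \<rho>] \<pi>])
    have "sg \<pi> = sg \<rho> * sg ?\<pi>'" using sg_comp[OF \<rho> \<pi>'] unfolding 1 .
    moreover have "f (\<lambda>i r. ?\<pi>' i -` T i r) = f (\<lambda>i r. \<pi> i -` \<rho> i ` T i r)"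
    proof (rule local_funD[OF f], rule ext)
      fix i r assume i: "i \<in> {1..l}"
      have eqv: "\<pi> i x \<in> \<rho> i ` T i r \<longleftrightarrow> inv_into UNIV (\<rho> i) (\<pi> i x) \<in> T i r" for x
        using column_group_inverses[OF \<rho> i] by (metis image_iff)
      show "?\<pi>' i -` T i r = \<pi> i -` \<rho> i ` T i r" using i by (simp add: vimage_def eqv)
    qed
    ultimately show "sg \<rho> * sg ?\<pi>' * f (\<lambda>i r. ?\<pi>' i -` T i r) = sg \<pi> * f (\<lambda>i r. \<pi> i -` \<rho> i ` T i r)" by simp
  next
    fix \<pi> assume \<pi>: "\<pi> \<in> column_group t"
    let ?\<rho>' = "\<lambda>i\<in>{1..l}. inv_into UNIV (\<rho> i)"
    show "(\<lambda>i\<in>{1..l}. \<rho> i \<circ> \<pi> i) \<in> column_group t" by (rule column_group_comp[OF \<rho> \<pi>])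
    show "(\<lambda>i\<in>{1..l}. ?\<rho>' i \<circ> (\<lambda>i\<in>{1..l}. \<rho> i \<circ> \<pi> i) i) = \<pi>"
      by (rule extensionalityI[of _ "{1..l}"]) (use column_group_ext[OF \<pi>] column_group_inverses[OF \<rho>] in \<open>auto simp: fun_eq_iff\<close>)
  qed
  finally show ?thesis by (simp add: antisymmetrise_def sum_distrib_left mult.assoc)
qed

lemma local_antisymmetrise: "local_fun f \<Longrightarrow> local_fun (antisymmetrise t f)"
  unfolding local_fun_def antisymmetrise_def by (auto intro!: sum.cong)

text \<open>Presenting \<open>E t\<close> as the signed column sum of the indicator of
  \<open>tab t\<close> lets each fact about \<open>antisymmetrise\<close> be applied to
  \<open>E t\<close> as well.\<close>

lemma E_antisymmetrise: "E t T = antisymmetrise t (\<lambda>T. if \<forall>i\<in>{1..l}. T i = tab t i then 1 else 0) T"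
proof -
  have "E t T = (\<Sum>\<pi>\<in>column_group t. \<Prod>i=1..l. of_int (sign (\<pi> i)) * basis_vec (tabloid_of (\<mu> i) (\<pi> i \<circ> t i)) (T i))"
    unfolding E_def polytabloid_def column_group_def by (intro prod_sum_PiE finite_column_stabilizer) simp
  also have "\<dots> = (\<Sum>\<pi>\<in>column_group t. sg \<pi> * (if \<forall>i\<in>{1..l}. (\<lambda>r. \<pi> i -` T i r) = tab t i then 1 else 0))"
  proof (rule sum.cong[OF refl])
    fix \<pi> assume \<pi>: "\<pi> \<in> column_group t"
    have "T i = tabloid_of (\<mu> i) (\<pi> i \<circ> t i) \<longleftrightarrow> (\<lambda>r. \<pi> i -` T i r) = tab t i" if "i \<in> {1..l}" for i
      unfolding tabloid_of_comp tab_def fun_eq_iff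
        vimage_eq_iff_image[OF column_stabilizer_permutes[OF column_group_mem[OF \<pi> that]]] ..
    then have "(\<Prod>i=1..l. basis_vec (tabloid_of (\<mu> i) (\<pi> i \<circ> t i)) (T i)) =
       (\<Prod>i=1..l. if (\<lambda>r. \<pi> i -` T i r) = tab t i then 1 else 0)"
      by (intro prod.cong refl) (simp add: basis_vec_def)
    also have "\<dots> = (if \<forall>i\<in>{1..l}. (\<lambda>r. \<pi> i -` T i r) = tab t i then 1 else 0)"
      by auto
    finally show "(\<Prod>i=1..l. of_int (sign (\<pi> i)) * basis_vec (tabloid_of (\<mu> i) (\<pi> i \<circ> t i)) (T i)) =
        sg \<pi> * (if \<forall>i\<in>{1..l}. (\<lambda>r. \<pi> i -` T i r) = tab t i then 1 else 0)"
      by (simp only: prod.distrib sg_def)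
  qed
  finally show ?thesis by (simp add: antisymmetrise_def)
qed

lemma E_self: "t \<in> tableau_tuples \<Longrightarrow> E t (tab t) = 1"
  unfolding E_def tab_def using polytabloid_self[OF tableau_tuples_mem] by (intro prod.neutral) auto

text \<open>The transposition of the two entries belongs to the column group, fixes the tuple
  \<open>T\<close> and has sign -1, so the value equals its own negative.\<close>

lemma antisymmetrise_bad:
  assumes f: "local_fun f" and t: "t \<in> tableau_tuples" and i: "i \<in> {1..l}"
    and x: "x \<in> cells (\<mu> i)" and y: "y \<in> cells (\<mu> i)" and xy: "snd x = snd y" "x \<noteq> y"
    and row: "\<And>r. t i x \<in> T i r \<longleftrightarrow> t i y \<in> T i r"
  shows "antisymmetrise t f T = 0"
proof -
  let ?a = "t i x" and ?b = "t i y"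
  let ?\<tau> = "transpose ?a ?b"
  define \<rho> where "\<rho> = (\<lambda>j\<in>{1..l}. if j = i then ?\<tau> else id)"
  note ti = tableau_tuples_mem[OF t i]
  have ab: "?a \<in> {1..sum_list (\<mu> i)}" "?b \<in> {1..sum_list (\<mu> i)}"
    using tableauxD[OF ti] x y by (auto simp: bij_betw_def)
  have ne: "?a \<noteq> ?b" using tableaux_inj[OF ti x y] xy by blast
  have p: "?\<tau> permutes {1..sum_list (\<mu> i)}" by (rule permutes_swap_id[OF ab])
  have "\<exists>z'\<in>cells (\<mu> i). snd z' = snd z \<and> ?\<tau> (t i z) = t i z'" if "z \<in> cells (\<mu> i)" for z
    using that x y xy tableaux_inj[OF ti that x] tableaux_inj[OF ti that y]
    by (cases "z = x"; cases "z = y") (auto simp: transpose_def)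
  then have "?\<tau> \<in> column_stabilizer (\<mu> i) (t i)" unfolding column_stabilizer_iff[OF ti p] by blast
  then have \<rho>: "\<rho> \<in> column_group t" unfolding column_group_def \<rho>_def by (auto simp: id_column_stabilizer)
  have "sg \<rho> = (\<Prod>j=1..l. if j = i then -1 else 1)"
    unfolding sg_def \<rho>_def using ne by (intro prod.cong) (auto simp: sign_swap_id sign_id)
  then have sg: "sg \<rho> = -1" using i by simp
  have "antisymmetrise t f T = antisymmetrise t f (\<lambda>j r. \<rho> j ` T j r)"
  proof (rule local_funD[OF local_antisymmetrise[OF f]], rule ext)
    fix j r assume "j \<in> {1..l}"
    moreover have "?\<tau> ` T i r = T i r" using row[of r] by (auto simp: transpose_def image_iff)
    ultimately show "T j r = \<rho> j ` T j r" by (simp add: \<rho>_def)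
  qed
  also have "\<dots> = - antisymmetrise t f T" using antisymmetrise_shift[OF f \<rho>] sg by simp
  finally show ?thesis by simp
qed

text \<open>By column straightening a tuple of tabloids either lies in the column orbit of
  \<open>tab t\<close>, where both sides change by the same sign, or in some factor has two entries
  in one row of the tuple and one column of \<open>t\<close>, where both sides vanish. On tuples
  that are not tabloids both vanish by support.\<close>

lemma antisymmetrise_eq:
  assumes f: "local_fun f" and supp: "\<And>i T. i \<in> {1..l} \<Longrightarrow> T i \<notin> tabloid_of (\<mu> i) ` tableaux (\<mu> i) \<Longrightarrow> f T = 0"
    and t: "t \<in> tableau_tuples"
  shows "antisymmetrise t f T = antisymmetrise t f (tab t) * E t T"
proof (cases "\<forall>i\<in>{1..l}. T i \<in> tabloid_of (\<mu> i) ` tableaux (\<mu> i)")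
  case False
  then obtain i where i: "i \<in> {1..l}" "T i \<notin> tabloid_of (\<mu> i) ` tableaux (\<mu> i)" by blast
  have "f (\<lambda>i r. \<pi> i -` T i r) = 0" if \<pi>: "\<pi> \<in> column_group t" for \<pi>
  proof (rule supp[OF i(1)], rule notI)
    note p = column_stabilizer_permutes[OF column_group_mem[OF \<pi> i(1)]]
    assume "(\<lambda>r. \<pi> i -` T i r) \<in> tabloid_of (\<mu> i) ` tableaux (\<mu> i)"
    then obtain u where u: "u \<in> tableaux (\<mu> i)" "(\<lambda>r. \<pi> i -` T i r) = tabloid_of (\<mu> i) u" by blast
    have "T i = tabloid_of (\<mu> i) (\<pi> i \<circ> u)"
      using u(2) unfolding tabloid_of_comp fun_eq_iff vimage_eq_iff_image[OF p] by simp
    also have "\<dots> = tabloid_of (\<mu> i) (move (\<mu> i) (\<pi> i) u)" by (rule tabloid_of_cong) (simp add: move_def)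
    finally show False using i(2) move_tableaux[OF u(1) p] by blast
  qed
  then have "antisymmetrise t f T = 0" unfolding antisymmetrise_def by (intro sum.neutral) auto
  then show ?thesis using support_E[OF t i(1), of T] i(2) by simp
next
  case True
  then have "\<forall>i\<in>{1..l}. \<exists>v. v \<in> tableaux (\<mu> i) \<and> T i = tabloid_of (\<mu> i) v" by blast
  then obtain u where u: "\<And>i. i \<in> {1..l} \<Longrightarrow> u i \<in> tableaux (\<mu> i) \<and> T i = tabloid_of (\<mu> i) (u i)" by metis
  let ?g = "\<lambda>T. if \<forall>i\<in>{1..l}. T i = tab t i then 1 else 0 :: complex"
  have g: "local_fun ?g" by (auto simp: local_fun_def)
  show ?thesis
  proof (cases "\<forall>i\<in>{1..l}. \<exists>\<pi>\<in>column_stabilizer (\<mu> i) (t i). tabloid_of (\<mu> i) (\<pi> \<circ> t i) = T i")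
    case True
    then obtain \<rho>0 where \<rho>0: "\<And>i. i \<in> {1..l} \<Longrightarrow> \<rho>0 i \<in> column_stabilizer (\<mu> i) (t i) \<and> tabloid_of (\<mu> i) (\<rho>0 i \<circ> t i) = T i"
      by metis
    define \<rho> where "\<rho> = restrict \<rho>0 {1..l}"
    have \<rho>: "\<rho> \<in> column_group t" using \<rho>0 by (auto simp: \<rho>_def column_group_def)
    have T: "T i = (\<lambda>r. \<rho> i ` tab t i r)" if "i \<in> {1..l}" for i
      using \<rho>0[OF that] that by (simp add: \<rho>_def tab_def tabloid_of_comp)
    have sh: "antisymmetrise t h T = sg \<rho> * antisymmetrise t h (tab t)" if "local_fun h" for h
      using local_funD[OF local_antisymmetrise[OF that], of T "\<lambda>i r. \<rho> i ` tab t i r" t] T antisymmetrise_shift[OF that \<rho>] by simp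
    have "E t T = sg \<rho>" using sh[OF g] E_antisymmetrise[of t T] E_antisymmetrise[of t "tab t"] E_self[OF t] by simp
    then show ?thesis using sh[OF f] by simp
  next
    case False
    then obtain i where i: "i \<in> {1..l}" "\<not> (\<exists>\<pi>\<in>column_stabilizer (\<mu> i) (t i). tabloid_of (\<mu> i) (\<pi> \<circ> t i) = tabloid_of (\<mu> i) (u i))"
      using u by metis
    note ui = u[OF i(1)] and ti = tableau_tuples_mem[OF t i(1)]
    obtain x y x' y' where c: "x \<in> cells (\<mu> i)" "y \<in> cells (\<mu> i)" "snd x = snd y" "x' \<in> cells (\<mu> i)" "y' \<in> cells (\<mu> i)"
      "fst x' = fst y'" "t i x = u i x'" "t i y = u i y'" "x \<noteq> y"
      using column_straightening[OF ip[OF i(1)] ti conjunct1[OF ui]] i(2) by blast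
    have row: "t i x \<in> T i r \<longleftrightarrow> t i y \<in> T i r" for r
    proof -
      have "u i z \<in> T i r \<longleftrightarrow> fst z = r" if "z \<in> cells (\<mu> i)" for z
        using ui that tableaux_inj[of "u i" "\<mu> i" z] by (auto simp: tabloid_of_def)
      then show ?thesis using c by simp
    qed
    have "antisymmetrise t f T = 0" "antisymmetrise t ?g T = 0" using antisymmetrise_bad[where T=T and i=i, OF _ t i(1) c(1,2,3,9) row] f g by blast+
    then show ?thesis using E_antisymmetrise[of t T] by simp
  qed
qed

text \<open>The signed column sum is self-adjoint: only the translates of \<open>tab t\<close>
  contribute to the pairing, and passing to inverses in the column group preserves the
  signs.\<close>

lemma pairing_E:
  assumes w: "w \<in> SP" and t: "t \<in> tableau_tuples"
  shows "(\<Sum>T\<in>TB. w T * E t T) = antisymmetrise t w (tab t)"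
proof -
  have finTB: "finite TB" unfolding TB_def by (intro finite_PiE finite_imageI finite_tableaux) simp
  have "(\<Sum>T\<in>TB. w T * E t T) = (\<Sum>T\<in>TB. \<Sum>\<pi>\<in>column_group t. w T * (sg \<pi> * (if \<forall>i\<in>{1..l}. (\<lambda>r. \<pi> i -` T i r) = tab t i then 1 else 0)))"
    by (intro sum.cong refl) (simp add: E_antisymmetrise antisymmetrise_def sum_distrib_left)
  also have "\<dots> = (\<Sum>\<pi>\<in>column_group t. \<Sum>T\<in>TB. w T * (sg \<pi> * (if \<forall>i\<in>{1..l}. (\<lambda>r. \<pi> i -` T i r) = tab t i then 1 else 0)))"
    by (rule sum.swap)
  also have "\<dots> = (\<Sum>\<pi>\<in>column_group t. sg \<pi> * w (\<lambda>i r. \<pi> i ` tab t i r))"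
  proof (rule sum.cong[OF refl])
    fix \<pi> assume \<pi>: "\<pi> \<in> column_group t"
    define T0 where "T0 = (\<lambda>i\<in>{1..l}. \<lambda>r. \<pi> i ` tab t i r)"
    have "(\<lambda>r. \<pi> i ` tab t i r) \<in> tabloid_of (\<mu> i) ` tableaux (\<mu> i)" if i: "i \<in> {1..l}" for i
    proof -
      have "(\<lambda>r. \<pi> i ` tab t i r) = tabloid_of (\<mu> i) (move (\<mu> i) (\<pi> i) (t i))"
        unfolding tab_def tabloid_of_comp[symmetric] by (rule tabloid_of_cong) (simp add: move_def)
      then show ?thesis using move_tableaux[OF tableau_tuples_mem[OF t i] column_stabilizer_permutes[OF column_group_mem[OF \<pi> i]]] by blast
    qed
    then have T0: "T0 \<in> TB" by (auto simp: T0_def TB_def)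
    have "(\<forall>i\<in>{1..l}. (\<lambda>r. \<pi> i -` T i r) = tab t i) \<longleftrightarrow> T = T0" if "T \<in> TB" for T
    proof -
      have "(\<forall>i\<in>{1..l}. (\<lambda>r. \<pi> i -` T i r) = tab t i) \<longleftrightarrow> (\<forall>i\<in>{1..l}. T i = (\<lambda>r. \<pi> i ` tab t i r))"
        unfolding fun_eq_iff using vimage_eq_iff_image[OF column_stabilizer_permutes[OF column_group_mem[OF \<pi>]]] by metis
      also have "\<dots> \<longleftrightarrow> T = T0"
        using that extensionalityI[of T "{1..l}" T0] by (auto simp: T0_def TB_def PiE_iff)
      finally show ?thesis .
    qed
    then have "(\<Sum>T\<in>TB. w T * (sg \<pi> * (if \<forall>i\<in>{1..l}. (\<lambda>r. \<pi> i -` T i r) = tab t i then 1 else 0))) =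
        (\<Sum>T\<in>TB. if T = T0 then w T * sg \<pi> else 0)"
      by (intro sum.cong refl) simp
    also have "\<dots> = w T0 * sg \<pi>" using T0 finTB by simp
    also have "w T0 = w (\<lambda>i r. \<pi> i ` tab t i r)" by (rule local_funD[OF local_SP[OF w]]) (simp add: T0_def)
    finally show "(\<Sum>T\<in>TB. w T * (sg \<pi> * (if \<forall>i\<in>{1..l}. (\<lambda>r. \<pi> i -` T i r) = tab t i then 1 else 0))) =
        sg \<pi> * w (\<lambda>i r. \<pi> i ` tab t i r)" by simp
  qed
  also have "\<dots> = (\<Sum>\<pi>\<in>column_group t. sg \<pi> * w (\<lambda>i r. \<pi> i -` tab t i r))"
  proof -
    have ii: "inv_into UNIV (inv_into UNIV (\<pi> i)) = \<pi> i" if "\<pi> \<in> column_group t" "i \<in> {1..l}" for \<pi> i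
      by (rule permutes_inv_inv[OF column_stabilizer_permutes[OF column_group_mem[OF that]]])
    have ee: "(\<lambda>i\<in>{1..l}. inv_into UNIV ((\<lambda>i\<in>{1..l}. inv_into UNIV (\<pi> i)) i)) = \<pi>" if "\<pi> \<in> column_group t" for \<pi>
      by (rule extensionalityI[of _ "{1..l}"]) (use column_group_ext[OF that] ii[OF that] in auto)
    show ?thesis
    proof (rule sum.reindex_bij_witness[of _ "\<lambda>\<pi>. \<lambda>i\<in>{1..l}. inv_into UNIV (\<pi> i)" "\<lambda>\<pi>. \<lambda>i\<in>{1..l}. inv_into UNIV (\<pi> i)"])
      fix \<pi> assume \<pi>: "\<pi> \<in> column_group t"
      let ?\<pi>' = "\<lambda>i\<in>{1..l}. inv_into UNIV (\<pi> i)"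
      have "sg ?\<pi>' = sg \<pi>" unfolding sg_def
        using column_stabilizer_permutes[OF column_group_mem[OF \<pi>]] sign_inverse
        by (intro prod.cong) (auto simp: permutation_permutes)
      moreover have "w (\<lambda>i r. ?\<pi>' i -` tab t i r) = w (\<lambda>i r. \<pi> i ` tab t i r)"
      proof (rule local_funD[OF local_SP[OF w]], rule ext)
        fix i r assume i: "i \<in> {1..l}"
        show "?\<pi>' i -` tab t i r = \<pi> i ` tab t i r"
          using bij_vimage_eq_inv_image[OF permutes_bij[OF column_stabilizer_permutes[OF column_group_mem[OF column_group_inv[OF \<pi>] i]]]] ii[OF \<pi> i] i by simp
      qed
      ultimately show "sg ?\<pi>' * w (\<lambda>i r. ?\<pi>' i -` tab t i r) = sg \<pi> * w (\<lambda>i r. \<pi> i ` tab t i r)" by simp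
    qed (simp_all only: ee column_group_inv)
  qed
  finally show ?thesis by (simp add: antisymmetrise_def)
qed

lemma cnj_E: "cnj (E t T) = E t T"
proof -
  have "cnj (basis_vec p q) = basis_vec p q" for p q :: tabloid by (simp add: basis_vec_def)
  then show ?thesis by (simp add: E_def polytabloid_def)
qed

text \<open>This is the submodule theorem over the complex numbers: some signed column sum of
  \<open>w\<close> is a nonzero multiple of \<open>E t\<close>, and the group carries
  \<open>E t\<close> to all other generators.\<close>

lemma outer_specht_irreducible:
  assumes U: "U \<subseteq> SP" and add: "\<And>f g. f \<in> U \<Longrightarrow> g \<in> U \<Longrightarrow> (\<lambda>T. f T + g T) \<in> U"
    and smult: "\<And>\<alpha> f. \<alpha> \<in> supported_on SG \<Longrightarrow> f \<in> U \<Longrightarrow> (\<lambda>T. \<Sum>\<sigma>\<in>SG. \<alpha> \<sigma> * f (\<lambda>i r. \<sigma> i -` T i r)) \<in> U"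
    and w: "w \<in> U" "w \<noteq> (\<lambda>_. 0)"
  shows "SP \<subseteq> U"
proof -
  have wS: "w \<in> SP" using w U by blast
  \<comment> \<open>Otherwise \<open>w\<close> is orthogonal to every \<open>E t\<close>. These are
    real-valued and span, so the sum of the squared absolute values of \<open>w\<close>
    vanishes.\<close>
  have "\<exists>t\<in>tableau_tuples. antisymmetrise t w (tab t) \<noteq> 0"
  proof (rule ccontr)
    assume "\<not> ?thesis"
    then have z: "(\<Sum>T\<in>TB. w T * E t T) = 0" if "t \<in> tableau_tuples" for t using pairing_E[OF wS that] that by simp
    obtain c where c: "w = (\<lambda>T. \<Sum>t\<in>tableau_tuples. c t * E t T)" using wS unfolding SP_def by blast
    have "(\<Sum>T\<in>TB. w T * cnj (w T)) = (\<Sum>T\<in>TB. \<Sum>t\<in>tableau_tuples. cnj (c t) * (w T * E t T))"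
    proof (intro sum.cong refl)
      fix T
      have "cnj (w T) = (\<Sum>t\<in>tableau_tuples. cnj (c t) * E t T)" by (simp add: c cnj_E)
      then show "w T * cnj (w T) = (\<Sum>t\<in>tableau_tuples. cnj (c t) * (w T * E t T))" by (simp add: sum_distrib_left mult_ac)
    qed
    also have "\<dots> = (\<Sum>t\<in>tableau_tuples. \<Sum>T\<in>TB. cnj (c t) * (w T * E t T))" by (rule sum.swap)
    also have "\<dots> = 0" using z by (simp add: sum_distrib_left[symmetric])
    finally have "(\<Sum>T\<in>TB. complex_of_real ((cmod (w T))\<^sup>2)) = 0" by (simp add: complex_norm_square[symmetric])
    then have "complex_of_real (\<Sum>T\<in>TB. (cmod (w T))\<^sup>2) = 0" by simp
    then have "(\<Sum>T\<in>TB. (cmod (w T))\<^sup>2) = 0" by (simp only: of_real_eq_0_iff)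
    moreover have "finite TB" unfolding TB_def by (intro finite_PiE finite_imageI finite_tableaux) simp
    ultimately have TB0: "w T = 0" if "T \<in> TB" for T using that by (simp add: sum_nonneg_eq_0_iff)
    have "w T = 0" for T
    proof (cases "\<forall>i\<in>{1..l}. T i \<in> tabloid_of (\<mu> i) ` tableaux (\<mu> i)")
      case True
      then have "w (restrict T {1..l}) = 0" by (intro TB0) (auto simp: TB_def)
      moreover have "w T = w (restrict T {1..l})" by (rule local_funD[OF local_SP[OF wS]]) simp
      ultimately show ?thesis by simp
    next
      case False then show ?thesis using support_SP[OF wS] by blast
    qed
    then show False using w(2) by auto
  qed
  then obtain t where t: "t \<in> tableau_tuples" "antisymmetrise t w (tab t) \<noteq> 0" by blast
  \<comment> \<open>Closure under complex scalars comes from the group algebra, through multiples of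
    the identity tuple.\<close>
  have scale: "(\<lambda>T. a * f T) \<in> U" if f: "f \<in> U" for a f
  proof -
    define e where "e = (\<lambda>i\<in>{1..l}. id :: nat \<Rightarrow> nat)"
    have e: "e \<in> SG" by (auto simp: e_def SG_iff permutes_id)
    define \<alpha> where "\<alpha> = (\<lambda>\<sigma>. if \<sigma> = e then a else 0)"
    have "(\<Sum>\<sigma>\<in>SG. \<alpha> \<sigma> * f (\<lambda>i r. \<sigma> i -` T i r)) = a * f T" for T
    proof -
      have "(\<Sum>\<sigma>\<in>SG. \<alpha> \<sigma> * f (\<lambda>i r. \<sigma> i -` T i r)) = (\<Sum>\<sigma>\<in>SG. if \<sigma> = e then a * f (\<lambda>i r. \<sigma> i -` T i r) else 0)"
        by (intro sum.cong) (auto simp: \<alpha>_def)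
      also have "\<dots> = a * f (\<lambda>i r. e i -` T i r)" using e finite_SG by simp
      also have "f (\<lambda>i r. e i -` T i r) = f T" using f U by (intro local_funD[OF local_SP]) (auto simp: e_def)
      finally show ?thesis .
    qed
    moreover have "\<alpha> \<in> supported_on SG" using e by (auto simp: supported_on_def \<alpha>_def)
    ultimately show ?thesis using smult[of \<alpha> f] f by simp
  qed
  have act: "(\<lambda>T. f (\<lambda>i r. \<sigma> i -` T i r)) \<in> U" if f: "f \<in> U" and \<sigma>: "\<sigma> \<in> SG" for f \<sigma>
  proof -
    define \<alpha> where "\<alpha> = (\<lambda>\<sigma>'. if \<sigma>' = \<sigma> then 1 else 0 :: complex)"
    have "(\<Sum>\<sigma>'\<in>SG. \<alpha> \<sigma>' * f (\<lambda>i r. \<sigma>' i -` T i r)) = f (\<lambda>i r. \<sigma> i -` T i r)" for T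
    proof -
      have "(\<Sum>\<sigma>'\<in>SG. \<alpha> \<sigma>' * f (\<lambda>i r. \<sigma>' i -` T i r)) = (\<Sum>\<sigma>'\<in>SG. if \<sigma>' = \<sigma> then f (\<lambda>i r. \<sigma>' i -` T i r) else 0)"
        by (intro sum.cong) (auto simp: \<alpha>_def)
      then show ?thesis using \<sigma> finite_SG by simp
    qed
    moreover have "\<alpha> \<in> supported_on SG" using \<sigma> by (auto simp: supported_on_def \<alpha>_def)
    ultimately show ?thesis using smult[of \<alpha> f] f by simp
  qed
  have "antisymmetrise t w \<in> U"
  proof -
    define \<alpha> where "\<alpha> = (\<lambda>\<sigma>. if \<sigma> \<in> column_group t then sg \<sigma> else 0)"
    have "antisymmetrise t w = (\<lambda>T. \<Sum>\<sigma>\<in>SG. \<alpha> \<sigma> * w (\<lambda>i r. \<sigma> i -` T i r))"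
    proof
     fix T show "antisymmetrise t w T = (\<Sum>\<sigma>\<in>SG. \<alpha> \<sigma> * w (\<lambda>i r. \<sigma> i -` T i r))"
      unfolding antisymmetrise_def by (rule sum.mono_neutral_cong_left) (auto simp: \<alpha>_def finite_SG column_group_SG[THEN subsetD])
    qed
    moreover have "\<alpha> \<in> supported_on SG" using column_group_SG by (auto simp: supported_on_def \<alpha>_def)
    ultimately show ?thesis using smult[of \<alpha> w] w(1) by simp
  qed
  moreover have "antisymmetrise t w = (\<lambda>T. antisymmetrise t w (tab t) * E t T)"
    by (rule ext) (rule antisymmetrise_eq[OF local_SP[OF wS] support_SP[OF wS] t(1)])
  ultimately have "(\<lambda>T. antisymmetrise t w (tab t) * E t T) \<in> U" by simp
  then have "(\<lambda>T. (1 / antisymmetrise t w (tab t)) * (antisymmetrise t w (tab t) * E t T)) \<in> U" by (rule scale)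
  then have Et: "E t \<in> U" using t(2) by simp
  have Eu: "E u \<in> U" if u: "u \<in> tableau_tuples" for u
  proof -
    \<comment> \<open>In each factor the permutation that takes the entry of \<open>t\<close> in a
      cell to the entry of \<open>u\<close> in that cell.\<close>
    define \<sigma> where "\<sigma> = (\<lambda>i\<in>{1..l}. \<lambda>a. if a \<in> {1..sum_list (\<mu> i)} then u i (inv_into (cells (\<mu> i)) (t i) a) else a)"
    have p: "\<sigma> i permutes {1..sum_list (\<mu> i)}" if i: "i \<in> {1..l}" for i
    proof (rule bij_imp_permutes)
      have "bij_betw (\<lambda>a. u i (inv_into (cells (\<mu> i)) (t i) a)) {1..sum_list (\<mu> i)} {1..sum_list (\<mu> i)}"
        using bij_betw_trans[OF bij_betw_inv_into[OF tableauxD[OF tableau_tuples_mem[OF t(1) i]]] tableauxD[OF tableau_tuples_mem[OF u i]]]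
        by (simp add: comp_def)
      then show "bij_betw (\<sigma> i) {1..sum_list (\<mu> i)} {1..sum_list (\<mu> i)}"
        by (subst bij_betw_cong[where g="\<lambda>a. u i (inv_into (cells (\<mu> i)) (t i) a)"]) (use i in \<open>auto simp: \<sigma>_def\<close>)
    qed (use i in \<open>auto simp: \<sigma>_def\<close>)
    then have \<sigma>: "\<sigma> \<in> SG" using sum_list_\<mu> by (auto simp: SG_iff \<sigma>_def)
    have "move (\<mu> i) (\<sigma> i) (t i) = u i" if i: "i \<in> {1..l}" for i
    proof (rule extensionalityI[of _ "cells (\<mu> i)"])
      fix x assume x: "x \<in> cells (\<mu> i)"
      note b = tableauxD[OF tableau_tuples_mem[OF t(1) i]]
      have "t i x \<in> {1..sum_list (\<mu> i)}" using b x by (rule bij_betw_apply)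
      then show "move (\<mu> i) (\<sigma> i) (t i) x = u i x"
        using x i bij_betw_inv_into_left[OF b x] by (simp add: move_def \<sigma>_def)
    qed (use tableau_tuples_mem[OF u i] in \<open>auto simp: move_def tableaux_def\<close>)
    then have "E (\<lambda>i\<in>{1..l}. move (\<mu> i) (\<sigma> i) (t i)) = E u" unfolding E_def by (intro ext prod.cong) auto
    then have "(\<lambda>T. E t (\<lambda>i r. \<sigma> i -` T i r)) = E u" using E_move(2)[OF t(1) \<sigma>] by simp
    then show ?thesis using act[OF Et \<sigma>] by simp
  qed
  show ?thesis
  proof
    fix f assume "f \<in> SP"
    then obtain c where c: "f = (\<lambda>T. \<Sum>u\<in>tableau_tuples. c u * E u T)" unfolding SP_def by blast
    have zero: "(\<lambda>_. 0) \<in> U" using scale[OF w(1), of 0] by simp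
    have "(\<lambda>T. \<Sum>u\<in>A. c u * E u T) \<in> U" if "finite A" "A \<subseteq> tableau_tuples" for A
      using that by (induction A rule: finite_induct) (auto simp: zero intro!: add scale Eu)
    then show "f \<in> U" unfolding c using finite_tableau_tuples by blast
  qed
qed

end

subsection \<open>The left module structure on a tensor product\<close>

text \<open>The operations of \<open>tensor_module\<close> are defined through coset
  representatives; these laws make them well defined and give the module axioms.\<close>

locale balanced_bimodule =
  fixes S :: "('s, 'e) ring_scheme" and act :: "'s \<Rightarrow> 'a \<Rightarrow> 'a"
    and R :: "('r, 'c) ring_scheme" and M :: "('r, 'a, 'd) module_scheme" and N :: "('r, 'b, 'f) module_scheme"
  assumes ring_S: "ring S"
    and M_add: "\<And>x y. x \<in> carrier M \<Longrightarrow> y \<in> carrier M \<Longrightarrow> x \<oplus>\<^bsub>M\<^esub> y \<in> carrier M"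
    and N_add: "\<And>x y. x \<in> carrier N \<Longrightarrow> y \<in> carrier N \<Longrightarrow> x \<oplus>\<^bsub>N\<^esub> y \<in> carrier N"
    and M_smult: "\<And>r x. r \<in> carrier R \<Longrightarrow> x \<in> carrier M \<Longrightarrow> r \<odot>\<^bsub>M\<^esub> x \<in> carrier M"
    and N_smult: "\<And>r x. r \<in> carrier R \<Longrightarrow> x \<in> carrier N \<Longrightarrow> r \<odot>\<^bsub>N\<^esub> x \<in> carrier N"
    and act_closed: "\<And>s x. s \<in> carrier S \<Longrightarrow> x \<in> carrier M \<Longrightarrow> act s x \<in> carrier M"
    and act_add: "\<And>s x y. s \<in> carrier S \<Longrightarrow> x \<in> carrier M \<Longrightarrow> y \<in> carrier M \<Longrightarrow>
      act s (x \<oplus>\<^bsub>M\<^esub> y) = act s x \<oplus>\<^bsub>M\<^esub> act s y"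
    and act_smult: "\<And>s r x. s \<in> carrier S \<Longrightarrow> r \<in> carrier R \<Longrightarrow> x \<in> carrier M \<Longrightarrow>
      act s (r \<odot>\<^bsub>M\<^esub> x) = r \<odot>\<^bsub>M\<^esub> act s x"
    and add_act: "\<And>s t x. s \<in> carrier S \<Longrightarrow> t \<in> carrier S \<Longrightarrow> x \<in> carrier M \<Longrightarrow>
      act (s \<oplus>\<^bsub>S\<^esub> t) x = act s x \<oplus>\<^bsub>M\<^esub> act t x"
    and mult_act: "\<And>s t x. s \<in> carrier S \<Longrightarrow> t \<in> carrier S \<Longrightarrow> x \<in> carrier M \<Longrightarrow>
      act (s \<otimes>\<^bsub>S\<^esub> t) x = act s (act t x)"
    and one_act: "\<And>x. x \<in> carrier M \<Longrightarrow> act \<one>\<^bsub>S\<^esub> x = x"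
begin

abbreviation "pairs \<equiv> carrier M \<times> carrier N"
abbreviation "FG \<equiv> free_Abelian_group pairs"
abbreviation "K \<equiv> tensor_relations R M N"
abbreviation "TM \<equiv> tensor_module act R M N"

definition gens :: "(('a \<times> 'b) \<Rightarrow>\<^sub>0 int) set" where
  "gens = {frag_of (x \<oplus>\<^bsub>M\<^esub> x', y) - frag_of (x, y) - frag_of (x', y) | x x' y.
           x \<in> carrier M \<and> x' \<in> carrier M \<and> y \<in> carrier N} \<union>
        {frag_of (x, y \<oplus>\<^bsub>N\<^esub> y') - frag_of (x, y) - frag_of (x, y') | x y y'.
           x \<in> carrier M \<and> y \<in> carrier N \<and> y' \<in> carrier N} \<union>
        {frag_of (r \<odot>\<^bsub>M\<^esub> x, y) - frag_of (x, r \<odot>\<^bsub>N\<^esub> y) | r x y.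
           r \<in> carrier R \<and> x \<in> carrier M \<and> y \<in> carrier N}"

definition ext :: "'s \<Rightarrow> (('a \<times> 'b) \<Rightarrow>\<^sub>0 int) \<Rightarrow> (('a \<times> 'b) \<Rightarrow>\<^sub>0 int)" where
  "ext s = frag_extend (\<lambda>(x, y). frag_of (act s x, y))"

lemma K_eq: "K = generate FG gens"
  unfolding tensor_relations_def gens_def by (rule refl)

lemma FG_diff: "c \<in> carrier FG \<Longrightarrow> d \<in> carrier FG \<Longrightarrow> c - d \<in> carrier FG"
  using keys_diff[of c d] by auto

lemma FG_add: "c \<in> carrier FG \<Longrightarrow> d \<in> carrier FG \<Longrightarrow> c + d \<in> carrier FG"
  using Poly_Mapping.keys_add[of c d] by auto

lemma FG_of: "x \<in> carrier M \<Longrightarrow> y \<in> carrier N \<Longrightarrow> frag_of (x, y) \<in> carrier FG"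
  by simp

lemma gens_FG: "gens \<subseteq> carrier FG"
proof
  fix g assume "g \<in> gens"
  then consider (a) x x' y where "g = frag_of (x \<oplus>\<^bsub>M\<^esub> x', y) - frag_of (x, y) - frag_of (x', y)"
      "x \<in> carrier M" "x' \<in> carrier M" "y \<in> carrier N"
    | (b) x y y' where "g = frag_of (x, y \<oplus>\<^bsub>N\<^esub> y') - frag_of (x, y) - frag_of (x, y')"
      "x \<in> carrier M" "y \<in> carrier N" "y' \<in> carrier N"
    | (c) r x y where "g = frag_of (r \<odot>\<^bsub>M\<^esub> x, y) - frag_of (x, r \<odot>\<^bsub>N\<^esub> y)"
      "r \<in> carrier R" "x \<in> carrier M" "y \<in> carrier N"
    unfolding gens_def by blast
  then show "g \<in> carrier FG"
  proof cases
    case a show ?thesis unfolding a(1) by (intro FG_diff FG_of M_add a)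
  next
    case b show ?thesis unfolding b(1) by (intro FG_diff FG_of N_add b)
  next
    case c show ?thesis unfolding c(1) by (intro FG_diff FG_of M_smult N_smult c)
  qed
qed

lemma K_subgroup: "subgroup K FG"
  unfolding K_eq by (rule group.generate_is_subgroup[OF group_free_Abelian_group gens_FG])

lemma K_normal: "K \<lhd> FG"
  by (rule comm_group.subgroup_imp_normal[OF abelian_free_Abelian_group K_subgroup])

lemma K_FG: "c \<in> K \<Longrightarrow> c \<in> carrier FG"
  using subgroup.subset[OF K_subgroup] by blast

lemma K_add: "c \<in> K \<Longrightarrow> d \<in> K \<Longrightarrow> c + d \<in> K"
  using subgroup.m_closed[OF K_subgroup, of c d] by simp

lemma K_zero: "0 \<in> K"
  using subgroup.one_closed[OF K_subgroup] by simp

lemma K_uminus: "c \<in> K \<Longrightarrow> - c \<in> K"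
  using subgroup.m_inv_closed[OF K_subgroup, of c] K_FG[of c] by simp

lemma K_diff: "c \<in> K \<Longrightarrow> d \<in> K \<Longrightarrow> c - d \<in> K"
  using K_add[of c "- d"] K_uminus[of d] by simp

lemma K_gens: "g \<in> gens \<Longrightarrow> g \<in> K"
  unfolding K_eq by (rule generate.incl)

lemma K_add_left:
  "x \<in> carrier M \<Longrightarrow> x' \<in> carrier M \<Longrightarrow> y \<in> carrier N \<Longrightarrow>
    frag_of (x \<oplus>\<^bsub>M\<^esub> x', y) - frag_of (x, y) - frag_of (x', y) \<in> K"
  by (rule K_gens) (unfold gens_def, blast)

lemma K_add_right:
  "x \<in> carrier M \<Longrightarrow> y \<in> carrier N \<Longrightarrow> y' \<in> carrier N \<Longrightarrow>
    frag_of (x, y \<oplus>\<^bsub>N\<^esub> y') - frag_of (x, y) - frag_of (x, y') \<in> K"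
  by (rule K_gens) (unfold gens_def, blast)

lemma K_balanced:
  "r \<in> carrier R \<Longrightarrow> x \<in> carrier M \<Longrightarrow> y \<in> carrier N \<Longrightarrow>
    frag_of (r \<odot>\<^bsub>M\<^esub> x, y) - frag_of (x, r \<odot>\<^bsub>N\<^esub> y) \<in> K"
  by (rule K_gens) (unfold gens_def, blast)

lemma ext_simps [simp]:
  "ext s 0 = 0" "ext s (c - d) = ext s c - ext s d" "ext s (c + d) = ext s c + ext s d"
  "ext s (- c) = - ext s c" "ext s (frag_of (x, y)) = frag_of (act s x, y)"
  by (simp_all add: ext_def frag_extend_diff frag_extend_add frag_extend_minus)

lemma ext_FG:
  assumes "s \<in> carrier S" "c \<in> carrier FG"
  shows "ext s c \<in> carrier FG"
proof -
  have "Poly_Mapping.keys c \<subseteq> pairs" using assms by simp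
  then show ?thesis
  proof (induction c rule: frag_induction)
    case (one z)
    then show ?case using act_closed[OF assms(1)] by (cases z) simp
  next
    case (diff a b)
    then show ?case using FG_diff[of "ext s a" "ext s b"] by simp
  qed simp
qed

text \<open>The action sends every generating relation to a relation of the same kind, so it
  descends to cosets.\<close>

lemma ext_K:
  assumes s: "s \<in> carrier S" and "c \<in> K"
  shows "ext s c \<in> K"
  using assms(2) unfolding K_eq
proof (induction rule: generate.induct)
  case one
  then show ?case using K_zero by (simp add: K_eq)
next
  have g: "ext s h \<in> K" if "h \<in> gens" for h
  proof -
    from that consider (a) x x' y where "h = frag_of (x \<oplus>\<^bsub>M\<^esub> x', y) - frag_of (x, y) - frag_of (x', y)"
        "x \<in> carrier M" "x' \<in> carrier M" "y \<in> carrier N"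
      | (b) x y y' where "h = frag_of (x, y \<oplus>\<^bsub>N\<^esub> y') - frag_of (x, y) - frag_of (x, y')"
        "x \<in> carrier M" "y \<in> carrier N" "y' \<in> carrier N"
      | (c) r x y where "h = frag_of (r \<odot>\<^bsub>M\<^esub> x, y) - frag_of (x, r \<odot>\<^bsub>N\<^esub> y)"
        "r \<in> carrier R" "x \<in> carrier M" "y \<in> carrier N"
      unfolding gens_def by blast
    then show ?thesis
    proof cases
      case a then show ?thesis
        using K_add_left[OF act_closed[OF s a(2)] act_closed[OF s a(3)] a(4)] by (simp add: act_add[OF s])
    next
      case b then show ?thesis using K_add_right[OF act_closed[OF s b(2)] b(3,4)] by simp
    next
      case c then show ?thesis using K_balanced[OF c(2) act_closed[OF s c(3)] c(4)] by (simp add: act_smult[OF s])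
    qed
  qed
  { case (incl h) then show ?case using g by (simp add: K_eq) }
  { case (inv h)
    then have "h \<in> carrier FG" using gens_FG by blast
    then have "inv\<^bsub>FG\<^esub> h = - h" by simp
    then show ?case using K_uminus[OF g[OF inv]] by (simp add: K_eq) }
next
  case (eng h1 h2)
  then show ?case using K_add[of "ext s h1" "ext s h2"] by (simp add: K_eq)
qed

lemma coset_eq_iff:
  assumes "c \<in> carrier FG" "d \<in> carrier FG"
  shows "K #>\<^bsub>FG\<^esub> c = K #>\<^bsub>FG\<^esub> d \<longleftrightarrow> c - d \<in> K"
proof
  assume "K #>\<^bsub>FG\<^esub> c = K #>\<^bsub>FG\<^esub> d"
  moreover have "c \<in> K #>\<^bsub>FG\<^esub> c" using K_zero by (force simp: r_coset_def)
  ultimately obtain k where "k \<in> K" "c = k + d" by (auto simp: r_coset_def)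
  then show "c - d \<in> K" by simp
next
  assume cd: "c - d \<in> K"
  show "K #>\<^bsub>FG\<^esub> c = K #>\<^bsub>FG\<^esub> d"
  proof
    show "K #>\<^bsub>FG\<^esub> c \<subseteq> K #>\<^bsub>FG\<^esub> d"
    proof
      fix z assume "z \<in> K #>\<^bsub>FG\<^esub> c"
      then obtain k where k: "k \<in> K" "z = k + c" by (auto simp: r_coset_def)
      have "z = (k + (c - d)) + d" using k by simp
      then show "z \<in> K #>\<^bsub>FG\<^esub> d" using K_add[OF k(1) cd] by (force simp: r_coset_def)
    qed
    show "K #>\<^bsub>FG\<^esub> d \<subseteq> K #>\<^bsub>FG\<^esub> c"
    proof
      fix z assume "z \<in> K #>\<^bsub>FG\<^esub> d"
      then obtain k where k: "k \<in> K" "z = k + d" by (auto simp: r_coset_def)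
      have "z = (k - (c - d)) + c" using k by simp
      then show "z \<in> K #>\<^bsub>FG\<^esub> c" using K_diff[OF k(1) cd] by (force simp: r_coset_def)
    qed
  qed
qed

lemma coset_mem: "c \<in> K #>\<^bsub>FG\<^esub> d \<longleftrightarrow> c - d \<in> K"
proof
  assume "c \<in> K #>\<^bsub>FG\<^esub> d"
  then obtain k where "k \<in> K" "c = k + d" by (auto simp: r_coset_def)
  then show "c - d \<in> K" by simp
next
  assume "c - d \<in> K"
  then show "c \<in> K #>\<^bsub>FG\<^esub> d" by (force simp: r_coset_def)
qed

lemma TM_carrier: "carrier TM = (\<lambda>c. K #>\<^bsub>FG\<^esub> c) ` carrier FG"
  unfolding tensor_module_def tensor_group_def by (simp add: carrier_FactGroup)

lemma TM_zero: "\<zero>\<^bsub>TM\<^esub> = K"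
  unfolding tensor_module_def tensor_group_def by simp

lemma TM_zero': "\<zero>\<^bsub>TM\<^esub> = K #>\<^bsub>FG\<^esub> 0"
  unfolding TM_zero using coset_mem[of _ 0] by auto

lemma TM_add:
  assumes "c \<in> carrier FG" "d \<in> carrier FG"
  shows "(K #>\<^bsub>FG\<^esub> c) \<oplus>\<^bsub>TM\<^esub> (K #>\<^bsub>FG\<^esub> d) = K #>\<^bsub>FG\<^esub> (c + d)"
  using normal.rcos_sum[OF K_normal assms]
  unfolding tensor_module_def tensor_group_def by simp

lemma TM_smult:
  assumes s: "s \<in> carrier S" and c: "c \<in> carrier FG"
  shows "s \<odot>\<^bsub>TM\<^esub> (K #>\<^bsub>FG\<^esub> c) = K #>\<^bsub>FG\<^esub> (ext s c)"
proof -
  have "K #>\<^bsub>FG\<^esub> ext s d = K #>\<^bsub>FG\<^esub> ext s c" if "d \<in> K #>\<^bsub>FG\<^esub> c" for d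
  proof -
    have dc: "d - c \<in> K" using that coset_mem by blast
    have "d \<in> carrier FG" using FG_add[OF K_FG[OF dc] c] by simp
    then show ?thesis using coset_eq_iff[OF ext_FG[OF s] ext_FG[OF s c], of d] ext_K[OF s dc] by simp
  qed
  moreover have "c \<in> K #>\<^bsub>FG\<^esub> c" using coset_mem[of c c] K_zero by simp
  ultimately have "(\<Union>d\<in>K #>\<^bsub>FG\<^esub> c. K #>\<^bsub>FG\<^esub> ext s d) = K #>\<^bsub>FG\<^esub> ext s c" by blast
  then show ?thesis by (simp add: tensor_module_def ext_def)
qed

text \<open>A sum in \<open>S\<close> acts on a generator by adding inside the first slot; splitting
  that slot is itself a tensor relation, so the identity holds only modulo \<open>K\<close>.\<close>

lemma ext_add:
  assumes "s \<in> carrier S" "t \<in> carrier S" "c \<in> carrier FG"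
  shows "ext (s \<oplus>\<^bsub>S\<^esub> t) c - (ext s c + ext t c) \<in> K"
proof -
  have "Poly_Mapping.keys c \<subseteq> pairs" using assms by simp
  then show ?thesis
  proof (induction c rule: frag_induction)
    case zero
    then show ?case using K_zero by simp
  next
    case (one z)
    then obtain x y where z: "z = (x, y)" "x \<in> carrier M" "y \<in> carrier N" by auto
    then show ?case using K_add_left[OF act_closed[OF assms(1) z(2)] act_closed[OF assms(2) z(2)] z(3)]
      by (simp add: add_act[OF assms(1,2)] algebra_simps)
  next
    case (diff a b)
    then show ?case using K_diff[OF diff] by (simp add: algebra_simps)
  qed
qed

lemma ext_mult:
  assumes "s \<in> carrier S" "t \<in> carrier S" "c \<in> carrier FG"
  shows "ext (s \<otimes>\<^bsub>S\<^esub> t) c = ext s (ext t c)"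
proof -
  have "Poly_Mapping.keys c \<subseteq> pairs" using assms by simp
  then show ?thesis
  proof (induction c rule: frag_induction)
    case (one z)
    then show ?case by (cases z) (simp add: mult_act[OF assms(1,2)])
  qed simp_all
qed

lemma ext_one:
  assumes "c \<in> carrier FG"
  shows "ext \<one>\<^bsub>S\<^esub> c = c"
proof -
  have "Poly_Mapping.keys c \<subseteq> pairs" using assms by simp
  then show ?thesis
  proof (induction c rule: frag_induction)
    case (one z)
    then show ?case by (cases z) (simp add: one_act)
  qed simp_all
qed

lemma TM_left_module: "left_module S TM"
proof (intro left_module.intro left_module_axioms.intro)
  show "ring S" by (rule ring_S)
  show "abelian_group TM"
  proof (rule abelian_groupI)
    fix x assume "x \<in> carrier TM"
    then obtain c where c: "c \<in> carrier FG" "x = K #>\<^bsub>FG\<^esub> c" unfolding TM_carrier by blast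
    have c': "- c \<in> carrier FG" using c by simp
    show "\<zero>\<^bsub>TM\<^esub> \<oplus>\<^bsub>TM\<^esub> x = x" unfolding TM_zero' c(2) using TM_add[of 0 c] c(1) by simp
    show "\<exists>y\<in>carrier TM. y \<oplus>\<^bsub>TM\<^esub> x = \<zero>\<^bsub>TM\<^esub>"
      using TM_add[OF c' c(1)] c' unfolding TM_zero' TM_carrier c(2) by auto
    fix y assume "y \<in> carrier TM"
    then obtain d where d: "d \<in> carrier FG" "y = K #>\<^bsub>FG\<^esub> d" unfolding TM_carrier by blast
    show "x \<oplus>\<^bsub>TM\<^esub> y \<in> carrier TM" unfolding c(2) d(2) TM_add[OF c(1) d(1)] TM_carrier
      using FG_add[OF c(1) d(1)] by blast
    show "x \<oplus>\<^bsub>TM\<^esub> y = y \<oplus>\<^bsub>TM\<^esub> x" unfolding c(2) d(2) TM_add[OF c(1) d(1)] TM_add[OF d(1) c(1)]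
      by (simp add: add.commute)
    fix z assume "z \<in> carrier TM"
    then obtain e where e: "e \<in> carrier FG" "z = K #>\<^bsub>FG\<^esub> e" unfolding TM_carrier by blast
    show "x \<oplus>\<^bsub>TM\<^esub> y \<oplus>\<^bsub>TM\<^esub> z = x \<oplus>\<^bsub>TM\<^esub> (y \<oplus>\<^bsub>TM\<^esub> z)"
      unfolding c(2) d(2) e(2) TM_add[OF c(1) d(1)] TM_add[OF d(1) e(1)]
        TM_add[OF FG_add[OF c(1) d(1)] e(1)] TM_add[OF c(1) FG_add[OF d(1) e(1)]] by (simp add: add.assoc)
  next
    show "\<zero>\<^bsub>TM\<^esub> \<in> carrier TM" unfolding TM_zero' TM_carrier by simp
  qed
next
  fix a x assume a: "a \<in> carrier S" and "x \<in> carrier TM"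
  then obtain c where c: "c \<in> carrier FG" "x = K #>\<^bsub>FG\<^esub> c" unfolding TM_carrier by blast
  show "a \<odot>\<^bsub>TM\<^esub> x \<in> carrier TM" unfolding c(2) TM_smult[OF a c(1)] TM_carrier using ext_FG[OF a c(1)] by blast
  fix y assume "y \<in> carrier TM"
  then obtain d where d: "d \<in> carrier FG" "y = K #>\<^bsub>FG\<^esub> d" unfolding TM_carrier by blast
  show "a \<odot>\<^bsub>TM\<^esub> (x \<oplus>\<^bsub>TM\<^esub> y) = a \<odot>\<^bsub>TM\<^esub> x \<oplus>\<^bsub>TM\<^esub> a \<odot>\<^bsub>TM\<^esub> y"
    unfolding c(2) d(2) TM_add[OF c(1) d(1)] TM_smult[OF a FG_add[OF c(1) d(1)]] TM_smult[OF a c(1)] TM_smult[OF a d(1)]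
      TM_add[OF ext_FG[OF a c(1)] ext_FG[OF a d(1)]] by simp
next
  fix a b x assume a: "a \<in> carrier S" and b: "b \<in> carrier S" and "x \<in> carrier TM"
  then obtain c where c: "c \<in> carrier FG" "x = K #>\<^bsub>FG\<^esub> c" unfolding TM_carrier by blast
  interpret S: ring S by (rule ring_S)
  have ab: "a \<oplus>\<^bsub>S\<^esub> b \<in> carrier S" "a \<otimes>\<^bsub>S\<^esub> b \<in> carrier S" using a b by simp_all
  note e = ext_FG[OF a c(1)] ext_FG[OF b c(1)]
  show "(a \<oplus>\<^bsub>S\<^esub> b) \<odot>\<^bsub>TM\<^esub> x = a \<odot>\<^bsub>TM\<^esub> x \<oplus>\<^bsub>TM\<^esub> b \<odot>\<^bsub>TM\<^esub> x"
    unfolding c(2) TM_smult[OF ab(1) c(1)] TM_smult[OF a c(1)] TM_smult[OF b c(1)] TM_add[OF e]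
      coset_eq_iff[OF ext_FG[OF ab(1) c(1)] FG_add[OF e]] by (rule ext_add[OF a b c(1)])
  show "(a \<otimes>\<^bsub>S\<^esub> b) \<odot>\<^bsub>TM\<^esub> x = a \<odot>\<^bsub>TM\<^esub> (b \<odot>\<^bsub>TM\<^esub> x)"
    unfolding c(2) TM_smult[OF ab(2) c(1)] TM_smult[OF b c(1)] TM_smult[OF a e(2)] ext_mult[OF a b c(1)] ..
next
  fix x assume "x \<in> carrier TM"
  then obtain c where c: "c \<in> carrier FG" "x = K #>\<^bsub>FG\<^esub> c" unfolding TM_carrier by blast
  interpret S: ring S by (rule ring_S)
  show "\<one>\<^bsub>S\<^esub> \<odot>\<^bsub>TM\<^esub> x = x" unfolding c(2) TM_smult[OF S.one_closed c(1)] ext_one[OF c(1)] ..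
qed

text \<open>Submodules of the tensor product are handled through their preimages in the free abelian group.\<close>

lemma simple_tensorI:
  assumes nz: "c0 \<in> carrier FG" "c0 \<notin> K"
    and max: "\<And>H c. H \<subseteq> carrier FG \<Longrightarrow> K \<subseteq> H \<Longrightarrow> (\<And>c d. c \<in> H \<Longrightarrow> d \<in> H \<Longrightarrow> c - d \<in> H) \<Longrightarrow>
       (\<And>s c. s \<in> carrier S \<Longrightarrow> c \<in> H \<Longrightarrow> ext s c \<in> H) \<Longrightarrow> c \<in> H \<Longrightarrow> c \<notin> K \<Longrightarrow> carrier FG \<subseteq> H"
  shows "simple_module S TM"
  unfolding simple_module_def
proof (intro conjI allI impI)
  show "left_module S TM" by (rule TM_left_module)
  have "K #>\<^bsub>FG\<^esub> c0 \<in> carrier TM" unfolding TM_carrier using nz by blast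
  moreover have "K #>\<^bsub>FG\<^esub> c0 \<noteq> \<zero>\<^bsub>TM\<^esub>" unfolding TM_zero' using coset_eq_iff[of c0 0] nz by simp
  ultimately show "carrier TM \<noteq> {\<zero>\<^bsub>TM\<^esub>}" by blast
  fix H assume H: "submodule H S TM"
  have sub: "subgroup H (add_monoid TM)" and sm: "\<And>a x. a \<in> carrier S \<Longrightarrow> x \<in> H \<Longrightarrow> a \<odot>\<^bsub>TM\<^esub> x \<in> H"
    using H unfolding submodule_def submodule_axioms_def by auto
  interpret T: left_module S TM by (rule TM_left_module)
  define H0 where "H0 = {c \<in> carrier FG. K #>\<^bsub>FG\<^esub> c \<in> H}"
  have HT: "H \<subseteq> carrier TM" using subgroup.subset[OF sub] by simp
  have zero: "\<zero>\<^bsub>TM\<^esub> \<in> H" using subgroup.one_closed[OF sub] by simp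
  have "K \<subseteq> H0"
  proof
    fix c assume c: "c \<in> K"
    then have "K #>\<^bsub>FG\<^esub> c = K #>\<^bsub>FG\<^esub> 0" using coset_eq_iff[of c 0] K_FG[OF c] by simp
    then show "c \<in> H0" using K_FG[OF c] zero unfolding H0_def TM_zero' by simp
  qed
  moreover have "c - d \<in> H0" if "c \<in> H0" "d \<in> H0" for c d
  proof -
    have c: "c \<in> carrier FG" "K #>\<^bsub>FG\<^esub> c \<in> H" and d: "d \<in> carrier FG" "K #>\<^bsub>FG\<^esub> d \<in> H" using that by (auto simp: H0_def)
    have d': "- d \<in> carrier FG" using d(1) by simp
    have dT: "K #>\<^bsub>FG\<^esub> d \<in> carrier TM" "K #>\<^bsub>FG\<^esub> (- d) \<in> carrier TM" unfolding TM_carrier using d d' by blast+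
    have "(K #>\<^bsub>FG\<^esub> (- d)) \<oplus>\<^bsub>TM\<^esub> (K #>\<^bsub>FG\<^esub> d) = \<zero>\<^bsub>TM\<^esub>"
      using TM_add[OF d' d(1)] by (simp add: TM_zero')
    then have "K #>\<^bsub>FG\<^esub> (- d) = \<ominus>\<^bsub>TM\<^esub> (K #>\<^bsub>FG\<^esub> d)" using dT T.M.minus_equality by metis
    then have "K #>\<^bsub>FG\<^esub> (- d) \<in> H" using subgroup.m_inv_closed[OF sub d(2)] by (simp add: a_inv_def)
    then have "(K #>\<^bsub>FG\<^esub> c) \<oplus>\<^bsub>TM\<^esub> (K #>\<^bsub>FG\<^esub> (- d)) \<in> H" using subgroup.m_closed[OF sub c(2)] by simp
    then show ?thesis using TM_add[OF c(1) d'] FG_diff[OF c(1) d(1)] by (simp add: H0_def)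
  qed
  moreover have "ext s c \<in> H0" if "s \<in> carrier S" "c \<in> H0" for s c
    using that sm[of s "K #>\<^bsub>FG\<^esub> c"] TM_smult[of s c] ext_FG[of s c] unfolding H0_def by auto
  ultimately have H0: "c \<in> H0 \<Longrightarrow> c \<notin> K \<Longrightarrow> carrier FG \<subseteq> H0" for c
    using max[of H0 c] unfolding H0_def by blast
  show "H = {\<zero>\<^bsub>TM\<^esub>} \<or> H = carrier TM"
  proof (cases "H0 \<subseteq> K")
    case True
    have "x = \<zero>\<^bsub>TM\<^esub>" if x: "x \<in> H" for x
    proof -
      obtain c where c: "c \<in> carrier FG" "x = K #>\<^bsub>FG\<^esub> c" using x HT unfolding TM_carrier by blast
      then have "c \<in> K" using x True unfolding H0_def by blast
      then show ?thesis unfolding c(2) TM_zero' using coset_eq_iff[OF c(1), of 0] by simp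
    qed
    then show ?thesis using zero by blast
  next
    case False
    then have "carrier FG \<subseteq> H0" using H0 by blast
    then have "carrier TM \<subseteq> H" unfolding TM_carrier H0_def by blast
    then show ?thesis using HT by blast
  qed
qed

text \<open>A balanced biadditive map extends additively to the free abelian group and kills the
  relations; a nonzero value certifies a nonzero pure tensor.\<close>

lemma not_in_K:
  fixes \<beta> :: "'a \<Rightarrow> 'b \<Rightarrow> complex"
  assumes add1: "\<And>x x' y. x \<in> carrier M \<Longrightarrow> x' \<in> carrier M \<Longrightarrow> y \<in> carrier N \<Longrightarrow> \<beta> (x \<oplus>\<^bsub>M\<^esub> x') y = \<beta> x y + \<beta> x' y"
    and add2: "\<And>x y y'. x \<in> carrier M \<Longrightarrow> y \<in> carrier N \<Longrightarrow> y' \<in> carrier N \<Longrightarrow> \<beta> x (y \<oplus>\<^bsub>N\<^esub> y') = \<beta> x y + \<beta> x y'"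
    and bal: "\<And>r x y. r \<in> carrier R \<Longrightarrow> x \<in> carrier M \<Longrightarrow> y \<in> carrier N \<Longrightarrow> \<beta> (r \<odot>\<^bsub>M\<^esub> x) y = \<beta> x (r \<odot>\<^bsub>N\<^esub> y)"
    and nz: "\<beta> x0 y0 \<noteq> 0"
  shows "frag_of (x0, y0) \<notin> K"
proof
  define F where "F c = (\<Sum>k\<in>Poly_Mapping.keys c. of_int (Poly_Mapping.lookup c k) * \<beta> (fst k) (snd k))" for c
  \<comment> \<open>The sum may run over any finite set containing the keys, which gives several
    elements a common index set.\<close>
  have F: "F c = (\<Sum>k\<in>A. of_int (Poly_Mapping.lookup c k) * \<beta> (fst k) (snd k))"
    if "finite A" "Poly_Mapping.keys c \<subseteq> A" for c A
    unfolding F_def using that by (intro sum.mono_neutral_left) (auto simp: in_keys_iff)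
  have diff: "F (c - d) = F c - F d" for c d
    using F[of "Poly_Mapping.keys c \<union> Poly_Mapping.keys d" c] F[of "Poly_Mapping.keys c \<union> Poly_Mapping.keys d" d]
      F[of "Poly_Mapping.keys c \<union> Poly_Mapping.keys d" "c - d"] keys_diff[of c d]
    by (simp add: lookup_minus sum_subtractf algebra_simps)
  have zero: "F 0 = 0" by (simp add: F_def)
  have add: "F (c + d) = F c + F d" for c d
    using diff[of c "- d"] diff[of 0 d] zero by simp
  have sing: "F (frag_of (x, y)) = \<beta> x y" for x y
    by (simp add: F_def)
  have g: "F h = 0" if "h \<in> gens" for h
    using that unfolding gens_def by (auto simp: diff sing add1 add2 bal)
  have "F c = 0" if "c \<in> K" for c
    using that unfolding K_eq
  proof (induction rule: generate.induct)
    case (inv h)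
    then have "h \<in> carrier FG" using gens_FG by blast
    then have "inv\<^bsub>FG\<^esub> h = - h" by simp
    then show ?case using diff[of 0 h] g[OF inv] zero by simp
  qed (simp_all add: zero g add)
  moreover assume "frag_of (x0, y0) \<in> K"
  ultimately show False using sing nz by metis
qed

end

subsection \<open>Gram matrices of powers of the parameter\<close>

text \<open>In the Leibniz formula the diagonal contributes \<open>\<delta>\<close> to the power \<open>\<Sum>p\<in>H. N p\<close> and every other
  permutation a strictly smaller power, so the determinant is a monic polynomial in \<open>\<delta>\<close>.\<close>

lemma finite_singular_parameters:
  fixes H :: "'h set" and N :: "'h \<Rightarrow> nat" and e :: "'h \<Rightarrow> 'h \<Rightarrow> nat" and P :: "'h \<Rightarrow> 'h \<Rightarrow> bool"
  assumes fin: "finite H" and diag: "\<And>p. p \<in> H \<Longrightarrow> P p p \<and> e p p = N p"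
    and off: "\<And>p q. p \<in> H \<Longrightarrow> q \<in> H \<Longrightarrow> p \<noteq> q \<Longrightarrow> P q p \<Longrightarrow> 2 * e q p < N q + N p"
  shows "finite {\<delta> :: complex. \<exists>v. (\<exists>p\<in>H. v p \<noteq> 0) \<and>
    (\<forall>q\<in>H. (\<Sum>p\<in>H. (if P q p then \<delta> ^ e q p else 0) * v p) = 0)}"
proof -
  define k where "k = card H"
  obtain f where f: "bij_betw f {0..<k} H" using ex_bij_betw_nat_finite[OF fin] unfolding k_def by blast
  have fH: "f i \<in> H" if "i \<in> {0..<k}" for i using f that by (rule bij_betw_apply)
  define S where "S = (\<Sum>i=0..<k. N (f i))"
  let ?M = "mat k k (\<lambda>(i, j). if P (f i) (f j) then monom 1 (e (f i) (f j)) else 0) :: complex poly mat"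
  let ?A = "\<lambda>\<delta>. mat k k (\<lambda>(i, j). if P (f i) (f j) then \<delta> ^ e (f i) (f j) else 0) :: complex mat"
  let ?D = "det ?M"
  let ?\<Pi> = "{p. p permutes {0..<k}}"
  have D: "?D = (\<Sum>p\<in>?\<Pi>. signof p * (\<Prod>i=0..<k. if P (f i) (f (p i)) then monom 1 (e (f i) (f (p i))) else 0))"
    by (subst det_def'[of _ k]) (auto intro!: sum.cong arg_cong2[of _ _ _ _ "(*)"] prod.cong dest: permutes_in_image)
  have A: "det (?A \<delta>) = (\<Sum>p\<in>?\<Pi>. signof p * (\<Prod>i=0..<k. if P (f i) (f (p i)) then \<delta> ^ e (f i) (f (p i)) else 0))" for \<delta>
    by (subst det_def'[of _ k]) (auto intro!: sum.cong arg_cong2[of _ _ _ _ "(*)"] prod.cong dest: permutes_in_image)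
  have prodm: "(\<Prod>i=0..<k. if P (f i) (f (p i)) then monom 1 (e (f i) (f (p i))) else 0 :: complex poly) =
     (if \<forall>i\<in>{0..<k}. P (f i) (f (p i)) then monom 1 (\<Sum>i=0..<k. e (f i) (f (p i))) else 0)" for p
  proof (cases "\<forall>i\<in>{0..<k}. P (f i) (f (p i))")
    case True
    have "(\<Prod>i\<in>B. monom 1 (e (f i) (f (p i)))) = (monom 1 (\<Sum>i\<in>B. e (f i) (f (p i))) :: complex poly)"
      if "finite B" for B
      using that by (induction B rule: finite_induct) (simp_all add: mult_monom one_pCons monom_0)
    then show ?thesis using True by simp
  next
    case False
    then obtain j where "j \<in> {0..<k}" "\<not> P (f j) (f (p j))" by blast
    then have "(\<Prod>i=0..<k. if P (f i) (f (p i)) then monom 1 (e (f i) (f (p i))) else 0 :: complex poly) = 0"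
      by (intro prod_zero) auto
    then show ?thesis unfolding if_not_P[OF False] .
  qed
  \<comment> \<open>\<open>S\<close> is the degree of the diagonal term, and no other permutation
    reaches it.\<close>
  have "coeff ?D S = (\<Sum>p\<in>?\<Pi>. if p = id then 1 else 0)"
    unfolding D coeff_sum
  proof (rule sum.cong[OF refl])
    fix p assume p: "p \<in> ?\<Pi>"
    show "coeff (signof p * (\<Prod>i=0..<k. if P (f i) (f (p i)) then monom 1 (e (f i) (f (p i))) else 0)) S =
      (if p = id then 1 else 0 :: complex)"
    proof (cases "p = id")
      case True
      have 1: "(\<Sum>i=0..<k. e (f i) (f (p i))) = S" unfolding S_def True using diag fH by (intro sum.cong) auto
      have 2: "\<forall>i\<in>{0..<k}. P (f i) (f (p i))" unfolding True using diag fH by auto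
      have 3: "(\<Prod>i=0..<k. if P (f i) (f (p i)) then monom 1 (e (f i) (f (p i))) else 0 :: complex poly) = monom 1 S"
        unfolding prodm[of p] if_P[OF 2] 1 ..
      show ?thesis unfolding 3 using True by (simp add: sign_id)
    next
      case False
      show ?thesis
      proof (cases "\<forall>i\<in>{0..<k}. P (f i) (f (p i))")
        case True
        have pin: "p i \<in> {0..<k}" if "i \<in> {0..<k}" for i using p that permutes_in_image[of p "{0..<k}" i] by simp
        have inj: "f i = f (p i) \<longleftrightarrow> p i = i" if "i \<in> {0..<k}" for i
          using f pin[OF that] that unfolding bij_betw_def inj_on_def by metis
        have le: "2 * e (f i) (f (p i)) \<le> N (f i) + N (f (p i))" if "i \<in> {0..<k}" for i
        proof (cases "p i = i")
          case True then show ?thesis using diag[OF fH[OF that]] by simp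
        next
          case False
          then have "2 * e (f i) (f (p i)) < N (f i) + N (f (p i))"
            using off[of "f (p i)" "f i"] fH[OF pin[OF that]] fH[OF that] inj[OF that] True that by metis
          then show ?thesis by simp
        qed
        obtain j where j: "p j \<noteq> j" using False by (auto simp: fun_eq_iff)
        then have jk: "j \<in> {0..<k}" using p by (auto simp: permutes_def)
        have lt: "2 * e (f j) (f (p j)) < N (f j) + N (f (p j))"
          using off[of "f (p j)" "f j"] fH[OF pin[OF jk]] fH[OF jk] inj[OF jk] True jk j by metis
        \<comment> \<open>Each diagonal exponent is counted once through \<open>i\<close> and once
          through \<open>p i\<close>, so the bounds add up to \<open>2 * S\<close>; one moved index
          makes the inequality strict.\<close>
        have "(\<Sum>i=0..<k. 2 * e (f i) (f (p i))) < (\<Sum>i=0..<k. N (f i) + N (f (p i)))"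
          using le lt jk by (intro sum_strict_mono_ex1) auto
        also have "\<dots> = S + (\<Sum>i=0..<k. N (f (p i)))" by (simp add: sum.distrib S_def)
        also have "(\<Sum>i=0..<k. N (f (p i))) = S"
          unfolding S_def using p by (intro sum.permute[of p "{0..<k}" "\<lambda>i. N (f i)", unfolded comp_def, symmetric]) simp
        finally have "2 * (\<Sum>i=0..<k. e (f i) (f (p i))) < 2 * S" by (simp add: sum_distrib_left)
        then have "coeff (monom (1::complex) (\<Sum>i=0..<k. e (f i) (f (p i)))) S = 0" by simp
        then show ?thesis using True False unfolding prodm by (simp add: sign_def)
      next
        case False
        show ?thesis unfolding prodm if_not_P[OF False] using \<open>p \<noteq> id\<close> by simp
      qed
    qed
  qed
  also have "\<dots> = 1" by (simp add: finite_permutations permutes_id)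
  finally have "?D \<noteq> 0" by auto
  then have "finite {\<delta>. poly ?D \<delta> = 0}" by (rule poly_roots_finite)
  moreover have "poly ?D \<delta> = 0" if v: "\<exists>p\<in>H. v p \<noteq> 0" and z: "\<forall>q\<in>H. (\<Sum>p\<in>H. (if P q p then \<delta> ^ e q p else 0) * v p) = 0"
    for \<delta> and v :: "'h \<Rightarrow> complex"
  proof -
    have "poly ?D \<delta> = det (?A \<delta>)"
      unfolding D A poly_sum poly_mult poly_prod
      by (intro sum.cong refl arg_cong2[of _ _ _ _ "(*)"] prod.cong) (auto simp: poly_monom sign_def)
    also have "det (?A \<delta>) = 0"
    proof -
      \<comment> \<open>The kernel vector is transported along the enumeration of
        \<open>H\<close>.\<close>
      let ?v = "vec k (\<lambda>i. v (f i))"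
      have "?A \<delta> *\<^sub>v ?v = 0\<^sub>v k"
      proof (rule eq_vecI)
        fix i assume "i < dim_vec (0\<^sub>v k :: complex vec)"
        then have i: "i \<in> {0..<k}" by simp
        have "(?A \<delta> *\<^sub>v ?v) $ i = (\<Sum>j=0..<k. (if P (f i) (f j) then \<delta> ^ e (f i) (f j) else 0) * v (f j))"
          using i by (simp add: scalar_prod_def)
        also have "\<dots> = (\<Sum>p\<in>H. (if P (f i) p then \<delta> ^ e (f i) p else 0) * v p)"
          by (rule sum.reindex_bij_betw[OF f])
        also have "\<dots> = 0" using z fH[OF i] by blast
        finally show "(?A \<delta> *\<^sub>v ?v) $ i = 0\<^sub>v k $ i" using i by simp
      qed simp
      moreover have "?v \<noteq> 0\<^sub>v k"
      proof
        assume 0: "?v = 0\<^sub>v k"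
        obtain p where p: "p \<in> H" "v p \<noteq> 0" using v by blast
        then obtain i where i: "i \<in> {0..<k}" "p = f i" using f unfolding bij_betw_def by blast
        have "?v $ i = 0\<^sub>v k $ i" unfolding 0 ..
        then show False using i p by simp
      qed
      ultimately show ?thesis by (subst det_0_iff_vec_prod_zero_field[of _ k]) (auto intro!: exI[of _ ?v])
    qed
    finally show ?thesis .
  qed
  ultimately show ?thesis by (elim finite_subset[rotated]) blast
qed

subsection \<open>Combinatorics of the half basis\<close>

context
  fixes l n :: nat and m :: "nat \<Rightarrow> nat"
  assumes l: "l \<ge> 1" and m: "m \<in> gamma l n"
begin

abbreviation "HB \<equiv> half_basis l n m"
abbreviation "ra \<equiv> permute_blocks l m"
abbreviation "am \<equiv> a_diag l n m"
abbreviation "SGr \<equiv> sym_product l m"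

lemmas H_iff = half_basis_iff[OF l m]
lemmas H_tonal = half_basis_tonal[OF l m]
lemmas fBk = famB[OF l m]

lemma group_SGr: "group SGr"
  unfolding sym_product_def by (intro product_group sym_group_is_group)

lemma SGr_iff: "\<sigma> \<in> carrier SGr \<longleftrightarrow> \<sigma> \<in> (\<Pi>\<^sub>E i\<in>{1..l}. {p. p permutes {1..m i}})"
  by (simp add: sym_product_def sym_group_def)

lemma SGr_mult: "\<sigma> \<otimes>\<^bsub>SGr\<^esub> \<tau> = (\<lambda>i\<in>{1..l}. \<sigma> i \<circ> \<tau> i)"
  by (simp add: sym_product_def sym_group_def)

lemma SGr_one: "\<one>\<^bsub>SGr\<^esub> = (\<lambda>i\<in>{1..l}. id)"
  by (simp add: sym_product_def sym_group_def)

lemma hdiag_cong: "(\<And>x. x \<in> idx l m \<Longrightarrow> T x = T' x) \<Longrightarrow> hdiag l n m T U = hdiag l n m T' U"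
  unfolding hdiag_def[OF l m] mk_def by (intro arg_cong2[of _ _ _ _ "(\<union>)"] image_cong refl) auto

lemma ra_H: "h \<in> HB \<Longrightarrow> \<sigma> \<in> carrier SGr \<Longrightarrow> ra h \<sigma> \<in> HB"
  unfolding H_iff using permute_blocks_hdiag[OF l m] half_data_perm[OF l m] by blast

lemma ra_ra:
  assumes "h \<in> HB" "\<sigma> \<in> carrier SGr" "\<tau> \<in> carrier SGr"
  shows "ra (ra h \<sigma>) \<tau> = ra h (\<sigma> \<otimes>\<^bsub>SGr\<^esub> \<tau>)"
proof -
  obtain T U where h: "half_data l n m T U" "h = hdiag l n m T U" using assms(1) unfolding H_iff by blast
  have st: "\<sigma> \<otimes>\<^bsub>SGr\<^esub> \<tau> \<in> carrier SGr" using group.subgroup_self[OF group_SGr] assms(2,3)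
    by (simp add: subgroup.m_closed)
  show ?thesis
    unfolding h(2) permute_blocks_hdiag[OF l m h(1) assms(2)] permute_blocks_hdiag[OF l m half_data_perm[OF l m h(1) assms(2)] assms(3)]
      permute_blocks_hdiag[OF l m h(1) st]
    by (rule hdiag_cong) (auto simp: perm_idx_def SGr_mult idx_def)
qed

lemma ra_one: "h \<in> HB \<Longrightarrow> ra h \<one>\<^bsub>SGr\<^esub> = h"
proof -
  assume "h \<in> HB"
  then obtain T U where h: "half_data l n m T U" "h = hdiag l n m T U" unfolding H_iff by blast
  have 1: "\<one>\<^bsub>SGr\<^esub> \<in> carrier SGr" using group.is_monoid[OF group_SGr] by (rule monoid.one_closed)
  show ?thesis unfolding h(2) permute_blocks_hdiag[OF l m h(1) 1]
    by (rule hdiag_cong) (auto simp: perm_idx_def SGr_one idx_def)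
qed

lemma SGr_closed:
  "\<sigma> \<in> carrier SGr \<Longrightarrow> \<tau> \<in> carrier SGr \<Longrightarrow> \<sigma> \<otimes>\<^bsub>SGr\<^esub> \<tau> \<in> carrier SGr"
  "\<sigma> \<in> carrier SGr \<Longrightarrow> inv\<^bsub>SGr\<^esub> \<sigma> \<in> carrier SGr" "\<one>\<^bsub>SGr\<^esub> \<in> carrier SGr"
  "\<sigma> \<in> carrier SGr \<Longrightarrow> \<sigma> \<otimes>\<^bsub>SGr\<^esub> inv\<^bsub>SGr\<^esub> \<sigma> = \<one>\<^bsub>SGr\<^esub>" "\<sigma> \<in> carrier SGr \<Longrightarrow> inv\<^bsub>SGr\<^esub> \<sigma> \<otimes>\<^bsub>SGr\<^esub> \<sigma> = \<one>\<^bsub>SGr\<^esub>"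
proof -
  interpret group SGr by (rule group_SGr)
  show "\<sigma> \<in> carrier SGr \<Longrightarrow> \<tau> \<in> carrier SGr \<Longrightarrow> \<sigma> \<otimes>\<^bsub>SGr\<^esub> \<tau> \<in> carrier SGr"
    "\<sigma> \<in> carrier SGr \<Longrightarrow> inv\<^bsub>SGr\<^esub> \<sigma> \<in> carrier SGr" "\<one>\<^bsub>SGr\<^esub> \<in> carrier SGr"
    "\<sigma> \<in> carrier SGr \<Longrightarrow> \<sigma> \<otimes>\<^bsub>SGr\<^esub> inv\<^bsub>SGr\<^esub> \<sigma> = \<one>\<^bsub>SGr\<^esub>" "\<sigma> \<in> carrier SGr \<Longrightarrow> inv\<^bsub>SGr\<^esub> \<sigma> \<otimes>\<^bsub>SGr\<^esub> \<sigma> = \<one>\<^bsub>SGr\<^esub>"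
    by simp_all
qed

lemma ra_inv:
  assumes "h \<in> HB" "\<sigma> \<in> carrier SGr"
  shows "ra (ra h \<sigma>) (inv\<^bsub>SGr\<^esub> \<sigma>) = h" "ra (ra h (inv\<^bsub>SGr\<^esub> \<sigma>)) \<sigma> = h"
  using ra_ra[OF assms(1,2) SGr_closed(2)[OF assms(2)]] ra_ra[OF assms(1) SGr_closed(2)[OF assms(2)] assms(2)]
  by (simp_all add: SGr_closed assms ra_one)

lemma ra_bij: "\<sigma> \<in> carrier SGr \<Longrightarrow> bij_betw (\<lambda>h. ra h \<sigma>) HB HB"
  by (rule bij_betw_byWitness[where f'="\<lambda>h. ra h (inv\<^bsub>SGr\<^esub> \<sigma>)"]) (auto simp: ra_inv ra_H SGr_closed)

text \<open>The blocks of \<open>am\<close> are distinct, so the permuted upper half shows where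
  each label went; outside \<open>{1..m i}\<close> the permutations are the identity.\<close>

lemma ra_am_inj:
  assumes s: "\<sigma> \<in> carrier SGr" "\<tau> \<in> carrier SGr" "ra am \<sigma> = ra am \<tau>"
  shows "\<sigma> = \<tau>"
proof -
  note hb = half_data_blk[OF l m]
  have e: "hdiag l n m (blk l m \<circ> perm_idx \<sigma>) (rest l n m) = hdiag l n m (blk l m \<circ> perm_idx \<tau>) (rest l n m)"
    using s(3) unfolding a_hdiag[OF l m] permute_blocks_hdiag[OF l m hb s(1)] permute_blocks_hdiag[OF l m hb s(2)] .
  have ij: "\<sigma> i j = \<tau> i j" if "(i, j) \<in> idx l m" for i j
  proof -
    have b: "blk l m (perm_idx \<sigma> (i, j)) = blk l m (perm_idx \<tau> (i, j))"
      using hdiag_inject[OF l m half_data_perm[OF l m hb s(1)] half_data_perm[OF l m hb s(2)] e that] by simp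
    have p: "perm_idx \<sigma> (i, j) \<in> idx l m" "perm_idx \<tau> (i, j) \<in> idx l m"
      using bij_betw_apply[OF perm_idx_bij[OF l m s(1)] that] bij_betw_apply[OF perm_idx_bij[OF l m s(2)] that] by auto
    have "perm_idx \<sigma> (i, j) = perm_idx \<tau> (i, j)"
      using fam_tableau_tuples[OF fBk p] fam_ne[OF fBk p(1)] b by blast
    then show ?thesis by (simp add: perm_idx_def)
  qed
  show ?thesis
  proof (rule extensionalityI[of _ "{1..l}"])
    show "\<sigma> \<in> extensional {1..l}" "\<tau> \<in> extensional {1..l}" using s(1,2) unfolding SGr_iff by (auto simp: PiE_iff)
    fix i assume i: "i \<in> {1..l}"
    have p: "\<sigma> i permutes {1..m i}" "\<tau> i permutes {1..m i}" using s(1,2) i unfolding SGr_iff by auto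
    show "\<sigma> i = \<tau> i"
    proof
      fix j show "\<sigma> i j = \<tau> i j"
      proof (cases "j \<in> {1..m i}")
        case True then show ?thesis using ij[of i j] i by (simp add: idx_def)
      next
        case False then show ?thesis using permutes_not_in[OF p(1)] permutes_not_in[OF p(2)] by simp
      qed
    qed
  qed
qed

text \<open>Relabelling the propagating parts of \<open>h\<close> along \<sigma> makes its lower
  half agree, label by label, with the upper half of \<open>ra am \<sigma>\<close>; then
  \<open>compose_mk\<close> applies.\<close>

lemma
  assumes h: "h \<in> HB" and s: "\<sigma> \<in> carrier SGr"
  shows compose_ra_am: "compose n n n h (ra am \<sigma>) = ra h \<sigma>"
    and loops_ra_am: "loops n n n h (ra am \<sigma>) = card (rest l n m)"
proof -
  obtain T U where TU: "half_data l n m T U" "h = hdiag l n m T U" using h unfolding H_iff by blast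
  have f: "fam (idx l m) T U {1..n}" using TU(1) by (simp add: half_data_def[OF l m])
  note b = perm_idx_bij[OF l m s]
  let ?p = "perm_idx \<sigma>"
  have h': "h = mk (idx l m) (T \<circ> ?p) (blk l m \<circ> ?p) U (rest l n m)"
    unfolding TU(2) hdiag_def[OF l m] mk_reindex[OF b] ..
  have a': "ra am \<sigma> = mk (idx l m) (blk l m \<circ> ?p) (blk l m) (rest l n m) (rest l n m)"
  proof -
    have "ra am \<sigma> = hdiag l n m (blk l m \<circ> ?p) (rest l n m)"
      unfolding a_hdiag[OF l m] by (rule permute_blocks_hdiag[OF l m half_data_blk[OF l m] s])
    then show ?thesis by (simp only: hdiag_def[OF l m])
  qed
  have r: "ra h \<sigma> = mk (idx l m) (T \<circ> ?p) (blk l m) U (rest l n m)"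
  proof -
    have "ra h \<sigma> = hdiag l n m (T \<circ> ?p) U" unfolding TU(2) by (rule permute_blocks_hdiag[OF l m TU(1) s])
    then show ?thesis by (simp only: hdiag_def[OF l m])
  qed
  note ff = fam_reindex[OF f b] fam_reindex[OF fBk b] fBk
  show "compose n n n h (ra am \<sigma>) = ra h \<sigma>" unfolding a' r unfolding h' by (rule compose_mk[OF ff])
  show "loops n n n h (ra am \<sigma>) = card (rest l n m)" unfolding a' unfolding h' by (rule loops_mk[OF ff])
qed

lemma compose_am: "h \<in> HB \<Longrightarrow> compose n n n h am = h" "h \<in> HB \<Longrightarrow> loops n n n h am = card (rest l n m)"
  using compose_ra_am[OF _ SGr_closed(3)] loops_ra_am[OF _ SGr_closed(3)] ra_one ra_one[OF a_half_basis[OF l m]] by simp_all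

lemma nprop_H: "h \<in> HB \<Longrightarrow> nprop h = (\<Sum>k=1..l. m k)"
proof -
  assume h: "h \<in> HB"
  then have "prop_vec l h = m" by (simp add: half_basis_def)
  then show ?thesis using nprop_prop_vec[OF l tonal_diagrams[OF H_tonal[OF h]]] by simp
qed

text \<open>A left multiple with the full number of propagating parts has an unchanged bottom row,
  and tonality then puts it back into the half basis.\<close>

lemma nprop_compose_H:
  assumes "x \<in> tonal l n" "h \<in> HB" "compose n n n x h \<notin> HB"
  shows "nprop (compose n n n x h) < (\<Sum>k=1..l. m k)"
proof (rule ccontr)
  assume contr: "\<not> ?thesis"
  note d = tonal_diagrams[OF assms(1)] tonal_diagrams[OF H_tonal[OF assms(2)]]
  have "nprop (compose n n n x h) = nprop h"
    using nprop_compose_right[OF d] nprop_H[OF assms(2)] contr by simp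
  then have e: "bottom_restriction (compose n n n x h) = bottom_restriction h" "nonprop_bottom (compose n n n x h) = nonprop_bottom h"
    using bottom_restriction_compose[OF d] nonprop_bottom_compose[OF d] by simp_all
  have "bottom_restriction h = bottom_restriction am" "nonprop_bottom h = nonprop_bottom am"
    using assms(2) by (auto simp: half_basis_def)
  then have "\<exists>T U. half_data l n m T U \<and> compose n n n x h = hdiag l n m T U"
    using half_basisI[OF l m compose_tonal[OF assms(1) H_tonal[OF assms(2)]]] e by simp
  then show False using assms(3) H_iff by blast
qed

text \<open>Writing \<open>ra h \<sigma>\<close> as \<open>h\<close> composed with
  \<open>ra am \<sigma>\<close> reduces both claims to associativity. Composing with
  \<open>ra am \<sigma>\<close> closes the same \<open>card (rest l n m)\<close> loops on either
  side, and these cancel.\<close>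

lemma
  assumes x: "x \<in> tonal l n" and h: "h \<in> HB" and c: "compose n n n x h \<in> HB" and s: "\<sigma> \<in> carrier SGr"
  shows compose_ra: "compose n n n x (ra h \<sigma>) = ra (compose n n n x h) \<sigma>"
    and loops_ra: "loops n n n x (ra h \<sigma>) = loops n n n x h"
proof -
  note d = tonal_diagrams[OF x] tonal_diagrams[OF H_tonal[OF h]] tonal_diagrams[OF H_tonal[OF ra_H[OF a_half_basis[OF l m] s]]]
  show "compose n n n x (ra h \<sigma>) = ra (compose n n n x h) \<sigma>"
    using compose_assoc[OF d] by (simp add: compose_ra_am[OF h s] compose_ra_am[OF c s])
  show "loops n n n x (ra h \<sigma>) = loops n n n x h"
    using loops_assoc[OF d] by (simp add: compose_ra_am[OF h s] loops_ra_am[OF h s] loops_ra_am[OF c s])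
qed

lemma compose_ra_H_iff:
  assumes x: "x \<in> tonal l n" and h: "h \<in> HB" and s: "\<sigma> \<in> carrier SGr"
  shows "compose n n n x (ra h \<sigma>) \<in> HB \<longleftrightarrow> compose n n n x h \<in> HB"
proof
  assume "compose n n n x h \<in> HB"
  then show "compose n n n x (ra h \<sigma>) \<in> HB" using compose_ra[OF x h _ s] ra_H s by simp
next
  assume "compose n n n x (ra h \<sigma>) \<in> HB"
  then show "compose n n n x h \<in> HB"
    using compose_ra[OF x ra_H[OF h s] _ SGr_closed(2)[OF s]] ra_H[OF _ SGr_closed(2)[OF s]] ra_inv(1)[OF h s] by metis
qed

text \<open>Both halves now consist of the blocks of \<open>am\<close>. Their sizes lie in
  \<open>{1..l}\<close>, so tonality lets a block be joined only to one of equal size, and the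
  matching is a family of permutations, one per size.\<close>

lemma flip_H_ra:
  assumes h: "h \<in> HB" and fh: "flip h \<in> HB"
  shows "\<exists>\<sigma>\<in>carrier SGr. h = ra am \<sigma>"
proof -
  let ?J = "idx l m" and ?B = "blk l m" and ?R = "rest l n m"
  obtain T U where TU: "half_data l n m T U" "h = hdiag l n m T U" using h unfolding H_iff by blast
  have f: "fam ?J T U {1..n}" and cT: "\<And>x. x \<in> ?J \<Longrightarrow> [card (T x) = fst x] (mod l)"
    using TU(1) by (auto simp: half_data_def[OF l m])
  have fl: "flip h = mk ?J ?B T ?R U" unfolding TU(2) hdiag_def[OF l m] by (rule flip_mk)
  have am': "am = mk ?J ?B ?B ?R ?R" unfolding a_hdiag[OF l m] hdiag_def[OF l m] ..
  have br: "(\<lambda>j. Bot ` T j) ` ?J \<union> (`) Bot ` U = (\<lambda>j. Bot ` ?B j) ` ?J \<union> (`) Bot ` ?R"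
    using fh unfolding half_basis_def fl am' by (simp add: bottom_restriction_mk[OF fBk f] bottom_restriction_mk[OF fBk fBk])
  have nb: "(`) Bot ` U = (`) Bot ` ?R"
    using fh unfolding half_basis_def fl am' by (simp add: nonprop_bottom_mk[OF fBk f] nonprop_bottom_mk[OF fBk fBk])
  have injB: "Bot ` X = Bot ` Y \<longleftrightarrow> X = Y" for X Y :: "nat set" by (simp add: inj_image_eq_iff inj_def)
  have UR: "U = ?R"
  proof (rule Set.set_eqI)
    fix u
    have "u \<in> U \<longleftrightarrow> Bot ` u \<in> (`) Bot ` U" "u \<in> ?R \<longleftrightarrow> Bot ` u \<in> (`) Bot ` ?R" by (auto simp: injB)
    then show "u \<in> U \<longleftrightarrow> u \<in> ?R" using nb by simp
  qed
  have "\<exists>y\<in>?J. T x = ?B y" if x: "x \<in> ?J" for x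
  proof -
    have "Bot ` T x \<in> (\<lambda>j. Bot ` ?B j) ` ?J \<union> (`) Bot ` ?R" unfolding br[symmetric] using x by blast
    moreover have "T x \<notin> ?R" using fam_TU[OF f x, of "T x"] fam_ne[OF f x] unfolding UR by blast
    ultimately show ?thesis by (auto simp: injB)
  qed
  then obtain \<pi> where \<pi>: "\<And>x. x \<in> ?J \<Longrightarrow> \<pi> x \<in> ?J \<and> T x = ?B (\<pi> x)" by metis
  have f1: "fst (\<pi> x) = fst x" if x: "x \<in> ?J" for x
    using cT[OF x] \<pi>[OF x] cong_l_iff[OF J_fst[OF l m] J_fst[OF l m], of "\<pi> x" x] x by simp
  have inj: "x = y" if "x \<in> ?J" "y \<in> ?J" "\<pi> x = \<pi> y" for x y
    using fam_tableau_tuples[OF f that(1,2)] fam_ne[OF f that(1)] \<pi>[OF that(1)] \<pi>[OF that(2)] that(3) by auto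
  define \<sigma> where "\<sigma> = (\<lambda>i\<in>{1..l}. \<lambda>j. if j \<in> {1..m i} then snd (\<pi> (i, j)) else j)"
  have "\<sigma> i permutes {1..m i}" if i: "i \<in> {1..l}" for i
  proof (rule bij_imp_permutes)
    have J: "(i, j) \<in> ?J \<longleftrightarrow> j \<in> {1..m i}" for j using i by (simp add: idx_def)
    have in1: "snd (\<pi> (i, j)) \<in> {1..m i}" if j: "j \<in> {1..m i}" for j
    proof -
      have ij: "(i, j) \<in> ?J" using j J by blast
      have "\<pi> (i, j) = (i, snd (\<pi> (i, j)))" using f1[OF ij] by (simp add: prod_eq_iff)
      then show ?thesis using \<pi>[OF ij] J by metis
    qed
    have "inj_on (\<lambda>j. snd (\<pi> (i, j))) {1..m i}"
    proof (rule inj_onI)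
      fix j j' assume j: "j \<in> {1..m i}" "j' \<in> {1..m i}" "snd (\<pi> (i, j)) = snd (\<pi> (i, j'))"
      then have ij: "(i, j) \<in> ?J" "(i, j') \<in> ?J" using J by blast+
      have "\<pi> (i, j) = \<pi> (i, j')" using f1[OF ij(1)] f1[OF ij(2)] j(3) by (simp add: prod_eq_iff)
      then show "j = j'" using inj[OF ij] by simp
    qed
    moreover have "(\<lambda>j. snd (\<pi> (i, j))) ` {1..m i} \<subseteq> {1..m i}" using in1 by blast
    ultimately have "bij_betw (\<lambda>j. snd (\<pi> (i, j))) {1..m i} {1..m i}" by (simp add: bij_betw_def endo_inj_surj)
    then show "bij_betw (\<sigma> i) {1..m i} {1..m i}"
      by (subst bij_betw_cong[where g="\<lambda>j. snd (\<pi> (i, j))"]) (use i in \<open>auto simp: \<sigma>_def\<close>)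
  qed (use i in \<open>auto simp: \<sigma>_def\<close>)
  then have s: "\<sigma> \<in> carrier SGr" unfolding SGr_iff by (auto simp: \<sigma>_def)
  have "T x = (?B \<circ> perm_idx \<sigma>) x" if x: "x \<in> ?J" for x
  proof -
    obtain i j where ij: "x = (i, j)" "i \<in> {1..l}" "j \<in> {1..m i}" using x by (auto simp: idx_def)
    then have "perm_idx \<sigma> x = (i, snd (\<pi> x))" by (simp add: perm_idx_def \<sigma>_def)
    also have "\<dots> = \<pi> x" using f1[OF x] ij(1) by (cases "\<pi> x") simp
    finally have "perm_idx \<sigma> x = \<pi> x" .
    then show ?thesis using \<pi>[OF x] by simp
  qed
  then have "h = ra am \<sigma>"
    unfolding TU(2) a_hdiag[OF l m] permute_blocks_hdiag[OF l m half_data_blk[OF l m] s] UR by (rule hdiag_cong)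
  then show ?thesis using s by blast
qed

text \<open>The reflected product is \<open>flip p\<close> composed with \<open>q\<close>.
  Reflection keeps the number of propagating parts, so this product is in the half basis
  too.\<close>

lemma compose_flip_H:
  assumes q: "q \<in> HB" and p: "p \<in> HB" and c: "compose n n n (flip q) p \<in> HB"
  shows "\<exists>\<sigma>\<in>carrier SGr. compose n n n (flip q) p = ra am \<sigma>"
proof (rule flip_H_ra[OF c])
  note d = flip_diagrams[OF tonal_diagrams[OF H_tonal[OF q]]] tonal_diagrams[OF H_tonal[OF p]]
  have e: "flip (compose n n n (flip q) p) = compose n n n (flip p) q" using compose_flip[OF d] by simp
  have "nprop (flip (compose n n n (flip q) p)) = (\<Sum>k=1..l. m k)" using nprop_H[OF c] by (simp add: nprop_flip)
  then show "flip (compose n n n (flip q) p) \<in> HB"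
    using nprop_compose_H[OF flip_tonal[OF H_tonal[OF p]] q] unfolding e by fastforce
qed

section \<open>Exponents of the Gram matrix\<close>

definition "ntop p = card {s \<in> p. s \<inter> range Bot = {}}"

lemma ntop_hdiag:
  assumes "half_data l n m T U"
  shows "ntop (hdiag l n m T U) = card U"
proof -
  have f: "fam (idx l m) T U {1..n}" using assms by (simp add: half_data_def[OF l m])
  have "{s \<in> hdiag l n m T U. s \<inter> range Bot = {}} = (`) Top ` U"
  proof
    show "{s \<in> hdiag l n m T U. s \<inter> range Bot = {}} \<subseteq> (`) Top ` U"
      using fam_ne[OF fBk] fam_ne'[OF fBk] by (auto simp: hdiag_def[OF l m] mk_def)
    show "(`) Top ` U \<subseteq> {s \<in> hdiag l n m T U. s \<inter> range Bot = {}}"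
      by (auto simp: hdiag_def[OF l m] mk_def)
  qed
  then show ?thesis by (simp add: ntop_def card_image inj_on_def inj_image_eq_iff)
qed

text \<open>The middle rows of \<open>flip p\<close> and \<open>p\<close> are mirror images, so
  labelled blocks meet their own copies and each unlabelled top block closes one loop.\<close>

lemma
  assumes p: "p \<in> HB"
  shows compose_flip_self: "compose n n n (flip p) p = am" and loops_flip_self: "loops n n n (flip p) p = ntop p"
proof -
  obtain T U where TU: "half_data l n m T U" "p = hdiag l n m T U" using p unfolding H_iff by blast
  have f: "fam (idx l m) T U {1..n}" using TU(1) by (simp add: half_data_def[OF l m])
  have e: "flip p = mk (idx l m) (blk l m) T (rest l n m) U" unfolding TU(2) hdiag_def[OF l m] by (rule flip_mk)
  have e': "p = mk (idx l m) T (blk l m) U (rest l n m)" unfolding TU(2) hdiag_def[OF l m] ..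
  have a: "am = mk (idx l m) (blk l m) (blk l m) (rest l n m) (rest l n m)" unfolding a_hdiag[OF l m] hdiag_def[OF l m] ..
  show "compose n n n (flip p) p = am" unfolding e a unfolding e' by (rule compose_mk[OF fBk f fBk])
  have "loops n n n (flip p) p = card U" unfolding e unfolding e' by (rule loops_mk[OF fBk f fBk])
  then show "loops n n n (flip p) p = ntop p" using ntop_hdiag[OF TU(1)] TU(2) by simp
qed

text \<open>A component inside the middle row avoids every \<open>T x\<close>, since it would
  otherwise reach the bottom row through that part; so it is made up of sets from \<open>U\<close>.
  If there are as many such components as sets, each consists of a single set.\<close>

lemma flip_loops_aux:
  assumes hd: "half_data l n m T U" "half_data l n m T' U'"
  defines "S \<equiv> stack n n n (flip (hdiag l n m T' U')) (hdiag l n m T U)"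
  shows "card {t \<in> S. t \<subseteq> range Mid} \<le> card U"
    and "card {t \<in> S. t \<subseteq> range Mid} = card U \<Longrightarrow> {t \<in> S. t \<subseteq> range Mid} = (`) Mid ` U"
proof -
  let ?J = "idx l m" and ?B = "blk l m" and ?R = "rest l n m"
  let ?p = "hdiag l n m T U" and ?q = "hdiag l n m T' U'"
  have f: "fam ?J T U {1..n}" and f': "fam ?J T' U' {1..n}" using hd by (auto simp: half_data_def[OF l m])
  have d: "flip ?q \<in> diagrams n n" "?p \<in> diagrams n n"
    unfolding hdiag_def[OF l m] using mk_diagrams[OF f fBk] flip_diagrams[OF mk_diagrams[OF f' fBk]] by auto
  have ed: "Mid ` T x \<union> Bot ` ?B x \<in> edges (flip ?q) ?p" if "x \<in> ?J" for x
  proof -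
    have "Top ` T x \<union> Bot ` ?B x \<in> ?p" using that by (auto simp: hdiag_def[OF l m] mk_def)
    then have "top_to_mid ` (Top ` T x \<union> Bot ` ?B x) \<in> edges (flip ?q) ?p" unfolding edges_def by blast
    then show ?thesis by (simp add: image_Un image_image)
  qed
  have eu: "Mid ` u \<in> edges (flip ?q) ?p" if "u \<in> U" for u
  proof -
    have "Top ` u \<in> ?p" using that by (auto simp: hdiag_def[OF l m] mk_def)
    then have "top_to_mid ` Top ` u \<in> edges (flip ?q) ?p" unfolding edges_def by blast
    then show ?thesis by (simp add: image_image)
  qed
  let ?L = "{t \<in> S. t \<subseteq> range Mid}"
  have Sc: "S = comps (edges (flip ?q) ?p)" unfolding S_def by (rule stack_eq[OF d])
  have cov: "\<exists>u\<in>U. i \<in> u \<and> Mid ` u \<subseteq> t" if t: "t \<in> ?L" "Mid i \<in> t" for t i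
  proof -
    have tS: "t \<in> comps (edges (flip ?q) ?p)" using t(1) Sc by blast
    have "i \<in> {1..n}" using stack_part[OF d, of t] t unfolding S_def by auto
    then consider x where "x \<in> ?J" "i \<in> T x" | u where "u \<in> U" "i \<in> u" using fam_cover[OF f] by blast
    then show ?thesis
    proof cases
      case 1
      have "Mid ` T x \<union> Bot ` ?B x \<subseteq> t" using comps_edge[OF tS ed[OF 1(1)]] 1(2) t(2) by blast
      then show ?thesis using fam_ne[OF fBk 1(1)] t(1) by auto
    next
      case 2
      have "Mid ` u \<subseteq> t" using comps_edge[OF tS eu[OF 2(1)]] 2(2) t(2) by blast
      then show ?thesis using 2 by blast
    qed
  qed
  have "\<exists>u\<in>U. Mid ` u \<subseteq> t" if t: "t \<in> ?L" for t
  proof -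
    obtain y where "y \<in> t" using t comps_nonempty[of t] Sc by blast
    then obtain i where "Mid i \<in> t" using t by auto
    then show ?thesis using cov[OF t] by blast
  qed
  then obtain \<psi> where \<psi>: "\<And>t. t \<in> ?L \<Longrightarrow> \<psi> t \<in> U \<and> Mid ` \<psi> t \<subseteq> t" by metis
  have share: "t = t'" if t: "t \<in> ?L" "t' \<in> ?L" "u \<in> U" "Mid ` u \<subseteq> t" "Mid ` u \<subseteq> t'" for t t' u
  proof -
    have "u \<noteq> {}" using fam_ne'[OF f] t(3) by blast
    then obtain i where "i \<in> u" by blast
    then have "Mid i \<in> t" "Mid i \<in> t'" using t(4,5) by auto
    then show ?thesis using comps_disjoint[of t "edges (flip ?q) ?p" t' "Mid i"] t(1,2) Sc by blast
  qed
  have inj: "inj_on \<psi> ?L"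
  proof (rule inj_onI)
    fix t t' assume t: "t \<in> ?L" "t' \<in> ?L" "\<psi> t = \<psi> t'"
    show "t = t'" by (rule share[OF t(1,2), of "\<psi> t"]) (use \<psi>[OF t(1)] \<psi>[OF t(2)] t(3) in auto)
  qed
  have sub: "\<psi> ` ?L \<subseteq> U" using \<psi> by blast
  have finU: "finite U"
  proof (rule finite_subset)
    show "U \<subseteq> Pow {1..n}" using fam_Union[OF f] by blast
  qed simp
  show "card ?L \<le> card U" by (rule card_inj_on_le[OF inj sub finU])
  assume "card ?L = card U"
  then have surj: "\<psi> ` ?L = U" using inj sub finU by (intro card_subset_eq) (simp_all add: card_image)
  have tm: "t = Mid ` \<psi> t" if t: "t \<in> ?L" for t
  proof
    show "Mid ` \<psi> t \<subseteq> t" using \<psi>[OF t] by blast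
    show "t \<subseteq> Mid ` \<psi> t"
    proof
      fix y assume y: "y \<in> t"
      then obtain i where i: "y = Mid i" using t by auto
      obtain u where u: "u \<in> U" "i \<in> u" "Mid ` u \<subseteq> t" using cov[OF t] y i by blast
      obtain t' where t': "t' \<in> ?L" "u = \<psi> t'" using surj u(1) by blast
      have "t = t'" using share[OF t t'(1) u(1,3)] \<psi>[OF t'(1)] t'(2) by blast
      then show "y \<in> Mid ` \<psi> t" using u(2) i t'(2) by blast
    qed
  qed
  show "?L = (`) Mid ` U"
  proof
    show "?L \<subseteq> (`) Mid ` U" using tm \<psi> by blast
    show "(`) Mid ` U \<subseteq> ?L"
    proof
      fix x assume "x \<in> (`) Mid ` U"
      then obtain u where u: "u \<in> U" "x = Mid ` u" by blast
      then obtain t where t: "t \<in> ?L" "u = \<psi> t" using surj by blast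
      then have "x = t" using tm[OF t(1)] u(2) by simp
      then show "x \<in> ?L" using t(1) by simp
    qed
  qed
qed

text \<open>The product being \<open>am\<close> itself, not a permuted copy, means that the part of
  \<open>am\<close> with label \<open>x\<close> arises from a component through both tops with that
  label.\<close>

lemma stack_flip_block:
  assumes hd: "half_data l n m T U" "half_data l n m T' U'" and x: "x \<in> idx l m"
    and c: "compose n n n (flip (hdiag l n m T' U')) (hdiag l n m T U) = am"
  shows "\<exists>t\<in>stack n n n (flip (hdiag l n m T' U')) (hdiag l n m T U).
    t - range Mid = Top ` blk l m x \<union> Bot ` blk l m x \<and> Mid ` T x \<subseteq> t \<and> Mid ` T' x \<subseteq> t"
proof -
  let ?J = "idx l m" and ?B = "blk l m" and ?R = "rest l n m"
  let ?p = "hdiag l n m T U" and ?q = "hdiag l n m T' U'"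
  have f: "fam ?J T U {1..n}" and f': "fam ?J T' U' {1..n}" using hd by (auto simp: half_data_def[OF l m])
  have d: "flip ?q \<in> diagrams n n" "?p \<in> diagrams n n"
    unfolding hdiag_def[OF l m] using mk_diagrams[OF f fBk] flip_diagrams[OF mk_diagrams[OF f' fBk]] by auto
  have "Top ` ?B x \<union> Bot ` ?B x \<in> am" using x unfolding a_hdiag[OF l m] hdiag_def[OF l m] mk_def by blast
  then obtain t where t: "t \<in> stack n n n (flip ?q) ?p" "t - range Mid = Top ` ?B x \<union> Bot ` ?B x"
    unfolding c[symmetric] compose_erase[OF d] erase_iff by metis
  have tc: "t \<in> comps (edges (flip ?q) ?p)" using t(1) stack_eq[OF d] by simp
  obtain b where b: "b \<in> ?B x" using fam_ne[OF fBk x] by blast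
  have tb: "Top b \<in> t" "Bot b \<in> t" using t(2) b by blast+
  have "Top ` T x \<union> Bot ` ?B x \<in> ?p" using x by (auto simp: hdiag_def[OF l m] mk_def)
  then have "top_to_mid ` (Top ` T x \<union> Bot ` ?B x) \<in> edges (flip ?q) ?p" unfolding edges_def by blast
  then have e1: "Mid ` T x \<union> Bot ` ?B x \<in> edges (flip ?q) ?p" by (simp add: image_Un image_image)
  have fq: "flip ?q = mk ?J ?B T' ?R U'" unfolding hdiag_def[OF l m] by (rule flip_mk)
  have "Top ` ?B x \<union> Bot ` T' x \<in> flip ?q" using x unfolding fq mk_def by blast
  then have "bot_to_mid ` (Top ` ?B x \<union> Bot ` T' x) \<in> edges (flip ?q) ?p" unfolding edges_def by blast
  then have e2: "Top ` ?B x \<union> Mid ` T' x \<in> edges (flip ?q) ?p" by (simp add: image_Un image_image)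
  have "Mid ` T x \<subseteq> t" "Mid ` T' x \<subseteq> t"
    using comps_edge[OF tc e1] comps_edge[OF tc e2] tb b by blast+
  then show ?thesis using t by blast
qed

text \<open>If the bound failed, the loop number would equal both diagonal exponents. The loops are
  then exactly the non-propagating tops of \<open>p\<close> and, in the mirror, those of
  \<open>q\<close>; comparing the remaining points gives \<open>p = q\<close>.\<close>

lemma loops_flip_less:
  assumes q: "q \<in> HB" and p: "p \<in> HB" and ne: "p \<noteq> q" and c: "compose n n n (flip q) p = am"
  shows "2 * loops n n n (flip q) p < ntop q + ntop p"
proof (rule ccontr)
  assume contr: "\<not> ?thesis"
  let ?J = "idx l m" and ?B = "blk l m"
  obtain T U where TU: "half_data l n m T U" "p = hdiag l n m T U" using p unfolding H_iff by blast
  obtain T' U' where TU': "half_data l n m T' U'" "q = hdiag l n m T' U'" using q unfolding H_iff by blast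
  have f: "fam ?J T U {1..n}" and f': "fam ?J T' U' {1..n}" using TU(1) TU'(1) by (auto simp: half_data_def[OF l m])
  note dp = tonal_diagrams[OF H_tonal[OF p]] and dq = tonal_diagrams[OF H_tonal[OF q]]
  let ?S = "stack n n n (flip q) p" and ?S' = "stack n n n (flip p) q"
  have L: "loops n n n (flip q) p = card {t \<in> ?S. t \<subseteq> range Mid}" by (rule loops_eq[OF flip_diagrams[OF dq] dp])
  have L': "loops n n n (flip q) p = card {t \<in> ?S'. t \<subseteq> range Mid}"
    using loops_eq[OF flip_diagrams[OF dp] dq] loops_flip[OF flip_diagrams[OF dq] dp] by simp
  have le: "loops n n n (flip q) p \<le> card U" unfolding L unfolding TU(2) TU'(2) by (rule flip_loops_aux(1)[OF TU(1) TU'(1)])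
  have le': "loops n n n (flip q) p \<le> card U'" unfolding L' unfolding TU(2) TU'(2) by (rule flip_loops_aux(1)[OF TU'(1) TU(1)])
  have eq: "loops n n n (flip q) p = card U" "loops n n n (flip q) p = card U'"
    using le le' contr ntop_hdiag[OF TU(1)] ntop_hdiag[OF TU'(1)] unfolding TU(2) TU'(2) by linarith+
  have M: "{t \<in> ?S. t \<subseteq> range Mid} = (`) Mid ` U"
    using flip_loops_aux(2)[OF TU(1) TU'(1)] eq(1) unfolding L unfolding TU(2) TU'(2) by blast
  have M': "{t \<in> ?S'. t \<subseteq> range Mid} = (`) Mid ` U'"
    using flip_loops_aux(2)[OF TU'(1) TU(1)] eq(2) unfolding L' unfolding TU(2) TU'(2) by blast
  have flipmid: "flip_vertex ` t = t" if "t \<subseteq> range Mid" for t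
  proof -
    have "flip_vertex ` t = id ` t" using that by (intro image_cong) auto
    then show ?thesis by simp
  qed
  \<comment> \<open>Reflection turns one stack into the other and fixes the middle row pointwise, so
    both products have the same loops as sets.\<close>
  have st: "?S' = (`) flip_vertex ` ?S"
  proof -
    have b: "bot_to_mid (flip_vertex v) = flip_vertex (top_to_mid v)" "top_to_mid (flip_vertex v) = flip_vertex (bot_to_mid v)" for v
      by (cases v; simp)+
    have "edges (flip p) q = (`) flip_vertex ` edges (flip q) p"
      unfolding edges_def flip_def image_Un image_image b by (simp add: Un_commute)
    then show ?thesis
      using comps_image[of flip_vertex "edges (flip q) p"] inj_on_subset[OF inj_flip_vertex]
      by (simp add: stack_eq[OF flip_diagrams[OF dp] dq] stack_eq[OF flip_diagrams[OF dq] dp])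
  qed
  have UU: "U = U'"
  proof -
    have sub: "flip_vertex ` t \<subseteq> range Mid \<longleftrightarrow> t \<subseteq> range Mid" for t
    proof
      assume a: "flip_vertex ` t \<subseteq> range Mid"
      show "t \<subseteq> range Mid"
      proof
        fix v assume "v \<in> t"
        then have "flip_vertex v \<in> range Mid" using a by blast
        then show "v \<in> range Mid" by (cases v) auto
      qed
    qed auto
    have "{t \<in> ?S'. t \<subseteq> range Mid} = (`) flip_vertex ` {t \<in> ?S. t \<subseteq> range Mid}"
      unfolding st using sub by auto
    also have "\<dots> = id ` {t \<in> ?S. t \<subseteq> range Mid}"
      using flipmid by (intro image_cong) auto
    also have "\<dots> = {t \<in> ?S. t \<subseteq> range Mid}" by simp
    finally have "(`) Mid ` U' = (`) Mid ` U" unfolding M M' .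
    moreover have "inj ((`) Mid)" by (auto simp: inj_def inj_image_eq_iff)
    ultimately show ?thesis by (metis inj_image_eq_iff)
  qed
  have tx: "\<exists>t\<in>?S. t - range Mid = Top ` ?B x \<union> Bot ` ?B x \<and> Mid ` T x \<subseteq> t \<and> Mid ` T' x \<subseteq> t" if "x \<in> ?J" for x
    using stack_flip_block[OF TU(1) TU'(1) that] c unfolding TU(2) TU'(2) by blast
  then obtain t where t: "\<And>x. x \<in> ?J \<Longrightarrow> t x \<in> ?S \<and> t x - range Mid = Top ` ?B x \<union> Bot ` ?B x \<and> Mid ` T x \<subseteq> t x \<and> Mid ` T' x \<subseteq> t x"
    by metis
  have tinj: "x = y" if xy: "x \<in> ?J" "y \<in> ?J" "z \<in> t x" "z \<in> t y" for x y z
  proof -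
    have "t x = t y"
      using stack_same[OF flip_diagrams[OF dq] dp conjunct1[OF t[OF xy(1)]] conjunct1[OF t[OF xy(2)]] xy(3,4)] .
    then have e: "Top ` ?B x \<union> Bot ` ?B x = Top ` ?B y \<union> Bot ` ?B y" using t[OF xy(1)] t[OF xy(2)] by metis
    have "?B x = ?B y" using arg_cong[OF e, of "\<lambda>s. Bot -` s"] by (simp add: vimage_Un)
    then show ?thesis using fam_tableau_tuples[OF fBk xy(1,2)] fam_ne[OF fBk xy(1)] by blast
  qed
  have tm: "Mid i \<in> t x" if "x \<in> ?J" "i \<in> T x" for x i
    using t[OF that(1)] that(2) by (simp add: image_subset_iff)
  have tm': "Mid i \<in> t x" if "x \<in> ?J" "i \<in> T' x" for x i
    using t[OF that(1)] that(2) by (simp add: image_subset_iff)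
  \<comment> \<open>A point of \<open>T x\<close> is not in the common set of non-propagating tops,
    so it lies in some \<open>T' y\<close>; its component carries both labels, whence
    \<open>x = y\<close>.\<close>
  have tableau_tuples: "T x = T' x" if x: "x \<in> ?J" for x
  proof
    show "T x \<subseteq> T' x"
    proof
      fix i assume i: "i \<in> T x"
      then have "i \<in> {1..n}" using fam_sub[OF f x] by blast
      then consider y where "y \<in> ?J" "i \<in> T' y" | u where "u \<in> U'" "i \<in> u" using fam_cover[OF f'] by blast
      then show "i \<in> T' x"
      proof cases
        case 1
        show ?thesis using tinj[OF x 1(1) tm[OF x i] tm'[OF 1]] 1(2) by simp
      next
        case 2 then show ?thesis using fam_TU[OF f x] i UU by blast
      qed
    qed
    show "T' x \<subseteq> T x"
    proof
      fix i assume i: "i \<in> T' x"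
      then have "i \<in> {1..n}" using fam_sub[OF f' x] by blast
      then consider y where "y \<in> ?J" "i \<in> T y" | u where "u \<in> U" "i \<in> u" using fam_cover[OF f] by blast
      then show "i \<in> T x"
      proof cases
        case 1
        show ?thesis using tinj[OF x 1(1) tm'[OF x i] tm[OF 1]] 1(2) by simp
      next
        case 2 then show ?thesis using fam_TU[OF f' x] i UU by blast
      qed
    qed
  qed
  have "p = q" unfolding TU(2) TU'(2) UU by (rule hdiag_cong) (rule tableau_tuples)
  then show False using ne by simp
qed

end

subsection \<open>The ideal, the quotient algebra and its left ideal\<close>

locale standard_data =
  fixes l n :: nat and m :: "nat \<Rightarrow> nat" and \<delta> :: complex
  assumes l: "l \<ge> 1" and m: "m \<in> gamma l n" and \<delta>: "\<delta> \<noteq> 0"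
begin

abbreviation "A \<equiv> tonal_algebra l n \<delta>"
abbreviation "IB \<equiv> ideal_below l n \<delta> m"
abbreviation "Q \<equiv> quotient_algebra l n \<delta> m"
abbreviation "cls \<equiv> quotient_class l n \<delta> m"
abbreviation "H \<equiv> half_basis l n m"
abbreviation "W \<equiv> supported_on (half_basis l n m)"
abbreviation "ad \<equiv> a_diag l n m"
abbreviation "G \<equiv> sym_product l m"
abbreviation "cc \<equiv> \<delta> ^ card (rest l n m)"
abbreviation "LM \<equiv> left_ideal l n \<delta> m"

definition "ideal_gens = {x \<otimes>\<^bsub>A\<^esub> basis_vec (a_diag l n m') \<otimes>\<^bsub>A\<^esub> y | x y m'.
          x \<in> carrier A \<and> y \<in> carrier A \<and> m' \<in> gamma l n \<and> index_less l m' m}"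

lemma IB_eq: "IB = generate (add_monoid A) ideal_gens"
  unfolding ideal_below_def ideal_gens_def by (rule refl)

lemmas As = PA_simps[of l n \<delta>]

lemma A_mult_support:
  assumes "(x \<otimes>\<^bsub>A\<^esub> y) q \<noteq> 0"
  shows "\<exists>p\<in>tonal l n. \<exists>p'\<in>tonal l n. x p \<noteq> 0 \<and> y p' \<noteq> 0 \<and> compose n n n p p' = q"
proof (rule ccontr)
  assume "\<not> ?thesis"
  then have "(x \<otimes>\<^bsub>A\<^esub> y) q = 0" unfolding As by (intro sum.neutral ballI) auto
  then show False using assms by simp
qed

lemma supported_add: "x \<in> supported_on B \<Longrightarrow> y \<in> supported_on B \<Longrightarrow> (\<lambda>p. x p + y p) \<in> supported_on B"
  by (auto simp: supported_on_def)

lemma supported_scale: "x \<in> supported_on B \<Longrightarrow> (\<lambda>p. c * x p) \<in> supported_on B"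
  by (auto simp: supported_on_def)

lemma basis_supported: "p \<in> B \<Longrightarrow> basis_vec p \<in> supported_on B"
  by (auto simp: supported_on_def basis_vec_def)

lemma H_sub_tonal: "H \<subseteq> tonal l n"
  using half_basis_tonal[OF l m] by blast

lemma W_A: "w \<in> W \<Longrightarrow> w \<in> carrier A"
  using H_sub_tonal by (auto simp: As supported_on_def)

lemma basis_A: "p \<in> tonal l n \<Longrightarrow> basis_vec p \<in> carrier A"
  by (simp add: As basis_supported)

lemma scale_A: "x \<in> carrier A \<Longrightarrow> (\<lambda>p. c * x p) \<in> carrier A"
  by (simp add: As supported_scale)

lemma ring_A: "ring A"
  by (rule PA_ring)

lemma ideal_gens_A: "ideal_gens \<subseteq> carrier A"
  unfolding ideal_gens_def using PA_mult_closed by blast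

text \<open>The ideal is defined as an additive subgroup; absorbing a scalar into the left factor of
  a generator makes it a complex subspace.\<close>

lemma ideal_gens_scale: "g \<in> ideal_gens \<Longrightarrow> (\<lambda>p. c * g p) \<in> ideal_gens"
proof -
  assume "g \<in> ideal_gens"
  then obtain x y m' where g: "g = x \<otimes>\<^bsub>A\<^esub> basis_vec (a_diag l n m') \<otimes>\<^bsub>A\<^esub> y" "x \<in> carrier A" "y \<in> carrier A"
    "m' \<in> gamma l n" "index_less l m' m" unfolding ideal_gens_def by blast
  have "(\<lambda>p. c * g p) = (\<lambda>p. c * x p) \<otimes>\<^bsub>A\<^esub> basis_vec (a_diag l n m') \<otimes>\<^bsub>A\<^esub> y"
    unfolding g(1) PA_scale ..
  then show ?thesis unfolding ideal_gens_def using g scale_A by blast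
qed

lemma A_neg: "x \<in> carrier A \<Longrightarrow> inv\<^bsub>add_monoid A\<^esub> x = (\<lambda>p. - x p)"
proof -
  assume x: "x \<in> carrier A"
  interpret ring A by (rule ring_A)
  have n: "(\<lambda>p. - x p) \<in> carrier A" using scale_A[OF x, of "-1"] by simp
  have "(\<lambda>p. - x p) \<oplus>\<^bsub>A\<^esub> x = \<zero>\<^bsub>A\<^esub>" by (simp add: As)
  then have "\<ominus>\<^bsub>A\<^esub> x = (\<lambda>p. - x p)" by (rule minus_equality[OF _ x n])
  then show ?thesis by (simp add: a_inv_def)
qed

text \<open>The case of inverses from \<open>generate\<close> is absorbed: the negative of a
  generator is again a generator.\<close>

lemma IB_induct [consumes 1, case_names zero gen add]:
  assumes "x \<in> IB" "P (\<lambda>_. 0)" "\<And>g. g \<in> ideal_gens \<Longrightarrow> P g"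
    "\<And>x y. x \<in> IB \<Longrightarrow> y \<in> IB \<Longrightarrow> P x \<Longrightarrow> P y \<Longrightarrow> P (\<lambda>p. x p + y p)"
  shows "P x"
  using assms(1) unfolding IB_eq
proof (induction rule: generate.induct)
  case one
  then show ?case using assms(2) by (simp add: As)
next
  case (incl h)
  then show ?case by (rule assms(3))
next
  case (inv h)
  then have "inv\<^bsub>add_monoid A\<^esub> h = (\<lambda>p. -1 * h p)" using A_neg ideal_gens_A by auto
  then show ?case using assms(3)[OF ideal_gens_scale[OF inv, of "-1"]] by simp
next
  case (eng h1 h2)
  then show ?case using assms(4)[of h1 h2] by (simp add: As IB_eq)
qed

lemma IB_subgroup: "subgroup IB (add_monoid A)"
proof -
  interpret ring A by (rule ring_A)
  show ?thesis unfolding IB_eq by (rule add.generate_is_subgroup) (use ideal_gens_A in simp)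
qed

lemma IB_zero: "(\<lambda>_. 0) \<in> IB"
  using subgroup.one_closed[OF IB_subgroup] by (simp add: As)

lemma IB_add: "x \<in> IB \<Longrightarrow> y \<in> IB \<Longrightarrow> (\<lambda>p. x p + y p) \<in> IB"
  using subgroup.m_closed[OF IB_subgroup, of x y] by (simp add: As)

lemma IB_gen: "g \<in> ideal_gens \<Longrightarrow> g \<in> IB"
  unfolding IB_eq by (rule generate.incl)

lemma IB_scale: "x \<in> IB \<Longrightarrow> (\<lambda>p. c * x p) \<in> IB"
proof (induction rule: IB_induct)
  case zero
  then show ?case using IB_zero by simp
next
  case (gen g)
  then show ?case by (intro IB_gen ideal_gens_scale)
next
  case (add x y)
  then show ?case using IB_add[of "\<lambda>p. c * x p" "\<lambda>p. c * y p"] by (simp add: distrib_left)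
qed

lemma IB_sum: "finite B \<Longrightarrow> (\<And>b. b \<in> B \<Longrightarrow> f b \<in> IB) \<Longrightarrow> (\<lambda>p. \<Sum>b\<in>B. f b p) \<in> IB"
  by (induction B rule: finite_induct) (auto simp: IB_zero intro!: IB_add)

lemma zero_mult: "(\<lambda>_. 0) \<otimes>\<^bsub>A\<^esub> x = (\<lambda>_. 0)" "x \<otimes>\<^bsub>A\<^esub> (\<lambda>_. 0) = (\<lambda>_. 0)"
  unfolding As by (intro ext sum.neutral ballI; simp)+

lemma IB_l_closed:
  assumes "x \<in> IB" "z \<in> carrier A"
  shows "z \<otimes>\<^bsub>A\<^esub> x \<in> IB"
  using assms(1)
proof (induction rule: IB_induct)
  case zero
  then show ?case using IB_zero by (simp add: zero_mult)
next
  case (gen g)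
  then obtain x y m' where g: "g = x \<otimes>\<^bsub>A\<^esub> basis_vec (a_diag l n m') \<otimes>\<^bsub>A\<^esub> y" "x \<in> carrier A" "y \<in> carrier A"
    "m' \<in> gamma l n" "index_less l m' m" unfolding ideal_gens_def by blast
  have "z \<otimes>\<^bsub>A\<^esub> g = (z \<otimes>\<^bsub>A\<^esub> x) \<otimes>\<^bsub>A\<^esub> basis_vec (a_diag l n m') \<otimes>\<^bsub>A\<^esub> y"
    unfolding g(1) by (simp only: PA_assoc)
  then show ?case using g PA_mult_closed by (intro IB_gen) (unfold ideal_gens_def, blast)
next
  case (add x y)
  then show ?case using IB_add[of "z \<otimes>\<^bsub>A\<^esub> x" "z \<otimes>\<^bsub>A\<^esub> y"] PA_distrib(2)[where l = l and n = n and \<delta> = \<delta> and z = z and x = x and y = y] unfolding As(4) by simp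
qed

lemma IB_r_closed:
  assumes "x \<in> IB" "z \<in> carrier A"
  shows "x \<otimes>\<^bsub>A\<^esub> z \<in> IB"
  using assms(1)
proof (induction rule: IB_induct)
  case zero
  then show ?case using IB_zero by (simp add: zero_mult)
next
  case (gen g)
  then obtain x y m' where g: "g = x \<otimes>\<^bsub>A\<^esub> basis_vec (a_diag l n m') \<otimes>\<^bsub>A\<^esub> y" "x \<in> carrier A" "y \<in> carrier A"
    "m' \<in> gamma l n" "index_less l m' m" unfolding ideal_gens_def by blast
  have "g \<otimes>\<^bsub>A\<^esub> z = x \<otimes>\<^bsub>A\<^esub> basis_vec (a_diag l n m') \<otimes>\<^bsub>A\<^esub> (y \<otimes>\<^bsub>A\<^esub> z)"
    unfolding g(1) by (simp only: PA_assoc)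
  then show ?case using g PA_mult_closed by (intro IB_gen) (unfold ideal_gens_def, blast)
next
  case (add x y)
  then show ?case using IB_add[of "x \<otimes>\<^bsub>A\<^esub> z" "y \<otimes>\<^bsub>A\<^esub> z"] PA_distrib(1)[where l = l and n = n and \<delta> = \<delta> and z = z and x = x and y = y] unfolding As(4) by simp
qed

lemma ideal_IB: "ideal IB A"
  by (rule idealI[OF ring_A IB_subgroup IB_l_closed IB_r_closed])

section \<open>The ideal and the number of propagating parts\<close>

lemma sum_index_less:
  assumes m': "m' \<in> gamma l n" and less: "index_less l m' m"
  shows "(\<Sum>k=1..l. m' k) < (\<Sum>k=1..l. m k)"
proof (rule ccontr)
  assume c: "\<not> ?thesis"
  let ?d = "\<lambda>k. int (m' k) - int (m k)"
  have d: "?d \<in> cone l" using less unfolding index_less_def index_le_cone by blast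
  have "(\<Sum>k=1..l. ?d k) = int (\<Sum>k=1..l. m' k) - int (\<Sum>k=1..l. m k)" by (simp add: sum_subtractf)
  then have "(\<Sum>k=1..l. ?d k) = 0" using cone_sum_nonpos(1)[OF l d] c by linarith
  then have "?d k = 0" if "k \<in> {1..l}" for k using cone_sum_nonpos(2)[OF l d _ that] by blast
  then have "m' k = m k" for k
    using m m' by (cases "k \<in> {1..l}") (auto simp: gamma_def)
  then show False using less by (auto simp: index_less_def)
qed

text \<open>A generator passes through an \<open>a_diag\<close> with fewer propagating parts, and
  composition on either side cannot raise their number.\<close>

lemma IB_low: "x \<in> IB \<Longrightarrow> x p \<noteq> 0 \<Longrightarrow> nprop p < (\<Sum>k=1..l. m k)"
proof (induction rule: IB_induct)
  case (gen g)
  then obtain x y m' where g: "g = x \<otimes>\<^bsub>A\<^esub> basis_vec (a_diag l n m') \<otimes>\<^bsub>A\<^esub> y"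
    "m' \<in> gamma l n" "index_less l m' m" unfolding ideal_gens_def by blast
  have a': "a_diag l n m' \<in> half_basis l n m'" by (rule a_half_basis[OF l g(2)])
  obtain u v where u: "u \<in> tonal l n" "v \<in> tonal l n" "(x \<otimes>\<^bsub>A\<^esub> basis_vec (a_diag l n m')) u \<noteq> 0" "compose n n n u v = p"
    using A_mult_support[of "x \<otimes>\<^bsub>A\<^esub> basis_vec (a_diag l n m')" y p] gen(2) unfolding g(1) by blast
  obtain c b where c: "c \<in> tonal l n" "b \<in> tonal l n" "basis_vec (a_diag l n m') b \<noteq> 0" "compose n n n c b = u"
    using A_mult_support[OF u(3)] by blast
  have b: "b = a_diag l n m'" using c(3) by (auto simp: basis_vec_def split: if_splits)
  have "nprop p \<le> nprop u" using nprop_compose_left[OF tonal_diagrams[OF u(1)] tonal_diagrams[OF u(2)]] u(4) by simp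
  also have "\<dots> \<le> nprop (a_diag l n m')" using nprop_compose_right[OF tonal_diagrams[OF c(1)] tonal_diagrams[OF c(2)]] c(4) b by simp
  also have "\<dots> = (\<Sum>k=1..l. m' k)" by (rule nprop_H[OF l g(2) a'])
  also have "\<dots> < (\<Sum>k=1..l. m k)" by (rule sum_index_less[OF g(2,3)])
  finally show ?case .
next
  case (add x y)
  then have "x p \<noteq> 0 \<or> y p \<noteq> 0" by auto
  then show ?case using add by blast
qed simp

lemma ideal_gensI:
  "g = x \<otimes>\<^bsub>A\<^esub> basis_vec (a_diag l n m') \<otimes>\<^bsub>A\<^esub> y \<Longrightarrow> x \<in> carrier A \<Longrightarrow> y \<in> carrier A \<Longrightarrow>
   m' \<in> gamma l n \<Longrightarrow> index_less l m' m \<Longrightarrow> g \<in> ideal_gens"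
  unfolding ideal_gens_def by blast

text \<open>Invertibility of \<open>\<delta>\<close> is used here to absorb the loops of the factorisation through \<open>a\<^bsup>m'\<^esup>\<close>.\<close>

lemma basis_in_IB:
  assumes x: "x \<in> tonal l n" and h: "h \<in> H" and c: "compose n n n x h \<notin> H"
  shows "basis_vec (compose n n n x h) \<in> IB"
proof -
  let ?q = "compose n n n x h"
  let ?m = "prop_vec l ?q"
  have hT: "h \<in> tonal l n" using h H_sub_tonal by blast
  have q: "?q \<in> tonal l n" by (rule compose_tonal[OF x hT])
  have g: "?m \<in> gamma l n" by (rule prop_vec_gamma(1)[OF l q])
  \<comment> \<open>Every left multiple of \<open>h\<close> has a vector below or equal to
    \<open>m\<close>; the loss of a propagating part excludes equality.\<close>
  have "nprop ?q < (\<Sum>k=1..l. m k)" by (rule nprop_compose_H[OF l m x h c])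
  then have "?m \<noteq> m" using nprop_prop_vec[OF l tonal_diagrams[OF q]] by auto
  moreover have "index_le l ?m m" using index_le_compose[OF l x hT] h by (simp add: half_basis_def)
  ultimately have less: "index_less l ?m m" by (simp add: index_less_def)
  let ?J = "idx l ?m" and ?B = "blk l ?m" and ?R = "rest l n ?m"
  obtain T B U L where TB0: "?q = mk ?J T B U L \<and> fam ?J T U {1..n} \<and> fam ?J B L {1..n} \<and>
    (\<forall>x\<in>?J. [card (T x) = fst x] (mod l)) \<and> (\<forall>x\<in>?J. [card (B x) = fst x] (mod l)) \<and>
    (\<forall>u\<in>U. l dvd card u) \<and> (\<forall>u\<in>L. l dvd card u)"
    using prop_vec_gamma(2)[OF l q] by (elim exE) (erule that)
  note c2 = TB0[THEN conjunct2] note c3 = c2[THEN conjunct2] note c4 = c3[THEN conjunct2]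
  note c5 = c4[THEN conjunct2] note c6 = c5[THEN conjunct2]
  note TB = TB0[THEN conjunct1] c2[THEN conjunct1] c3[THEN conjunct1] c4[THEN conjunct1, rule_format]
    c5[THEN conjunct1, rule_format] c6[THEN conjunct1, rule_format] c6[THEN conjunct2, rule_format]
  note fb = fam_blk[OF l g]
  \<comment> \<open>The propagating parts of \<open>?q\<close> are cut in the middle, with the
    standard blocks of \<open>?a\<close> inserted.\<close>
  let ?X = "mk ?J T ?B U ?R" and ?Y = "mk ?J ?B B ?R L" and ?a = "a_diag l n ?m"
  have a: "?a = mk ?J ?B ?B ?R ?R" by (rule a_diag_mk[OF l])
  have X: "?X \<in> tonal l n" using TB(4,6) card_rest by (intro mk_tonal[OF TB(2) fb]) auto
  have Y: "?Y \<in> tonal l n" using TB(5,7) card_rest by (intro mk_tonal[OF fb TB(3)]) (auto intro: cong_sym)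
  have aT: "?a \<in> tonal l n" using a_half_basis[OF l g] by (simp add: half_basis_def)
  have Xa: "compose n n n ?X ?a = ?X" "loops n n n ?X ?a = card ?R"
    unfolding a using compose_mk[OF TB(2) fb fb] loops_mk[OF TB(2) fb fb] by simp_all
  have XY: "compose n n n ?X ?Y = ?q" "loops n n n ?X ?Y = card ?R"
    using trans[OF compose_mk[OF TB(2) fb TB(3)] TB(1)[symmetric]] loops_mk[OF TB(2) fb TB(3)] by blast+
  \<comment> \<open>Two powers, because the loops of \<open>card ?R\<close> arise twice: when
    \<open>?X\<close> meets \<open>?a\<close>, and when the result meets \<open>?Y\<close>.\<close>
  let ?x = "\<lambda>p. (1 / (\<delta> ^ card ?R * \<delta> ^ card ?R)) * basis_vec ?X p"
  have "?x \<otimes>\<^bsub>A\<^esub> basis_vec ?a \<otimes>\<^bsub>A\<^esub> basis_vec ?Y = basis_vec ?q"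
    unfolding PA_scale PA_basis_mult[OF X aT] Xa PA_basis_mult[OF X Y] XY using \<delta> by (simp add: fun_eq_iff)
  moreover have "?x \<in> carrier A" by (intro scale_A basis_A X)
  ultimately have "basis_vec ?q \<in> ideal_gens"
    by (intro ideal_gensI[OF _ _ basis_A[OF Y] g less]) (rule sym)
  then show ?thesis by (rule IB_gen)
qed

lemma expand: "finite B \<Longrightarrow> x \<in> supported_on B \<Longrightarrow> x = (\<lambda>p. \<Sum>b\<in>B. x b * basis_vec b p)"
proof
  fix p assume B: "finite B" "x \<in> supported_on B"
  have "(\<Sum>b\<in>B. x b * basis_vec b p) = (\<Sum>b\<in>B. if b = p then x b else 0)"
    by (intro sum.cong) (auto simp: basis_vec_def)
  also have "\<dots> = x p" using B by (auto simp: supported_on_def)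
  finally show "x p = (\<Sum>b\<in>B. x b * basis_vec b p)" by simp
qed

lemma IB_supportI:
  assumes "x \<in> carrier A" "\<And>p. x p \<noteq> 0 \<Longrightarrow> basis_vec p \<in> IB"
  shows "x \<in> IB"
proof -
  have "(\<lambda>p. \<Sum>b\<in>tonal l n. x b * basis_vec b p) \<in> IB"
  proof (intro IB_sum finite_tonal)
    fix b show "(\<lambda>p. x b * basis_vec b p) \<in> IB"
      using IB_scale[OF assms(2)[of b], of "x b"] IB_zero by (cases "x b = 0") simp_all
  qed
  moreover have "x = (\<lambda>p. \<Sum>b\<in>tonal l n. x b * basis_vec b p)"
    using assms(1) by (intro expand[OF finite_tonal]) (simp add: As(1))
  ultimately show ?thesis by (simp only:)
qed

text \<open>Diagrams of \<open>H\<close> have exactly as many propagating parts as \<open>m\<close>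
  prescribes, those occurring in the ideal have fewer.\<close>

lemma W_IB: "x \<in> W \<Longrightarrow> x \<in> IB \<Longrightarrow> x = (\<lambda>_. 0)"
proof
  fix p assume x: "x \<in> W" "x \<in> IB"
  show "x p = 0"
  proof (rule ccontr)
    assume p: "x p \<noteq> 0"
    then have "p \<in> H" using x(1) by (auto simp: supported_on_def)
    then show False using IB_low[OF x(2) p] nprop_H[OF l m, of p] by simp
  qed
qed

definition "res y = (\<lambda>p. if p \<in> H then y p else 0 :: complex)"

lemma res_W: "res y \<in> W"
  by (auto simp: res_def supported_on_def)

text \<open>Diagrams of the product outside \<open>H\<close> are left multiples that leave the half
  basis; their basis vectors lie in the ideal, so the action may be computed on
  \<open>H\<close>.\<close>

lemma mult_res:
  assumes x: "x \<in> carrier A" and w: "w \<in> W"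
  shows "(\<lambda>p. (x \<otimes>\<^bsub>A\<^esub> w) p - res (x \<otimes>\<^bsub>A\<^esub> w) p) \<in> IB"
proof (rule IB_supportI)
  have "x \<otimes>\<^bsub>A\<^esub> w \<in> carrier A" by (rule PA_mult_closed)
  then show "(\<lambda>p. (x \<otimes>\<^bsub>A\<^esub> w) p - res (x \<otimes>\<^bsub>A\<^esub> w) p) \<in> carrier A" by (auto simp: As(1) supported_on_def res_def)
  fix q assume "(x \<otimes>\<^bsub>A\<^esub> w) q - res (x \<otimes>\<^bsub>A\<^esub> w) q \<noteq> 0"
  then have q: "q \<notin> H" "(x \<otimes>\<^bsub>A\<^esub> w) q \<noteq> 0" by (auto simp: res_def split: if_splits)
  obtain p h where p: "p \<in> tonal l n" "w h \<noteq> 0" "compose n n n p h = q" using A_mult_support[OF q(2)] by blast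
  have "h \<in> H" using p(2) w by (auto simp: supported_on_def)
  then show "basis_vec q \<in> IB" using basis_in_IB[OF p(1), of h] p(3) q(1) by simp
qed

section \<open>Classes modulo the ideal\<close>

lemma cls_mem: "y \<in> cls x \<longleftrightarrow> (\<lambda>p. y p - x p) \<in> IB"
proof
  assume "y \<in> cls x"
  then obtain i where "i \<in> IB" "y = i \<oplus>\<^bsub>A\<^esub> x" unfolding quotient_class_def a_r_coset_def' by blast
  then show "(\<lambda>p. y p - x p) \<in> IB" by (simp add: As)
next
  assume i: "(\<lambda>p. y p - x p) \<in> IB"
  have "y = (\<lambda>p. y p - x p) \<oplus>\<^bsub>A\<^esub> x" by (simp add: As)
  then show "y \<in> cls x" unfolding quotient_class_def a_r_coset_def' using i by blast
qed

lemma cls_eq: "cls x = cls y \<longleftrightarrow> (\<lambda>p. x p - y p) \<in> IB"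
proof
  assume "cls x = cls y"
  moreover have "x \<in> cls x" using cls_mem IB_zero by simp
  ultimately show "(\<lambda>p. x p - y p) \<in> IB" using cls_mem by simp
next
  assume i: "(\<lambda>p. x p - y p) \<in> IB"
  have "(\<lambda>p. z p - x p) \<in> IB \<longleftrightarrow> (\<lambda>p. z p - y p) \<in> IB" for z
    using IB_add[of "\<lambda>p. z p - x p", OF _ i] IB_add[of "\<lambda>p. z p - y p", OF _ IB_scale[OF i, of "-1"]] by auto
  then show "cls x = cls y" using cls_mem by blast
qed

lemma cls_inj: "x \<in> W \<Longrightarrow> y \<in> W \<Longrightarrow> cls x = cls y \<Longrightarrow> x = y"
proof -
  assume xy: "x \<in> W" "y \<in> W" "cls x = cls y"
  have "(\<lambda>p. x p - y p) \<in> W" using xy(1,2) by (auto simp: supported_on_def)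
  then have "(\<lambda>p. x p - y p) = (\<lambda>_. 0)" using W_IB xy(3) cls_eq by blast
  then show ?thesis by (simp add: fun_eq_iff)
qed

lemma Q_ring: "ring Q"
  unfolding quotient_algebra_def by (rule ideal.quotient_is_ring[OF ideal_IB])

lemma cls_hom: "cls \<in> ring_hom A Q"
proof -
  have "cls = (+>\<^bsub>A\<^esub>) IB" by (rule ext) (simp add: quotient_class_def)
  then show ?thesis unfolding quotient_algebra_def using ideal.rcos_ring_hom[OF ideal_IB] by simp
qed

lemma cls_mult: "x \<in> carrier A \<Longrightarrow> y \<in> carrier A \<Longrightarrow> cls x \<otimes>\<^bsub>Q\<^esub> cls y = cls (x \<otimes>\<^bsub>A\<^esub> y)"
  using ring_hom_mult[OF cls_hom] by simp

lemma cls_add: "x \<in> carrier A \<Longrightarrow> y \<in> carrier A \<Longrightarrow> cls x \<oplus>\<^bsub>Q\<^esub> cls y = cls (\<lambda>p. x p + y p)"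
  using ring_hom_add[OF cls_hom] by (simp add: As)

lemma cls_one: "cls \<one>\<^bsub>A\<^esub> = \<one>\<^bsub>Q\<^esub>"
  by (rule ring_hom_one[OF cls_hom])

lemma cls_Q: "x \<in> carrier A \<Longrightarrow> cls x \<in> carrier Q"
  using ring_hom_closed[OF cls_hom] .

lemma carrier_Q: "carrier Q = cls ` carrier A"
proof -
  have "cls = (+>\<^bsub>A\<^esub>) IB" by (rule ext) (simp add: quotient_class_def)
  then show ?thesis unfolding quotient_algebra_def FactRing_def A_RCOSETS_def' by auto
qed

text \<open>Each diagram of \<open>H\<close> ends in the lower half of \<open>ad\<close>, so the
  product closes one loop per member of \<open>rest l n m\<close> and changes nothing else.\<close>

lemma W_am:
  assumes "w \<in> W"
  shows "w \<otimes>\<^bsub>A\<^esub> basis_vec ad = (\<lambda>p. cc * w p)"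
proof
  fix q
  have "(w \<otimes>\<^bsub>A\<^esub> basis_vec ad) q = (\<Sum>p\<in>tonal l n. \<Sum>p'\<in>tonal l n. if p' = ad then (if p = q then cc * w p else 0) else 0)"
    unfolding As
  proof (intro sum.cong refl)
    fix p p' assume p: "p \<in> tonal l n"
    show "(if compose n n n p p' = q then \<delta> ^ loops n n n p p' * w p * basis_vec ad p' else 0) =
      (if p' = ad then (if p = q then cc * w p else 0) else 0)"
    proof (cases "p \<in> H")
      case True
      then show ?thesis using compose_am[OF l m True] by (auto simp: basis_vec_def)
    next
      case False
      then show ?thesis using assms by (auto simp: supported_on_def)
    qed
  qed
  also have "\<dots> = cc * w q"
  proof -
    have "ad \<in> tonal l n" using a_half_basis[OF l m] H_sub_tonal by blast
    then have "(\<Sum>p\<in>tonal l n. \<Sum>p'\<in>tonal l n. if p' = ad then (if p = q then cc * w p else 0) else 0) =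
       (\<Sum>p\<in>tonal l n. if p = q then cc * w p else 0)" by (simp add: finite_tonal)
    also have "\<dots> = cc * w q" using W_A[OF assms] by (auto simp: finite_tonal As(1) supported_on_def)
    finally show ?thesis .
  qed
  finally show "(w \<otimes>\<^bsub>A\<^esub> basis_vec ad) q = cc * w q" .
qed

lemma ad_H: "ad \<in> H"
  by (rule a_half_basis[OF l m])

lemma ad_A: "basis_vec ad \<in> carrier A"
  using ad_H H_sub_tonal by (intro basis_A) blast

lemma cls_mult_W:
  assumes "x \<in> carrier A" "w \<in> W"
  shows "cls x \<otimes>\<^bsub>Q\<^esub> cls w = cls (res (x \<otimes>\<^bsub>A\<^esub> w))"
  using mult_res[OF assms] cls_eq cls_mult[OF assms(1) W_A[OF assms(2)]] by simp

lemma cls_W: "w \<in> W \<Longrightarrow> cls w = cls (\<lambda>p. 1 / cc * w p) \<otimes>\<^bsub>Q\<^esub> cls (basis_vec ad)"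
proof -
  assume w: "w \<in> W"
  then have w': "(\<lambda>p. 1 / cc * w p) \<in> W" by (rule supported_scale)
  have "cls (\<lambda>p. 1 / cc * w p) \<otimes>\<^bsub>Q\<^esub> cls (basis_vec ad) = cls ((\<lambda>p. 1 / cc * w p) \<otimes>\<^bsub>A\<^esub> basis_vec ad)"
    by (rule cls_mult[OF W_A[OF w'] ad_A])
  also have "(\<lambda>p. 1 / cc * w p) \<otimes>\<^bsub>A\<^esub> basis_vec ad = w"
    unfolding W_am[OF w'] using \<delta> by (simp add: fun_eq_iff)
  finally show ?thesis by simp
qed

text \<open>One inclusion discards the diagrams outside \<open>H\<close> modulo the ideal; the other
  divides by \<open>cc\<close>, which is invertible as \<delta> is nonzero.\<close>

lemma carrier_LM: "carrier LM = cls ` W"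
proof
  show "carrier LM \<subseteq> cls ` W"
  proof
    fix C assume "C \<in> carrier LM"
    then obtain x where x: "x \<in> carrier A" "C = cls x \<otimes>\<^bsub>Q\<^esub> cls (basis_vec ad)"
      unfolding left_ideal_def carrier_Q by auto
    then show "C \<in> cls ` W" using cls_mult_W[OF x(1) basis_supported[OF ad_H]] res_W by auto
  qed
  show "cls ` W \<subseteq> carrier LM"
  proof (rule image_subsetI)
    fix w assume w: "w \<in> W"
    then have "(\<lambda>p. 1 / cc * w p) \<in> W" by (rule supported_scale)
    then show "cls w \<in> carrier LM" unfolding cls_W[OF w] left_ideal_def carrier_Q using W_A by auto
  qed
qed

lemma LM_add: "C \<oplus>\<^bsub>LM\<^esub> D = C \<oplus>\<^bsub>Q\<^esub> D"
  by (simp add: left_ideal_def)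

abbreviation "pbl \<equiv> permute_blocks_lin l n m"

lemma finite_G: "finite (carrier G)"
  unfolding sym_product_def by (simp add: sym_group_def finite_permutations finite_PiE)

lemma finite_H: "finite H"
  by (rule finite_half_basis[OF l m])

lemma pbl_W: "pbl w \<alpha> \<in> W"
  unfolding supported_on_def permute_blocks_lin_def
  using ra_H[OF l m] by (auto intro!: sum.neutral)

text \<open>Each such class meets \<open>W\<close> in a single vector, so the union in the
  definition of the action has one member.\<close>

lemma LM_smult:
  assumes w: "w \<in> W"
  shows "\<alpha> \<odot>\<^bsub>LM\<^esub> cls w = cls (pbl w \<alpha>)"
proof -
  have "cls w \<inter> W = {w}"
  proof -
    have "x = w" if "x \<in> cls w" "x \<in> W" for x
      using that cls_inj[OF that(2) w] cls_mem cls_eq by blast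
    moreover have "w \<in> cls w" using cls_mem IB_zero by simp
    ultimately show ?thesis using w by blast
  qed
  then show ?thesis by (simp add: left_ideal_def)
qed

text \<open>The factor \<open>1 / cc\<close> cancels the loops that arise when a diagram of
  \<open>H\<close> meets the permuted copies of \<open>ad\<close>.\<close>

definition "right_mult_elem \<alpha> = (\<lambda>q. 1 / cc * pbl (basis_vec ad) \<alpha> q)"

lemma right_mult_elem_W: "right_mult_elem \<alpha> \<in> W"
  unfolding right_mult_elem_def by (rule supported_scale[OF pbl_W])

lemma pbl_basis: "h \<in> H \<Longrightarrow> pbl (basis_vec h) \<alpha> q = (\<Sum>\<sigma>\<in>carrier G. if permute_blocks l m h \<sigma> = q then \<alpha> \<sigma> else 0)"
proof -
  assume h: "h \<in> H"
  have "pbl (basis_vec h) \<alpha> q = (\<Sum>\<sigma>\<in>carrier G. \<Sum>p\<in>H. if p = h then (if permute_blocks l m h \<sigma> = q then \<alpha> \<sigma> else 0) else 0)"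
    unfolding permute_blocks_lin_def by (intro sum.cong refl) (auto simp: basis_vec_def)
  then show ?thesis using h by (simp add: finite_H)
qed

text \<open>The right action of the group algebra is right multiplication by an element of the quotient
  algebra, so that it commutes with the left action.\<close>

lemma mult_right_mult_elem:
  assumes w: "w \<in> W"
  shows "w \<otimes>\<^bsub>A\<^esub> right_mult_elem \<alpha> = pbl w \<alpha>"
proof
  fix q
  let ?ra = "permute_blocks l m"
  have "(w \<otimes>\<^bsub>A\<^esub> right_mult_elem \<alpha>) q = (\<Sum>p\<in>tonal l n. \<Sum>p'\<in>tonal l n. \<Sum>\<sigma>\<in>carrier G.
     if p' = ?ra ad \<sigma> then (if compose n n n p p' = q then \<delta> ^ loops n n n p p' * w p * (1 / cc) * \<alpha> \<sigma> else 0) else 0)"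
    unfolding As right_mult_elem_def pbl_basis[OF ad_H]
  proof (intro sum.cong refl)
    fix p p'
    show "(if compose n n n p p' = q then \<delta> ^ loops n n n p p' * w p *
        (1 / cc * (\<Sum>\<sigma>\<in>carrier G. if ?ra ad \<sigma> = p' then \<alpha> \<sigma> else 0)) else 0) =
      (\<Sum>\<sigma>\<in>carrier G. if p' = ?ra ad \<sigma> then
        (if compose n n n p p' = q then \<delta> ^ loops n n n p p' * w p * (1 / cc) * \<alpha> \<sigma> else 0) else 0)"
    proof (cases "compose n n n p p' = q")
      case True
      show ?thesis unfolding True sum_distrib_left if_P[OF refl] by (intro sum.cong refl) simp
    qed (simp only: if_False if_cancel sum.neutral_const)
  qed
  also have "\<dots> = (\<Sum>p\<in>tonal l n. \<Sum>\<sigma>\<in>carrier G. \<Sum>p'\<in>tonal l n.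
     if p' = ?ra ad \<sigma> then (if compose n n n p p' = q then \<delta> ^ loops n n n p p' * w p * (1 / cc) * \<alpha> \<sigma> else 0) else 0)"
    by (rule sum.cong[OF refl]) (rule sum.swap)
  also have "\<dots> = (\<Sum>p\<in>tonal l n. \<Sum>\<sigma>\<in>carrier G.
      (if compose n n n p (?ra ad \<sigma>) = q then \<delta> ^ loops n n n p (?ra ad \<sigma>) * w p * (1 / cc) * \<alpha> \<sigma> else 0))"
  proof (intro sum.cong refl)
    fix p \<sigma> assume "\<sigma> \<in> carrier G"
    then have "?ra ad \<sigma> \<in> tonal l n" using ra_H[OF l m ad_H] H_sub_tonal by blast
    then show "(\<Sum>p'\<in>tonal l n. if p' = ?ra ad \<sigma> then (if compose n n n p p' = q then \<delta> ^ loops n n n p p' * w p * (1 / cc) * \<alpha> \<sigma> else 0) else 0) =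
      (if compose n n n p (?ra ad \<sigma>) = q then \<delta> ^ loops n n n p (?ra ad \<sigma>) * w p * (1 / cc) * \<alpha> \<sigma> else 0)"
      by (simp add: finite_tonal)
  qed
  also have "\<dots> = (\<Sum>p\<in>H. \<Sum>\<sigma>\<in>carrier G.
      (if compose n n n p (?ra ad \<sigma>) = q then \<delta> ^ loops n n n p (?ra ad \<sigma>) * w p * (1 / cc) * \<alpha> \<sigma> else 0))"
    using w H_sub_tonal finite_tonal
    by (intro sum.mono_neutral_right) (auto simp: supported_on_def intro!: sum.neutral)
  also have "\<dots> = (\<Sum>p\<in>H. \<Sum>\<sigma>\<in>carrier G. if ?ra p \<sigma> = q then w p * \<alpha> \<sigma> else 0)"
    using \<delta> by (intro sum.cong refl) (simp add: compose_ra_am[OF l m] loops_ra_am[OF l m])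
  also have "\<dots> = pbl w \<alpha> q" unfolding permute_blocks_lin_def by (rule sum.swap)
  finally show "(w \<otimes>\<^bsub>A\<^esub> right_mult_elem \<alpha>) q = pbl w \<alpha> q" .
qed

lemma LM_smult_mult:
  assumes "C \<in> carrier LM"
  shows "\<alpha> \<odot>\<^bsub>LM\<^esub> C = C \<otimes>\<^bsub>Q\<^esub> cls (right_mult_elem \<alpha>)"
proof -
  obtain w where w: "w \<in> W" "C = cls w" using assms unfolding carrier_LM by blast
  show ?thesis unfolding w(2) LM_smult[OF w(1)] cls_mult[OF W_A[OF w(1)] W_A[OF right_mult_elem_W]] mult_right_mult_elem[OF w(1)] ..
qed

lemma LM_Q: "C \<in> carrier LM \<Longrightarrow> C \<in> carrier Q"
  unfolding carrier_LM using cls_Q W_A by blast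

text \<open>Once the right action is right multiplication in the quotient algebra, its commuting
  with the left action is associativity there.\<close>

lemma balanced_bimodule_standard:
  fixes N :: "((nat \<Rightarrow> nat \<Rightarrow> nat) \<Rightarrow> complex, 'v, 'b) module_scheme"
  assumes N_add: "\<And>x y. x \<in> carrier N \<Longrightarrow> y \<in> carrier N \<Longrightarrow> x \<oplus>\<^bsub>N\<^esub> y \<in> carrier N"
    and N_smult: "\<And>r x. r \<in> carrier (group_algebra G) \<Longrightarrow> x \<in> carrier N \<Longrightarrow> r \<odot>\<^bsub>N\<^esub> x \<in> carrier N"
  shows "balanced_bimodule A (\<lambda>x C. cls x \<otimes>\<^bsub>Q\<^esub> C) (group_algebra G) LM N"
proof (rule balanced_bimodule.intro)
  interpret Q: ring Q by (rule Q_ring)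
  show "ring A" by (rule ring_A)
  show "x \<oplus>\<^bsub>LM\<^esub> y \<in> carrier LM" if xy: "x \<in> carrier LM" "y \<in> carrier LM" for x y
  proof -
    obtain v w where "v \<in> W" "x = cls v" "w \<in> W" "y = cls w" using xy unfolding carrier_LM by blast
    then show ?thesis unfolding LM_add using cls_add[OF W_A W_A, of v w] supported_add[of v H w] by (simp add: carrier_LM)
  qed
  show "r \<odot>\<^bsub>LM\<^esub> x \<in> carrier LM" if "x \<in> carrier LM" for r x
    using that LM_smult pbl_W unfolding carrier_LM by auto
  show ac: "cls s \<otimes>\<^bsub>Q\<^esub> x \<in> carrier LM" if "s \<in> carrier A" "x \<in> carrier LM" for s x
    using that cls_mult_W res_W unfolding carrier_LM by auto
  show "cls s \<otimes>\<^bsub>Q\<^esub> (x \<oplus>\<^bsub>LM\<^esub> y) = cls s \<otimes>\<^bsub>Q\<^esub> x \<oplus>\<^bsub>LM\<^esub> cls s \<otimes>\<^bsub>Q\<^esub> y"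
    if "s \<in> carrier A" "x \<in> carrier LM" "y \<in> carrier LM" for s x y
    unfolding LM_add using that cls_Q LM_Q by (simp add: Q.r_distr)
  show "cls s \<otimes>\<^bsub>Q\<^esub> (r \<odot>\<^bsub>LM\<^esub> x) = r \<odot>\<^bsub>LM\<^esub> (cls s \<otimes>\<^bsub>Q\<^esub> x)" if s: "s \<in> carrier A" and x: "x \<in> carrier LM" for s r x
    unfolding LM_smult_mult[OF x] LM_smult_mult[OF ac[OF s x]]
    using cls_Q[OF s] LM_Q[OF x] cls_Q[OF W_A[OF right_mult_elem_W]] by (simp add: Q.m_assoc)
  show "cls (s \<oplus>\<^bsub>A\<^esub> t) \<otimes>\<^bsub>Q\<^esub> x = cls s \<otimes>\<^bsub>Q\<^esub> x \<oplus>\<^bsub>LM\<^esub> cls t \<otimes>\<^bsub>Q\<^esub> x"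
    if s: "s \<in> carrier A" and t: "t \<in> carrier A" and x: "x \<in> carrier LM" for s t x
    unfolding LM_add ring_hom_add[OF cls_hom s t] using cls_Q[OF s] cls_Q[OF t] LM_Q[OF x] by (simp add: Q.l_distr)
  show "cls (s \<otimes>\<^bsub>A\<^esub> t) \<otimes>\<^bsub>Q\<^esub> x = cls s \<otimes>\<^bsub>Q\<^esub> (cls t \<otimes>\<^bsub>Q\<^esub> x)"
    if s: "s \<in> carrier A" and t: "t \<in> carrier A" and x: "x \<in> carrier LM" for s t x
    unfolding ring_hom_mult[OF cls_hom s t] using cls_Q[OF s] cls_Q[OF t] LM_Q[OF x] by (simp add: Q.m_assoc)
  show "cls \<one>\<^bsub>A\<^esub> \<otimes>\<^bsub>Q\<^esub> x = x" if "x \<in> carrier LM" for x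
    unfolding cls_one using LM_Q[OF that] by simp
qed (use N_add N_smult in auto)

end

subsection \<open>Simplicity\<close>

locale standard_specht = standard_data +
  fixes \<mu> :: "nat \<Rightarrow> nat list"
  assumes ip: "\<And>i. i \<in> {1..l} \<Longrightarrow> integer_partition (\<mu> i) (m i)"
begin

abbreviation "Gs \<equiv> carrier G"
abbreviation "N \<equiv> outer_specht l m \<mu>"
abbreviation "Ss \<equiv> SP l \<mu>"
abbreviation "rr \<equiv> permute_blocks l m"
abbreviation "sact \<sigma> f \<equiv> (\<lambda>T. f (\<lambda>i r. \<sigma> i -` T i r))"

lemmas grp = SGr_closed[OF l m]
lemmas gmult = SGr_mult[OF l m] and gone = SGr_one[OF l m]

lemma N_simps:
  "carrier N = Ss" "f \<oplus>\<^bsub>N\<^esub> g = (\<lambda>T. f T + g T)"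
  "\<alpha> \<odot>\<^bsub>N\<^esub> f = (\<lambda>T. \<Sum>\<sigma>\<in>Gs. \<alpha> \<sigma> * sact \<sigma> f T)"
  using carrier_outer[OF ip] by (simp_all add: outer_specht_def)

lemma R_carrier: "carrier (group_algebra G) = supported_on Gs"
  by (simp add: group_algebra_def)

lemma bim: "balanced_bimodule A (\<lambda>x C. cls x \<otimes>\<^bsub>Q\<^esub> C) (group_algebra G) LM N"
  by (rule balanced_bimodule_standard)
    (auto simp: N_simps intro: SP_add[OF ip] SP_smult[OF ip])

interpretation B: balanced_bimodule A "\<lambda>x C. cls x \<otimes>\<^bsub>Q\<^esub> C" "group_algebra G" LM N
  by (rule bim)

lemma kl_L: "w \<in> W \<Longrightarrow> cls w \<in> carrier LM"
  unfolding carrier_LM by (rule imageI)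

lemma basis_W: "p \<in> H \<Longrightarrow> basis_vec p \<in> W"
  by (rule basis_supported)

lemma finGg: "finite Gs"
  by (rule finite_G)

lemma finHb: "finite H"
  by (rule finite_H)

definition "rep C = (THE w. w \<in> W \<and> cls w = C)"

lemma rep_kl: "w \<in> W \<Longrightarrow> rep (cls w) = w"
  unfolding rep_def by (rule the_equality) (use cls_inj in auto)

text \<open>The tensor relations speak of the group algebra only; multiples of its unit are what
  carries complex scalars across the tensor sign.\<close>

lemma unit_smult_N: "y \<in> Ss \<Longrightarrow> (\<lambda>\<sigma>. c * basis_vec \<one>\<^bsub>G\<^esub> \<sigma>) \<odot>\<^bsub>N\<^esub> y = (\<lambda>T. c * y T)"
proof
  fix T assume y: "y \<in> Ss"
  let ?e = "\<one>\<^bsub>G\<^esub>"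
  have "(\<Sum>\<sigma>\<in>Gs. c * basis_vec ?e \<sigma> * sact \<sigma> y T) = (\<Sum>\<sigma>\<in>Gs. if \<sigma> = ?e then c * sact ?e y T else 0)"
    by (intro sum.cong) (auto simp: basis_vec_def)
  also have "\<dots> = c * sact ?e y T" using grp(3) finGg by simp
  also have "sact ?e y T = y T"
    by (rule local_funD[OF ip local_SP[OF ip y]]) (simp_all add: gone)
  finally show "((\<lambda>\<sigma>. c * basis_vec ?e \<sigma>) \<odot>\<^bsub>N\<^esub> y) T = c * y T" by (simp add: N_simps)
qed

lemma unit_smult_L:
  assumes w: "w \<in> W"
  shows "(\<lambda>\<sigma>. c * basis_vec \<one>\<^bsub>G\<^esub> \<sigma>) \<odot>\<^bsub>LM\<^esub> cls w = cls (\<lambda>p. c * w p)"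
proof -
  let ?e = "\<one>\<^bsub>G\<^esub>"
  have "pbl w (\<lambda>\<sigma>. c * basis_vec ?e \<sigma>) q = c * w q" for q
  proof -
    have "pbl w (\<lambda>\<sigma>. c * basis_vec ?e \<sigma>) q =
      (\<Sum>\<sigma>\<in>Gs. if \<sigma> = ?e then (\<Sum>p\<in>H. if p = q then c * w p else 0) else 0)"
      unfolding permute_blocks_lin_def
    proof (intro sum.cong refl)
      fix \<sigma>
      show "(\<Sum>p\<in>H. if rr p \<sigma> = q then w p * (c * basis_vec ?e \<sigma>) else 0) =
        (if \<sigma> = ?e then \<Sum>p\<in>H. if p = q then c * w p else 0 else 0)"
      proof (cases "\<sigma> = ?e")
        case True
        have "(\<Sum>p\<in>H. if rr p \<sigma> = q then w p * (c * basis_vec ?e \<sigma>) else 0) = (\<Sum>p\<in>H. if p = q then c * w p else 0)"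
          unfolding True by (intro sum.cong refl) (simp add: ra_one[OF l m] basis_vec_def)
        then show ?thesis using True by simp
      next
        case False
        then show ?thesis by (simp add: basis_vec_def cong: if_cong)
      qed
    qed
    also have "\<dots> = (\<Sum>p\<in>H. if p = q then c * w p else 0)" using grp(3) finGg by simp
    also have "\<dots> = c * w q" using w finHb by (auto simp: supported_on_def)
    finally show ?thesis .
  qed
  then have "pbl w (\<lambda>\<sigma>. c * basis_vec ?e \<sigma>) = (\<lambda>p. c * w p)" by (rule ext)
  then show ?thesis unfolding LM_smult[OF w] by simp
qed

lemma basis_R: "\<sigma> \<in> Gs \<Longrightarrow> (\<lambda>\<tau>. c * basis_vec \<sigma> \<tau>) \<in> carrier (group_algebra G)"
  unfolding R_carrier by (intro supported_scale basis_supported)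

lemma basis_smult_L:
  assumes p: "p \<in> H" and s: "\<sigma> \<in> Gs"
  shows "basis_vec \<sigma> \<odot>\<^bsub>LM\<^esub> cls (basis_vec p) = cls (basis_vec (rr p \<sigma>))"
proof -
  have "pbl (basis_vec p) (basis_vec \<sigma>) q = basis_vec (rr p \<sigma>) q" for q
  proof -
    have "pbl (basis_vec p) (basis_vec \<sigma>) q =
       (\<Sum>\<tau>\<in>Gs. if \<tau> = \<sigma> then (if rr p \<sigma> = q then 1 else 0) else 0)"
      unfolding pbl_basis[OF p] by (intro sum.cong refl) (auto simp: basis_vec_def)
    also have "\<dots> = (if rr p \<sigma> = q then 1 else 0)" using s finGg by simp
    finally show ?thesis by (auto simp: basis_vec_def)
  qed
  then have "pbl (basis_vec p) (basis_vec \<sigma>) = basis_vec (rr p \<sigma>)" by (rule ext)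
  then show ?thesis unfolding LM_smult[OF basis_W[OF p]] by simp
qed

lemma basis_smult_N: "\<sigma> \<in> Gs \<Longrightarrow> basis_vec \<sigma> \<odot>\<^bsub>N\<^esub> y = sact \<sigma> y"
proof
  fix T assume s: "\<sigma> \<in> Gs"
  have "(\<Sum>\<tau>\<in>Gs. basis_vec \<sigma> \<tau> * sact \<tau> y T) = (\<Sum>\<tau>\<in>Gs. if \<tau> = \<sigma> then sact \<sigma> y T else 0)"
    by (intro sum.cong) (auto simp: basis_vec_def)
  then show "(basis_vec \<sigma> \<odot>\<^bsub>N\<^esub> y) T = sact \<sigma> y T" using s finGg by (simp add: N_simps)
qed

section \<open>Calculating with pure tensors modulo the relations\<close>

lemma K_right_zero: "x \<in> carrier LM \<Longrightarrow> frag_of (x, (\<lambda>_. 0)) \<in> B.K"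
  using B.K_add_right[of x "\<lambda>_. 0" "\<lambda>_. 0"] B.K_uminus[of "- frag_of (x, (\<lambda>_. 0))"] SP_zero[OF ip]
  by (simp add: N_simps)

lemma K_right_sum:
  assumes "x \<in> carrier LM" "finite F" "\<And>i. i \<in> F \<Longrightarrow> f i \<in> Ss"
  shows "(\<Sum>i\<in>F. frag_of (x, f i)) - frag_of (x, (\<lambda>T. \<Sum>i\<in>F. f i T)) \<in> B.K"
  using assms(2,3)
proof (induction F rule: finite_induct)
  case empty
  then show ?case using B.K_uminus[OF K_right_zero[OF assms(1)]] by simp
next
  case (insert a F)
  let ?s = "\<lambda>T. \<Sum>i\<in>F. f i T"
  have s: "?s \<in> Ss" using insert by (intro SP_sum[OF ip]) auto
  have "frag_of (x, f a \<oplus>\<^bsub>N\<^esub> ?s) - frag_of (x, f a) - frag_of (x, ?s) \<in> B.K"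
    using insert s assms(1) by (intro B.K_add_right) (simp_all add: N_simps)
  moreover have "(\<Sum>i\<in>F. frag_of (x, f i)) - frag_of (x, ?s) \<in> B.K" using insert by simp
  ultimately have "((\<Sum>i\<in>F. frag_of (x, f i)) - frag_of (x, ?s)) - (frag_of (x, f a \<oplus>\<^bsub>N\<^esub> ?s) - frag_of (x, f a) - frag_of (x, ?s)) \<in> B.K"
    by (rule B.K_diff[rotated])
  then show ?case using insert by (simp add: N_simps algebra_simps)
qed

lemma K_scale:
  assumes "w \<in> W" "y \<in> Ss"
  shows "frag_of (cls (\<lambda>p. c * w p), y) - frag_of (cls w, (\<lambda>T. c * y T)) \<in> B.K"
  using B.K_balanced[OF basis_R[OF grp(3), of c] kl_L[OF assms(1)], of y] assms
  by (simp add: unit_smult_L unit_smult_N N_simps(1))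

lemma K_twist:
  assumes "p \<in> H" "\<sigma> \<in> Gs" "y \<in> Ss"
  shows "frag_of (cls (basis_vec (rr p \<sigma>)), y) - frag_of (cls (basis_vec p), sact \<sigma> y) \<in> B.K"
  using B.K_balanced[OF basis_R[OF assms(2), of 1] kl_L[OF basis_W[OF assms(1)]], of y] assms
  by (simp add: basis_smult_L basis_smult_N N_simps(1))

lemma K_left_zero: "y \<in> Ss \<Longrightarrow> frag_of (cls (\<lambda>_. 0), y) \<in> B.K"
proof -
  assume y: "y \<in> Ss"
  have z: "(\<lambda>_. 0) \<in> W" by (simp add: supported_on_def)
  have "frag_of (cls (\<lambda>_. 0), y) - frag_of (cls (\<lambda>_. 0), (\<lambda>_. 0)) \<in> B.K"
    using K_scale[OF z y, of 0] by simp
  then show ?thesis using B.K_add[OF _ K_right_zero[OF kl_L[OF z]]] by fastforce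
qed

lemma K_left_sum:
  assumes y: "y \<in> Ss" and F: "finite F" "F \<subseteq> H"
  shows "frag_of (cls (\<lambda>p. \<Sum>b\<in>F. w b * basis_vec b p), y) - (\<Sum>b\<in>F. frag_of (cls (basis_vec b), (\<lambda>T. w b * y T))) \<in> B.K"
  using F
proof (induction F rule: finite_induct)
  case empty
  then show ?case using K_left_zero[OF y] by simp
next
  case (insert a F)
  let ?s = "\<lambda>p. \<Sum>b\<in>F. w b * basis_vec b p" and ?a = "\<lambda>p. w a * basis_vec a p"
  have "?s p = 0" if "p \<notin> H" for p
    using that insert by (intro sum.neutral ballI) (auto simp: basis_vec_def)
  then have s: "?s \<in> W" by (simp add: supported_on_def)
  have aW: "?a \<in> W" using insert by (intro supported_scale basis_W) auto
  have add: "cls ?a \<oplus>\<^bsub>LM\<^esub> cls ?s = cls (\<lambda>p. ?a p + ?s p)"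
    unfolding LM_add by (rule cls_add[OF W_A[OF aW] W_A[OF s]])
  have "frag_of (cls ?a \<oplus>\<^bsub>LM\<^esub> cls ?s, y) - frag_of (cls ?a, y) - frag_of (cls ?s, y) \<in> B.K"
    using y by (intro B.K_add_left kl_L aW s) (simp add: N_simps)
  then have 1: "frag_of (cls (\<lambda>p. ?a p + ?s p), y) - frag_of (cls ?a, y) - frag_of (cls ?s, y) \<in> B.K"
    unfolding add .
  have 2: "frag_of (cls ?a, y) - frag_of (cls (basis_vec a), (\<lambda>T. w a * y T)) \<in> B.K"
    using insert by (intro K_scale basis_W y) auto
  have 3: "frag_of (cls ?s, y) - (\<Sum>b\<in>F. frag_of (cls (basis_vec b), (\<lambda>T. w b * y T))) \<in> B.K"
    using insert by simp
  show ?case using B.K_add[OF B.K_add[OF 1 2] 3] insert by (simp add: algebra_simps)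
qed

text \<open>The family \<open>v\<close> is not unique: by \<open>K_twist\<close>, a term at
  \<open>rr p \<sigma>\<close> can be moved to \<open>p\<close>.\<close>

lemma expand_tensor:
  assumes "c \<in> carrier B.FG"
  shows "\<exists>v. (\<forall>p\<in>H. v p \<in> Ss) \<and> c - (\<Sum>p\<in>H. frag_of (cls (basis_vec p), v p)) \<in> B.K"
proof -
  have "Poly_Mapping.keys c \<subseteq> carrier LM \<times> carrier N" using assms by simp
  then show ?thesis
  proof (induction c rule: frag_induction)
    case zero
    have "(\<Sum>p\<in>H. frag_of (cls (basis_vec p), (\<lambda>_. 0))) \<in> B.K"
    proof -
      have "(\<Sum>p\<in>F. frag_of (cls (basis_vec p), (\<lambda>_. 0))) \<in> B.K" if "finite F" "F \<subseteq> H" for F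
        using that by (induction F rule: finite_induct) (auto simp: B.K_zero intro!: B.K_add K_right_zero kl_L basis_W)
      then show ?thesis using finHb by blast
    qed
    then show ?case using B.K_uminus SP_zero[OF ip] by (intro exI[of _ "\<lambda>p. \<lambda>_. 0"]) simp
  next
    case (one z)
    then obtain w y where w: "w \<in> W" "y \<in> Ss" "z = (cls w, y)"
      unfolding carrier_LM by (auto simp: N_simps)
    have "cls (\<lambda>p. \<Sum>b\<in>H. w b * basis_vec b p) = cls w" using expand[OF finHb w(1)] by simp
    then show ?case using K_left_sum[OF w(2) finHb order_refl, of w] w SP_scale[OF ip w(2)]
      by (intro exI[of _ "\<lambda>b. \<lambda>T. w b * y T"]) simp
  next
    case (diff c d)
    then obtain v u where v: "\<forall>p\<in>H. v p \<in> Ss" "c - (\<Sum>p\<in>H. frag_of (cls (basis_vec p), v p)) \<in> B.K"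
      and u: "\<forall>p\<in>H. u p \<in> Ss" "d - (\<Sum>p\<in>H. frag_of (cls (basis_vec p), u p)) \<in> B.K" by blast
    let ?d = "\<lambda>p T. v p T - u p T"
    have dS: "?d p \<in> Ss" if "p \<in> H" for p
    proof -
      have "(\<lambda>T. -1 * u p T) \<in> Ss" by (rule SP_scale[OF ip]) (use u(1) that in auto)
      then have "(\<lambda>T. v p T + -1 * u p T) \<in> Ss" by (intro SP_add[OF ip]) (use v(1) that in auto)
      then show ?thesis by simp
    qed
    have "(\<Sum>p\<in>F. frag_of (cls (basis_vec p), v p)) - (\<Sum>p\<in>F. frag_of (cls (basis_vec p), u p)) -
        (\<Sum>p\<in>F. frag_of (cls (basis_vec p), ?d p)) \<in> B.K" if "finite F" "F \<subseteq> H" for F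
      using that
    proof (induction F rule: finite_induct)
      case empty
      then show ?case using B.K_zero by simp
    next
      case (insert p F)
      \<comment> \<open>Additivity in the second slot, for \<open>v p\<close> written as
        \<open>?d p\<close> plus \<open>u p\<close>.\<close>
      have "frag_of (cls (basis_vec p), ?d p \<oplus>\<^bsub>N\<^esub> u p) - frag_of (cls (basis_vec p), ?d p) - frag_of (cls (basis_vec p), u p) \<in> B.K"
        using insert dS[of p] u(1) by (intro B.K_add_right kl_L basis_W) (auto simp: N_simps)
      then have 1: "frag_of (cls (basis_vec p), v p) - frag_of (cls (basis_vec p), ?d p) - frag_of (cls (basis_vec p), u p) \<in> B.K"
        by (simp add: N_simps)
      have 2: "(\<Sum>p\<in>F. frag_of (cls (basis_vec p), v p)) - (\<Sum>p\<in>F. frag_of (cls (basis_vec p), u p)) -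
        (\<Sum>p\<in>F. frag_of (cls (basis_vec p), ?d p)) \<in> B.K" using insert by simp
      show ?case using B.K_add[OF 1 2] insert by (simp add: algebra_simps)
    qed
    then have 3: "(\<Sum>p\<in>H. frag_of (cls (basis_vec p), v p)) - (\<Sum>p\<in>H. frag_of (cls (basis_vec p), u p)) -
        (\<Sum>p\<in>H. frag_of (cls (basis_vec p), ?d p)) \<in> B.K" using finHb by blast
    have "c - d - (\<Sum>p\<in>H. frag_of (cls (basis_vec p), ?d p)) \<in> B.K"
      using B.K_add[OF B.K_diff[OF v(2) u(2)] 3] by (simp add: algebra_simps)
    then show ?case using dS by (intro exI[of _ ?d]) blast
  qed
qed

text \<open>The functional for \<open>not_in_K\<close> is built on the unique representative in
  \<open>W\<close> of a class; that it is balanced is a change of variables in the group.\<close>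

lemma nonzero_tensor:
  assumes t: "t \<in> tableau_tuples l \<mu>"
  shows "frag_of (cls (basis_vec ad), E l \<mu> t) \<notin> B.K"
proof -
  define V where "V v \<rho> = sact \<rho> v (tab \<mu> t)" for v :: "(nat \<Rightarrow> tabloid) \<Rightarrow> complex" and \<rho> :: "nat \<Rightarrow> nat \<Rightarrow> nat"
  \<comment> \<open>Only the diagrams \<open>a \<sigma>\<close> contribute; \<open>\<beta>\<close> reads off the coefficient of a tabloid tuple in \<open>a \<otimes> v\<close>.\<close>
  define \<beta> where "\<beta> C v = (\<Sum>\<rho>\<in>Gs. rep C (rr ad \<rho>) * V v \<rho>)" for C v
  let ?m = "\<lambda>\<sigma> \<tau>. \<sigma> \<otimes>\<^bsub>G\<^esub> \<tau>" and ?i = "\<lambda>\<sigma>. inv\<^bsub>G\<^esub> \<sigma>"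
  have aH: "ad \<in> H" by (rule a_half_basis[OF l m])
  interpret Gr: group G by (rule group_SGr[OF l m])
  have Vm: "V v (?m \<sigma> \<tau>) = v (\<lambda>i r. \<tau> i -` \<sigma> i -` tab \<mu> t i r)" if v: "v \<in> Ss" for v \<sigma> \<tau>
    unfolding V_def by (rule local_funD[OF ip local_SP[OF ip v]]) (auto simp: gmult)
  show ?thesis
  proof (rule B.not_in_K[of \<beta>])
    fix x x' y assume x: "x \<in> carrier LM" "x' \<in> carrier LM"
    then obtain w w' where w: "w \<in> W" "x = cls w" "w' \<in> W" "x' = cls w'" unfolding carrier_LM by blast
    have "x \<oplus>\<^bsub>LM\<^esub> x' = cls (\<lambda>p. w p + w' p)"
      unfolding w LM_add by (rule cls_add[OF W_A[OF w(1)] W_A[OF w(3)]])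
    then show "\<beta> (x \<oplus>\<^bsub>LM\<^esub> x') y = \<beta> x y + \<beta> x' y"
      by (simp add: \<beta>_def w rep_kl supported_add distrib_right sum.distrib)
  next
    fix x y y'
    show "\<beta> x (y \<oplus>\<^bsub>N\<^esub> y') = \<beta> x y + \<beta> x y'"
      by (simp add: \<beta>_def V_def N_simps distrib_left sum.distrib)
  next
    fix \<alpha> x y assume x: "x \<in> carrier LM" and y: "y \<in> carrier N"
    then obtain w where w: "w \<in> W" "x = cls w" unfolding carrier_LM by blast
    have yS: "y \<in> Ss" using y by (simp add: N_simps)
    have pb: "pbl w \<alpha> (rr ad \<rho>) = (\<Sum>\<tau>\<in>Gs. w (rr ad (?m \<rho> (?i \<tau>))) * \<alpha> \<tau>)" if r: "\<rho> \<in> Gs" for \<rho>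
      unfolding permute_blocks_lin_def
    proof (rule sum.cong[OF refl])
      fix \<tau> assume t: "\<tau> \<in> Gs"
      let ?h = "rr ad (?m \<rho> (?i \<tau>))"
      have hH: "?h \<in> H" using r t by (intro ra_H[OF l m] aH) simp
      have "rr p \<tau> = rr ad \<rho> \<longleftrightarrow> p = ?h" if p: "p \<in> H" for p
      proof
        assume "rr p \<tau> = rr ad \<rho>"
        then have "rr (rr p \<tau>) (?i \<tau>) = rr (rr ad \<rho>) (?i \<tau>)" by simp
        then show "p = ?h" using ra_inv(1)[OF l m p t] ra_ra[OF l m aH r, of "?i \<tau>"] t by simp
      next
        assume "p = ?h"
        then have "rr p \<tau> = rr ad (?m (?m \<rho> (?i \<tau>)) \<tau>)" using ra_ra[OF l m aH, of "?m \<rho> (?i \<tau>)" \<tau>] r t by simp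
        then show "rr p \<tau> = rr ad \<rho>" using r t by (simp add: Gr.m_assoc)
      qed
      then have "(\<Sum>p\<in>H. if rr p \<tau> = rr ad \<rho> then w p * \<alpha> \<tau> else 0) = (\<Sum>p\<in>H. if p = ?h then w p * \<alpha> \<tau> else 0)"
        by (intro sum.cong refl) simp
      then show "(\<Sum>p\<in>H. if rr p \<tau> = rr ad \<rho> then w p * \<alpha> \<tau> else 0) = w ?h * \<alpha> \<tau>" using hH finHb by simp
    qed
    have "\<beta> (\<alpha> \<odot>\<^bsub>LM\<^esub> x) y = (\<Sum>\<rho>\<in>Gs. (\<Sum>\<tau>\<in>Gs. w (rr ad (?m \<rho> (?i \<tau>))) * \<alpha> \<tau>) * V y \<rho>)"
      unfolding \<beta>_def w(2) LM_smult[OF w(1)] rep_kl[OF pbl_W] by (intro sum.cong refl) (simp add: pb)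
    also have "\<dots> = (\<Sum>\<tau>\<in>Gs. \<Sum>\<rho>\<in>Gs. w (rr ad (?m \<rho> (?i \<tau>))) * \<alpha> \<tau> * V y \<rho>)"
      unfolding sum_distrib_right by (rule sum.swap)
    \<comment> \<open>Substituting \<rho> = \<sigma> \<tau> turns the right translation of diagrams
      into the left action on Specht vectors.\<close>
    also have "\<dots> = (\<Sum>\<tau>\<in>Gs. \<Sum>\<sigma>\<in>Gs. w (rr ad \<sigma>) * \<alpha> \<tau> * V y (?m \<sigma> \<tau>))"
    proof (rule sum.cong[OF refl])
      fix \<tau> assume t: "\<tau> \<in> Gs"
      show "(\<Sum>\<rho>\<in>Gs. w (rr ad (?m \<rho> (?i \<tau>))) * \<alpha> \<tau> * V y \<rho>) = (\<Sum>\<sigma>\<in>Gs. w (rr ad \<sigma>) * \<alpha> \<tau> * V y (?m \<sigma> \<tau>))"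
        by (rule sum.reindex_bij_witness[of _ "\<lambda>\<sigma>. ?m \<sigma> \<tau>" "\<lambda>\<rho>. ?m \<rho> (?i \<tau>)"]) (use t in \<open>simp_all add: Gr.m_assoc\<close>)
    qed
    also have "\<dots> = (\<Sum>\<sigma>\<in>Gs. \<Sum>\<tau>\<in>Gs. w (rr ad \<sigma>) * \<alpha> \<tau> * V y (?m \<sigma> \<tau>))" by (rule sum.swap)
    also have "\<dots> = (\<Sum>\<sigma>\<in>Gs. w (rr ad \<sigma>) * (\<Sum>\<tau>\<in>Gs. \<alpha> \<tau> * y (\<lambda>i r. \<tau> i -` \<sigma> i -` tab \<mu> t i r)))"
      by (simp add: Vm[OF yS] sum_distrib_left mult.assoc)
    also have "\<dots> = \<beta> x (\<alpha> \<odot>\<^bsub>N\<^esub> y)"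
      unfolding \<beta>_def w(2) rep_kl[OF w(1)] V_def by (simp add: N_simps)
    finally show "\<beta> (\<alpha> \<odot>\<^bsub>LM\<^esub> x) y = \<beta> x (\<alpha> \<odot>\<^bsub>N\<^esub> y)" .
  next
    \<comment> \<open>The action on \<open>ad\<close> is free, so only the unit contributes;
      \<open>E\<close> has the coefficient 1 at its own tabloids.\<close>
    have "\<beta> (cls (basis_vec ad)) (E l \<mu> t) = (\<Sum>\<rho>\<in>Gs. if \<rho> = \<one>\<^bsub>G\<^esub> then V (E l \<mu> t) \<rho> else 0)"
      unfolding \<beta>_def rep_kl[OF basis_W[OF aH]]
    proof (intro sum.cong refl)
      fix \<rho> assume r: "\<rho> \<in> Gs"
      have "rr ad \<rho> = ad \<longleftrightarrow> \<rho> = \<one>\<^bsub>G\<^esub>"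
        using ra_am_inj[OF l m r grp(3)] ra_one[OF l m aH] by auto
      then show "basis_vec ad (rr ad \<rho>) * V (E l \<mu> t) \<rho> = (if \<rho> = \<one>\<^bsub>G\<^esub> then V (E l \<mu> t) \<rho> else 0)"
        by (simp add: basis_vec_def)
    qed
    also have "\<dots> = V (E l \<mu> t) \<one>\<^bsub>G\<^esub>" using finGg by simp
    also have "\<dots> = E l \<mu> t (tab \<mu> t)"
      unfolding V_def by (rule local_funD[OF ip local_E[OF ip]]) (auto simp: gone)
    also have "\<dots> = 1" by (rule E_self[OF ip t])
    finally show "\<beta> (cls (basis_vec ad)) (E l \<mu> t) \<noteq> 0" by simp
  qed
qed

lemma flip_basis_A: "q \<in> H \<Longrightarrow> basis_vec (flip q) \<in> carrier A"
  by (intro basis_A flip_tonal half_basis_tonal[OF l m])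

text \<open>When the product is \<open>rr ad \<tau>\<close>, the permutation crosses the tensor
  sign, and by freeness \<tau> is the only nonzero term of the sum. When the product leaves
  \<open>H\<close>, it lies in the ideal and the sum is empty of nonzero terms.\<close>

lemma flip_mult:
  assumes q: "q \<in> H" and p: "p \<in> H" and y: "y \<in> Ss"
  defines "L \<equiv> loops n n n (flip q) p" and "c \<equiv> compose n n n (flip q) p"
  shows "frag_of (cls (basis_vec (flip q)) \<otimes>\<^bsub>Q\<^esub> cls (basis_vec p), y) -
    frag_of (cls (basis_vec ad), (\<lambda>T. \<Sum>\<sigma>\<in>Gs. (if c = rr ad \<sigma> then \<delta> ^ L else 0) * sact \<sigma> y T)) \<in> B.K"
proof -
  have qT: "flip q \<in> tonal l n" and pT: "p \<in> tonal l n"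
    using flip_tonal half_basis_tonal[OF l m] q p by blast+
  have aH: "ad \<in> H" by (rule a_half_basis[OF l m])
  have e: "cls (basis_vec (flip q)) \<otimes>\<^bsub>Q\<^esub> cls (basis_vec p) = cls (\<lambda>x. \<delta> ^ L * basis_vec c x)"
    unfolding cls_mult[OF basis_A[OF qT] basis_A[OF pT]] PA_basis_mult[OF qT pT] L_def c_def ..
  show ?thesis
  proof (cases "c \<in> H")
    case True
    then obtain \<tau> where t: "\<tau> \<in> Gs" "c = rr ad \<tau>" using compose_flip_H[OF l m q p] unfolding c_def by blast
    have s: "(\<Sum>\<sigma>\<in>Gs. (if c = rr ad \<sigma> then \<delta> ^ L else 0) * sact \<sigma> y T) = \<delta> ^ L * sact \<tau> y T" for T
    proof -
      have "(\<Sum>\<sigma>\<in>Gs. (if c = rr ad \<sigma> then \<delta> ^ L else 0) * sact \<sigma> y T) = (\<Sum>\<sigma>\<in>Gs. if \<sigma> = \<tau> then \<delta> ^ L * sact \<tau> y T else 0)"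
        using ra_am_inj[OF l m t(1)] unfolding t(2) by (intro sum.cong refl) auto
      then show ?thesis using t(1) finGg by simp
    qed
    have "frag_of (cls (\<lambda>x. \<delta> ^ L * basis_vec c x), y) - frag_of (cls (basis_vec c), (\<lambda>T. \<delta> ^ L * y T)) \<in> B.K"
      by (rule K_scale[OF basis_W[OF True] y])
    moreover have "frag_of (cls (basis_vec c), (\<lambda>T. \<delta> ^ L * y T)) - frag_of (cls (basis_vec ad), (\<lambda>T. \<delta> ^ L * sact \<tau> y T)) \<in> B.K"
      using K_twist[OF aH t(1) SP_scale[OF ip y]] unfolding t(2) .
    ultimately show ?thesis unfolding e s using B.K_add by fastforce
  next
    case False
    then have "basis_vec c \<in> IB" unfolding c_def by (rule basis_in_IB[OF qT p])
    then have "(\<lambda>x. \<delta> ^ L * basis_vec c x - 0) \<in> IB" using IB_scale by simp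
    then have k: "cls (\<lambda>x. \<delta> ^ L * basis_vec c x) = cls (\<lambda>_. 0)" unfolding cls_eq by simp
    have "c \<noteq> rr ad \<sigma>" if "\<sigma> \<in> Gs" for \<sigma> using False ra_H[OF l m aH that] by auto
    then have s: "(\<lambda>T. \<Sum>\<sigma>\<in>Gs. (if c = rr ad \<sigma> then \<delta> ^ L else 0) * sact \<sigma> y T) = (\<lambda>_. 0)"
      by (intro ext sum.neutral ballI) simp
    show ?thesis unfolding e k s by (intro B.K_diff K_left_zero y K_right_zero kl_L basis_W aH)
  qed
qed

definition "gram q p = (if compose n n n (flip q) p = ad then \<delta> ^ loops n n n (flip q) p else 0)"

text \<open>Left multiplication by \<open>flip q\<close> commutes with the right action, which can
  be undone. One scalar matrix thus records all coefficients of the form with values in the group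
  algebra.\<close>

lemma gram_shift:
  assumes q: "q \<in> H" and p: "p \<in> H" and s: "\<sigma> \<in> Gs"
  shows "gram q p = (if compose n n n (flip q) (rr p \<sigma>) = rr ad \<sigma> then \<delta> ^ loops n n n (flip q) (rr p \<sigma>) else 0)"
proof -
  have qT: "flip q \<in> tonal l n" using flip_tonal half_basis_tonal[OF l m] q by blast
  have aH: "ad \<in> H" by (rule a_half_basis[OF l m])
  have *: "compose n n n (flip q) (rr p \<sigma>) = rr ad \<sigma> \<and> loops n n n (flip q) (rr p \<sigma>) = loops n n n (flip q) p"
    if "compose n n n (flip q) p = ad" "p \<in> H" "\<sigma> \<in> Gs" for p \<sigma>
    using compose_ra[OF l m qT that(2) _ that(3)] loops_ra[OF l m qT that(2) _ that(3)] that(1) aH by simp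
  have "compose n n n (flip q) p = ad" if c: "compose n n n (flip q) (rr p \<sigma>) = rr ad \<sigma>"
  proof -
    have cH: "compose n n n (flip q) p \<in> H"
      using compose_ra_H_iff[OF l m qT p s] c ra_H[OF l m aH s] by simp
    then have "rr (compose n n n (flip q) p) \<sigma> = rr ad \<sigma>" using compose_ra[OF l m qT p _ s] c by simp
    then show ?thesis using ra_inv(1)[OF l m cH s] ra_inv(1)[OF l m aH s] by metis
  qed
  then show ?thesis unfolding gram_def using *[OF _ p s] by auto
qed

lemma simple_standard:
  assumes ns: "\<And>v :: diagram \<Rightarrow> complex. \<exists>p\<in>H. v p \<noteq> 0 \<Longrightarrow> \<exists>q\<in>H. (\<Sum>p\<in>H. gram q p * v p) \<noteq> 0"
  shows "simple_module A B.TM"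
proof -
  have aH: "ad \<in> H" by (rule a_half_basis[OF l m])
  let ?e = "\<lambda>p y. frag_of (cls (basis_vec p), y)"
  obtain t0 where t0: "t0 \<in> tableau_tuples l \<mu>" using tableau_tuples_nonempty[where l = l and \<mu> = \<mu>, OF ip] by blast
  show ?thesis
  proof (rule B.simple_tensorI)
    show "?e ad (E l \<mu> t0) \<in> carrier B.FG" using E_SP[OF ip t0] by (intro B.FG_of kl_L basis_W aH) (simp add: N_simps)
    show "?e ad (E l \<mu> t0) \<notin> B.K" by (rule nonzero_tensor[OF t0])
    fix Hs c
    assume HF: "Hs \<subseteq> carrier B.FG" and KH: "B.K \<subseteq> Hs" and diff: "\<And>c d. c \<in> Hs \<Longrightarrow> d \<in> Hs \<Longrightarrow> c - d \<in> Hs"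
      and ext: "\<And>s c. s \<in> carrier A \<Longrightarrow> c \<in> Hs \<Longrightarrow> B.ext s c \<in> Hs" and c: "c \<in> Hs" "c \<notin> B.K"
    have zero: "0 \<in> Hs" using B.K_zero KH by blast
    have cong: "d \<in> Hs" if "c \<in> Hs" "c - d \<in> B.K" for c d
      using diff[OF that(1) subsetD[OF KH that(2)]] by simp
    have cong': "c \<in> Hs" if "d \<in> Hs" "c - d \<in> B.K" for c d
      using cong[of d c] B.K_uminus[OF that(2)] that(1) by simp
    have add: "c + d \<in> Hs" if "c \<in> Hs" "d \<in> Hs" for c d
      using diff[OF that(1) diff[OF zero that(2)]] by simp
    obtain v where v: "\<And>p. p \<in> H \<Longrightarrow> v p \<in> Ss" and cv: "c - (\<Sum>p\<in>H. ?e p (v p)) \<in> B.K"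
      using expand_tensor[of c] c(1) HF by blast
    \<comment> \<open>Averaging \<open>p \<otimes> v p\<close> over the group makes the coefficients unique, so that \<open>c \<notin> K\<close> is visible on them.\<close>
    define V where "V p = (\<lambda>T. \<Sum>\<sigma>\<in>Gs. sact \<sigma> (v (rr p \<sigma>)) T)" for p
    have VS: "V p \<in> Ss" if p: "p \<in> H" for p
      unfolding V_def by (intro SP_sum[OF ip] finGg SP_act[OF ip] v ra_H[OF l m p])
    have "\<exists>p\<in>H. V p \<noteq> (\<lambda>_. 0)"
    proof (rule ccontr)
      assume "\<not> ?thesis"
      then have V0: "V p = (\<lambda>_. 0)" if "p \<in> H" for p using that by blast
      \<comment> \<open>Each tensor of \<open>p\<close> with \<open>v p\<close> is spread evenly
        over the group, the sum over \<open>H\<close> is reindexed by \<open>rr p \<sigma>\<close>,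
        and \<sigma> is moved across the tensor sign; at \<open>p\<close> this collects a multiple
        of \<open>V p\<close>, which is zero.\<close>
      let ?g = "1 / of_nat (card Gs) :: complex"
      have cg: "of_nat (card Gs) \<noteq> (0::complex)" using finGg grp(3) by auto
      let ?u = "\<lambda>p T. ?g * v p T"
      have uS: "?u p \<in> Ss" if "p \<in> H" for p by (rule SP_scale[OF ip v[OF that]])
      have k1: "?e p (v p) - (\<Sum>\<sigma>\<in>Gs. ?e p (?u p)) \<in> B.K" if p: "p \<in> H" for p
      proof -
        have "(\<Sum>\<sigma>\<in>Gs. ?e p (?u p)) - ?e p (\<lambda>T. \<Sum>\<sigma>\<in>Gs. ?u p T) \<in> B.K"
          by (intro K_right_sum kl_L basis_W p finGg uS)
        moreover have "(\<lambda>T. \<Sum>\<sigma>\<in>Gs. ?u p T) = v p" using cg by simp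
        ultimately show ?thesis using B.K_uminus by fastforce
      qed
      have k2: "(\<Sum>\<sigma>\<in>Gs. ?e (rr p \<sigma>) (?u (rr p \<sigma>))) \<in> B.K" if p: "p \<in> H" for p
      proof -
        have "(\<Sum>\<sigma>\<in>F. ?e (rr p \<sigma>) (?u (rr p \<sigma>)) - ?e p (sact \<sigma> (?u (rr p \<sigma>)))) \<in> B.K" if "finite F" "F \<subseteq> Gs" for F
          using that by (induction F rule: finite_induct)
            (auto simp: B.K_zero intro!: B.K_add K_twist p uS[simplified] ra_H[OF l m p])
        then have 1: "(\<Sum>\<sigma>\<in>Gs. ?e (rr p \<sigma>) (?u (rr p \<sigma>))) - (\<Sum>\<sigma>\<in>Gs. ?e p (sact \<sigma> (?u (rr p \<sigma>)))) \<in> B.K"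
          using finGg by (simp add: sum_subtractf)
        have 2: "(\<Sum>\<sigma>\<in>Gs. ?e p (sact \<sigma> (?u (rr p \<sigma>)))) - ?e p (\<lambda>T. \<Sum>\<sigma>\<in>Gs. sact \<sigma> (?u (rr p \<sigma>)) T) \<in> B.K"
          by (intro K_right_sum kl_L basis_W p finGg SP_act[OF ip] uS ra_H[OF l m p])
        have "(\<lambda>T. \<Sum>\<sigma>\<in>Gs. sact \<sigma> (?u (rr p \<sigma>)) T) = (\<lambda>T. ?g * V p T)"
          by (simp add: V_def sum_distrib_left)
        then have 3: "?e p (\<lambda>T. \<Sum>\<sigma>\<in>Gs. sact \<sigma> (?u (rr p \<sigma>)) T) \<in> B.K"
          using K_right_zero[OF kl_L[OF basis_W[OF p]]] V0[OF p] by simp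
        show ?thesis using B.K_add[OF B.K_add[OF 1 2] 3] by simp
      qed
      have Ksum: "(\<Sum>p\<in>H. f p) \<in> B.K" if "\<And>p. p \<in> H \<Longrightarrow> f p \<in> B.K" for f
      proof -
        have "(\<Sum>p\<in>F. f p) \<in> B.K" if "finite F" "F \<subseteq> H" for F
          using that \<open>\<And>p. p \<in> H \<Longrightarrow> f p \<in> B.K\<close> by (induction F rule: finite_induct) (auto simp: B.K_zero intro!: B.K_add)
        then show ?thesis using finHb by blast
      qed
      have "(\<Sum>p\<in>H. ?e p (v p)) - (\<Sum>p\<in>H. \<Sum>\<sigma>\<in>Gs. ?e p (?u p)) \<in> B.K"
        using Ksum[OF k1] by (simp add: sum_subtractf)
      moreover have "(\<Sum>p\<in>H. \<Sum>\<sigma>\<in>Gs. ?e p (?u p)) = (\<Sum>p\<in>H. \<Sum>\<sigma>\<in>Gs. ?e (rr p \<sigma>) (?u (rr p \<sigma>)))"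
      proof -
        have "(\<Sum>p\<in>H. \<Sum>\<sigma>\<in>Gs. ?e p (?u p)) = (\<Sum>\<sigma>\<in>Gs. \<Sum>p\<in>H. ?e p (?u p))" by (rule sum.swap)
        also have "\<dots> = (\<Sum>\<sigma>\<in>Gs. \<Sum>p\<in>H. ?e (rr p \<sigma>) (?u (rr p \<sigma>)))"
          by (rule sum.cong[OF refl]) (rule sum.reindex_bij_betw[OF ra_bij[OF l m], symmetric])
        also have "\<dots> = (\<Sum>p\<in>H. \<Sum>\<sigma>\<in>Gs. ?e (rr p \<sigma>) (?u (rr p \<sigma>)))" by (rule sum.swap)
        finally show ?thesis .
      qed
      ultimately have "(\<Sum>p\<in>H. ?e p (v p)) \<in> B.K" using B.K_add[OF _ Ksum[OF k2]] by fastforce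
      then have "c \<in> B.K" using B.K_add[OF cv] by fastforce
      then show False using c(2) by simp
    qed
    \<comment> \<open>Evaluation at one tabloid tuple turns the family \<open>V\<close> into a
      complex vector, to which nonsingularity applies.\<close>
    then obtain p1 T1 where pT: "p1 \<in> H" "V p1 T1 \<noteq> 0" by (metis ext)
    then obtain q where q: "q \<in> H" "(\<Sum>p\<in>H. gram q p * V p T1) \<noteq> 0" using ns[of "\<lambda>p. V p T1"] by blast
    define w where "w = (\<lambda>T. \<Sum>p\<in>H. gram q p * V p T)"
    have wS: "w \<in> Ss" unfolding w_def by (intro SP_sum[OF ip] finHb SP_scale[OF ip] VS)
    have w0: "w \<noteq> (\<lambda>_. 0)" using q(2) unfolding w_def by metis
    \<comment> \<open>The reflection of \<open>q\<close> sends every term to \<open>ad\<close>;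
      reindexing by each \<sigma> turns the coefficients into the Gram matrix applied to
      \<open>V\<close>.\<close>
    have we: "?e ad w \<in> Hs"
    proof -
      let ?s = "basis_vec (flip q)"
      have sA: "?s \<in> carrier A" by (rule flip_basis_A[OF q(1)])
      let ?x = "\<lambda>p T. \<Sum>\<sigma>\<in>Gs. (if compose n n n (flip q) p = rr ad \<sigma> then \<delta> ^ loops n n n (flip q) p else 0) * sact \<sigma> (v p) T"
      have 1: "B.ext ?s (\<Sum>p\<in>H. ?e p (v p)) \<in> Hs"
      proof -
        have "(\<Sum>p\<in>H. ?e p (v p)) \<in> Hs" by (rule cong[OF c(1) cv])
        then show ?thesis by (rule ext[OF sA])
      qed
      have xS: "?x p \<in> Ss" if "p \<in> H" for p
        by (intro SP_sum[OF ip] finGg SP_scale[OF ip] SP_act[OF ip] v that)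
      have 2: "B.ext ?s (\<Sum>p\<in>H. ?e p (v p)) - (\<Sum>p\<in>H. ?e ad (?x p)) \<in> B.K"
      proof -
        have "B.ext ?s (\<Sum>p\<in>F. ?e p (v p)) - (\<Sum>p\<in>F. ?e ad (?x p)) \<in> B.K" if "finite F" "F \<subseteq> H" for F
          using that
        proof (induction F rule: finite_induct)
          case empty
          then show ?case using B.K_zero by simp
        next
          case (insert p F)
          have a: "B.ext ?s (\<Sum>p\<in>F. ?e p (v p)) - (\<Sum>p\<in>F. ?e ad (?x p)) \<in> B.K" using insert by simp
          have b: "B.ext ?s (?e p (v p)) - ?e ad (?x p) \<in> B.K"
            unfolding B.ext_simps using insert by (intro flip_mult q(1) v) auto
          show ?case using B.K_add[OF a b] insert by (simp add: algebra_simps)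
        qed
        then show ?thesis using finHb by blast
      qed
      have 3: "(\<Sum>p\<in>H. ?e ad (?x p)) - ?e ad (\<lambda>T. \<Sum>p\<in>H. ?x p T) \<in> B.K"
        by (intro K_right_sum kl_L basis_W aH finHb xS)
      have "(\<Sum>p\<in>H. ?x p T) = w T" for T
      proof -
        have "(\<Sum>p\<in>H. ?x p T) = (\<Sum>\<sigma>\<in>Gs. \<Sum>p\<in>H. (if compose n n n (flip q) p = rr ad \<sigma> then \<delta> ^ loops n n n (flip q) p else 0) * sact \<sigma> (v p) T)"
          by (rule sum.swap)
        also have "\<dots> = (\<Sum>\<sigma>\<in>Gs. \<Sum>p\<in>H. gram q p * sact \<sigma> (v (rr p \<sigma>)) T)"
        proof (rule sum.cong[OF refl])
          fix \<sigma> assume s: "\<sigma> \<in> Gs"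
          have "(\<Sum>p\<in>H. (if compose n n n (flip q) p = rr ad \<sigma> then \<delta> ^ loops n n n (flip q) p else 0) * sact \<sigma> (v p) T) =
            (\<Sum>p\<in>H. (if compose n n n (flip q) (rr p \<sigma>) = rr ad \<sigma> then \<delta> ^ loops n n n (flip q) (rr p \<sigma>) else 0) * sact \<sigma> (v (rr p \<sigma>)) T)"
            by (rule sum.reindex_bij_betw[OF ra_bij[OF l m s], symmetric])
          also have "\<dots> = (\<Sum>p\<in>H. gram q p * sact \<sigma> (v (rr p \<sigma>)) T)"
            by (intro sum.cong refl) (simp only: gram_shift[OF q(1) _ s])
          finally show "(\<Sum>p\<in>H. (if compose n n n (flip q) p = rr ad \<sigma> then \<delta> ^ loops n n n (flip q) p else 0) * sact \<sigma> (v p) T) =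
            (\<Sum>p\<in>H. gram q p * sact \<sigma> (v (rr p \<sigma>)) T)" .
        qed
        also have "\<dots> = (\<Sum>p\<in>H. \<Sum>\<sigma>\<in>Gs. gram q p * sact \<sigma> (v (rr p \<sigma>)) T)" by (rule sum.swap)
        also have "\<dots> = w T" by (simp add: w_def V_def sum_distrib_left)
        finally show ?thesis .
      qed
      then have "(\<lambda>T. \<Sum>p\<in>H. ?x p T) = w" by (rule HOL.ext)
      then show ?thesis using cong[OF cong[OF 1 2] 3] by simp
    qed
    \<comment> \<open>The Specht vectors whose tensor with \<open>ad\<close> lies in the given
      submodule form a submodule of the outer Specht module.\<close>
    define U where "U = {y \<in> Ss. ?e ad y \<in> Hs}"
    have SU: "Ss \<subseteq> U"
    proof (rule outer_specht_irreducible[OF ip])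
      show "U \<subseteq> Ss" by (auto simp: U_def)
      show "w \<in> U" using wS we by (simp add: U_def)
      show "w \<noteq> (\<lambda>_. 0)" by (rule w0)
      fix f g assume fg: "f \<in> U" "g \<in> U"
      then have fgS: "f \<in> Ss" "g \<in> Ss" "?e ad f \<in> Hs" "?e ad g \<in> Hs" by (auto simp: U_def)
      have "?e ad (f \<oplus>\<^bsub>N\<^esub> g) - ?e ad f - ?e ad g \<in> B.K"
        using fgS by (intro B.K_add_right kl_L basis_W aH) (simp_all add: N_simps)
      then have "?e ad (\<lambda>T. f T + g T) - (?e ad f + ?e ad g) \<in> B.K" by (simp add: N_simps algebra_simps)
      then have "?e ad (\<lambda>T. f T + g T) \<in> Hs" by (rule cong'[OF add[OF fgS(3,4)]])
      then show "(\<lambda>T. f T + g T) \<in> U" using SP_add[OF ip fgS(1,2)] by (simp add: U_def)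
    next
      fix \<alpha> f assume \<alpha>: "\<alpha> \<in> supported_on Gs" and f: "f \<in> U"
      then have fS: "f \<in> Ss" "?e ad f \<in> Hs" by (auto simp: U_def)
      \<comment> \<open>On the class of \<open>ad\<close> the right action of \<alpha> agrees with
        left multiplication by the class of \<open>?s\<close>, so closure under the left action
        suffices.\<close>
      let ?w = "pbl (basis_vec ad) \<alpha>"
      let ?s = "\<lambda>p. 1 / cc * ?w p"
      have wW: "?w \<in> W" by (rule pbl_W)
      have "?s \<in> carrier A" by (intro scale_A W_A wW)
      then have "B.ext ?s (?e ad f) \<in> Hs" using fS(2) by (rule ext)
      then have 1: "frag_of (cls ?w, f) \<in> Hs" unfolding B.ext_simps cls_W[OF wW, symmetric] .
      have "frag_of (\<alpha> \<odot>\<^bsub>LM\<^esub> cls (basis_vec ad), f) - ?e ad (\<alpha> \<odot>\<^bsub>N\<^esub> f) \<in> B.K"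
        using \<alpha> fS(1) by (intro B.K_balanced kl_L basis_W aH) (simp_all add: R_carrier N_simps)
      then have "frag_of (cls ?w, f) - ?e ad (\<lambda>T. \<Sum>\<sigma>\<in>Gs. \<alpha> \<sigma> * f (\<lambda>i r. \<sigma> i -` T i r)) \<in> B.K"
        unfolding LM_smult[OF basis_W[OF aH]] N_simps .
      then have "?e ad (\<lambda>T. \<Sum>\<sigma>\<in>Gs. \<alpha> \<sigma> * f (\<lambda>i r. \<sigma> i -` T i r)) \<in> Hs" by (rule cong[OF 1])
      then show "(\<lambda>T. \<Sum>\<sigma>\<in>Gs. \<alpha> \<sigma> * f (\<lambda>i r. \<sigma> i -` T i r)) \<in> U" using SP_smult[OF ip fS(1)] by (simp add: U_def)
    qed
    have pure: "frag_of z \<in> Hs" if z: "z \<in> carrier LM \<times> carrier N" for z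
    proof -
      obtain w y where wy: "w \<in> W" "y \<in> Ss" "z = (cls w, y)"
        using z unfolding carrier_LM by (auto simp: N_simps)
      \<comment> \<open>Dividing by \<open>cc\<close> makes \<open>?s\<close> carry
        \<open>ad\<close> to \<open>w\<close>, so every pure tensor is a left multiple of one at
        \<open>ad\<close>.\<close>
      let ?s = "\<lambda>p. 1 / cc * w p"
      have "?s \<in> carrier A" by (intro scale_A W_A wy)
      moreover have "?e ad y \<in> Hs" using SU wy(2) by (auto simp: U_def)
      ultimately have "B.ext ?s (?e ad y) \<in> Hs" by (rule ext)
      then show ?thesis unfolding B.ext_simps cls_W[OF wy(1), symmetric] wy(3) .
    qed
    show "carrier B.FG \<subseteq> Hs"
    proof
      fix d assume "d \<in> carrier B.FG"
      then have "Poly_Mapping.keys d \<subseteq> carrier LM \<times> carrier N" by simp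
      then show "d \<in> Hs" by (induction d rule: frag_induction) (auto simp: zero pure intro: diff)
    qed
  qed
qed

end

theorem theorem9p6:
  fixes l n :: nat and \<mu> :: "nat \<Rightarrow> nat list"
  assumes "l \<ge> 1" and "\<mu> \<in> Lambda_tonal l n"
  shows "finite {\<delta> :: complex. \<not> simple_module (tonal_algebra l n \<delta>) (standard_module l n \<delta> \<mu>)}"
proof -
  note l = \<open>l \<ge> 1\<close>
  obtain m where m: "m \<in> gamma l n" "\<mu> \<in> Lambda_index l m" using assms(2) by (auto simp: Lambda_tonal_def)
  have ip: "\<And>i. i \<in> {1..l} \<Longrightarrow> integer_partition (\<mu> i) (m i)" using m(2) by (simp add: Lambda_index_def)
  have mm: "(\<lambda>i. sum_list (\<mu> i)) = m"
  proof
    fix i show "sum_list (\<mu> i) = m i"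
    proof (cases "i \<in> {1..l}")
      case True then show ?thesis using ip by (simp add: integer_partition_def)
    next
      case False
      then have "\<mu> i = []" "m i = 0" using m unfolding Lambda_index_def gamma_def by blast+
      then show ?thesis by simp
    qed
  qed
  let ?H = "half_basis l n m" and ?P = "\<lambda>q p. compose n n n (flip q) p = a_diag l n m"
  let ?L = "\<lambda>q p. loops n n n (flip q) p"
  let ?bad = "{\<delta> :: complex. \<exists>v. (\<exists>p\<in>?H. v p \<noteq> 0) \<and>
    (\<forall>q\<in>?H. (\<Sum>p\<in>?H. (if ?P q p then \<delta> ^ ?L q p else 0) * v p) = 0)}"
  have "finite ?bad"
  proof (rule finite_singular_parameters[where N=ntop])
    show "finite ?H" by (rule finite_half_basis[OF l m(1)])
    show "?P p p \<and> ?L p p = ntop p" if "p \<in> ?H" for p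
      using compose_flip_self[OF l m(1) that] loops_flip_self[OF l m(1) that] by simp
    show "2 * ?L q p < ntop q + ntop p" if "p \<in> ?H" "q \<in> ?H" "p \<noteq> q" "?P q p" for p q
      by (rule loops_flip_less[OF l m(1) that(2,1,3,4)])
  qed
  \<comment> \<open>The value 0 joins the exceptional set because the construction divides by powers
    of \<delta>.\<close>
  moreover have "{\<delta> :: complex. \<not> simple_module (tonal_algebra l n \<delta>) (standard_module l n \<delta> \<mu>)} \<subseteq> insert 0 ?bad"
  proof
    fix \<delta> :: complex
    assume "\<delta> \<in> {\<delta>. \<not> simple_module (tonal_algebra l n \<delta>) (standard_module l n \<delta> \<mu>)}"
    then have nsim: "\<not> simple_module (tonal_algebra l n \<delta>) (standard_module l n \<delta> \<mu>)" by simp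
    show "\<delta> \<in> insert 0 ?bad"
    proof (rule ccontr)
      assume "\<delta> \<notin> insert 0 ?bad"
      then have \<delta>: "\<delta> \<noteq> 0" "\<delta> \<notin> ?bad" by simp_all
      interpret S: standard_specht l n m \<delta> \<mu>
        using l m(1) \<delta>(1) ip by unfold_locales
      have gram: "S.gram q p = (if ?P q p then \<delta> ^ ?L q p else 0)" for q p
        by (rule S.gram_def)
      have "simple_module (tonal_algebra l n \<delta>) (tensor_module (\<lambda>x C. quotient_class l n \<delta> m x \<otimes>\<^bsub>quotient_algebra l n \<delta> m\<^esub> C)
         (group_algebra (sym_product l m)) (left_ideal l n \<delta> m) (outer_specht l m \<mu>))"
      proof (rule S.simple_standard)
        fix v :: "diagram \<Rightarrow> complex" assume "\<exists>p\<in>?H. v p \<noteq> 0"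
        then show "\<exists>q\<in>?H. (\<Sum>p\<in>?H. S.gram q p * v p) \<noteq> 0"
        proof (rule contrapos_pp)
          assume "\<not> (\<exists>q\<in>?H. (\<Sum>p\<in>?H. S.gram q p * v p) \<noteq> 0)"
          then have "\<forall>q\<in>?H. (\<Sum>p\<in>?H. (if ?P q p then \<delta> ^ ?L q p else 0) * v p) = 0"
            unfolding gram by blast
          then show "\<not> (\<exists>p\<in>?H. v p \<noteq> 0)" using \<delta>(2) by blast
        qed
      qed
      then show False using nsim unfolding standard_module_def Let_def mm by simp
    qed
  qed
  ultimately show ?thesis by (meson finite_insert finite_subset)
qed

end
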